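(* Let $\mathcal{S}=\{S_1,\ldots,S_r\}$ be a finite set of (pairwise non-isomorphic) finite dimensional simple $A$-modules. Then the subcategory $\mathrm{wide}(\mathcal{S})$ of $\mathrm{rep}(A)$ is equivalent to the category of nilpotent representations of the quiver $Q(\mathcal{S})$.
   Context: $\mathbb{K}$ is an algebraically closed field, $m\ge 1$, and $A=A_1*\cdots*A_m$ is the free product (coproduct in associative unital $\mathbb{K}$-algebras) of finite dimensional semisimple $\mathbb{K}$-algebras $A_i$, none of which is one-dimensional. Write $A_i=A_{i1}\times\cdots\times A_{ir_i}$ with $A_{ij}=\mathrm{Mat}_{w_{ij}}(\mathbb{K})$, and let $e_{ij}^{pq}\in A_{ij}$ be the matrix units. $\mathrm{rep}(A)$ is the category of finite dimensional left $A$-modules. The quiver $\Gamma$ has one sink $v_0$, a source $v_{ij}$ for each $1\le i\le m$, $1\le j\le r_i$, and $w_{ij}$ arrows from $v_{ij}$ to $v_0$. The dimension vector of an $A$-module $M$ is the vector $\delta\in\mathbb{Z}_{\ge0}^{\Gamma_0}$ with $\delta_{v_0}=\dim_{\mathbb{K}}M$ and $\delta_{v_{ij}}=\dim_{\mathbb{K}}e_{ij}^{11}M$. The Euler form of $\Gamma$ is $\langle d,d'\rangle=\sum_{v\in\Gamma_0}d_vd'_v-\sum_{\alpha:u\to v}d_ud'_v$, the second sum over the arrows of $\Gamma$. $\mathrm{wide}(\mathcal{S})$ is the (smallest) full abelian extension-closed subcategory of $\mathrm{rep}(A)$ containing $\mathcal{S}$; it consists of the finite dimensional $A$-modules all of whose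 composition factors are (isomorphic to modules) in $\mathcal{S}$. With $\delta_i$ the dimension vector of $S_i$, the quiver $Q(\mathcal{S})$ has vertices $S_1,\dots,S_r$, has $-\langle\delta_i,\delta_j\rangle$ arrows from $S_i$ to $S_j$ for each pair $i\ne j$, and has $1-\langle\delta_i,\delta_i\rangle$ loops at $S_i$ for each $i$ (equivalently, $\dim_{\mathbb{K}}\mathrm{Ext}^1(S_i,S_j)$ arrows from $S_i$ to $S_j$). A nilpotent representation of a quiver is a finite dimensional representation over $\mathbb{K}$ annihilated by all sufficiently long paths. *)

theory Defs
  imports
    "HOL-Algebra.QuotRing"
    "HOL-Library.Poly_Mapping"
    "HOL-Computational_Algebra.Polynomial"
    "Jordan_Normal_Form.VS_Connect"
    "Graph_Theory.Arc_Walk"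
begin

hide_const (open) Polynomial.smult Modules.module Modules.module_hom
hide_fact (open) Modules.module_hom_def

section \<open>Linear categories and their equivalence\<close>

text \<open>Hom sets are indexed by pairs of objects and need not be disjoint, so composition and the
  linear structure take the objects involved as arguments.\<close>

record ('o, 'm, 'k) lincat =
  Ob :: "'o set"
  Hom :: "'o \<Rightarrow> 'o \<Rightarrow> 'm set"
  Ident :: "'o \<Rightarrow> 'm"
  Comp :: "'o \<Rightarrow> 'o \<Rightarrow> 'o \<Rightarrow> 'm \<Rightarrow> 'm \<Rightarrow> 'm"  \<comment> \<open>\<open>Comp C X Y Z g f\<close> is \<open>g\<close> after \<open>f\<close>\<close>
  Plus :: "'o \<Rightarrow> 'o \<Rightarrow> 'm \<Rightarrow> 'm \<Rightarrow> 'm"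
  Scale :: "'o \<Rightarrow> 'o \<Rightarrow> 'k \<Rightarrow> 'm \<Rightarrow> 'm"

definition full_subcategory :: "('o, 'm, 'k) lincat \<Rightarrow> 'o set \<Rightarrow> ('o, 'm, 'k) lincat" where
  "full_subcategory C P = C\<lparr>Ob := Ob C \<inter> P\<rparr>"

locale linear_category =
  fixes C :: "('o, 'm, 'k::field) lincat"
  assumes Ident_in: "X \<in> Ob C \<Longrightarrow> Ident C X \<in> Hom C X X"
    and Comp_in: "\<lbrakk>X \<in> Ob C; Y \<in> Ob C; Z \<in> Ob C; f \<in> Hom C X Y; g \<in> Hom C Y Z\<rbrakk>
      \<Longrightarrow> Comp C X Y Z g f \<in> Hom C X Z"
    and Comp_Ident: "\<lbrakk>X \<in> Ob C; Y \<in> Ob C; f \<in> Hom C X Y\<rbrakk> \<Longrightarrow> Comp C X X Y f (Ident C X) = f"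
    and Ident_Comp: "\<lbrakk>X \<in> Ob C; Y \<in> Ob C; f \<in> Hom C X Y\<rbrakk> \<Longrightarrow> Comp C X Y Y (Ident C Y) f = f"
    and Comp_assoc: "\<lbrakk>W \<in> Ob C; X \<in> Ob C; Y \<in> Ob C; Z \<in> Ob C;
        f \<in> Hom C W X; g \<in> Hom C X Y; h \<in> Hom C Y Z\<rbrakk>
      \<Longrightarrow> Comp C W Y Z h (Comp C W X Y g f) = Comp C W X Z (Comp C X Y Z h g) f"
    and Hom_vectorspace: "\<lbrakk>X \<in> Ob C; Y \<in> Ob C\<rbrakk> \<Longrightarrow> \<exists>z. vectorspace class_ring
      \<lparr>carrier = Hom C X Y, mult = (\<lambda>_ _. z), one = z, zero = z,
       add = Plus C X Y, smult = Scale C X Y\<rparr>"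
    and Comp_Plus_right: "\<lbrakk>X \<in> Ob C; Y \<in> Ob C; Z \<in> Ob C;
        f \<in> Hom C X Y; f' \<in> Hom C X Y; g \<in> Hom C Y Z\<rbrakk>
      \<Longrightarrow> Comp C X Y Z g (Plus C X Y f f') = Plus C X Z (Comp C X Y Z g f) (Comp C X Y Z g f')"
    and Comp_Plus_left: "\<lbrakk>X \<in> Ob C; Y \<in> Ob C; Z \<in> Ob C;
        f \<in> Hom C X Y; g \<in> Hom C Y Z; g' \<in> Hom C Y Z\<rbrakk>
      \<Longrightarrow> Comp C X Y Z (Plus C Y Z g g') f = Plus C X Z (Comp C X Y Z g f) (Comp C X Y Z g' f)"
    and Comp_Scale_right: "\<lbrakk>X \<in> Ob C; Y \<in> Ob C; Z \<in> Ob C; f \<in> Hom C X Y; g \<in> Hom C Y Z\<rbrakk>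
      \<Longrightarrow> Comp C X Y Z g (Scale C X Y c f) = Scale C X Z c (Comp C X Y Z g f)"
    and Comp_Scale_left: "\<lbrakk>X \<in> Ob C; Y \<in> Ob C; Z \<in> Ob C; f \<in> Hom C X Y; g \<in> Hom C Y Z\<rbrakk>
      \<Longrightarrow> Comp C X Y Z (Scale C Y Z c g) f = Scale C X Z c (Comp C X Y Z g f)"

lemma linear_category_full_subcategory:
  "linear_category C \<Longrightarrow> linear_category (full_subcategory C P)"
  unfolding linear_category_def full_subcategory_def by simp

definition linear_functor ::
  "('o, 'm, 'k) lincat \<Rightarrow> ('p, 'n, 'k) lincat \<Rightarrow> ('o \<Rightarrow> 'p) \<Rightarrow> ('o \<Rightarrow> 'o \<Rightarrow> 'm \<Rightarrow> 'n) \<Rightarrow> bool" where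
  "linear_functor C D F \<Phi> \<longleftrightarrow>
     (\<forall>X\<in>Ob C. F X \<in> Ob D) \<and>
     (\<forall>X\<in>Ob C. \<forall>Y\<in>Ob C. \<forall>f\<in>Hom C X Y. \<Phi> X Y f \<in> Hom D (F X) (F Y)) \<and>
     (\<forall>X\<in>Ob C. \<Phi> X X (Ident C X) = Ident D (F X)) \<and>
     (\<forall>X\<in>Ob C. \<forall>Y\<in>Ob C. \<forall>Z\<in>Ob C. \<forall>f\<in>Hom C X Y. \<forall>g\<in>Hom C Y Z.
        \<Phi> X Z (Comp C X Y Z g f) = Comp D (F X) (F Y) (F Z) (\<Phi> Y Z g) (\<Phi> X Y f)) \<and>
     (\<forall>X\<in>Ob C. \<forall>Y\<in>Ob C. \<forall>f\<in>Hom C X Y. \<forall>g\<in>Hom C X Y.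
        \<Phi> X Y (Plus C X Y f g) = Plus D (F X) (F Y) (\<Phi> X Y f) (\<Phi> X Y g)) \<and>
     (\<forall>X\<in>Ob C. \<forall>Y\<in>Ob C. \<forall>f\<in>Hom C X Y. \<forall>c.
        \<Phi> X Y (Scale C X Y c f) = Scale D (F X) (F Y) c (\<Phi> X Y f))"

definition isomorphism :: "('o, 'm, 'k) lincat \<Rightarrow> 'o \<Rightarrow> 'o \<Rightarrow> 'm \<Rightarrow> bool" where
  "isomorphism C X Y f \<longleftrightarrow> f \<in> Hom C X Y \<and>
     (\<exists>g\<in>Hom C Y X. Comp C X Y X g f = Ident C X \<and> Comp C Y X Y f g = Ident C Y)"

definition natural_iso_from_id ::
  "('o, 'm, 'k) lincat \<Rightarrow> ('o \<Rightarrow> 'o) \<Rightarrow> ('o \<Rightarrow> 'o \<Rightarrow> 'm \<Rightarrow> 'm) \<Rightarrow> ('o \<Rightarrow> 'm) \<Rightarrow> bool" where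
  "natural_iso_from_id C F \<Phi> \<eta> \<longleftrightarrow>
     (\<forall>X\<in>Ob C. isomorphism C X (F X) (\<eta> X)) \<and>
     (\<forall>X\<in>Ob C. \<forall>Y\<in>Ob C. \<forall>f\<in>Hom C X Y.
        Comp C X Y (F Y) (\<eta> Y) f = Comp C X (F X) (F Y) (\<Phi> X Y f) (\<eta> X))"

definition equivalent_categories :: "('o, 'm, 'k) lincat \<Rightarrow> ('p, 'n, 'k) lincat \<Rightarrow> bool" where
  "equivalent_categories C D \<longleftrightarrow> (\<exists>F \<Phi> G \<Psi> \<eta> \<epsilon>.
     linear_functor C D F \<Phi> \<and> linear_functor D C G \<Psi> \<and>
     natural_iso_from_id C (G \<circ> F) (\<lambda>X Y f. \<Psi> (F X) (F Y) (\<Phi> X Y f)) \<eta> \<and>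
     natural_iso_from_id D (F \<circ> G) (\<lambda>X Y f. \<Phi> (G X) (G Y) (\<Psi> X Y f)) \<epsilon>)"

section \<open>Associative algebras and free products\<close>

text \<open>An algebra is a record of the library type \<open>module\<close>, which carries both a ring and a scalar
  multiplication. (The library locale \<open>algebra\<close> is for commutative algebras.)\<close>

locale assoc_algebra = ring A + vec: Module.module class_ring A
  for A :: "('k::field, 'a, 'm) module_scheme" (structure) +
  assumes smult_mult: "\<lbrakk>x \<in> carrier A; y \<in> carrier A\<rbrakk> \<Longrightarrow> (c \<odot> x) \<otimes> y = c \<odot> (x \<otimes> y)"
    and mult_smult: "\<lbrakk>x \<in> carrier A; y \<in> carrier A\<rbrakk> \<Longrightarrow> x \<otimes> (c \<odot> y) = c \<odot> (x \<otimes> y)"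

definition alg_hom ::
  "('k, 'a, 'm) module_scheme \<Rightarrow> ('k, 'b, 'n) module_scheme \<Rightarrow> ('a \<Rightarrow> 'b) set" where
  "alg_hom A B = {f \<in> Ring.ring_hom A B. \<forall>c. \<forall>x\<in>carrier A. f (c \<odot>\<^bsub>A\<^esub> x) = c \<odot>\<^bsub>B\<^esub> f x}"

text \<open>Words form a monoid under concatenation, so that \<open>'x free_word \<Rightarrow>\<^sub>0 'k\<close> with the convolution
  product of \<^theory>\<open>HOL-Library.Poly_Mapping\<close> is the free algebra on \<open>'x\<close>.\<close>

datatype 'x free_word = Word (letters: "'x list")

instantiation free_word :: (type) monoid_add
begin

definition zero_free_word :: "'a free_word" where "0 = Word []"

definition plus_free_word :: "'a free_word \<Rightarrow> 'a free_word \<Rightarrow> 'a free_word" where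
  "u + v = Word (letters u @ letters v)"

instance by standard (simp_all add: zero_free_word_def plus_free_word_def)

end

definition const :: "'k \<Rightarrow> ('x free_word \<Rightarrow>\<^sub>0 'k::field)" where
  "const c = Poly_Mapping.single 0 c"

definition gen :: "'x \<Rightarrow> ('x free_word \<Rightarrow>\<^sub>0 'k::field)" where
  "gen x = Poly_Mapping.single (Word [x]) 1"

definition free_algebra :: "'x set \<Rightarrow> ('k::field, 'x free_word \<Rightarrow>\<^sub>0 'k) module" where
  "free_algebra X = \<lparr>carrier = {p. \<forall>u\<in>Poly_Mapping.keys p. set (letters u) \<subseteq> X},
     mult = (*), one = 1, zero = 0, add = (+), smult = (\<lambda>c p. const c * p)\<rparr>"

text \<open>The free product of a family of algebras is the free algebra on the disjoint union of their
  carriers, modulo the relations that make each inclusion an algebra homomorphism.\<close>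

definition free_product_relations ::
  "'i set \<Rightarrow> ('i \<Rightarrow> ('k::field, 'a, 'm) module_scheme) \<Rightarrow> (('i \<times> 'a) free_word \<Rightarrow>\<^sub>0 'k) set" where
  "free_product_relations I A =
     (\<Union>i\<in>I. {gen (i, a \<oplus>\<^bsub>A i\<^esub> b) - (gen (i, a) + gen (i, b)) | a b.
               a \<in> carrier (A i) \<and> b \<in> carrier (A i)}
          \<union> {gen (i, a \<otimes>\<^bsub>A i\<^esub> b) - gen (i, a) * gen (i, b) | a b.
               a \<in> carrier (A i) \<and> b \<in> carrier (A i)}
          \<union> {gen (i, c \<odot>\<^bsub>A i\<^esub> a) - const c * gen (i, a) | c a. a \<in> carrier (A i)}
          \<union> {gen (i, \<one>\<^bsub>A i\<^esub>) - 1})"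

definition free_product_ideal ::
  "'i set \<Rightarrow> ('i \<Rightarrow> ('k::field, 'a, 'm) module_scheme) \<Rightarrow> (('i \<times> 'a) free_word \<Rightarrow>\<^sub>0 'k) set" where
  "free_product_ideal I A =
     Idl\<^bsub>free_algebra (Sigma I (\<lambda>i. carrier (A i)))\<^esub> free_product_relations I A"

definition free_product_class ::
  "'i set \<Rightarrow> ('i \<Rightarrow> ('k::field, 'a, 'm) module_scheme)
   \<Rightarrow> (('i \<times> 'a) free_word \<Rightarrow>\<^sub>0 'k) \<Rightarrow> (('i \<times> 'a) free_word \<Rightarrow>\<^sub>0 'k) set" where
  "free_product_class I A p =
     free_product_ideal I A +>\<^bsub>free_algebra (Sigma I (\<lambda>i. carrier (A i)))\<^esub> p"

definition free_product ::
  "'i set \<Rightarrow> ('i \<Rightarrow> ('k::field, 'a, 'm) module_scheme)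
   \<Rightarrow> ('k, (('i \<times> 'a) free_word \<Rightarrow>\<^sub>0 'k) set) module" where
  "free_product I A =
     (let Q = free_algebra (Sigma I (\<lambda>i. carrier (A i))) Quot free_product_ideal I A
      in ring.extend Q (module.fields (\<lambda>c X. free_product_class I A (const c) \<otimes>\<^bsub>Q\<^esub> X)))"

definition free_product_incl ::
  "'i set \<Rightarrow> ('i \<Rightarrow> ('k::field, 'a, 'm) module_scheme)
   \<Rightarrow> 'i \<Rightarrow> 'a \<Rightarrow> (('i \<times> 'a) free_word \<Rightarrow>\<^sub>0 'k) set" where
  "free_product_incl I A i a = free_product_class I A (gen (i, a))"

section \<open>Left modules\<close>

text \<open>The library locale \<open>module\<close> is for modules over commutative rings. In the record of a module
  the fields \<open>mult\<close> and \<open>one\<close> are not used.\<close>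

locale left_module = R?: ring R + M?: abelian_group M
  for R :: "('a, 'm) ring_scheme" (structure) and M :: "('a, 'v, 'n) module_scheme" (structure) +
  assumes smult_closed: "\<lbrakk>a \<in> carrier R; x \<in> carrier M\<rbrakk> \<Longrightarrow> a \<odot>\<^bsub>M\<^esub> x \<in> carrier M"
    and smult_l_distr: "\<lbrakk>a \<in> carrier R; b \<in> carrier R; x \<in> carrier M\<rbrakk>
      \<Longrightarrow> (a \<oplus>\<^bsub>R\<^esub> b) \<odot>\<^bsub>M\<^esub> x = a \<odot>\<^bsub>M\<^esub> x \<oplus>\<^bsub>M\<^esub> b \<odot>\<^bsub>M\<^esub> x"
    and smult_r_distr: "\<lbrakk>a \<in> carrier R; x \<in> carrier M; y \<in> carrier M\<rbrakk>
      \<Longrightarrow> a \<odot>\<^bsub>M\<^esub> (x \<oplus>\<^bsub>M\<^esub> y) = a \<odot>\<^bsub>M\<^esub> x \<oplus>\<^bsub>M\<^esub> a \<odot>\<^bsub>M\<^esub> y"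
    and smult_assoc: "\<lbrakk>a \<in> carrier R; b \<in> carrier R; x \<in> carrier M\<rbrakk>
      \<Longrightarrow> (a \<otimes>\<^bsub>R\<^esub> b) \<odot>\<^bsub>M\<^esub> x = a \<odot>\<^bsub>M\<^esub> (b \<odot>\<^bsub>M\<^esub> x)"
    and smult_one: "x \<in> carrier M \<Longrightarrow> \<one>\<^bsub>R\<^esub> \<odot>\<^bsub>M\<^esub> x = x"

definition simple_module :: "('a, 'm) ring_scheme \<Rightarrow> ('a, 'v, 'n) module_scheme \<Rightarrow> bool" where
  "simple_module R M \<longleftrightarrow> left_module R M \<and> carrier M \<noteq> {\<zero>\<^bsub>M\<^esub>} \<and>
     (\<forall>H. Module.submodule H R M \<longrightarrow> H = {\<zero>\<^bsub>M\<^esub>} \<or> H = carrier M)"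

definition isomorphic_modules ::
  "('a, 'm) ring_scheme \<Rightarrow> ('a, 'v, 'n) module_scheme \<Rightarrow> ('a, 'u, 'l) module_scheme \<Rightarrow> bool" where
  "isomorphic_modules R M N \<longleftrightarrow> (\<exists>f\<in>module_hom R M N. bij_betw f (carrier M) (carrier N))"

definition quotient_module :: "('a, 'v) module \<Rightarrow> 'v set \<Rightarrow> ('a, 'v set) module" where
  "quotient_module M H = \<lparr>carrier = a_rcosets\<^bsub>M\<^esub> H, mult = (\<lambda>_ _. H), one = H, zero = H,
     add = set_add M, smult = (\<lambda>a X. \<Union>x\<in>X. H +>\<^bsub>M\<^esub> (a \<odot>\<^bsub>M\<^esub> x))\<rparr>"

definition composition_series ::
  "('a, 'm) ring_scheme \<Rightarrow> ('a, 'v) module \<Rightarrow> 'v set list \<Rightarrow> bool" where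
  "composition_series R M Hs \<longleftrightarrow> Hs \<noteq> [] \<and> hd Hs = {\<zero>\<^bsub>M\<^esub>} \<and> last Hs = carrier M \<and>
     (\<forall>H\<in>set Hs. Module.submodule H R M) \<and>
     (\<forall>l. Suc l < length Hs \<longrightarrow> Hs ! l \<subseteq> Hs ! Suc l \<and>
        simple_module R (quotient_module (M\<lparr>carrier := Hs ! Suc l\<rparr>) (Hs ! l)))"

definition composition_factors ::
  "('a, 'm) ring_scheme \<Rightarrow> ('a, 'v) module \<Rightarrow> ('a, 'v set) module set" where
  "composition_factors R M = {quotient_module (M\<lparr>carrier := Hs ! Suc l\<rparr>) (Hs ! l) | Hs l.
     composition_series R M Hs \<and> Suc l < length Hs}"

text \<open>The vector space underlying a module over an algebra.\<close>

definition over_field ::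
  "('k::field, 'a, 'm) module_scheme \<Rightarrow> ('a, 'v) module \<Rightarrow> ('k, 'v) module" where
  "over_field A M = \<lparr>carrier = carrier M, mult = mult M, one = one M, zero = zero M,
     add = add M, smult = (\<lambda>c x. (c \<odot>\<^bsub>A\<^esub> \<one>\<^bsub>A\<^esub>) \<odot>\<^bsub>M\<^esub> x)\<rparr>"

text \<open>The finite dimensional modules carried by a subset of the type \<open>'v\<close>. If \<open>'k\<close> is infinite and
  injects into \<open>'v\<close>, then every finite dimensional module is isomorphic to one of these. Morphisms are
  made extensional, so that two of them are equal iff they agree on the carrier.\<close>

definition rep :: "('k::field, 'a, 'm) module_scheme \<Rightarrow> (('a, 'v) module, 'v \<Rightarrow> 'v, 'k) lincat" where
  "rep A = \<lparr>
     Ob = {M. left_module A M \<and> vectorspace.fin_dim class_ring (over_field A M)},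
     Hom = (\<lambda>M N. module_hom A M N \<inter> extensional (carrier M)),
     Ident = (\<lambda>M. \<lambda>x\<in>carrier M. x),
     Comp = (\<lambda>M N L g f. compose (carrier M) g f),
     Plus = (\<lambda>M N f g. \<lambda>x\<in>carrier M. f x \<oplus>\<^bsub>N\<^esub> g x),
     Scale = (\<lambda>M N c f. \<lambda>x\<in>carrier M. c \<odot>\<^bsub>over_field A N\<^esub> f x)\<rparr>"

text \<open>The finite dimensional modules all of whose composition factors are isomorphic to members
  of \<open>\<S>\<close>. For a set \<open>\<S>\<close> of simple modules this is the smallest full abelian extension-closed
  subcategory containing \<open>\<S>\<close>.\<close>

definition wide ::
  "('k::field, 'a, 'm) module_scheme \<Rightarrow> ('a, 'v) module set
   \<Rightarrow> (('a, 'v) module, 'v \<Rightarrow> 'v, 'k) lincat" where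
  "wide A \<S> = full_subcategory (rep A)
     {M. \<forall>N\<in>composition_factors A M. \<exists>S\<in>\<S>. isomorphic_modules A N S}"

section \<open>Quivers and their nilpotent representations\<close>

text \<open>Quivers are directed multigraphs of type \<open>pre_digraph\<close>.\<close>

definition euler_form :: "('v, 'e) pre_digraph \<Rightarrow> ('v \<Rightarrow> nat) \<Rightarrow> ('v \<Rightarrow> nat) \<Rightarrow> int" where
  "euler_form Q d d' = (\<Sum>v\<in>verts Q. int (d v) * int (d' v))
     - (\<Sum>a\<in>arcs Q. int (d (tail Q a)) * int (d' (head Q a)))"

record ('v, 'e, 'k, 'u) quiver_rep =
  space :: "'v \<Rightarrow> ('k, 'u) module"
  arrow :: "'e \<Rightarrow> 'u \<Rightarrow> 'u"

definition is_quiver_rep ::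
  "('v, 'e) pre_digraph \<Rightarrow> ('v, 'e, 'k::field, 'u) quiver_rep \<Rightarrow> bool" where
  "is_quiver_rep Q V \<longleftrightarrow>
     (\<forall>v\<in>verts Q. vectorspace class_ring (space V v) \<and>
        vectorspace.fin_dim class_ring (space V v)) \<and>
     (\<forall>a\<in>arcs Q. arrow V a \<in> module_hom class_ring (space V (tail Q a)) (space V (head Q a)))"

definition nilpotent_rep ::
  "('v, 'e) pre_digraph \<Rightarrow> ('v, 'e, 'k::field, 'u) quiver_rep \<Rightarrow> bool" where
  "nilpotent_rep Q V \<longleftrightarrow> (\<exists>n. \<forall>u p v. pre_digraph.awalk Q u p v \<and> length p \<ge> n \<longrightarrow>
     (\<forall>x\<in>carrier (space V u). fold (arrow V) p x = \<zero>\<^bsub>space V v\<^esub>))"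

definition quiver_reps ::
  "('v, 'e) pre_digraph
   \<Rightarrow> (('v, 'e, 'k::field, 'u) quiver_rep, 'v \<Rightarrow> 'u \<Rightarrow> 'u, 'k) lincat" where
  "quiver_reps Q = \<lparr>
     Ob = {V. is_quiver_rep Q V},
     Hom = (\<lambda>V W. {\<phi>. \<phi> \<in> (\<Pi>\<^sub>E v\<in>verts Q.
          module_hom class_ring (space V v) (space W v) \<inter> extensional (carrier (space V v))) \<and>
        (\<forall>a\<in>arcs Q. \<forall>x\<in>carrier (space V (tail Q a)).
           \<phi> (head Q a) (arrow V a x) = arrow W a (\<phi> (tail Q a) x))}),
     Ident = (\<lambda>V. \<lambda>v\<in>verts Q. \<lambda>x\<in>carrier (space V v). x),
     Comp = (\<lambda>V W U \<psi> \<phi>. \<lambda>v\<in>verts Q. compose (carrier (space V v)) (\<psi> v) (\<phi> v)),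
     Plus = (\<lambda>V W \<phi> \<psi>. \<lambda>v\<in>verts Q. \<lambda>x\<in>carrier (space V v). \<phi> v x \<oplus>\<^bsub>space W v\<^esub> \<psi> v x),
     Scale = (\<lambda>V W c \<phi>. \<lambda>v\<in>verts Q. \<lambda>x\<in>carrier (space V v). c \<odot>\<^bsub>space W v\<^esub> \<phi> v x)\<rparr>"

definition nilpotent_reps ::
  "('v, 'e) pre_digraph
   \<Rightarrow> (('v, 'e, 'k::field, 'u) quiver_rep, 'v \<Rightarrow> 'u \<Rightarrow> 'u, 'k) lincat" where
  "nilpotent_reps Q = full_subcategory (quiver_reps Q) {V. nilpotent_rep Q V}"

section \<open>Free products of semisimple algebras\<close>

text \<open>All indices start at \<open>0\<close>: the algebras \<open>A\<^sub>i\<close> are indexed by \<open>i < m\<close>, the simple factors of \<open>A\<^sub>i\<close>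
  by \<open>j < r i\<close>, and the \<open>j\<close>-th factor consists of the matrices of size \<open>w i j\<close>. An element of a
  product of matrix algebras is the list of its components.\<close>

definition matrix_product_algebra ::
  "nat \<Rightarrow> (nat \<Rightarrow> nat) \<Rightarrow> ('k::field, 'k mat list) module" where
  "matrix_product_algebra r w = \<lparr>
     carrier = {Xs. length Xs = r \<and> (\<forall>j<r. Xs ! j \<in> carrier_mat (w j) (w j))},
     mult = map2 (*), one = map (\<lambda>j. 1\<^sub>m (w j)) [0..<r],
     zero = map (\<lambda>j. 0\<^sub>m (w j) (w j)) [0..<r], add = map2 (+),
     smult = (\<lambda>c. map ((\<cdot>\<^sub>m) c))\<rparr>"

definition matrix_unit ::
  "nat \<Rightarrow> (nat \<Rightarrow> nat) \<Rightarrow> nat \<Rightarrow> nat \<Rightarrow> nat \<Rightarrow> 'k::field mat list" where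
  "matrix_unit r w j p q = map (\<lambda>j'. mat (w j') (w j')
     (\<lambda>(p', q'). if j' = j \<and> p' = p \<and> q' = q then 1 else 0)) [0..<r]"

type_synonym 'k coprod = "((nat \<times> 'k mat list) free_word \<Rightarrow>\<^sub>0 'k) set"

definition semisimple_free_product ::
  "nat \<Rightarrow> (nat \<Rightarrow> nat) \<Rightarrow> (nat \<Rightarrow> nat \<Rightarrow> nat) \<Rightarrow> ('k::field, 'k coprod) module" where
  "semisimple_free_product m r w =
     free_product {..<m} (\<lambda>i. matrix_product_algebra (r i) (w i))"

text \<open>The element \<open>e\<^sub>i\<^sub>j\<^sup>p\<^sup>q\<close> of the free product.\<close>

definition free_product_matrix_unit ::
  "nat \<Rightarrow> (nat \<Rightarrow> nat) \<Rightarrow> (nat \<Rightarrow> nat \<Rightarrow> nat)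
   \<Rightarrow> nat \<Rightarrow> nat \<Rightarrow> nat \<Rightarrow> nat \<Rightarrow> 'k::field coprod" where
  "free_product_matrix_unit m r w i j p q =
     free_product_incl {..<m} (\<lambda>i. matrix_product_algebra (r i) (w i)) i
       (matrix_unit (r i) (w i) j p q)"

datatype gamma_vertex = Sink | Source nat nat

definition gamma_quiver ::
  "nat \<Rightarrow> (nat \<Rightarrow> nat) \<Rightarrow> (nat \<Rightarrow> nat \<Rightarrow> nat) \<Rightarrow> (gamma_vertex, nat \<times> nat \<times> nat) pre_digraph" where
  "gamma_quiver m r w = \<lparr>
     verts = insert Sink {Source i j | i j. i < m \<and> j < r i},
     arcs = {(i, j, k). i < m \<and> j < r i \<and> k < w i j},
     tail = (\<lambda>(i, j, k). Source i j),
     head = (\<lambda>_. Sink)\<rparr>"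

text \<open>In the second equation \<open>(0, 0)\<close> is the first diagonal position, so the space is \<open>e\<^sub>i\<^sub>j\<^sup>1\<^sup>1 M\<close>.\<close>

fun dimension_vector ::
  "nat \<Rightarrow> (nat \<Rightarrow> nat) \<Rightarrow> (nat \<Rightarrow> nat \<Rightarrow> nat) \<Rightarrow> ('k::field coprod, 'v) module
   \<Rightarrow> gamma_vertex \<Rightarrow> nat" where
  "dimension_vector m r w M Sink =
     vectorspace.dim class_ring (over_field (semisimple_free_product m r w) M)"
| "dimension_vector m r w M (Source i j) =
     vectorspace.dim class_ring ((over_field (semisimple_free_product m r w) M)
       \<lparr>carrier := (\<lambda>x. free_product_matrix_unit m r w i j 0 0 \<odot>\<^bsub>M\<^esub> x) ` carrier M\<rparr>)"

text \<open>The arrows from \<open>S\<close> to \<open>T\<close> are the triples \<open>(S, T, k)\<close> with \<open>k\<close> below the required number.\<close>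

definition simples_quiver ::
  "nat \<Rightarrow> (nat \<Rightarrow> nat) \<Rightarrow> (nat \<Rightarrow> nat \<Rightarrow> nat) \<Rightarrow> ('k::field coprod, 'v) module set
   \<Rightarrow> (('k coprod, 'v) module, ('k coprod, 'v) module \<times> ('k coprod, 'v) module \<times> nat) pre_digraph"
  where
  "simples_quiver m r w \<S> = \<lparr>
     verts = \<S>,
     arcs = {(S, T, k). S \<in> \<S> \<and> T \<in> \<S> \<and>
       (let e = euler_form (gamma_quiver m r w) (dimension_vector m r w S) (dimension_vector m r w T)
        in int k < (if S = T then 1 - e else - e))},
     tail = (\<lambda>(S, T, k). S),
     head = (\<lambda>(S, T, k). T)\<rparr>"

section \<open>The free product is the coproduct, and the categories are categories\<close>

lemma poly_mapping_sum_single: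
  fixes p :: "'x \<Rightarrow>\<^sub>0 'k::comm_monoid_add"
  shows "(\<Sum>u\<in>Poly_Mapping.keys p. Poly_Mapping.single u (Poly_Mapping.lookup p u)) = p"
proof (rule poly_mapping_eqI)
  fix k
  have "Poly_Mapping.lookup (\<Sum>u\<in>Poly_Mapping.keys p. Poly_Mapping.single u (Poly_Mapping.lookup p u)) k
     = (\<Sum>u\<in>Poly_Mapping.keys p. Poly_Mapping.lookup (Poly_Mapping.single u (Poly_Mapping.lookup p u)) k)"
    by (simp add: lookup_sum)
  also have "\<dots> = (\<Sum>u\<in>Poly_Mapping.keys p. if u = k then Poly_Mapping.lookup p k else 0)"
    by (rule sum.cong) (auto simp: lookup_single when_def)
  also have "\<dots> = Poly_Mapping.lookup p k" by (auto simp: in_keys_iff)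
  finally show "Poly_Mapping.lookup (\<Sum>u\<in>Poly_Mapping.keys p. Poly_Mapping.single u (Poly_Mapping.lookup p u)) k = Poly_Mapping.lookup p k" .
qed

lemma free_algebra_simps [simp]:
  "carrier (free_algebra X) = {p. \<forall>u\<in>Poly_Mapping.keys p. set (letters u) \<subseteq> X}"
  "mult (free_algebra X) = (*)" "one (free_algebra X) = 1"
  "zero (free_algebra X) = 0" "add (free_algebra X) = (+)"
  "module.smult (free_algebra X) = (\<lambda>c p. const c * p)"
  by (auto simp: free_algebra_def fun_eq_iff)

lemma const_simps: "const (c + d) = const c + const d" "const (c * d) = const c * const d"
  "const 1 = 1" "const 0 = 0"
  by (auto simp: const_def single_add mult_single)

lemma const_comm: "const c * (p :: 'x free_word \<Rightarrow>\<^sub>0 'k::field) = p * const c"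
proof -
  have "const c * (\<Sum>u\<in>Poly_Mapping.keys p. Poly_Mapping.single u (Poly_Mapping.lookup p u))
      = (\<Sum>u\<in>Poly_Mapping.keys p. Poly_Mapping.single u (Poly_Mapping.lookup p u)) * const c"
    unfolding sum_distrib_left sum_distrib_right
    by (rule sum.cong) (auto simp: const_def mult_single mult.commute)
  then show ?thesis by (simp add: poly_mapping_sum_single)
qed

lemma free_algebra_closed:
  assumes "p \<in> carrier (free_algebra X)" "q \<in> carrier (free_algebra X)"
  shows "p + q \<in> carrier (free_algebra X)" "p * q \<in> carrier (free_algebra X)"
    "- p \<in> carrier (free_algebra X)" "p - q \<in> carrier (free_algebra X)"
proof -
  show "p + q \<in> carrier (free_algebra X)" using assms keys_add[of p q] by fastforce
  show "- p \<in> carrier (free_algebra X)" using assms by simp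
  show "p - q \<in> carrier (free_algebra X)" using assms keys_diff[of p q] by fastforce
  show "p * q \<in> carrier (free_algebra X)"
  proof simp
    show "\<forall>u\<in>Poly_Mapping.keys (p * q). set (letters u) \<subseteq> X"
    proof
      fix u assume "u \<in> Poly_Mapping.keys (p * q)"
      then obtain a b where "u = a + b" "a \<in> Poly_Mapping.keys p" "b \<in> Poly_Mapping.keys q"
        using keys_mult[of p q] by blast
      then show "set (letters u) \<subseteq> X" using assms by (auto simp: plus_free_word_def)
    qed
  qed
qed

lemma const_closed [simp]: "const c \<in> carrier (free_algebra X)"
  by (auto simp: const_def zero_free_word_def)

lemma gen_closed [simp]: "x \<in> X \<Longrightarrow> gen x \<in> carrier (free_algebra X)"
  by (auto simp: gen_def)

lemma free_algebra_ring: "ring (free_algebra X)"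
proof -
  note cl = free_algebra_closed
  have one: "1 \<in> carrier (free_algebra X)" using const_closed[of 1] by (simp add: const_simps)
  have "abelian_group (free_algebra X)"
  proof (rule abelian_groupI)
    fix x assume "x \<in> carrier (free_algebra X)"
    then show "\<exists>y\<in>carrier (free_algebra X). y \<oplus>\<^bsub>free_algebra X\<^esub> x = \<zero>\<^bsub>free_algebra X\<^esub>"
      by (intro bexI[of _ "- x"]) auto
  qed (use cl in \<open>auto simp: algebra_simps simp del: free_algebra_simps(1)\<close>, simp)
  moreover have "Group.monoid (free_algebra X)"
    by (rule monoidI) (use cl one in \<open>auto simp: algebra_simps simp del: free_algebra_simps(1)\<close>)
  ultimately show ?thesis
    by (rule ringI) (auto simp: algebra_simps)
qed

lemma free_algebra_assoc_algebra:
  "assoc_algebra (free_algebra X :: ('k::field, 'x free_word \<Rightarrow>\<^sub>0 'k) module)"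
proof -
  interpret ring "free_algebra X :: ('k::field, 'x free_word \<Rightarrow>\<^sub>0 'k) module" by (rule free_algebra_ring)
  show ?thesis
  proof (intro_locales)
    show "module_axioms class_ring (free_algebra X :: ('k::field, 'x free_word \<Rightarrow>\<^sub>0 'k) module)"
      by unfold_locales
        (use free_algebra_closed const_closed in \<open>auto simp: free_algebra_closed(2)[OF const_closed] algebra_simps const_simps simp del: free_algebra_simps(1)\<close>)
    show "assoc_algebra_axioms (free_algebra X :: ('k::field, 'x free_word \<Rightarrow>\<^sub>0 'k) module)"
      by unfold_locales (simp_all, metis mult.assoc, metis const_comm mult.assoc)
  qed
qed

lemma free_algebra_induct [consumes 1, case_names const gen add mult]:
  assumes p: "p \<in> carrier (free_algebra X)"
    and c: "\<And>c. P (const c)"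
    and g: "\<And>x. x \<in> X \<Longrightarrow> P (gen x)"
    and a: "\<And>p q. \<lbrakk>p \<in> carrier (free_algebra X); q \<in> carrier (free_algebra X); P p; P q\<rbrakk> \<Longrightarrow> P (p + q)"
    and m: "\<And>p q. \<lbrakk>p \<in> carrier (free_algebra X); q \<in> carrier (free_algebra X); P p; P q\<rbrakk> \<Longrightarrow> P (p * q)"
  shows "P p"
proof -
  have mon: "Poly_Mapping.single (Word xs) 1 \<in> carrier (free_algebra X) \<and> P (Poly_Mapping.single (Word xs) 1)"
    if "set xs \<subseteq> X" for xs
    using that
  proof (induction xs)
    case Nil
    show ?case using c[of 1] const_closed[of 1 X] by (simp add: const_def zero_free_word_def)
  next
    case (Cons x xs)
    have eq: "Poly_Mapping.single (Word (x # xs)) 1 = gen x * Poly_Mapping.single (Word xs) 1"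
      by (simp add: gen_def mult_single plus_free_word_def)
    show ?case unfolding eq
    proof
      have *: "gen x \<in> carrier (free_algebra X)" "P (gen x)"
        "Poly_Mapping.single (Word xs) 1 \<in> carrier (free_algebra X)" "P (Poly_Mapping.single (Word xs) 1)"
        using Cons g[of x] gen_closed[of x X] by auto
      show "gen x * Poly_Mapping.single (Word xs) 1 \<in> carrier (free_algebra X)"
        by (rule free_algebra_closed) (use * in blast)+
      show "P (gen x * Poly_Mapping.single (Word xs) 1)" by (rule m) (use * in blast)+
    qed
  qed
  have sing: "Poly_Mapping.single u d \<in> carrier (free_algebra X) \<and> P (Poly_Mapping.single u d)"
    if "set (letters u) \<subseteq> X" for u d
  proof -
    have eq: "Poly_Mapping.single u d = const d * Poly_Mapping.single (Word (letters u)) 1"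
      by (simp add: const_def mult_single)
    show ?thesis unfolding eq using mon[OF that] c m free_algebra_closed(2) const_closed by blast
  qed
  have zero: "0 \<in> carrier (free_algebra X) \<and> P 0"
    using c[of 0] by (simp add: const_simps)
  have "(\<Sum>u\<in>F. Poly_Mapping.single u (Poly_Mapping.lookup p u)) \<in> carrier (free_algebra X) \<and>
      P (\<Sum>u\<in>F. Poly_Mapping.single u (Poly_Mapping.lookup p u))"
    if "finite F" "F \<subseteq> Poly_Mapping.keys p" for F
    using that
  proof (induction F rule: finite_induct)
    case empty then show ?case using zero by simp
  next
    case (insert u F)
    have "set (letters u) \<subseteq> X" using p insert.prems by auto
    from sing[OF this] show ?case
      using insert by (auto simp del: free_algebra_simps intro: a free_algebra_closed(1))
  qed
  from this[OF _ order_refl] show ?thesis by (simp add: poly_mapping_sum_single)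
qed

context assoc_algebra
begin

definition monom :: "('x \<Rightarrow> 'a) \<Rightarrow> 'x free_word \<Rightarrow> 'a" where
  "monom f u = foldr (\<lambda>x b. f x \<otimes> b) (letters u) \<one>"

definition eval_free :: "('x \<Rightarrow> 'a) \<Rightarrow> ('x free_word \<Rightarrow>\<^sub>0 'k) \<Rightarrow> 'a" where
  "eval_free f p = (\<Oplus>u\<in>Poly_Mapping.keys p. Poly_Mapping.lookup p u \<odot> monom f u)"

lemma monom_closed [simp]: "(\<And>x. f x \<in> carrier A) \<Longrightarrow> monom f u \<in> carrier A"
proof -
  assume f: "\<And>x. f x \<in> carrier A"
  have "foldr (\<lambda>x b. f x \<otimes> b) xs \<one> \<in> carrier A" for xs
    by (induction xs) (auto simp: f)
  then show ?thesis by (simp add: monom_def)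
qed

lemma monom_plus: "(\<And>x. f x \<in> carrier A) \<Longrightarrow> monom f (u + v) = monom f u \<otimes> monom f v"
proof -
  assume f: "\<And>x. f x \<in> carrier A"
  have cl: "foldr (\<lambda>x b. f x \<otimes> b) xs \<one> \<in> carrier A" for xs
    by (induction xs) (auto simp: f)
  have "foldr (\<lambda>x b. f x \<otimes> b) (xs @ ys) \<one>
      = foldr (\<lambda>x b. f x \<otimes> b) xs \<one> \<otimes> foldr (\<lambda>x b. f x \<otimes> b) ys \<one>" for xs ys
    by (induction xs) (use cl f in \<open>auto simp: m_assoc\<close>)
  then show ?thesis by (simp add: monom_def plus_free_word_def)
qed

lemma smult_one' [simp]: "x \<in> carrier A \<Longrightarrow> 1 \<odot> x = x"
  using vec.smult_one[of x] by simp

lemma scal_closed [simp]: "x \<in> carrier A \<Longrightarrow> c \<odot> x \<in> carrier A"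
  using vec.smult_closed[of c x] by simp

lemma scal_zero [simp]: "x \<in> carrier A \<Longrightarrow> 0 \<odot> x = \<zero>"
  using vec.smult_l_null[of x] by simp

lemma eval_free_superset:
  assumes f: "\<And>x. f x \<in> carrier A" and F: "finite F" "Poly_Mapping.keys p \<subseteq> F"
  shows "eval_free f p = (\<Oplus>u\<in>F. Poly_Mapping.lookup p u \<odot> monom f u)"
  unfolding eval_free_def
  by (rule add.finprod_mono_neutral_cong_left)
    (use F in \<open>auto simp: f in_keys_iff Pi_iff\<close>)

lemma eval_free_closed [simp]: "(\<And>x. f x \<in> carrier A) \<Longrightarrow> eval_free f p \<in> carrier A"
  unfolding eval_free_def by (intro finsum_closed) auto

lemma eval_free_add:
  assumes f: "\<And>x. f x \<in> carrier A"
  shows "eval_free f (p + q) = eval_free f p \<oplus> eval_free f q"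
proof -
  let ?F = "Poly_Mapping.keys p \<union> Poly_Mapping.keys q"
  have k: "Poly_Mapping.keys (p + q) \<subseteq> ?F" by (rule keys_add)
  have "eval_free f (p + q) = (\<Oplus>u\<in>?F. Poly_Mapping.lookup (p + q) u \<odot> monom f u)"
    by (rule eval_free_superset) (use f k in auto)
  also have "\<dots> = (\<Oplus>u\<in>?F. Poly_Mapping.lookup p u \<odot> monom f u \<oplus> Poly_Mapping.lookup q u \<odot> monom f u)"
    by (rule finsum_cong')
      (use f in \<open>auto simp: lookup_add vec.smult_l_distr[simplified]\<close>)
  also have "\<dots> = (\<Oplus>u\<in>?F. Poly_Mapping.lookup p u \<odot> monom f u) \<oplus> (\<Oplus>u\<in>?F. Poly_Mapping.lookup q u \<odot> monom f u)"
    by (rule finsum_addf) (use f in auto)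
  also have "\<dots> = eval_free f p \<oplus> eval_free f q"
    using eval_free_superset[OF f, of ?F p] eval_free_superset[OF f, of ?F q] by simp
  finally show ?thesis .
qed

lemma eval_free_single:
  assumes f: "\<And>x. f x \<in> carrier A"
  shows "eval_free f (Poly_Mapping.single u c) = c \<odot> monom f u"
proof -
  have "eval_free f (Poly_Mapping.single u c) = (\<Oplus>v\<in>{u}. Poly_Mapping.lookup (Poly_Mapping.single u c) v \<odot> monom f v)"
    by (rule eval_free_superset) (use f in auto)
  also have "\<dots> = c \<odot> monom f u"
    using f by (subst finsum_insert) (auto)
  finally show ?thesis .
qed

lemma eval_free_const:
  "(\<And>x. f x \<in> carrier A) \<Longrightarrow> eval_free f (const c) = c \<odot> \<one>"
  unfolding const_def by (subst eval_free_single) (auto simp: monom_def zero_free_word_def)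

lemma eval_free_gen:
  "(\<And>x. f x \<in> carrier A) \<Longrightarrow> eval_free f (gen x) = f x"
  unfolding gen_def using vec.smult_one
  by (subst eval_free_single) (auto simp: monom_def)

lemma eval_free_sum:
  assumes f: "\<And>x. f x \<in> carrier A"
  shows "finite F \<Longrightarrow> eval_free f (\<Sum>u\<in>F. g u) = (\<Oplus>u\<in>F. eval_free f (g u))"
proof (induction F rule: finite_induct)
  case empty
  show ?case by (simp add: eval_free_def)
next
  case (insert u F)
  then show ?case using f by (simp add: eval_free_add)
qed

lemma eval_free_mult:
  assumes f: "\<And>x. f x \<in> carrier A"
  shows "eval_free f (p * q) = eval_free f p \<otimes> eval_free f q"
proof -
  let ?s = "\<lambda>p u. Poly_Mapping.single u (Poly_Mapping.lookup p u)"
  have ss: "eval_free f (Poly_Mapping.single u c * Poly_Mapping.single v d)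
     = eval_free f (Poly_Mapping.single u c) \<otimes> eval_free f (Poly_Mapping.single v d)" for u v c d
    using f vec.smult_assoc1[of c d "monom f u \<otimes> monom f v"] vec.smult_assoc1[of d c "monom f u \<otimes> monom f v"]
    by (simp add: mult_single eval_free_single monom_plus smult_mult mult_smult mult.commute)
  have "eval_free f (p * q) = eval_free f ((\<Sum>u\<in>Poly_Mapping.keys p. ?s p u) * (\<Sum>v\<in>Poly_Mapping.keys q. ?s q v))"
    by (simp add: poly_mapping_sum_single)
  also have "\<dots> = (\<Oplus>u\<in>Poly_Mapping.keys p. \<Oplus>v\<in>Poly_Mapping.keys q. eval_free f (?s p u) \<otimes> eval_free f (?s q v))"
    unfolding sum_distrib_left sum_distrib_right
    by (subst sum.swap) (simp add: eval_free_sum f ss)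
  also have "\<dots> = (\<Oplus>u\<in>Poly_Mapping.keys p. eval_free f (?s p u)) \<otimes> (\<Oplus>v\<in>Poly_Mapping.keys q. eval_free f (?s q v))"
  proof -
    have "(\<Oplus>v\<in>Poly_Mapping.keys q. eval_free f (?s p u) \<otimes> eval_free f (?s q v))
       = eval_free f (?s p u) \<otimes> (\<Oplus>v\<in>Poly_Mapping.keys q. eval_free f (?s q v))" for u
      by (rule finsum_rdistr[symmetric]) (use f in auto)
    then show ?thesis
      by (simp) (rule finsum_ldistr[symmetric], use f in auto)
  qed
  also have "\<dots> = eval_free f (\<Sum>u\<in>Poly_Mapping.keys p. ?s p u) \<otimes> eval_free f (\<Sum>v\<in>Poly_Mapping.keys q. ?s q v)"
    by (simp add: eval_free_sum f)
  finally show ?thesis by (simp add: poly_mapping_sum_single)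
qed

end

context
  fixes I :: "'i set" and A :: "'i \<Rightarrow> ('k::field, 'a, 'm) module_scheme"
  assumes alg: "\<And>i. i \<in> I \<Longrightarrow> assoc_algebra (A i)"
begin

abbreviation "ambient \<equiv> free_algebra (Sigma I (\<lambda>i. carrier (A i))) :: ('k, ('i \<times> 'a) free_word \<Rightarrow>\<^sub>0 'k) module"

interpretation FA: assoc_algebra ambient by (rule free_algebra_assoc_algebra)

lemma free_product_relation_cases:
  assumes "p \<in> free_product_relations I A"
  obtains (add) i a b where "i \<in> I" "a \<in> carrier (A i)" "b \<in> carrier (A i)"
      "p = gen (i, a \<oplus>\<^bsub>A i\<^esub> b) - (gen (i, a) + gen (i, b))"
    | (mult) i a b where "i \<in> I" "a \<in> carrier (A i)" "b \<in> carrier (A i)"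
      "p = gen (i, a \<otimes>\<^bsub>A i\<^esub> b) - gen (i, a) * gen (i, b)"
    | (smult) i c a where "i \<in> I" "a \<in> carrier (A i)" "p = gen (i, c \<odot>\<^bsub>A i\<^esub> a) - const c * gen (i, a)"
    | (one) i where "i \<in> I" "p = gen (i, \<one>\<^bsub>A i\<^esub>) - 1"
  using assms unfolding free_product_relations_def by blast

lemma free_product_relation_intros:
  assumes i: "i \<in> I"
  shows "\<lbrakk>a \<in> carrier (A i); b \<in> carrier (A i)\<rbrakk>
      \<Longrightarrow> gen (i, a \<oplus>\<^bsub>A i\<^esub> b) - (gen (i, a) + gen (i, b)) \<in> free_product_relations I A"
    and "\<lbrakk>a \<in> carrier (A i); b \<in> carrier (A i)\<rbrakk>
      \<Longrightarrow> gen (i, a \<otimes>\<^bsub>A i\<^esub> b) - gen (i, a) * gen (i, b) \<in> free_product_relations I A"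
    and "a \<in> carrier (A i) \<Longrightarrow> gen (i, c \<odot>\<^bsub>A i\<^esub> a) - const c * gen (i, a) \<in> free_product_relations I A"
    and "gen (i, \<one>\<^bsub>A i\<^esub>) - 1 \<in> free_product_relations I A"
  unfolding free_product_relations_def
  subgoal by (rule UN_I[OF i], rule UnI1, rule UnI1, rule UnI1, rule CollectI, intro exI conjI) (rule refl)
  subgoal by (rule UN_I[OF i], rule UnI1, rule UnI1, rule UnI2, rule CollectI, intro exI conjI) (rule refl)
  subgoal by (rule UN_I[OF i], rule UnI1, rule UnI2, rule CollectI, intro exI conjI) (rule refl)
  subgoal by (rule UN_I[OF i], rule UnI2, rule singletonI)
  done

lemma gen_in_ambient: "\<lbrakk>i \<in> I; a \<in> carrier (A i)\<rbrakk> \<Longrightarrow> gen (i, a) \<in> carrier ambient"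
  by (rule gen_closed) auto

lemma free_product_relations_closed: "free_product_relations I A \<subseteq> carrier ambient"
proof
  fix p assume "p \<in> free_product_relations I A"
  then show "p \<in> carrier ambient"
  proof (cases rule: free_product_relation_cases)
    case (add i a b)
    interpret assoc_algebra "A i" by (rule alg[OF add(1)])
    have "a \<oplus>\<^bsub>A i\<^esub> b \<in> carrier (A i)" using add by simp
    then show ?thesis unfolding add(4) by (intro free_algebra_closed gen_in_ambient add)
  next
    case (mult i a b)
    interpret assoc_algebra "A i" by (rule alg[OF mult(1)])
    have "a \<otimes>\<^bsub>A i\<^esub> b \<in> carrier (A i)" using mult by simp
    then show ?thesis unfolding mult(4) by (intro free_algebra_closed gen_in_ambient mult)
  next
    case (smult i c a)
    interpret assoc_algebra "A i" by (rule alg[OF smult(1)])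
    have "c \<odot>\<^bsub>A i\<^esub> a \<in> carrier (A i)" using smult by simp
    then show ?thesis unfolding smult(3) by (intro free_algebra_closed gen_in_ambient smult const_closed)
  next
    case (one i)
    interpret assoc_algebra "A i" by (rule alg[OF one(1)])
    have "1 \<in> carrier ambient" using FA.one_closed by simp
    then show ?thesis unfolding one(2) by (intro free_algebra_closed gen_in_ambient one one_closed)
  qed
qed

interpretation FI: ideal "free_product_ideal I A" ambient
  unfolding free_product_ideal_def by (rule FA.genideal_ideal[OF free_product_relations_closed])

interpretation Q: ring "ambient Quot free_product_ideal I A" by (rule FI.quotient_is_ring)

lemma free_product_class_ring_hom: "free_product_class I A \<in> Ring.ring_hom ambient (ambient Quot free_product_ideal I A)"
  using FI.rcos_ring_hom unfolding free_product_class_def .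

interpretation cl: ring_hom_ring ambient "ambient Quot free_product_ideal I A" "free_product_class I A"
  by (rule ring_hom_ringI2[OF FA.ring_axioms Q.ring_axioms free_product_class_ring_hom])

lemma free_product_class_eqI:
  assumes "p \<in> carrier ambient" "q \<in> carrier ambient" "p - q \<in> free_product_relations I A"
  shows "free_product_class I A p = free_product_class I A q"
proof -
  have "p = (p - q) + q" by simp
  then have *: "free_product_class I A p = free_product_class I A (p - q) \<oplus>\<^bsub>ambient Quot free_product_ideal I A\<^esub> free_product_class I A q"
    using cl.hom_add[OF free_algebra_closed(4)[OF assms(1,2)] assms(2)] by simp
  have "p - q \<in> free_product_ideal I A"
    unfolding free_product_ideal_def using FA.genideal_self[OF free_product_relations_closed] assms(3) by blast
  then have "free_product_class I A (p - q) = \<zero>\<^bsub>ambient Quot free_product_ideal I A\<^esub>"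
    unfolding free_product_class_def using FI.a_rcos_const by (simp add: FactRing_def)
  moreover have "free_product_class I A q \<in> carrier (ambient Quot free_product_ideal I A)"
    using cl.hom_closed[OF assms(2)] .
  ultimately show ?thesis using * by simp
qed

lemma free_product_simps:
  "carrier (free_product I A) = carrier (ambient Quot free_product_ideal I A)"
  "mult (free_product I A) = mult (ambient Quot free_product_ideal I A)"
  "one (free_product I A) = one (ambient Quot free_product_ideal I A)"
  "zero (free_product I A) = zero (ambient Quot free_product_ideal I A)"
  "add (free_product I A) = add (ambient Quot free_product_ideal I A)"
  "module.smult (free_product I A) c X = free_product_class I A (const c) \<otimes>\<^bsub>ambient Quot free_product_ideal I A\<^esub> X"
  by (simp_all add: free_product_def Let_def ring.defs module.defs)

lemma free_product_carrier_class: "carrier (free_product I A) = free_product_class I A ` carrier ambient"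
  unfolding free_product_simps free_product_class_def FactRing_def A_RCOSETS_def' by auto

lemma free_product_class_closed: "p \<in> carrier ambient \<Longrightarrow> free_product_class I A p \<in> carrier (free_product I A)"
  unfolding free_product_carrier_class by blast

lemma free_product_class_ops:
  assumes "p \<in> carrier ambient" "q \<in> carrier ambient"
  shows "free_product_class I A p \<oplus>\<^bsub>free_product I A\<^esub> free_product_class I A q = free_product_class I A (p + q)"
    "free_product_class I A p \<otimes>\<^bsub>free_product I A\<^esub> free_product_class I A q = free_product_class I A (p * q)"
    "c \<odot>\<^bsub>free_product I A\<^esub> free_product_class I A p = free_product_class I A (const c * p)"
    "\<one>\<^bsub>free_product I A\<^esub> = free_product_class I A 1"
    "\<zero>\<^bsub>free_product I A\<^esub> = free_product_class I A 0"
  using cl.hom_add[OF assms] cl.hom_mult[OF assms] cl.hom_mult[OF const_closed assms(1)] cl.hom_one cl.hom_zero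
  by (auto simp: free_product_simps)

lemma free_product_ring: "ring (free_product I A)"
proof -
  have "abelian_group (free_product I A)"
    by (rule abelian_groupI)
      (use Q.a_assoc Q.a_comm in \<open>auto simp: free_product_simps intro: Q.l_neg Q.a_inv_closed bexI[of _ "\<ominus>\<^bsub>ambient Quot free_product_ideal I A\<^esub> _"]\<close>)
  moreover have "Group.monoid (free_product I A)"
    by (rule monoidI) (auto simp: free_product_simps Q.m_assoc)
  ultimately show ?thesis
    by (rule ringI) (auto simp: free_product_simps Q.l_distr Q.r_distr)
qed

theorem free_product_assoc_algebra: "assoc_algebra (free_product I A)"
proof -
  interpret ring "free_product I A" by (rule free_product_ring)
  note cls = free_algebra_closed const_closed
  have c: "const c * p \<in> carrier ambient" if "p \<in> carrier ambient" for c p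
    by (rule free_algebra_closed(2)[OF const_closed that])
  have ax: "module_axioms class_ring (free_product I A)"
  proof (unfold_locales, goal_cases)
    case (1 a x) then show ?case using c by (auto simp: free_product_carrier_class free_product_class_ops)
  next
    case (2 a b x)
    then obtain p where p: "p \<in> carrier ambient" "x = free_product_class I A p" unfolding free_product_carrier_class by blast
    show ?case unfolding p(2) using p(1) c
      by (simp add: free_product_class_ops const_simps algebra_simps del: free_algebra_simps)
  next
    case (3 a x y)
    then obtain p q where p: "p \<in> carrier ambient" "x = free_product_class I A p" and q: "q \<in> carrier ambient" "y = free_product_class I A q"
      unfolding free_product_carrier_class by blast
    show ?case unfolding p(2) q(2) using p(1) q(1) c free_algebra_closed(1)[OF p(1) q(1)]
      by (simp add: free_product_class_ops algebra_simps del: free_algebra_simps)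
  next
    case (4 a b x)
    then obtain p where p: "p \<in> carrier ambient" "x = free_product_class I A p" unfolding free_product_carrier_class by blast
    show ?case unfolding p(2) using p(1) c
      by (simp add: free_product_class_ops const_simps algebra_simps del: free_algebra_simps)
  next
    case (5 x)
    then obtain p where p: "p \<in> carrier ambient" "x = free_product_class I A p" unfolding free_product_carrier_class by blast
    show ?case unfolding p(2) using p(1)
      by (simp add: free_product_class_ops const_simps del: free_algebra_simps)
  qed
  have ax2: "assoc_algebra_axioms (free_product I A)"
  proof (unfold_locales, goal_cases)
    case (1 x y a)
    then obtain p q where p: "p \<in> carrier ambient" "x = free_product_class I A p" and q: "q \<in> carrier ambient" "y = free_product_class I A q"
      unfolding free_product_carrier_class by blast
    show ?case unfolding p(2) q(2) using p(1) q(1) c free_algebra_closed(2)[OF p(1) q(1)]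
      by (simp add: free_product_class_ops mult.assoc del: free_algebra_simps)
  next
    case (2 x y a)
    then obtain p q where p: "p \<in> carrier ambient" "x = free_product_class I A p" and q: "q \<in> carrier ambient" "y = free_product_class I A q"
      unfolding free_product_carrier_class by blast
    have "p * (const a * q) = const a * (p * q)" by (metis const_comm mult.assoc)
    then show ?case unfolding p(2) q(2) using p(1) q(1) c free_algebra_closed(2)[OF p(1) q(1)]
      by (simp add: free_product_class_ops del: free_algebra_simps)
  qed
  show ?thesis by (intro_locales) (use ax ax2 in auto)
qed

theorem free_product_incl_hom:
  assumes i: "i \<in> I"
  shows "free_product_incl I A i \<in> alg_hom (A i) (free_product I A)"
proof -
  interpret assoc_algebra "A i" by (rule alg[OF i])
  have o: "1 \<in> carrier ambient" using FA.one_closed by simp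
  note g = gen_in_ambient[OF i]
  show ?thesis unfolding alg_hom_def
  proof (intro CollectI conjI ballI allI ring_hom_memI)
    fix a assume a: "a \<in> carrier (A i)"
    show "free_product_incl I A i a \<in> carrier (free_product I A)"
      unfolding free_product_incl_def by (rule free_product_class_closed[OF g[OF a]])
    fix c
    show "free_product_incl I A i (c \<odot>\<^bsub>A i\<^esub> a) = c \<odot>\<^bsub>free_product I A\<^esub> free_product_incl I A i a"
      unfolding free_product_incl_def free_product_class_ops(3)[OF g[OF a] g[OF a]]
    proof (rule free_product_class_eqI)
      show "gen (i, c \<odot>\<^bsub>A i\<^esub> a) \<in> carrier ambient" by (rule g) (use a in simp)
      show "const c * gen (i, a) \<in> carrier ambient" by (rule free_algebra_closed(2)[OF const_closed g[OF a]])
      show "gen (i, c \<odot>\<^bsub>A i\<^esub> a) - const c * gen (i, a) \<in> free_product_relations I A"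
        by (rule free_product_relation_intros[OF i]) (fact a)+
    qed
  next
    fix a b assume a: "a \<in> carrier (A i)" "b \<in> carrier (A i)"
    show "free_product_incl I A i (a \<otimes>\<^bsub>A i\<^esub> b) = free_product_incl I A i a \<otimes>\<^bsub>free_product I A\<^esub> free_product_incl I A i b"
      unfolding free_product_incl_def free_product_class_ops(2)[OF g[OF a(1)] g[OF a(2)]]
      proof (rule free_product_class_eqI)
      show "gen (i, a \<otimes>\<^bsub>A i\<^esub> b) \<in> carrier ambient" by (rule g) (use a in simp)
      show "gen (i, a) * gen (i, b) \<in> carrier ambient" by (rule free_algebra_closed(2)[OF g[OF a(1)] g[OF a(2)]])
      show "gen (i, a \<otimes>\<^bsub>A i\<^esub> b) - (gen (i, a) * gen (i, b)) \<in> free_product_relations I A"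
        by (rule free_product_relation_intros[OF i]) (fact a)+
    qed
    show "free_product_incl I A i (a \<oplus>\<^bsub>A i\<^esub> b) = free_product_incl I A i a \<oplus>\<^bsub>free_product I A\<^esub> free_product_incl I A i b"
      unfolding free_product_incl_def free_product_class_ops(1)[OF g[OF a(1)] g[OF a(2)]]
      proof (rule free_product_class_eqI)
      show "gen (i, a \<oplus>\<^bsub>A i\<^esub> b) \<in> carrier ambient" by (rule g) (use a in simp)
      show "gen (i, a) + gen (i, b) \<in> carrier ambient" by (rule free_algebra_closed(1)[OF g[OF a(1)] g[OF a(2)]])
      show "gen (i, a \<oplus>\<^bsub>A i\<^esub> b) - (gen (i, a) + gen (i, b)) \<in> free_product_relations I A"
        by (rule free_product_relation_intros[OF i]) (fact a)+
    qed
  next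
    show "free_product_incl I A i \<one>\<^bsub>A i\<^esub> = \<one>\<^bsub>free_product I A\<^esub>"
      unfolding free_product_incl_def free_product_class_ops(4)[OF o o]
    proof (rule free_product_class_eqI)
      show "gen (i, \<one>\<^bsub>A i\<^esub>) \<in> carrier ambient" by (rule g) simp
      show "1 \<in> carrier ambient" by (rule o)
      show "gen (i, \<one>\<^bsub>A i\<^esub>) - 1 \<in> free_product_relations I A"
        by (rule free_product_relation_intros[OF i])
    qed
  qed
qed

theorem free_product_universal:
  assumes B: "assoc_algebra (B :: ('k, 'b, 'n) module_scheme)"
    and f: "\<And>i. i \<in> I \<Longrightarrow> f i \<in> alg_hom (A i) B"
  shows "\<exists>!h. h \<in> alg_hom (free_product I A) B \<inter> extensional (carrier (free_product I A)) \<and>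
    (\<forall>i\<in>I. \<forall>a\<in>carrier (A i). h (free_product_incl I A i a) = f i a)"
proof -
  interpret B: assoc_algebra B by (rule B)
  define g where "g = (\<lambda>(i, a). if i \<in> I \<and> a \<in> carrier (A i) then f i a else \<zero>\<^bsub>B\<^esub>)"
  have fr: "f i \<in> Ring.ring_hom (A i) B" if "i \<in> I" for i using f[OF that] by (simp add: alg_hom_def)
  have gc: "g x \<in> carrier B" for x
    using ring_hom_closed[OF fr] by (auto simp: g_def split: prod.splits)
  define ev where "ev = assoc_algebra.eval_free B g"
  have ev_gen: "ev (gen (i, a)) = f i a" if "i \<in> I" "a \<in> carrier (A i)" for i a
    unfolding ev_def using B.eval_free_gen[of g, OF gc] that by (simp add: g_def)
  have ev_add: "ev (p + q) = ev p \<oplus>\<^bsub>B\<^esub> ev q" for p q unfolding ev_def by (rule B.eval_free_add[OF gc])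
  have ev_mult: "ev (p * q) = ev p \<otimes>\<^bsub>B\<^esub> ev q" for p q unfolding ev_def by (rule B.eval_free_mult[OF gc])
  have ev_const: "ev (const c) = c \<odot>\<^bsub>B\<^esub> \<one>\<^bsub>B\<^esub>" for c unfolding ev_def by (rule B.eval_free_const[OF gc])
  have ev_one: "ev 1 = \<one>\<^bsub>B\<^esub>" using ev_const[of 1] by (simp add: const_simps)
  have ev_cl: "ev p \<in> carrier B" for p unfolding ev_def by (rule B.eval_free_closed[OF gc])
  have ev_hom: "ring_hom_ring ambient B ev"
    by (rule ring_hom_ringI2[OF FA.ring_axioms B.ring_axioms])
      (auto intro!: ring_hom_memI simp: ev_cl ev_add ev_mult ev_one)
  interpret ev: ring_hom_ring ambient B ev by (rule ev_hom)
  have ev_diff: "ev (p - q) = \<zero>\<^bsub>B\<^esub>" if "ev p = ev q" for p q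
  proof -
    have "ev (p - q) \<oplus>\<^bsub>B\<^esub> ev q = ev q" using ev_add[of "p - q" q] that by simp
    then show ?thesis using ev_cl by (metis B.add.l_cancel_one' B.a_comm)
  qed
  have "p \<in> a_kernel ambient B ev" if "p \<in> free_product_relations I A" for p
  proof -
    have "ev p = \<zero>\<^bsub>B\<^esub>" using that
    proof (cases rule: free_product_relation_cases)
      case (add i a b)
      interpret assoc_algebra "A i" by (rule alg[OF add(1)])
      show ?thesis unfolding add(4)
        by (rule ev_diff) (use add fr[OF add(1)] in \<open>simp add: ev_add ev_gen ring_hom_add\<close>)
    next
      case (mult i a b)
      interpret assoc_algebra "A i" by (rule alg[OF mult(1)])
      show ?thesis unfolding mult(4)
        by (rule ev_diff) (use mult fr[OF mult(1)] in \<open>simp add: ev_mult ev_gen ring_hom_mult\<close>)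
    next
      case (smult i c a)
      interpret assoc_algebra "A i" by (rule alg[OF smult(1)])
      have "f i a \<in> carrier B" using fr[OF smult(1)] smult ring_hom_closed by metis
      moreover have "f i (c \<odot>\<^bsub>A i\<^esub> a) = c \<odot>\<^bsub>B\<^esub> f i a"
        using f[OF smult(1)] smult(2) by (simp add: alg_hom_def)
      ultimately show ?thesis unfolding smult(3)
        by (intro ev_diff) (use smult in \<open>simp add: ev_mult ev_gen ev_const B.smult_mult\<close>)
    next
      case (one i)
      interpret assoc_algebra "A i" by (rule alg[OF one(1)])
      show ?thesis unfolding one(2)
        by (rule ev_diff) (use one fr[OF one(1)] in \<open>simp add: ev_one ev_gen ring_hom_one\<close>)
    qed
    then show ?thesis using subsetD[OF free_product_relations_closed that] unfolding a_kernel_def' by blast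
  qed
  then have "free_product_ideal I A \<subseteq> a_kernel ambient B ev"
    unfolding free_product_ideal_def by (intro FA.genideal_minimal ev.kernel_is_ideal) blast
  then have ker: "ev p = \<zero>\<^bsub>B\<^esub>" if "p \<in> free_product_ideal I A" for p
    using that unfolding a_kernel_def' by blast
  have ev_class: "ev p = ev q" if p: "p \<in> carrier ambient" and q: "q \<in> carrier ambient"
    and e: "free_product_class I A p = free_product_class I A q" for p q
  proof -
    have "p \<in> free_product_class I A p"
      unfolding free_product_class_def using p by (rule FI.a_rcos_self)
    then have "p \<in> free_product_ideal I A +>\<^bsub>ambient\<^esub> q" using e by (simp add: free_product_class_def)
    then obtain d where "d \<in> free_product_ideal I A" "p = d + q" by (auto simp: a_r_coset_def')
    then show ?thesis using ev_add[of d q] ker[of d] ev_cl by simp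
  qed
  define h where "h = (\<lambda>X\<in>carrier (free_product I A). ev (SOME p. p \<in> carrier ambient \<and> X = free_product_class I A p))"
  have h: "h (free_product_class I A p) = ev p" if p: "p \<in> carrier ambient" for p
  proof -
    let ?q = "SOME q. q \<in> carrier ambient \<and> free_product_class I A p = free_product_class I A q"
    have "?q \<in> carrier ambient \<and> free_product_class I A p = free_product_class I A ?q"
      by (rule someI[of _ p]) (use p in blast)
    then have "ev p = ev ?q" by (intro ev_class[OF p]) blast+
    then show ?thesis unfolding h_def using free_product_class_closed[OF p] by (simp del: free_algebra_simps)
  qed
  have o: "1 \<in> carrier ambient" using FA.one_closed by simp
  have h_hom: "h \<in> alg_hom (free_product I A) B"
    unfolding alg_hom_def
  proof (intro CollectI conjI ballI allI ring_hom_memI)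
    fix x assume "x \<in> carrier (free_product I A)"
    then obtain p where p: "p \<in> carrier ambient" "x = free_product_class I A p" unfolding free_product_carrier_class by blast
    show "h x \<in> carrier B" unfolding p(2) h[OF p(1)] by (rule ev_cl)
    fix c
    show "h (c \<odot>\<^bsub>free_product I A\<^esub> x) = c \<odot>\<^bsub>B\<^esub> h x"
      unfolding p(2) free_product_class_ops(3)[OF p(1) p(1)] h[OF p(1)] h[OF free_algebra_closed(2)[OF const_closed p(1)]]
      by (simp add: ev_mult ev_const ev_cl B.smult_mult)
  next
    fix x y assume "x \<in> carrier (free_product I A)" "y \<in> carrier (free_product I A)"
    then obtain p q where p: "p \<in> carrier ambient" "x = free_product_class I A p" and q: "q \<in> carrier ambient" "y = free_product_class I A q"
      unfolding free_product_carrier_class by blast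
    show "h (x \<otimes>\<^bsub>free_product I A\<^esub> y) = h x \<otimes>\<^bsub>B\<^esub> h y"
      unfolding p(2) q(2) free_product_class_ops(2)[OF p(1) q(1)] h[OF p(1)] h[OF q(1)] h[OF free_algebra_closed(2)[OF p(1) q(1)]]
      by (rule ev_mult)
    show "h (x \<oplus>\<^bsub>free_product I A\<^esub> y) = h x \<oplus>\<^bsub>B\<^esub> h y"
      unfolding p(2) q(2) free_product_class_ops(1)[OF p(1) q(1)] h[OF p(1)] h[OF q(1)] h[OF free_algebra_closed(1)[OF p(1) q(1)]]
      by (rule ev_add)
  next
    show "h \<one>\<^bsub>free_product I A\<^esub> = \<one>\<^bsub>B\<^esub>"
      unfolding free_product_class_ops(4)[OF o o] h[OF o] by (rule ev_one)
  qed
  show ?thesis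
  proof (rule ex1I[of _ h], intro conjI IntI ballI)
    show "h \<in> extensional (carrier (free_product I A))" unfolding h_def by simp
    fix i a assume "i \<in> I" "a \<in> carrier (A i)"
    then show "h (free_product_incl I A i a) = f i a"
      unfolding free_product_incl_def by (simp add: h gen_in_ambient ev_gen del: free_algebra_simps)
  next
    fix h' assume h': "h' \<in> alg_hom (free_product I A) B \<inter> extensional (carrier (free_product I A)) \<and>
      (\<forall>i\<in>I. \<forall>a\<in>carrier (A i). h' (free_product_incl I A i a) = f i a)"
    then have r: "h' \<in> Ring.ring_hom (free_product I A) B"
      and s: "\<And>c x. x \<in> carrier (free_product I A) \<Longrightarrow> h' (c \<odot>\<^bsub>free_product I A\<^esub> x) = c \<odot>\<^bsub>B\<^esub> h' x"
      by (auto simp: alg_hom_def)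
    have "h' (free_product_class I A p) = ev p" if "p \<in> carrier ambient" for p
      using that
    proof (induction p rule: free_algebra_induct)
      case (const c)
      have "free_product_class I A (const c) = c \<odot>\<^bsub>free_product I A\<^esub> \<one>\<^bsub>free_product I A\<^esub>"
        unfolding free_product_class_ops(4)[OF o o] free_product_class_ops(3)[OF o o] by simp
      then show ?case using s[of "\<one>\<^bsub>free_product I A\<^esub>" c] ring_hom_one[OF r] free_product_class_closed[OF o]
        by (simp add: ev_const free_product_class_ops(4)[OF o o])
    next
      case (gen x)
      then show ?case using h' ev_gen by (cases x) (auto simp: free_product_incl_def)
    next
      case (add p q)
      then show ?case using ring_hom_add[OF r free_product_class_closed[OF add(1)] free_product_class_closed[OF add(2)]]
        by (simp add: free_product_class_ops(1)[OF add(1,2)] ev_add)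
    next
      case (mult p q)
      then show ?case using ring_hom_mult[OF r free_product_class_closed[OF mult(1)] free_product_class_closed[OF mult(2)]]
        by (simp add: free_product_class_ops(2)[OF mult(1,2)] ev_mult)
    qed
    then have "h' x = h x" if "x \<in> carrier (free_product I A)" for x
      using that h unfolding free_product_carrier_class by auto
    then show "h' = h" using h' by (intro extensionalityI[of _ "carrier (free_product I A)"]) (auto simp: h_def)
  qed (use h_hom in auto)
qed

end

lemma matrix_product_assoc_algebra:
  "assoc_algebra (matrix_product_algebra r w :: ('k::field, 'k mat list) module)"
proof -
  let ?A = "matrix_product_algebra r w :: ('k, 'k mat list) module"
  note d = matrix_product_algebra_def
  have ag: "abelian_group ?A"
  proof (rule abelian_groupI, goal_cases)
    case (6 x)
    show ?case
      by (rule bexI[of _ "map uminus x"]) (use 6 in \<open>auto simp: d intro!: nth_equalityI uminus_l_inv_mat\<close>)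
  next
    case (3 x y z) then show ?case by (auto simp: d intro!: nth_equalityI assoc_add_mat)
  next
    case (4 x y) then show ?case by (auto simp: d intro!: nth_equalityI comm_add_mat)
  qed (auto simp: d intro!: nth_equalityI)
  have mo: "Group.monoid ?A"
  proof (rule monoidI, goal_cases)
    case (3 x y z)
    then have "x ! j * y ! j * z ! j = x ! j * (y ! j * z ! j)" if "j < r" for j
      using that by (intro assoc_mult_mat[of _ "w j" "w j" _ "w j" _ "w j"]) (auto simp: d)
    then show ?case using 3 by (auto simp: d intro!: nth_equalityI)
  qed (auto simp: d intro!: nth_equalityI)
  have ri: "ring ?A"
  proof (rule ringI[OF ag mo], goal_cases)
    case (1 x y z)
    then have "(x ! j + y ! j) * z ! j = x ! j * z ! j + y ! j * z ! j" if "j < r" for j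
      using that by (intro add_mult_distrib_mat[of _ "w j" "w j" _ _ "w j"]) (auto simp: d)
    then show ?case using 1 by (auto simp: d intro!: nth_equalityI)
  next
    case (2 x y z)
    then have "z ! j * (x ! j + y ! j) = z ! j * x ! j + z ! j * y ! j" if "j < r" for j
      using that by (intro mult_add_distrib_mat[of _ "w j" "w j" _ "w j"]) (auto simp: d)
    then show ?case using 2 by (auto simp: d intro!: nth_equalityI)
  qed
  have ax: "module_axioms class_ring ?A"
  proof (unfold_locales, goal_cases)
    case (2 a b x) then show ?case by (auto simp: d intro!: nth_equalityI add_smult_distrib_right_mat)
  next
    case (3 a x y) then show ?case by (auto simp: d intro!: nth_equalityI add_smult_distrib_left_mat)
  qed (auto simp: d intro!: nth_equalityI eq_matI)
  have ax2: "assoc_algebra_axioms ?A"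
  proof (unfold_locales, goal_cases)
    case (1 x y c)
    then have "(c \<cdot>\<^sub>m x ! j) * y ! j = c \<cdot>\<^sub>m (x ! j * y ! j)" if "j < r" for j
      using that by (intro mult_smult_assoc_mat[of _ "w j" "w j" _ "w j"]) (auto simp: d)
    then show ?case using 1 by (auto simp: d intro!: nth_equalityI)
  next
    case (2 x y c)
    then have "x ! j * (c \<cdot>\<^sub>m y ! j) = c \<cdot>\<^sub>m (x ! j * y ! j)" if "j < r" for j
      using that by (intro mult_smult_distrib[of _ "w j" "w j" _ "w j"]) (auto simp: d)
    then show ?case using 2 by (auto simp: d intro!: nth_equalityI)
  qed
  interpret ring ?A by (rule ri)
  show ?thesis by (intro_locales) (use ax ax2 in auto)
qed

lemma Hom_vectorspaceI:
  fixes H :: "'m set" and pl :: "'m \<Rightarrow> 'm \<Rightarrow> 'm" and sc :: "'k::field \<Rightarrow> 'm \<Rightarrow> 'm"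
  assumes "z \<in> H"
    and "\<And>f g. \<lbrakk>f \<in> H; g \<in> H\<rbrakk> \<Longrightarrow> pl f g \<in> H"
    and "\<And>f g. \<lbrakk>f \<in> H; g \<in> H\<rbrakk> \<Longrightarrow> pl f g = pl g f"
    and "\<And>f g h. \<lbrakk>f \<in> H; g \<in> H; h \<in> H\<rbrakk> \<Longrightarrow> pl (pl f g) h = pl f (pl g h)"
    and "\<And>f. f \<in> H \<Longrightarrow> pl z f = f"
    and "\<And>f. f \<in> H \<Longrightarrow> pl (sc (- 1) f) f = z"
    and "\<And>c f. f \<in> H \<Longrightarrow> sc c f \<in> H"
    and "\<And>c d f. f \<in> H \<Longrightarrow> sc (c + d) f = pl (sc c f) (sc d f)"
    and "\<And>c f g. \<lbrakk>f \<in> H; g \<in> H\<rbrakk> \<Longrightarrow> sc c (pl f g) = pl (sc c f) (sc c g)"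
    and "\<And>c d f. f \<in> H \<Longrightarrow> sc (c * d) f = sc c (sc d f)"
    and "\<And>f. f \<in> H \<Longrightarrow> sc 1 f = f"
  shows "vectorspace class_ring \<lparr>carrier = H, mult = (\<lambda>_ _. z), one = z, zero = z, add = pl, smult = sc\<rparr>"
    (is "vectorspace _ ?V")
proof -
  have "abelian_group ?V"
    by (rule abelian_groupI) (use assms in \<open>auto intro!: bexI[of _ "sc (-1) _"]\<close>)
  moreover have "module_axioms class_ring ?V"
    by unfold_locales (use assms in auto)
  moreover have "field (class_ring :: 'k ring)" by (rule class_field)
  ultimately show ?thesis
    unfolding vectorspace_def Module.module_def using class_cring.is_cring by blast
qed

lemma over_field_simps [simp]:
  "carrier (over_field A M) = carrier M" "zero (over_field A M) = zero M"
  "add (over_field A M) = add M"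
  "module.smult (over_field A M) = (\<lambda>c x. (c \<odot>\<^bsub>A\<^esub> \<one>\<^bsub>A\<^esub>) \<odot>\<^bsub>M\<^esub> x)"
  by (auto simp: over_field_def)

lemma over_field_vectorspace:
  assumes A: "assoc_algebra (A :: ('k::field, 'a, 'm) module_scheme)" and M: "left_module A M"
  shows "vectorspace class_ring (over_field A M)"
proof -
  interpret A: assoc_algebra A by (rule A)
  interpret left_module A M by (rule M)
  have "abelian_group (over_field A M)"
    by (rule abelian_groupI) (auto simp: M.a_ac intro!: bexI[of _ "\<ominus>\<^bsub>M\<^esub> _"] M.l_neg)
  moreover have "module_axioms class_ring (over_field A M)"
  proof (unfold_locales, goal_cases)
    case (4 a b x)
    have "(a * b) \<odot>\<^bsub>A\<^esub> \<one>\<^bsub>A\<^esub> = (a \<odot>\<^bsub>A\<^esub> \<one>\<^bsub>A\<^esub>) \<otimes>\<^bsub>A\<^esub> (b \<odot>\<^bsub>A\<^esub> \<one>\<^bsub>A\<^esub>)"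
      using A.vec.smult_assoc1[of a b "\<one>\<^bsub>A\<^esub>"] by (simp add: A.smult_mult)
    then show ?case using 4 by (simp add: smult_assoc)
  qed (use A.vec.smult_l_distr[of _ _ "\<one>\<^bsub>A\<^esub>"] in \<open>auto simp: smult_closed smult_l_distr smult_r_distr smult_one\<close>)
  ultimately show ?thesis
    unfolding vectorspace_def Module.module_def using class_cring.is_cring class_field by blast
qed

lemma rep_linear_category:
  assumes A: "assoc_algebra (A :: ('k::field, 'a, 'm) module_scheme)"
  shows "linear_category (rep A :: (('a, 'v) module, 'v \<Rightarrow> 'v, 'k) lincat)"
proof -
  interpret A: assoc_algebra A by (rule A)
  have central: "(c \<odot>\<^bsub>A\<^esub> \<one>\<^bsub>A\<^esub>) \<otimes>\<^bsub>A\<^esub> a = a \<otimes>\<^bsub>A\<^esub> (c \<odot>\<^bsub>A\<^esub> \<one>\<^bsub>A\<^esub>)" if "a \<in> carrier A" for a c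
    using that by (simp add: A.smult_mult A.mult_smult)
  have lm: "left_module A M" if "M \<in> Ob (rep A)" for M :: "('a, 'v) module"
    using that by (simp add: rep_def)
  have homI: "f \<in> Hom (rep A) M N \<longleftrightarrow> f \<in> extensional (carrier M) \<and> (\<forall>x\<in>carrier M. f x \<in> carrier N) \<and>
     (\<forall>x\<in>carrier M. \<forall>y\<in>carrier M. f (x \<oplus>\<^bsub>M\<^esub> y) = f x \<oplus>\<^bsub>N\<^esub> f y) \<and>
     (\<forall>a\<in>carrier A. \<forall>x\<in>carrier M. f (a \<odot>\<^bsub>M\<^esub> x) = a \<odot>\<^bsub>N\<^esub> f x)" for f and M N :: "('a, 'v) module"
    by (auto simp: rep_def LinearCombinations.module_hom_def)
  have rs: "Ident (rep A) M = (\<lambda>x\<in>carrier M. x)" "Comp (rep A) M N L g f = compose (carrier M) g f"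
    "Plus (rep A) M N f g = (\<lambda>x\<in>carrier M. f x \<oplus>\<^bsub>N\<^esub> g x)"
    "Scale (rep A) M N c f = (\<lambda>x\<in>carrier M. (c \<odot>\<^bsub>A\<^esub> \<one>\<^bsub>A\<^esub>) \<odot>\<^bsub>N\<^esub> f x)" for M N L :: "('a, 'v) module" and f g c
    by (simp_all add: rep_def)
  have ext: "f = g" if "f \<in> extensional S" "g \<in> extensional S" "\<And>x. x \<in> S \<Longrightarrow> f x = g x" for f g :: "'v \<Rightarrow> 'v" and S
    using that by (rule extensionalityI)
  show ?thesis
  proof (unfold_locales, goal_cases)
    case (1 X)
    interpret left_module A X by (rule lm[OF 1])
    show ?case by (auto simp: homI rs smult_closed)
  next
    case (2 X Y Z f g)
    interpret X: left_module A X by (rule lm[OF 2(1)])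
    show ?case using 2(4,5) by (auto simp: homI rs compose_def X.smult_closed)
  next
    case (3 X Y f)
    then show ?case by (intro ext[of _ "carrier X"]) (auto simp: homI rs compose_def)
  next
    case (4 X Y f)
    then show ?case by (intro ext[of _ "carrier X"]) (auto simp: homI rs compose_def)
  next
    case (5 W X Y Z f g h)
    then show ?case by (intro ext[of _ "carrier W"]) (auto simp: homI rs compose_def)
  next
    case (6 X Y)
    interpret X: left_module A X by (rule lm[OF 6(1)])
    interpret Y: left_module A Y by (rule lm[OF 6(2)])
    interpret Yv: vectorspace class_ring "over_field A Y" by (rule over_field_vectorspace[OF A lm[OF 6(2)]])
    have vs: "\<And>c d x. x \<in> carrier Y \<Longrightarrow> ((c + d) \<odot>\<^bsub>A\<^esub> \<one>\<^bsub>A\<^esub>) \<odot>\<^bsub>Y\<^esub> x = (c \<odot>\<^bsub>A\<^esub> \<one>\<^bsub>A\<^esub>) \<odot>\<^bsub>Y\<^esub> x \<oplus>\<^bsub>Y\<^esub> (d \<odot>\<^bsub>A\<^esub> \<one>\<^bsub>A\<^esub>) \<odot>\<^bsub>Y\<^esub> x"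
      "\<And>c d x. x \<in> carrier Y \<Longrightarrow> ((c * d) \<odot>\<^bsub>A\<^esub> \<one>\<^bsub>A\<^esub>) \<odot>\<^bsub>Y\<^esub> x = (c \<odot>\<^bsub>A\<^esub> \<one>\<^bsub>A\<^esub>) \<odot>\<^bsub>Y\<^esub> ((d \<odot>\<^bsub>A\<^esub> \<one>\<^bsub>A\<^esub>) \<odot>\<^bsub>Y\<^esub> x)"
      "\<And>x. x \<in> carrier Y \<Longrightarrow> (1 \<odot>\<^bsub>A\<^esub> \<one>\<^bsub>A\<^esub>) \<odot>\<^bsub>Y\<^esub> x = x"
      using Yv.smult_l_distr Yv.smult_assoc1 Yv.smult_one by auto
    have neg: "((- 1) \<odot>\<^bsub>A\<^esub> \<one>\<^bsub>A\<^esub>) \<odot>\<^bsub>Y\<^esub> x \<oplus>\<^bsub>Y\<^esub> x = \<zero>\<^bsub>Y\<^esub>" if "x \<in> carrier Y" for x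
    proof -
      have "((- 1) \<odot>\<^bsub>A\<^esub> \<one>\<^bsub>A\<^esub>) \<odot>\<^bsub>Y\<^esub> x \<oplus>\<^bsub>Y\<^esub> x = ((- 1 + 1) \<odot>\<^bsub>A\<^esub> \<one>\<^bsub>A\<^esub>) \<odot>\<^bsub>Y\<^esub> x"
        unfolding vs(1)[OF that] vs(3)[OF that] ..
      also have "\<dots> = \<zero>\<^bsub>Y\<^esub>" using Yv.smult_l_null[of x] that by simp
      finally show ?thesis .
    qed
    have az: "a \<odot>\<^bsub>Y\<^esub> \<zero>\<^bsub>Y\<^esub> = \<zero>\<^bsub>Y\<^esub>" if "a \<in> carrier A" for a
    proof -
      have "a \<odot>\<^bsub>Y\<^esub> \<zero>\<^bsub>Y\<^esub> \<oplus>\<^bsub>Y\<^esub> a \<odot>\<^bsub>Y\<^esub> \<zero>\<^bsub>Y\<^esub> = a \<odot>\<^bsub>Y\<^esub> \<zero>\<^bsub>Y\<^esub>"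
        using Y.smult_r_distr[OF that Y.M.zero_closed Y.M.zero_closed] by simp
      then show ?thesis using Y.smult_closed[OF that Y.M.zero_closed] by (metis Y.M.add.l_cancel_one')
    qed
    have c: "a \<odot>\<^bsub>Y\<^esub> ((c \<odot>\<^bsub>A\<^esub> \<one>\<^bsub>A\<^esub>) \<odot>\<^bsub>Y\<^esub> x) = (c \<odot>\<^bsub>A\<^esub> \<one>\<^bsub>A\<^esub>) \<odot>\<^bsub>Y\<^esub> (a \<odot>\<^bsub>Y\<^esub> x)"
      if "a \<in> carrier A" "x \<in> carrier Y" for a c x
      using Y.smult_assoc[of a "c \<odot>\<^bsub>A\<^esub> \<one>\<^bsub>A\<^esub>" x] Y.smult_assoc[of "c \<odot>\<^bsub>A\<^esub> \<one>\<^bsub>A\<^esub>" a x] that central[of a c] by simp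
    note simps = homI rs X.smult_closed Y.smult_closed Y.smult_r_distr Y.smult_one vs neg az c
    show ?case
    proof (rule exI[of _ "\<lambda>x\<in>carrier X. \<zero>\<^bsub>Y\<^esub>"], rule Hom_vectorspaceI, goal_cases)
      case 1 show ?case by (auto simp: simps)
    next
      case (2 f g)
      then have fc: "f x \<in> carrier Y" "g x \<in> carrier Y" if "x \<in> carrier X" for x using that by (auto simp: homI)
      show ?case using 2 fc by (auto simp: simps Y.M.a_ac)
    next
      case (3 f g) then show ?case by (intro ext[of _ "carrier X"]) (auto simp: simps Y.M.a_comm)
    next
      case (4 f g h) then show ?case by (intro ext[of _ "carrier X"]) (auto simp: simps Y.M.a_assoc)
    next
      case (5 f) then show ?case by (intro ext[of _ "carrier X"]) (auto simp: simps)
    next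
      case (6 f) then show ?case by (intro ext[of _ "carrier X"]) (auto simp: simps)
    next
      case (7 c f) then show ?case by (auto simp: simps)
    next
      case (8 c d f) then show ?case by (intro ext[of _ "carrier X"]) (auto simp: simps)
    next
      case (9 c f g) then show ?case by (intro ext[of _ "carrier X"]) (auto simp: simps)
    next
      case (10 c d f) then show ?case by (intro ext[of _ "carrier X"]) (auto simp: homI rs Y.smult_closed vs)
    next
      case (11 f) then show ?case by (intro ext[of _ "carrier X"]) (auto simp: simps)
    qed
  next
    case (7 X Y Z f f' g)
    then show ?case by (intro ext[of _ "carrier X"]) (auto simp: homI rs compose_def)
  next
    case (8 X Y Z f g g')
    then show ?case by (intro ext[of _ "carrier X"]) (auto simp: homI rs compose_def)
  next
    case (9 X Y Z f g c)
    then show ?case by (intro ext[of _ "carrier X"]) (auto simp: homI rs compose_def)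
  next
    case (10 X Y Z f g c)
    then show ?case by (intro ext[of _ "carrier X"]) (auto simp: homI rs compose_def)
  qed
qed

lemma class_vectorspace_facts:
  assumes "vectorspace (class_ring :: 'k::field ring) V"
  shows "\<lbrakk>x \<in> carrier V; y \<in> carrier V\<rbrakk> \<Longrightarrow> x \<oplus>\<^bsub>V\<^esub> y \<in> carrier V"
    and "x \<in> carrier V \<Longrightarrow> c \<odot>\<^bsub>V\<^esub> x \<in> carrier V"
    and "\<zero>\<^bsub>V\<^esub> \<in> carrier V"
    and "\<lbrakk>x \<in> carrier V; y \<in> carrier V\<rbrakk> \<Longrightarrow> x \<oplus>\<^bsub>V\<^esub> y = y \<oplus>\<^bsub>V\<^esub> x"
    and "\<lbrakk>x \<in> carrier V; y \<in> carrier V; z \<in> carrier V\<rbrakk> \<Longrightarrow> x \<oplus>\<^bsub>V\<^esub> y \<oplus>\<^bsub>V\<^esub> z = x \<oplus>\<^bsub>V\<^esub> (y \<oplus>\<^bsub>V\<^esub> z)"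
    and "\<lbrakk>x \<in> carrier V; y \<in> carrier V; z \<in> carrier V; u \<in> carrier V\<rbrakk>
      \<Longrightarrow> (x \<oplus>\<^bsub>V\<^esub> y) \<oplus>\<^bsub>V\<^esub> (z \<oplus>\<^bsub>V\<^esub> u) = (x \<oplus>\<^bsub>V\<^esub> z) \<oplus>\<^bsub>V\<^esub> (y \<oplus>\<^bsub>V\<^esub> u)"
    and "x \<in> carrier V \<Longrightarrow> \<zero>\<^bsub>V\<^esub> \<oplus>\<^bsub>V\<^esub> x = x"
    and "x \<in> carrier V \<Longrightarrow> (c + d) \<odot>\<^bsub>V\<^esub> x = c \<odot>\<^bsub>V\<^esub> x \<oplus>\<^bsub>V\<^esub> d \<odot>\<^bsub>V\<^esub> x"
    and "\<lbrakk>x \<in> carrier V; y \<in> carrier V\<rbrakk> \<Longrightarrow> c \<odot>\<^bsub>V\<^esub> (x \<oplus>\<^bsub>V\<^esub> y) = c \<odot>\<^bsub>V\<^esub> x \<oplus>\<^bsub>V\<^esub> c \<odot>\<^bsub>V\<^esub> y"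
    and "x \<in> carrier V \<Longrightarrow> (c * d) \<odot>\<^bsub>V\<^esub> x = c \<odot>\<^bsub>V\<^esub> (d \<odot>\<^bsub>V\<^esub> x)"
    and "x \<in> carrier V \<Longrightarrow> c \<odot>\<^bsub>V\<^esub> (d \<odot>\<^bsub>V\<^esub> x) = d \<odot>\<^bsub>V\<^esub> (c \<odot>\<^bsub>V\<^esub> x)"
    and "x \<in> carrier V \<Longrightarrow> 1 \<odot>\<^bsub>V\<^esub> x = x"
    and "x \<in> carrier V \<Longrightarrow> (- 1) \<odot>\<^bsub>V\<^esub> x \<oplus>\<^bsub>V\<^esub> x = \<zero>\<^bsub>V\<^esub>"
    and "c \<odot>\<^bsub>V\<^esub> \<zero>\<^bsub>V\<^esub> = \<zero>\<^bsub>V\<^esub>"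
    and "x \<in> carrier V \<Longrightarrow> 0 \<odot>\<^bsub>V\<^esub> x = \<zero>\<^bsub>V\<^esub>"
proof -
  interpret vectorspace class_ring V by (rule assms)
  show "\<lbrakk>x \<in> carrier V; y \<in> carrier V\<rbrakk> \<Longrightarrow> x \<oplus>\<^bsub>V\<^esub> y \<in> carrier V" "\<zero>\<^bsub>V\<^esub> \<in> carrier V"
    "\<lbrakk>x \<in> carrier V; y \<in> carrier V\<rbrakk> \<Longrightarrow> x \<oplus>\<^bsub>V\<^esub> y = y \<oplus>\<^bsub>V\<^esub> x"
    "\<lbrakk>x \<in> carrier V; y \<in> carrier V; z \<in> carrier V\<rbrakk> \<Longrightarrow> x \<oplus>\<^bsub>V\<^esub> y \<oplus>\<^bsub>V\<^esub> z = x \<oplus>\<^bsub>V\<^esub> (y \<oplus>\<^bsub>V\<^esub> z)"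
    "\<lbrakk>x \<in> carrier V; y \<in> carrier V; z \<in> carrier V; u \<in> carrier V\<rbrakk>
      \<Longrightarrow> (x \<oplus>\<^bsub>V\<^esub> y) \<oplus>\<^bsub>V\<^esub> (z \<oplus>\<^bsub>V\<^esub> u) = (x \<oplus>\<^bsub>V\<^esub> z) \<oplus>\<^bsub>V\<^esub> (y \<oplus>\<^bsub>V\<^esub> u)"
    "x \<in> carrier V \<Longrightarrow> \<zero>\<^bsub>V\<^esub> \<oplus>\<^bsub>V\<^esub> x = x"
    by (simp_all add: M.a_ac)
  show d: "x \<in> carrier V \<Longrightarrow> (c + d) \<odot>\<^bsub>V\<^esub> x = c \<odot>\<^bsub>V\<^esub> x \<oplus>\<^bsub>V\<^esub> d \<odot>\<^bsub>V\<^esub> x" for c d x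
    using smult_l_distr[of c d x] by auto
  show o: "x \<in> carrier V \<Longrightarrow> 1 \<odot>\<^bsub>V\<^esub> x = x" for x using smult_one[of x] by auto
  show n: "x \<in> carrier V \<Longrightarrow> 0 \<odot>\<^bsub>V\<^esub> x = \<zero>\<^bsub>V\<^esub>" for x using smult_l_null[of x] by auto
  show "x \<in> carrier V \<Longrightarrow> (- 1) \<odot>\<^bsub>V\<^esub> x \<oplus>\<^bsub>V\<^esub> x = \<zero>\<^bsub>V\<^esub>"
    using d[of x "-1" 1] o n by auto
  show a: "x \<in> carrier V \<Longrightarrow> (c * d) \<odot>\<^bsub>V\<^esub> x = c \<odot>\<^bsub>V\<^esub> (d \<odot>\<^bsub>V\<^esub> x)" for c d x
    using smult_assoc1[of c d x] by auto
  show "x \<in> carrier V \<Longrightarrow> c \<odot>\<^bsub>V\<^esub> (d \<odot>\<^bsub>V\<^esub> x) = d \<odot>\<^bsub>V\<^esub> (c \<odot>\<^bsub>V\<^esub> x)"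
    using a[of x c d] a[of x d c] by (auto simp: mult.commute)
  show "\<lbrakk>x \<in> carrier V; y \<in> carrier V\<rbrakk> \<Longrightarrow> c \<odot>\<^bsub>V\<^esub> (x \<oplus>\<^bsub>V\<^esub> y) = c \<odot>\<^bsub>V\<^esub> x \<oplus>\<^bsub>V\<^esub> c \<odot>\<^bsub>V\<^esub> y"
    using smult_r_distr[of c x y] by auto
  show "c \<odot>\<^bsub>V\<^esub> \<zero>\<^bsub>V\<^esub> = \<zero>\<^bsub>V\<^esub>" using smult_r_null[of c] by auto
  show "x \<in> carrier V \<Longrightarrow> c \<odot>\<^bsub>V\<^esub> x \<in> carrier V" using smult_closed[of c x] by auto
qed

lemma quiver_reps_linear_category:
  assumes Q: "wf_digraph Q"
  shows "linear_category (quiver_reps Q ::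
    (('v, 'e, 'k::field, 'u) quiver_rep, 'v \<Rightarrow> 'u \<Rightarrow> 'u, 'k) lincat)"
proof -
  interpret wf_digraph Q by (rule Q)
  have vs: "vectorspace class_ring (space V v)" if "V \<in> Ob (quiver_reps Q)" "v \<in> verts Q"
    for V :: "('v, 'e, 'k, 'u) quiver_rep" and v
    using that by (simp add: quiver_reps_def is_quiver_rep_def)
  have ar: "arrow V a x \<in> carrier (space V (head Q a))" 
      "y \<in> carrier (space V (tail Q a)) \<Longrightarrow> arrow V a (x \<oplus>\<^bsub>space V (tail Q a)\<^esub> y) = arrow V a x \<oplus>\<^bsub>space V (head Q a)\<^esub> arrow V a y"
      "arrow V a (c \<odot>\<^bsub>space V (tail Q a)\<^esub> x) = c \<odot>\<^bsub>space V (head Q a)\<^esub> arrow V a x"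
    if "V \<in> Ob (quiver_reps Q)" "a \<in> arcs Q" "x \<in> carrier (space V (tail Q a))"
    for V :: "('v, 'e, 'k, 'u) quiver_rep" and a x y c
    using that by (auto simp: quiver_reps_def is_quiver_rep_def LinearCombinations.module_hom_def)
  have homI: "f \<in> Hom (quiver_reps Q) V W \<longleftrightarrow> f \<in> extensional (verts Q) \<and>
     (\<forall>v\<in>verts Q. f v \<in> extensional (carrier (space V v))) \<and>
     (\<forall>v\<in>verts Q. \<forall>x\<in>carrier (space V v). f v x \<in> carrier (space W v)) \<and>
     (\<forall>v\<in>verts Q. \<forall>x\<in>carrier (space V v). \<forall>y\<in>carrier (space V v). f v (x \<oplus>\<^bsub>space V v\<^esub> y) = f v x \<oplus>\<^bsub>space W v\<^esub> f v y) \<and>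
     (\<forall>v\<in>verts Q. \<forall>a. \<forall>x\<in>carrier (space V v). f v (a \<odot>\<^bsub>space V v\<^esub> x) = a \<odot>\<^bsub>space W v\<^esub> f v x) \<and>
     (\<forall>a\<in>arcs Q. \<forall>x\<in>carrier (space V (tail Q a)). f (head Q a) (arrow V a x) = arrow W a (f (tail Q a) x))"
    for f and V W :: "('v, 'e, 'k, 'u) quiver_rep"
    by (auto simp: quiver_reps_def LinearCombinations.module_hom_def PiE_iff Pi_iff)
  have rs: "Ident (quiver_reps Q) V = (\<lambda>v\<in>verts Q. \<lambda>x\<in>carrier (space V v). x)"
    "Comp (quiver_reps Q) V W U g f = (\<lambda>v\<in>verts Q. compose (carrier (space V v)) (g v) (f v))"
    "Plus (quiver_reps Q) V W f g = (\<lambda>v\<in>verts Q. \<lambda>x\<in>carrier (space V v). f v x \<oplus>\<^bsub>space W v\<^esub> g v x)"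
    "Scale (quiver_reps Q) V W c f = (\<lambda>v\<in>verts Q. \<lambda>x\<in>carrier (space V v). c \<odot>\<^bsub>space W v\<^esub> f v x)"
    for V W U :: "('v, 'e, 'k, 'u) quiver_rep" and f g c
    by (simp_all add: quiver_reps_def)
  have ext: "f = g" if "f \<in> extensional (verts Q)" "g \<in> extensional (verts Q)"
    "\<And>v. v \<in> verts Q \<Longrightarrow> f v \<in> extensional (S v)" "\<And>v. v \<in> verts Q \<Longrightarrow> g v \<in> extensional (S v)"
    "\<And>v x. v \<in> verts Q \<Longrightarrow> x \<in> S v \<Longrightarrow> f v x = g v x" for f g :: "'v \<Rightarrow> 'u \<Rightarrow> 'u" and S
    by (rule extensionalityI[of _ "verts Q"], (fact that)+, rule extensionalityI[of _ "S _"]) (use that in auto)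
  show ?thesis
  proof (unfold_locales, goal_cases)
    case (1 X)
    note cl = class_vectorspace_facts(1,2)[OF vs[OF 1]]
    show ?case using ar[OF 1] cl by (auto simp: homI rs)
  next
    case (2 X Y Z f g)
    note cl = class_vectorspace_facts(1,2)[OF vs[OF 2(1)]]
    show ?case using 2(4,5) ar[OF 2(1)] cl by (auto simp: homI rs compose_def)
  next
    case (3 X Y f)
    then show ?case by (intro ext[of _ _ "\<lambda>v. carrier (space X v)"]) (auto simp: homI rs compose_def)
  next
    case (4 X Y f)
    then show ?case by (intro ext[of _ _ "\<lambda>v. carrier (space X v)"]) (auto simp: homI rs compose_def)
  next
    case (5 W X Y Z f g h)
    then show ?case by (intro ext[of _ _ "\<lambda>v. carrier (space W v)"]) (auto simp: homI rs compose_def)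
  next
    case (6 X Y)
    note clX = class_vectorspace_facts(1,2)[OF vs[OF 6(1)]]
    note Y = class_vectorspace_facts[OF vs[OF 6(2)]]
    have z: "arrow Y a \<zero>\<^bsub>space Y (tail Q a)\<^esub> = \<zero>\<^bsub>space Y (head Q a)\<^esub>" if a: "a \<in> arcs Q" for a
      using ar(3)[OF 6(2) a Y(3)[OF tail_in_verts[OF a]], of 0]
        Y(15)[OF tail_in_verts[OF a] Y(3)[OF tail_in_verts[OF a]]]
        Y(15)[OF head_in_verts[OF a] ar(1)[OF 6(2) a Y(3)[OF tail_in_verts[OF a]]]] by simp
    note e = ext[of _ _ "\<lambda>v. carrier (space X v)"]
    have h: "f v x \<in> carrier (space Y v)" if "f \<in> Hom (quiver_reps Q) X Y" "v \<in> verts Q" "x \<in> carrier (space X v)" for f v x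
      using that by (auto simp: homI)
    show ?case
    proof (rule exI[of _ "\<lambda>v\<in>verts Q. \<lambda>x\<in>carrier (space X v). \<zero>\<^bsub>space Y v\<^esub>"], rule Hom_vectorspaceI, goal_cases)
      case 1 show ?case using clX z Y(3,7,14) ar[OF 6(1)] by (simp add: homI)
    next
      case (2 f g)
      then show ?case using clX ar[OF 6(1)] ar[OF 6(2)] Y(1,6,9) unfolding homI rs by simp
    next
      case (3 f g) show ?case by (rule e) (use h[OF 3(1)] h[OF 3(2)] Y(4) in \<open>auto simp: rs\<close>)
    next
      case (4 f g k) show ?case by (rule e) (use h[OF 4(1)] h[OF 4(2)] h[OF 4(3)] Y(5) in \<open>auto simp: rs\<close>)
    next
      case (5 f) show ?case by (rule e) (use 5 h[OF 5] Y(7) in \<open>auto simp: rs homI\<close>)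
    next
      case (6 f) show ?case by (rule e) (use h[OF 6] Y(13) in \<open>auto simp: rs\<close>)
    next
      case (7 c f)
      then show ?case using clX ar[OF 6(1)] ar[OF 6(2)] Y(2,9,11) unfolding homI rs by simp
    next
      case (8 c d f) show ?case by (rule e) (use h[OF 8] Y(8) in \<open>auto simp: rs\<close>)
    next
      case (9 c f g) show ?case by (rule e) (use h[OF 9(1)] h[OF 9(2)] Y(9) in \<open>auto simp: rs\<close>)
    next
      case (10 c d f) show ?case by (rule e) (use h[OF 10] Y(10) in \<open>auto simp: rs\<close>)
    next
      case (11 f) show ?case by (rule e) (use 11 h[OF 11] Y(12) in \<open>auto simp: rs homI\<close>)
    qed
  next
    case (7 X Y Z f f' g)
    then show ?case by (intro ext[of _ _ "\<lambda>v. carrier (space X v)"]) (auto simp: homI rs compose_def)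
  next
    case (8 X Y Z f g g')
    then show ?case by (intro ext[of _ _ "\<lambda>v. carrier (space X v)"]) (auto simp: homI rs compose_def)
  next
    case (9 X Y Z f g c)
    then show ?case by (intro ext[of _ _ "\<lambda>v. carrier (space X v)"]) (auto simp: homI rs compose_def)
  next
    case (10 X Y Z f g c)
    then show ?case by (intro ext[of _ _ "\<lambda>v. carrier (space X v)"]) (auto simp: homI rs compose_def)
  qed
qed

lemma wf_simples_quiver: "wf_digraph (simples_quiver m r w \<S>)"
  by unfold_locales (auto simp: simples_quiver_def)

lemma semisimple_free_product_assoc_algebra:
  "assoc_algebra (semisimple_free_product m r w :: ('k::field, 'k coprod) module)"
  unfolding semisimple_free_product_def
  by (rule free_product_assoc_algebra) (rule matrix_product_assoc_algebra)

lemma wide_linear_category: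
  "linear_category (wide (semisimple_free_product m r w) \<S>)"
  unfolding wide_def
  by (intro linear_category_full_subcategory rep_linear_category semisimple_free_product_assoc_algebra)

lemma nilpotent_reps_linear_category:
  "linear_category (nilpotent_reps (simples_quiver m r w \<S>))"
  unfolding nilpotent_reps_def
  by (intro linear_category_full_subcategory quiver_reps_linear_category wf_simples_quiver)

end

theory Submission imports Defs "Jordan_Normal_Form.Char_Poly"
begin

hide_const (open) Polynomial.smult Modules.module Modules.module_hom Multiset.mult
hide_fact (open) Modules.module_hom_def

text \<open>
Both categories are compared with a third one, \<open>tri_cat Q\<close>, of representations of the quiver \<open>Q\<close> of the simple
modules that come with an ordered basis such that every arrow maps a basis vector at a vertex into the span of
earlier ones. Every nilpotent representation has such a basis (\<open>qrep_essentially_surjective\<close>), so \<open>tri_cat Q\<close>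
is equivalent to the nilpotent representations. A functor \<open>glued\<close> from \<open>tri_cat Q\<close> to the wide subcategory is also
fully faithful and essentially surjective, and two such functors out of one category give an equivalence between
their targets (\<open>equivalent_categories_span\<close>).

The functor \<open>glued\<close> rests on two observations. First, a representation of the free product is an independent choice
of a representation of each factor on the same space (\<open>rep_from_units\<close>), and the factors are semisimple. On a direct
sum of simple modules the \<open>i\<close>-th factor may therefore act by the conjugate of the diagonal action by any invertible
matrix \<open>g i\<close>. If the \<open>g i\<close> are block unitriangular, the result is an iterated extension of the simple modules, and
every iterated extension arises in this way. Two choices give the same extension of \<open>S\<close> by \<open>T\<close> if the blocks
differ by \<open>f - h i\<close> with one linear map \<open>f\<close> for all \<open>i\<close> and maps \<open>h i\<close> linear over the \<open>i\<close>-th factor. So the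
extensions form the cokernel of \<open>(f, h) \<mapsto> (f - h i)\<^sub>i\<close>, and the kernel consists of the homomorphisms, which are
known by Schur's lemma. Counting dimensions, the cokernel has as many basis vectors \<open>X S T k\<close> as the Euler form
prescribes arrows from \<open>S\<close> to \<open>T\<close> (\<open>extension_basis\<close>).

Second, the coefficients of the blocks of \<open>g i\<close> with respect to these bases are precisely the matrices of a
triangular representation of the quiver. They are the matrices \<open>amat V\<close> in the definition of \<open>N\<close>. Comparing an
intertwiner of two glued modules block by block, the independence of the \<open>X S T k\<close> shows that its blocks are scalars
which commute with the arrows (\<open>lift_full\<close>). Along a composition series, the fact that the \<open>X S T k\<close> span
makes it possible to bring one column of blocks after the other to this form (\<open>extension_step\<close>).
\<close>

section \<open>Finitely supported matrices\<close>

text \<open>Matrices of all sizes live in one type, so that sizes may vary within a proof. A size is recorded by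
an idempotent: \<open>J * x = x\<close> and \<open>x * I = x\<close> say that \<open>x\<close> goes from the space cut out by \<open>I\<close> to that
of \<open>J\<close>. The entries may be matrices themselves, which makes the type serve for block matrices.\<close>

typedef (overloaded) 'r fmat = "{A :: nat \<Rightarrow> nat \<Rightarrow> 'r::zero. \<exists>n. \<forall>i j. A i j \<noteq> 0 \<longrightarrow> i < n \<and> j < n}"
 morphisms ent Abs_fmat
 by (rule exI[of _ "\<lambda>_ _. 0"]) simp

setup_lifting type_definition_fmat

lemma fmat_eqI: "(\<And>i j. ent A i j = ent B i j) ==> A = B"
 by transfer (auto simp: fun_eq_iff)

lemma ent_bound: "\<exists>n. \<forall>i j. ent A i j \<noteq> 0 \<longrightarrow> i < n \<and> j < n"
 by transfer simp

lift_definition eunit :: "nat \<Rightarrow> nat \<Rightarrow> 'r \<Rightarrow> 'r::zero fmat" is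
 "\<lambda>i j x a b. if a = i \<and> b = j then x else 0"
proof goal_cases
 case (1 i j x)
 show ?case by (rule exI[of _ "Suc (max i j)"]) auto
qed

lift_definition fm :: "nat \<Rightarrow> nat \<Rightarrow> (nat \<Rightarrow> nat \<Rightarrow> 'r) \<Rightarrow> 'r::zero fmat" is
 "\<lambda>m n f a b. if a < m \<and> b < n then f a b else 0"
proof goal_cases
 case (1 m n f)
 show ?case by (rule exI[of _ "max m n"]) auto
qed

lift_definition emap :: "('r \<Rightarrow> 's) \<Rightarrow> 'r::zero fmat \<Rightarrow> 's::zero fmat" is
 "\<lambda>f A i j. if A i j = 0 then 0 else f (A i j)"
proof goal_cases
 case (1 f A)
 then obtain n where "\<forall>i j. A i j \<noteq> 0 \<longrightarrow> i < n \<and> j < n" by blast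
 then show ?case by (intro exI[of _ n]) auto
qed

lemma ent_eunit [simp]: "ent (eunit i j x) a b = (if a = i \<and> b = j then x else 0)" by transfer simp
lemma ent_fm [simp]: "ent (fm m n f) a b = (if a < m \<and> b < n then f a b else 0)" by transfer simp
lemma ent_emap: "f 0 = 0 ==> ent (emap f A) a b = f (ent A a b)" by transfer simp

instantiation fmat :: (ring) ring
begin

lift_definition zero_fmat :: "'a fmat" is "\<lambda>_ _. 0" by simp

lift_definition plus_fmat :: "'a fmat \<Rightarrow> 'a fmat \<Rightarrow> 'a fmat" is "\<lambda>A B i j. A i j + B i j"
proof goal_cases
 case (1 A B)
 then obtain n m where "\<forall>i j. A i j \<noteq> 0 \<longrightarrow> i < n \<and> j < n" "\<forall>i j. B i j \<noteq> 0 \<longrightarrow> i < m \<and> j < m" by blast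
 then show ?case by (intro exI[of _ "max n m"]) (metis add_0 less_max_iff_disj)
qed

lift_definition uminus_fmat :: "'a fmat \<Rightarrow> 'a fmat" is "\<lambda>A i j. - A i j" by simp

lift_definition minus_fmat :: "'a fmat \<Rightarrow> 'a fmat \<Rightarrow> 'a fmat" is "\<lambda>A B i j. A i j - B i j"
proof goal_cases
 case (1 A B)
 then obtain n m where "\<forall>i j. A i j \<noteq> 0 \<longrightarrow> i < n \<and> j < n" "\<forall>i j. B i j \<noteq> 0 \<longrightarrow> i < m \<and> j < m" by blast
 then show ?case by (intro exI[of _ "max n m"]) (metis diff_0_right less_max_iff_disj)
qed

lift_definition times_fmat :: "'a fmat \<Rightarrow> 'a fmat \<Rightarrow> 'a fmat" is
 "\<lambda>A B i k. \<Sum>j | A i j \<noteq> 0. A i j * B j k"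
proof goal_cases
 case (1 A B)
 then obtain n m where n: "\<forall>i j. A i j \<noteq> 0 \<longrightarrow> i < n \<and> j < n" and m: "\<forall>i j. B i j \<noteq> 0 \<longrightarrow> i < m \<and> j < m" by blast
 show ?case
 proof (intro exI[of _ "max n m"] allI impI)
  fix i k assume "(\<Sum>j | A i j \<noteq> 0. A i j * B j k) \<noteq> 0"
  then obtain j where "A i j \<noteq> 0" "A i j * B j k \<noteq> 0" by (auto elim: sum.not_neutral_contains_not_neutral)
  then have "A i j \<noteq> 0" "B j k \<noteq> 0" by auto
  with n m show "i < max n m \<and> k < max n m" by (meson less_max_iff_disj)
 qed
qed

lemma ent_simps [simp]:
 "ent (0 :: 'a fmat) i j = 0" "ent (A + B) i j = ent A i j + ent B i j"
 "ent (- A) i j = - ent A i j" "ent (A - B) i j = ent A i j - ent B i j"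
 by (transfer, simp)+

lemma ent_times_left:
 fixes A B :: "'a fmat"
 assumes "finite J" "\<And>j. ent A i j \<noteq> 0 ==> j \<in> J"
 shows "ent (A * B) i k = (\<Sum>j\<in>J. ent A i j * ent B j k)"
proof -
 have "ent (A * B) i k = (\<Sum>j | ent A i j \<noteq> 0. ent A i j * ent B j k)" by transfer simp
 also have "\<dots> = (\<Sum>j\<in>J. ent A i j * ent B j k)"
  by (rule sum.mono_neutral_left) (use assms in auto)
 finally show ?thesis .
qed

lemma ent_times_right:
 fixes A B :: "'a fmat"
 assumes "finite J" "\<And>j. ent B j k \<noteq> 0 ==> j \<in> J"
 shows "ent (A * B) i k = (\<Sum>j\<in>J. ent A i j * ent B j k)"
proof -
 obtain n where n: "\<forall>i j. ent A i j \<noteq> 0 \<longrightarrow> i < n \<and> j < n" using ent_bound by blast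
 have z: "ent B j k = 0" if "j \<notin> J" for j using assms(2) that by blast
 have "ent (A * B) i k = (\<Sum>j\<in>J \<union> {..<n}. ent A i j * ent B j k)"
  by (rule ent_times_left) (use n assms in auto)
 also have "\<dots> = (\<Sum>j\<in>J. ent A i j * ent B j k)"
  by (rule sum.mono_neutral_right) (use assms(1) z in auto)
 finally show ?thesis .
qed

instance
proof
 fix A B C :: "'a fmat"
 show "A * B * C = A * (B * C)"
 proof (rule fmat_eqI)
  fix i l
  obtain n where n: "\<forall>i j. ent A i j \<noteq> 0 \<longrightarrow> i < n \<and> j < n" using ent_bound by blast
  obtain m where m: "\<forall>i j. ent B i j \<noteq> 0 \<longrightarrow> i < m \<and> j < m" using ent_bound by blast
  obtain p where p: "\<forall>i j. ent C i j \<noteq> 0 \<longrightarrow> i < p \<and> j < p" using ent_bound by blast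
  have "ent (A * B * C) i l = (\<Sum>k<p. ent (A * B) i k * ent C k l)"
   by (rule ent_times_right) (use p in auto)
  also have "\<dots> = (\<Sum>k<p. (\<Sum>j<n. ent A i j * ent B j k) * ent C k l)"
   by (intro sum.cong refl arg_cong2[of _ _ _ _ "(*)"] ent_times_left) (use n in auto)
  also have "\<dots> = (\<Sum>j<n. ent A i j * (\<Sum>k<p. ent B j k * ent C k l))"
   by (simp add: sum_distrib_left sum_distrib_right mult.assoc) (rule sum.swap)
  also have "\<dots> = (\<Sum>j<n. ent A i j * ent (B * C) j l)"
   by (intro sum.cong refl arg_cong2[of _ _ _ _ "(*)"] ent_times_right[symmetric]) (use p in auto)
  also have "\<dots> = ent (A * (B * C)) i l"
   by (rule ent_times_left[symmetric]) (use n in auto)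
  finally show "ent (A * B * C) i l = ent (A * (B * C)) i l" .
 qed
 show "(A + B) * C = A * C + B * C"
 proof (rule fmat_eqI)
  fix i k
  obtain p where p: "\<forall>i j. ent C i j \<noteq> 0 \<longrightarrow> i < p \<and> j < p" using ent_bound by blast
  show "ent ((A + B) * C) i k = ent (A * C + B * C) i k"
   using p by (simp add: ent_times_right[of "{..<p}" C] distrib_right sum.distrib)
 qed
 show "A * (B + C) = A * B + A * C"
 proof (rule fmat_eqI)
  fix i k
  obtain n where n: "\<forall>i j. ent A i j \<noteq> 0 \<longrightarrow> i < n \<and> j < n" using ent_bound by blast
  show "ent (A * (B + C)) i k = ent (A * B + A * C) i k"
   using n by (simp add: ent_times_left[of "{..<n}" A] distrib_left sum.distrib)
 qed
qed (rule fmat_eqI, simp add: algebra_simps)+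

end

lemma ent_sum [simp]: "ent (\<Sum>x\<in>X. f x :: 'r::ring fmat) i j = (\<Sum>x\<in>X. ent (f x) i j)"
 by (induction X rule: infinite_finite_induct) auto

lemma eunit_simps:
 fixes x y :: "'r::ring"
 shows "eunit i j (x + y) = eunit i j x + eunit i j y" "eunit i j 0 = (0 :: 'r fmat)"
  "eunit i j (- x) = - eunit i j x" "eunit i j (x - y) = eunit i j x - eunit i j y"
 by (rule fmat_eqI, simp)+

lemma ent_eunit_times: "ent (eunit i j x * A) a b = (if a = i then x * ent A j b else (0::'r::ring))"
 by (subst ent_times_left[of "{j}"]) (auto split: if_splits)

lemma eunit_times: "eunit i j x * eunit k l y = (if j = k then eunit i l (x * y :: 'r::ring) else 0)"
 by (rule fmat_eqI) (auto simp: ent_eunit_times)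

lemma ent_times_eunit: "ent (A * eunit i j x) a b = (if b = j then ent A a i * x else (0::'r::ring))"
 by (subst ent_times_right[of "{i}"]) (auto split: if_splits)

definition diag :: "nat set \<Rightarrow> (nat \<Rightarrow> 'r) \<Rightarrow> 'r::ring fmat" where
 "diag K f = (\<Sum>k\<in>K. eunit k k (f k))"

lemma ent_diag: "finite K ==> ent (diag K f) a b = (if a = b \<and> a \<in> K then f a else 0)"
 unfolding diag_def by (cases "a = b") (auto intro!: sum.neutral)

lemma ent_diag_times: "finite K ==> ent (diag K f * A) a b = (if a \<in> K then f a * ent A a b else (0::'r::ring))"
 by (subst ent_times_left[of "{a}"]) (auto simp: ent_diag split: if_splits)

lemma ent_times_diag: "finite K ==> ent (A * diag K f) a b = (if b \<in> K then ent A a b * f b else (0::'r::ring))"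
 by (subst ent_times_right[of "{b}"]) (auto simp: ent_diag split: if_splits)

section \<open>Scalars and frames\<close>

text \<open>Matrices and block matrices over the field \<open>'k\<close> are handled alike through this interface.\<close>

locale scalars =
 fixes sc :: "'k::field \<Rightarrow> 'r::ring \<Rightarrow> 'r"
 assumes sc_add_left: "sc (c + d) x = sc c x + sc d x"
  and sc_add_right: "sc c (x + y) = sc c x + sc c y"
  and sc_sc: "sc (c * d) x = sc c (sc d x)"
  and sc_one [simp]: "sc 1 x = x"
  and sc_mult_left: "sc c x * y = sc c (x * y)"
  and sc_mult_right: "x * sc c y = sc c (x * y)"
begin

lemma sc_zero_left [simp]: "sc 0 x = 0"
 using sc_add_left[of 0 0 x] by simp

lemma sc_zero_right [simp]: "sc c 0 = 0"
 using sc_add_right[of c 0 0] by simp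

lemma sc_minus_right: "sc c (- x) = - sc c x"
 using sc_add_right[of c x "-x"] by (simp add: eq_neg_iff_add_eq_0 add.commute)

lemma sc_minus_left: "sc (- c) x = - sc c x"
 using sc_add_left[of c "-c" x] by (simp add: eq_neg_iff_add_eq_0 add.commute)

lemma sc_diff_right: "sc c (x - y) = sc c x - sc c y"
 using sc_add_right[of c x "-y"] by (simp add: sc_minus_right)

lemma sc_diff_left: "sc (c - d) x = sc c x - sc d x"
 using sc_add_left[of c "-d" x] by (simp add: sc_minus_left)

lemma sc_sum_right: "sc c (\<Sum>i\<in>S. f i) = (\<Sum>i\<in>S. sc c (f i))"
 by (induction S rule: infinite_finite_induct) (auto simp: sc_add_right)

lemma sc_sum_left: "sc (\<Sum>i\<in>S. f i) x = (\<Sum>i\<in>S. sc (f i) x)"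
 by (induction S rule: infinite_finite_induct) (auto simp: sc_add_left)

lemma sc_eq_0_iff [simp]: "sc c x = 0 \<longleftrightarrow> c = 0 \<or> x = 0"
 by (metis sc_zero_left sc_zero_right sc_sc sc_one left_inverse)

lemma sc_cancel: "x \<noteq> 0 ==> sc c x = sc d x \<longleftrightarrow> c = d"
 using sc_eq_0_iff[of "c - d" x] by (auto simp: sc_diff_left)

lemma scalars_fmat: "scalars (\<lambda>c. emap (sc c))"
proof
 fix c d :: 'k and A B :: "'r fmat"
 note e = ent_emap[of "sc _"]
 show "emap (sc c) A * B = emap (sc c) (A * B)"
 proof (rule fmat_eqI)
  fix i k
  obtain n where n: "\<forall>i j. ent A i j \<noteq> 0 \<longrightarrow> i < n \<and> j < n" using ent_bound by blast
  have "ent (emap (sc c) A * B) i k = (\<Sum>j<n. ent (emap (sc c) A) i j * ent B j k)"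
   by (rule ent_times_left) (use n in \<open>auto simp: e\<close>)
  then show "ent (emap (sc c) A * B) i k = ent (emap (sc c) (A * B)) i k"
   using n by (simp add: ent_times_left[of "{..<n}" A] e sc_sum_right sc_mult_left)
 qed
 show "A * emap (sc c) B = emap (sc c) (A * B)"
 proof (rule fmat_eqI)
  fix i k
  obtain n where n: "\<forall>i j. ent A i j \<noteq> 0 \<longrightarrow> i < n \<and> j < n" using ent_bound by blast
  show "ent (A * emap (sc c) B) i k = ent (emap (sc c) (A * B)) i k"
   using n by (simp add: ent_times_left[of "{..<n}"] e sc_sum_right sc_mult_right)
 qed
qed (rule fmat_eqI, simp add: ent_emap sc_add_left sc_add_right sc_sc)+

end

lemma scalars_field: "scalars ((*) :: 'k::field \<Rightarrow> 'k \<Rightarrow> 'k)"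
 by unfold_locales (auto simp: algebra_simps)

definition sc1 :: "'k::field \<Rightarrow> 'k fmat \<Rightarrow> 'k fmat" where "sc1 c = emap ((*) c)"
definition sc2 :: "'k::field \<Rightarrow> 'k fmat fmat \<Rightarrow> 'k fmat fmat" where "sc2 c = emap (sc1 c)"

interpretation sc1: scalars sc1
 unfolding sc1_def by (rule scalars.scalars_fmat[OF scalars_field])

interpretation sc2: scalars sc2
 unfolding sc2_def by (rule sc1.scalars_fmat)

lemma ent_sc1 [simp]: "ent (sc1 c A) i j = c * ent A i j" unfolding sc1_def by (simp add: ent_emap)
lemma ent_sc2 [simp]: "ent (sc2 c A) i j = sc1 c (ent A i j)" unfolding sc2_def by (simp add: ent_emap)

lemma sc2_eunit: "sc2 c (eunit i j x) = eunit i j (sc1 c x)" by (rule fmat_eqI) simp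

text \<open>The column space of an idempotent: vectors are one-column matrices.\<close>

definition col :: "'r::ring \<Rightarrow> 'r \<Rightarrow> 'r set" where "col I U = {x. I * x = x \<and> x * U = x}"

lemma colI: "I * x = x ==> x * U = x ==> x \<in> col I U" by (simp add: col_def)
lemma colD: "x \<in> col I U ==> I * x = x" "x \<in> col I U ==> x * U = x" by (simp_all add: col_def)

lemma col_zero [simp]: "0 \<in> col I U" by (simp add: col_def)
lemma col_add: "x \<in> col I U ==> y \<in> col I U ==> x + y \<in> col I U" by (simp add: col_def algebra_simps)
lemma col_uminus: "x \<in> col I U ==> - x \<in> col I U" by (simp add: col_def)
lemma col_diff: "x \<in> col I U ==> y \<in> col I U ==> x - y \<in> col I U" by (simp add: col_def algebra_simps)
lemma col_sum: "(\<And>i. i \<in> S ==> f i \<in> col I U) ==> sum f S \<in> col I U"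
 by (induction S rule: infinite_finite_induct) (auto intro: col_add)
lemma (in scalars) col_sc: "x \<in> col I U ==> sc c x \<in> col I U"
 by (simp add: col_def sc_mult_left sc_mult_right)
lemma col_mult: "J * A = A ==> x \<in> col I U ==> A * x \<in> col J U"
 by (simp add: col_def mult.assoc[symmetric]) (simp add: mult.assoc)

text \<open>\<open>I\<close> is the identity of a space with the basis \<open>u k\<close> and the dual basis \<open>v k\<close>, for \<open>k \<in> K\<close>. The vectors
are the columns, that is, the \<open>x\<close> with \<open>x * U = x\<close>, where the corner of \<open>U\<close> is a copy of the field.\<close>

locale frame = scalars sc for sc :: "'k::field \<Rightarrow> 'r::ring \<Rightarrow> 'r" +
 fixes I U :: 'r and K :: "'i set" and u v :: "'i \<Rightarrow> 'r"
 assumes finite_K [simp]: "finite K"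
  and I_sum: "I = (\<Sum>k\<in>K. u k * v k)"
  and U_idem: "U * U = U"
  and U_nonzero: "U \<noteq> 0"
  and u_U: "k \<in> K ==> u k * U = u k"
  and U_v: "k \<in> K ==> U * v k = v k"
  and v_u: "k \<in> K ==> l \<in> K ==> v k * u l = (if k = l then U else 0)"
  and U_scalar: "\<exists>c. U * x * U = sc c U"
begin

definition cf :: "'r \<Rightarrow> 'k" where "cf x = (THE c. U * x * U = sc c U)"

lemma cf: "sc (cf x) U = U * x * U"
proof -
 obtain c where c: "U * x * U = sc c U" using U_scalar by blast
 have "cf x = c" unfolding cf_def by (rule the_equality) (use c U_nonzero in \<open>auto simp: sc_cancel\<close>)
 with c show ?thesis by simp
qed

lemma cf_eqI: "U * x * U = sc c U ==> cf x = c"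
 using cf[of x] U_nonzero by (simp add: sc_cancel)

lemma cf_add: "cf (x + y) = cf x + cf y"
 by (rule cf_eqI) (simp add: cf distrib_left distrib_right sc_add_left)

lemma cf_sc: "cf (sc c x) = c * cf x"
 by (rule cf_eqI) (simp add: cf sc_sc sc_mult_left sc_mult_right)

lemma I_u: "k \<in> K ==> I * u k = u k"
 unfolding I_sum by (simp add: sum_distrib_right mult.assoc v_u if_distrib[of "(*) _"] u_U cong: if_cong)

lemma v_I: "k \<in> K ==> v k * I = v k"
 unfolding I_sum
 by (simp add: sum_distrib_left mult.assoc[symmetric] v_u if_distrib[of "\<lambda>x. x * _"] U_v cong: if_cong)

lemma I_idem: "I * I = I"
 by (subst (2) I_sum, subst (2) I_sum) (simp add: sum_distrib_left mult.assoc[symmetric] I_u)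

lemma u_col: "k \<in> K ==> u k \<in> col I U"
 by (simp add: col_def I_u u_U)

lemma col_expand:
 assumes x: "x \<in> col I U"
 shows "x = (\<Sum>k\<in>K. sc (cf (v k * x)) (u k))"
proof -
 have "x = I * x" using x by (simp add: col_def)
 also have "\<dots> = (\<Sum>k\<in>K. u k * (v k * x))" unfolding I_sum by (simp add: sum_distrib_right mult.assoc)
 also have "\<dots> = (\<Sum>k\<in>K. sc (cf (v k * x)) (u k))"
 proof (rule sum.cong[OF refl])
  fix k assume k: "k \<in> K"
  have "u k * (v k * x) = u k * (U * (v k * x) * U)"
   using x k by (simp add: col_def mult.assoc[symmetric] U_v) (simp add: mult.assoc)
  also have "\<dots> = sc (cf (v k * x)) (u k)"
   unfolding cf[symmetric] by (simp add: sc_mult_right u_U k)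
  finally show "u k * (v k * x) = sc (cf (v k * x)) (u k)" .
 qed
 finally show ?thesis .
qed

lemma cf_v_sum: "k \<in> K ==> cf (v k * (\<Sum>l\<in>K. sc (z l) (u l))) = z k"
 by (rule cf_eqI)
  (simp add: sum_distrib_left sum_distrib_right sc_mult_right sc_mult_left v_u if_distrib[of "sc _"]
   if_distrib[of "(*) _"] if_distrib[of "\<lambda>x. x * _"] U_idem cong: if_cong)

lemma matrix_unique:
 assumes "A * I = A" "B * I = B" "\<And>x. x \<in> col I U ==> A * x = B * x"
 shows "A = B"
proof -
 have "A * I = (\<Sum>k\<in>K. A * u k * v k)" for A by (simp add: I_sum sum_distrib_left mult.assoc)
 then have "A * I = B * I" using assms(3) u_col by simp
 then show ?thesis using assms by simp
qed

lemma matrix_exists: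
 assumes add: "\<And>x y. x \<in> col I U ==> y \<in> col I U ==> f (x + y) = f x + f y"
  and sc: "\<And>c x. x \<in> col I U ==> f (sc c x) = sc c (f x)"
  and cl: "\<And>x. x \<in> col I U ==> f x \<in> col J U"
 shows "\<exists>A. J * A = A \<and> A * I = A \<and> (\<forall>x\<in>col I U. A * x = f x)"
proof -
 define A where "A = (\<Sum>k\<in>K. f (u k) * v k)"
 have z: "f 0 = 0" using sc[of 0 0] by simp
 have fsum: "f (\<Sum>k\<in>S. sc (c k) (u k)) = (\<Sum>k\<in>S. sc (c k) (f (u k)))" if "S \<subseteq> K" for S c
 proof -
  have "finite S" using that finite_K finite_subset by blast
  then show ?thesis using that
  proof (induction S rule: finite_induct)
   case empty show ?case by (simp add: z)
  next
   case (insert k S)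
   then have "f (\<Sum>k\<in>insert k S. sc (c k) (u k)) = f (sc (c k) (u k) + (\<Sum>k\<in>S. sc (c k) (u k)))" by simp
   also have "\<dots> = f (sc (c k) (u k)) + f (\<Sum>k\<in>S. sc (c k) (u k))"
    by (rule add) (use insert in \<open>auto intro!: col_sum col_sc u_col\<close>)
   finally show ?case using insert by (simp add: sc u_col)
  qed
 qed
 have "A * x = f x" if x: "x \<in> col I U" for x
 proof -
  have "f (u k) * v k * x = sc (cf (v k * x)) (f (u k))" if k: "k \<in> K" for k
  proof -
   have fU: "f (u k) * U = f (u k)" using cl[OF u_col[OF k]] by (simp add: col_def)
   have "f (u k) * v k * x = f (u k) * (U * (v k * x) * U)"
    using x k fU by (simp add: col_def mult.assoc[symmetric]) (simp add: mult.assoc)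
   also have "\<dots> = sc (cf (v k * x)) (f (u k))"
    unfolding cf[symmetric] by (simp add: sc_mult_right fU)
   finally show ?thesis .
  qed
  then have "A * x = (\<Sum>k\<in>K. sc (cf (v k * x)) (f (u k)))" unfolding A_def by (simp add: sum_distrib_right)
  also have "\<dots> = f (\<Sum>k\<in>K. sc (cf (v k * x)) (u k))" by (rule fsum[symmetric]) simp
  finally show ?thesis using col_expand[OF x] by simp
 qed
 moreover have "J * A = A" unfolding A_def
  using cl[OF u_col] by (simp add: sum_distrib_left mult.assoc[symmetric] col_def)
 moreover have "A * I = A" unfolding A_def by (simp add: sum_distrib_right mult.assoc v_I)
 ultimately show ?thesis by blast
qed

end

definition U1 :: "'k::field fmat" where "U1 = eunit 0 0 1"
definition U2 :: "'k::field fmat fmat" where "U2 = eunit 0 0 U1"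
definition idn :: "nat set \<Rightarrow> 'k::field fmat" where "idn K = diag K (\<lambda>_. 1)"

lemma ent_idn: "finite K ==> ent (idn K) a b = (if a = b \<and> a \<in> K then 1 else 0)"
 by (simp add: idn_def ent_diag)

lemma ent_idn_times: "finite K ==> ent (idn K * A) a b = (if a \<in> K then ent A a b else 0)"
 by (simp add: idn_def ent_diag_times)

lemma ent_times_idn: "finite K ==> ent (A * idn K) a b = (if b \<in> K then ent A a b else 0)"
 by (simp add: idn_def ent_times_diag)

lemma frame1: 
 assumes "finite K"
 shows "frame (sc1 :: 'k::field \<Rightarrow> _) (idn K) U1 K (\<lambda>k. eunit k 0 1) (\<lambda>k. eunit 0 k 1)"
proof
 show "\<exists>c. U1 * x * U1 = sc1 c (U1 :: 'k fmat)" for x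
  by (rule exI[of _ "ent x 0 0"], rule fmat_eqI)
   (auto simp: U1_def ent_eunit_times ent_times_eunit)
 have "ent U1 0 0 = (1::'k)" by (simp add: U1_def)
 then show "U1 \<noteq> (0 :: 'k fmat)" by (metis ent_simps(1) zero_neq_one)
qed (use assms in \<open>auto simp: U1_def eunit_times idn_def diag_def\<close>)

definition bidn :: "nat \<Rightarrow> (nat \<Rightarrow> nat) \<Rightarrow> 'k::field fmat fmat" where
 "bidn n d = diag {..<n} (\<lambda>a. idn {..<d a})"

lemma frame2:
 "frame (sc2 :: 'k::field \<Rightarrow> _) (bidn n d) U2 (SIGMA a:{..<n}. {..<d a})
  (\<lambda>(a, p). eunit a 0 (eunit p 0 1)) (\<lambda>(a, p). eunit 0 a (eunit 0 p 1))"
proof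
 show "\<exists>c. U2 * x * U2 = sc2 c (U2 :: 'k fmat fmat)" for x
  by (rule exI[of _ "ent (ent x 0 0) 0 0"], rule fmat_eqI, rule fmat_eqI)
   (auto simp: U1_def U2_def ent_eunit_times ent_times_eunit)
 have "ent (ent U2 0 0) 0 0 = (1::'k)" by (simp add: U1_def U2_def)
 then show "U2 \<noteq> (0 :: 'k fmat fmat)" by (metis ent_simps(1) zero_neq_one)
 show "bidn n d = (\<Sum>k\<in>(SIGMA a:{..<n}. {..<d a}). (case k of (a, p) \<Rightarrow> eunit a 0 (eunit p 0 1)) *
   (case k of (a, p) \<Rightarrow> eunit 0 a (eunit 0 p (1::'k))))"
 proof -
  have "eunit a a (\<Sum>p\<in>P. x p) = (\<Sum>p\<in>P. eunit a a (x p))" for a and P :: "nat set" and x :: "nat \<Rightarrow> 'k fmat"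
   by (induction P rule: infinite_finite_induct) (auto simp: eunit_simps)
  then show ?thesis
   by (simp add: bidn_def diag_def idn_def eunit_times sum.Sigma split_def)
 qed
qed (auto simp: U1_def U2_def eunit_times eunit_simps split: if_splits)

section \<open>Equivalences from spans of fully faithful functors\<close>

definition fully_faithful ::
 "('o, 'm, 'k) lincat \<Rightarrow> ('p, 'n, 'k) lincat \<Rightarrow> ('o \<Rightarrow> 'p) \<Rightarrow> ('o \<Rightarrow> 'o \<Rightarrow> 'm \<Rightarrow> 'n) \<Rightarrow> bool" where
 "fully_faithful C D F \<Phi> \<longleftrightarrow>
   (\<forall>X\<in>Ob C. \<forall>Y\<in>Ob C. bij_betw (\<Phi> X Y) (Hom C X Y) (Hom D (F X) (F Y)))"

definition essentially_surjective ::
 "('o, 'm, 'k) lincat \<Rightarrow> ('p, 'n, 'k) lincat \<Rightarrow> ('o \<Rightarrow> 'p) \<Rightarrow> bool" where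
 "essentially_surjective C D F \<longleftrightarrow> (\<forall>Y\<in>Ob D. \<exists>X\<in>Ob C. \<exists>f. isomorphism D Y (F X) f)"

text \<open>The closure conditions on hom sets. For the source of a faithful functor to a linear category
 the equational laws follow.\<close>

definition homs_closed :: "('o, 'm, 'k) lincat \<Rightarrow> bool" where
 "homs_closed C \<longleftrightarrow> (\<forall>X\<in>Ob C. Ident C X \<in> Hom C X X) \<and>
   (\<forall>X\<in>Ob C. \<forall>Y\<in>Ob C. \<forall>Z\<in>Ob C. \<forall>f\<in>Hom C X Y. \<forall>g\<in>Hom C Y Z. Comp C X Y Z g f \<in> Hom C X Z) \<and>
   (\<forall>X\<in>Ob C. \<forall>Y\<in>Ob C. \<forall>f\<in>Hom C X Y. \<forall>g\<in>Hom C X Y. Plus C X Y f g \<in> Hom C X Y) \<and>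
   (\<forall>X\<in>Ob C. \<forall>Y\<in>Ob C. \<forall>f\<in>Hom C X Y. \<forall>c. Scale C X Y c f \<in> Hom C X Y)"

lemma linear_functorD:
 assumes "linear_functor C D F \<Phi>"
 shows "X \<in> Ob C ==> F X \<in> Ob D"
  and "[|X \<in> Ob C; Y \<in> Ob C; f \<in> Hom C X Y|] ==> \<Phi> X Y f \<in> Hom D (F X) (F Y)"
  and "X \<in> Ob C ==> \<Phi> X X (Ident C X) = Ident D (F X)"
  and "[|X \<in> Ob C; Y \<in> Ob C; Z \<in> Ob C; f \<in> Hom C X Y; g \<in> Hom C Y Z|]
   ==> \<Phi> X Z (Comp C X Y Z g f) = Comp D (F X) (F Y) (F Z) (\<Phi> Y Z g) (\<Phi> X Y f)"
  and "[|X \<in> Ob C; Y \<in> Ob C; f \<in> Hom C X Y; g \<in> Hom C X Y|]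
   ==> \<Phi> X Y (Plus C X Y f g) = Plus D (F X) (F Y) (\<Phi> X Y f) (\<Phi> X Y g)"
  and "[|X \<in> Ob C; Y \<in> Ob C; f \<in> Hom C X Y|]
   ==> \<Phi> X Y (Scale C X Y c f) = Scale D (F X) (F Y) c (\<Phi> X Y f)"
 using assms unfolding linear_functor_def by blast+

lemma homs_closedD:
 assumes "homs_closed C"
 shows "X \<in> Ob C ==> Ident C X \<in> Hom C X X"
  and "[|X \<in> Ob C; Y \<in> Ob C; Z \<in> Ob C; f \<in> Hom C X Y; g \<in> Hom C Y Z|] ==> Comp C X Y Z g f \<in> Hom C X Z"
  and "[|X \<in> Ob C; Y \<in> Ob C; f \<in> Hom C X Y; g \<in> Hom C X Y|] ==> Plus C X Y f g \<in> Hom C X Y"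
  and "[|X \<in> Ob C; Y \<in> Ob C; f \<in> Hom C X Y|] ==> Scale C X Y c f \<in> Hom C X Y"
 using assms unfolding homs_closed_def by blast+

lemma fully_faithful_eqI:
 assumes "fully_faithful C D F \<Phi>" "X \<in> Ob C" "Y \<in> Ob C" "f \<in> Hom C X Y" "g \<in> Hom C X Y" "\<Phi> X Y f = \<Phi> X Y g"
 shows "f = g"
 using assms unfolding fully_faithful_def bij_betw_def inj_on_def by blast

lemma fully_faithful_lift:
 assumes "fully_faithful C D F \<Phi>" "X \<in> Ob C" "Y \<in> Ob C" "g \<in> Hom D (F X) (F Y)"
 obtains f where "f \<in> Hom C X Y" "\<Phi> X Y f = g"
proof -
 have "g \<in> \<Phi> X Y ` Hom C X Y" using assms unfolding fully_faithful_def bij_betw_def by simp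
 then show ?thesis using that by auto
qed

lemma linear_functor_comp:
 assumes F: "linear_functor C D F \<Phi>" and G: "linear_functor D E G \<Psi>"
 shows "linear_functor C E (G \<circ> F) (\<lambda>X Y f. \<Psi> (F X) (F Y) (\<Phi> X Y f))"
 unfolding linear_functor_def o_def
 by (simp add: linear_functorD[OF F] linear_functorD[OF G])

lemma (in linear_category) isomorphism_comp:
 assumes "X \<in> Ob C" "Y \<in> Ob C" "Z \<in> Ob C" "isomorphism C X Y f" "isomorphism C Y Z g"
 shows "isomorphism C X Z (Comp C X Y Z g f)"
proof -
 obtain f' where f: "f \<in> Hom C X Y" "f' \<in> Hom C Y X" "Comp C X Y X f' f = Ident C X" "Comp C Y X Y f f' = Ident C Y"
  using assms(4) unfolding isomorphism_def by blast
 obtain g' where g: "g \<in> Hom C Y Z" "g' \<in> Hom C Z Y" "Comp C Y Z Y g' g = Ident C Y" "Comp C Z Y Z g g' = Ident C Z"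
  using assms(5) unfolding isomorphism_def by blast
 note ob = assms(1-3)
 have "Comp C X Z X (Comp C Z Y X f' g') (Comp C X Y Z g f) = Comp C X Y X f' (Comp C X Z Y g' (Comp C X Y Z g f))"
  using Comp_assoc[OF ob(1,3,2,1) Comp_in[OF ob f(1) g(1)] g(2) f(2)] by simp
 also have "Comp C X Z Y g' (Comp C X Y Z g f) = f"
  using Comp_assoc[OF ob(1,2,3,2) f(1) g(1) g(2)] g(3) Ident_Comp[OF ob(1,2) f(1)] by simp
 finally have 1: "Comp C X Z X (Comp C Z Y X f' g') (Comp C X Y Z g f) = Ident C X" using f by simp
 have "Comp C Z X Z (Comp C X Y Z g f) (Comp C Z Y X f' g') = Comp C Z Y Z g (Comp C Z X Y f (Comp C Z Y X f' g'))"
  using Comp_assoc[OF ob(3,1,2,3) Comp_in[OF ob(3,2,1) g(2) f(2)] f(1) g(1)] by simp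
 also have "Comp C Z X Y f (Comp C Z Y X f' g') = g'"
  using Comp_assoc[OF ob(3,2,1,2) g(2) f(2) f(1)] f(4) Ident_Comp[OF ob(3,2) g(2)] by simp
 finally have 2: "Comp C Z X Z (Comp C X Y Z g f) (Comp C Z Y X f' g') = Ident C Z" using g by simp
 show ?thesis unfolding isomorphism_def
  using 1 2 Comp_in[OF ob f(1) g(1)] Comp_in[OF ob(3,2,1) g(2) f(2)] by blast
qed

lemma linear_functor_isomorphism:
 assumes F: "linear_functor C D F \<Phi>" and ob: "X \<in> Ob C" "Y \<in> Ob C" and i: "isomorphism C X Y f"
 shows "isomorphism D (F X) (F Y) (\<Phi> X Y f)"
proof -
 obtain f' where f: "f \<in> Hom C X Y" "f' \<in> Hom C Y X" "Comp C X Y X f' f = Ident C X" "Comp C Y X Y f f' = Ident C Y"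
  using i unfolding isomorphism_def by blast
 note l = linear_functorD[OF F]
 show ?thesis unfolding isomorphism_def
  using l(2)[OF ob f(1)] l(2)[OF ob(2,1) f(2)] l(4)[OF ob(1,2,1) f(1,2)] l(4)[OF ob(2,1,2) f(2,1)]
   l(3)[OF ob(1)] l(3)[OF ob(2)] f(3,4) by metis
qed

lemma fully_faithful_isomorphism:
 assumes hc: "homs_closed C" and F: "linear_functor C D F \<Phi>" and ff: "fully_faithful C D F \<Phi>"
  and ob: "X \<in> Ob C" "Y \<in> Ob C" and i: "isomorphism D (F X) (F Y) g"
 obtains f where "isomorphism C X Y f" "\<Phi> X Y f = g"
proof -
 obtain g' where g: "g \<in> Hom D (F X) (F Y)" "g' \<in> Hom D (F Y) (F X)"
  "Comp D (F X) (F Y) (F X) g' g = Ident D (F X)" "Comp D (F Y) (F X) (F Y) g g' = Ident D (F Y)"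
  using i unfolding isomorphism_def by blast
 obtain f where f: "f \<in> Hom C X Y" "\<Phi> X Y f = g" using fully_faithful_lift[OF ff ob g(1)] .
 obtain f' where f': "f' \<in> Hom C Y X" "\<Phi> Y X f' = g'" using fully_faithful_lift[OF ff ob(2,1) g(2)] .
 note l = linear_functorD[OF F] and h = homs_closedD[OF hc]
 have "Comp C X Y X f' f = Ident C X"
  by (rule fully_faithful_eqI[OF ff ob(1,1)])
   (use h(2)[OF ob(1,2,1) f(1) f'(1)] h(1)[OF ob(1)] l(4)[OF ob(1,2,1) f(1) f'(1)] l(3)[OF ob(1)] f f' g in simp_all)
 moreover have "Comp C Y X Y f f' = Ident C Y"
  by (rule fully_faithful_eqI[OF ff ob(2,2)])
   (use h(2)[OF ob(2,1,2) f'(1) f(1)] h(1)[OF ob(2)] l(4)[OF ob(2,1,2) f'(1) f(1)] l(3)[OF ob(2)] f f' g in simp_all)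
 ultimately have "isomorphism C X Y f" unfolding isomorphism_def using f f' by blast
 with f that show ?thesis by blast
qed

text \<open>Choose for every object of \<open>C\<close> an isomorphism to an object in the image of \<open>F\<close>. Conjugating a morphism
by these isomorphisms gives one between objects in the image, which lifts uniquely along \<open>F\<close>.\<close>

lemma quasi_inverse:
 assumes C: "linear_category C" and hc: "homs_closed E"
  and F: "linear_functor E C F \<Phi>" and ff: "fully_faithful E C F \<Phi>" and es: "essentially_surjective E C F"
 obtains G \<Psi> \<eta> where "linear_functor C E G \<Psi>"
  "natural_iso_from_id C (F \<circ> G) (\<lambda>X Y f. \<Phi> (G X) (G Y) (\<Psi> X Y f)) \<eta>"
proof -
 interpret linear_category C by (rule C)
 have "\<forall>X\<in>Ob C. \<exists>p. fst p \<in> Ob E \<and> isomorphism C X (F (fst p)) (snd p)"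
  using es unfolding essentially_surjective_def by fastforce
 then obtain p where p: "\<And>X. X \<in> Ob C ==> fst (p X) \<in> Ob E \<and> isomorphism C X (F (fst (p X))) (snd (p X))"
  by metis
 define G where "G X = fst (p X)" for X
 define j where "j X = snd (p X)" for X
 have G: "G X \<in> Ob E" and ji: "isomorphism C X (F (G X)) (j X)" if "X \<in> Ob C" for X
  using p[OF that] by (auto simp: G_def j_def)
 have "\<forall>X\<in>Ob C. \<exists>i. i \<in> Hom C (F (G X)) X \<and> Comp C X (F (G X)) X i (j X) = Ident C X \<and>
   Comp C (F (G X)) X (F (G X)) (j X) i = Ident C (F (G X))"
  using ji unfolding isomorphism_def by blast
 then obtain i where i: "\<And>X. X \<in> Ob C ==> i X \<in> Hom C (F (G X)) X"
  and ij: "\<And>X. X \<in> Ob C ==> Comp C X (F (G X)) X (i X) (j X) = Ident C X"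
  and ji': "\<And>X. X \<in> Ob C ==> Comp C (F (G X)) X (F (G X)) (j X) (i X) = Ident C (F (G X))"
  by metis
 have j: "j X \<in> Hom C X (F (G X))" if "X \<in> Ob C" for X using ji[OF that] unfolding isomorphism_def by blast
 note l = linear_functorD[OF F] and h = homs_closedD[OF hc]
 have FG: "F (G X) \<in> Ob C" if "X \<in> Ob C" for X using l(1) G that by blast
 define q where "q X Y f = Comp C (F (G X)) Y (F (G Y)) (j Y) (Comp C (F (G X)) X Y f (i X))" for X Y f
 have q_in: "q X Y f \<in> Hom C (F (G X)) (F (G Y))" if "X \<in> Ob C" "Y \<in> Ob C" "f \<in> Hom C X Y" for X Y f
  unfolding q_def by (intro Comp_in) (use that FG i j in auto)
 define \<Psi> where "\<Psi> X Y f = (SOME g. g \<in> Hom E (G X) (G Y) \<and> \<Phi> (G X) (G Y) g = q X Y f)" for X Y f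
 have \<Psi>: "\<Psi> X Y f \<in> Hom E (G X) (G Y) \<and> \<Phi> (G X) (G Y) (\<Psi> X Y f) = q X Y f"
  if "X \<in> Ob C" "Y \<in> Ob C" "f \<in> Hom C X Y" for X Y f
  unfolding \<Psi>_def
  by (rule someI_ex) (use fully_faithful_lift[OF ff G[OF that(1)] G[OF that(2)] q_in[OF that]] in blast)
 note eqI = fully_faithful_eqI[OF ff G G]
 have qj: "Comp C X (F (G X)) (F (G Y)) (q X Y f) (j X) = Comp C X Y (F (G Y)) (j Y) f"
  if o: "X \<in> Ob C" "Y \<in> Ob C" "f \<in> Hom C X Y" for X Y f
 proof -
  have fi: "Comp C (F (G X)) X Y f (i X) \<in> Hom C (F (G X)) Y" by (intro Comp_in) (use o FG i in auto)
  have "Comp C X (F (G X)) (F (G Y)) (q X Y f) (j X)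
    = Comp C X Y (F (G Y)) (j Y) (Comp C X (F (G X)) Y (Comp C (F (G X)) X Y f (i X)) (j X))"
   unfolding q_def using Comp_assoc[OF o(1) FG[OF o(1)] o(2) FG[OF o(2)] j[OF o(1)] fi j[OF o(2)]] by simp
  also have "Comp C X (F (G X)) Y (Comp C (F (G X)) X Y f (i X)) (j X) = f"
   using Comp_assoc[OF o(1) FG[OF o(1)] o(1,2) j[OF o(1)] i[OF o(1)] o(3)] ij[OF o(1)] Comp_Ident[OF o] by simp
  finally show ?thesis .
 qed
 have "linear_functor C E G \<Psi>"
  unfolding linear_functor_def
 proof (intro conjI ballI allI)
  fix X assume o: "X \<in> Ob C"
  show "G X \<in> Ob E" using G o .
  show "\<Psi> X X (Ident C X) = Ident E (G X)"
  proof (rule eqI[OF o o])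
   show "\<Phi> (G X) (G X) (\<Psi> X X (Ident C X)) = \<Phi> (G X) (G X) (Ident E (G X))"
    using \<Psi>[OF o o Ident_in[OF o]] l(3)[OF G[OF o]] ji'[OF o] Ident_Comp[OF FG[OF o] o i[OF o]]
    by (simp add: q_def)
  qed (use \<Psi>[OF o o Ident_in[OF o]] h(1)[OF G[OF o]] in auto)
 next
  fix X Y f assume o: "X \<in> Ob C" "Y \<in> Ob C" and f: "f \<in> Hom C X Y"
  show "\<Psi> X Y f \<in> Hom E (G X) (G Y)" using \<Psi>[OF o f] by blast
  have fi: "Comp C (F (G X)) X Y f (i X) \<in> Hom C (F (G X)) Y" by (intro Comp_in) (use o f FG i in auto)
  fix c
  have cf: "Scale C X Y c f \<in> Hom C X Y"
  proof -
   obtain z where "vectorspace class_ring \<lparr>carrier = Hom C X Y, mult = (\<lambda>_ _. z), one = z, zero = z,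
    add = Plus C X Y, smult = Scale C X Y\<rparr>" using Hom_vectorspace[OF o] by blast
   from class_vectorspace_facts(2)[OF this, of f c] f show ?thesis by simp
  qed
  show "\<Psi> X Y (Scale C X Y c f) = Scale E (G X) (G Y) c (\<Psi> X Y f)"
  proof (rule eqI[OF o])
   show "\<Phi> (G X) (G Y) (\<Psi> X Y (Scale C X Y c f)) = \<Phi> (G X) (G Y) (Scale E (G X) (G Y) c (\<Psi> X Y f))"
    using \<Psi>[OF o cf] l(6)[OF G[OF o(1)] G[OF o(2)]] \<Psi>[OF o f]
     Comp_Scale_left[OF FG[OF o(1)] o i[OF o(1)] f] Comp_Scale_right[OF FG[OF o(1)] o(2) FG[OF o(2)] fi j[OF o(2)]]
    by (simp add: q_def)
  qed (use \<Psi>[OF o cf] \<Psi>[OF o f] h(4)[OF G[OF o(1)] G[OF o(2)]] in auto)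
 next
  fix X Y f g assume o: "X \<in> Ob C" "Y \<in> Ob C" and f: "f \<in> Hom C X Y" and g: "g \<in> Hom C X Y"
  have fi: "Comp C (F (G X)) X Y f (i X) \<in> Hom C (F (G X)) Y" if "f \<in> Hom C X Y" for f
   by (intro Comp_in) (use o that FG i in auto)
  have cf: "Plus C X Y f g \<in> Hom C X Y"
  proof -
   obtain z where "vectorspace class_ring \<lparr>carrier = Hom C X Y, mult = (\<lambda>_ _. z), one = z, zero = z,
    add = Plus C X Y, smult = Scale C X Y\<rparr>" using Hom_vectorspace[OF o] by blast
   from class_vectorspace_facts(1)[OF this, of f g] f g show ?thesis by simp
  qed
  show "\<Psi> X Y (Plus C X Y f g) = Plus E (G X) (G Y) (\<Psi> X Y f) (\<Psi> X Y g)"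
  proof (rule eqI[OF o])
   show "\<Phi> (G X) (G Y) (\<Psi> X Y (Plus C X Y f g)) = \<Phi> (G X) (G Y) (Plus E (G X) (G Y) (\<Psi> X Y f) (\<Psi> X Y g))"
    using \<Psi>[OF o cf] l(5)[OF G[OF o(1)] G[OF o(2)]] \<Psi>[OF o f] \<Psi>[OF o g]
     Comp_Plus_left[OF FG[OF o(1)] o i[OF o(1)] f g]
     Comp_Plus_right[OF FG[OF o(1)] o(2) FG[OF o(2)] fi[OF f] fi[OF g] j[OF o(2)]]
    by (simp add: q_def)
  qed (use \<Psi>[OF o cf] \<Psi>[OF o f] \<Psi>[OF o g] h(3)[OF G[OF o(1)] G[OF o(2)]] in auto)
 next
  fix X Y Z f g assume o: "X \<in> Ob C" "Y \<in> Ob C" "Z \<in> Ob C" and f: "f \<in> Hom C X Y" and g: "g \<in> Hom C Y Z"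
  have gf: "Comp C X Y Z g f \<in> Hom C X Z" using Comp_in[OF o f g] .
  have fi: "Comp C (F (G X)) X Y f (i X) \<in> Hom C (F (G X)) Y" by (intro Comp_in) (use o f FG i in auto)
  have "Comp C (F (G X)) (F (G Y)) (F (G Z)) (q Y Z g) (q X Y f)
    = Comp C (F (G X)) Y (F (G Z)) (Comp C Y (F (G Y)) (F (G Z)) (q Y Z g) (j Y)) (Comp C (F (G X)) X Y f (i X))"
   unfolding q_def[of X Y f]
   using Comp_assoc[OF FG[OF o(1)] o(2) FG[OF o(2)] FG[OF o(3)] fi j[OF o(2)] q_in[OF o(2,3) g]] by simp
  also have "\<dots> = Comp C (F (G X)) Y (F (G Z)) (Comp C Y Z (F (G Z)) (j Z) g) (Comp C (F (G X)) X Y f (i X))"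
   using qj[OF o(2,3) g] by simp
  also have "\<dots> = Comp C (F (G X)) Z (F (G Z)) (j Z) (Comp C (F (G X)) Y Z g (Comp C (F (G X)) X Y f (i X)))"
   using Comp_assoc[OF FG[OF o(1)] o(2,3) FG[OF o(3)] fi g j[OF o(3)]] by simp
  also have "\<dots> = q X Z (Comp C X Y Z g f)"
   unfolding q_def using Comp_assoc[OF FG[OF o(1)] o(1,2,3) i[OF o(1)] f g] by simp
  finally have q: "Comp C (F (G X)) (F (G Y)) (F (G Z)) (q Y Z g) (q X Y f) = q X Z (Comp C X Y Z g f)" .
  show "\<Psi> X Z (Comp C X Y Z g f) = Comp E (G X) (G Y) (G Z) (\<Psi> Y Z g) (\<Psi> X Y f)"
  proof (rule eqI[OF o(1,3)])
   show "\<Phi> (G X) (G Z) (\<Psi> X Z (Comp C X Y Z g f)) = \<Phi> (G X) (G Z) (Comp E (G X) (G Y) (G Z) (\<Psi> Y Z g) (\<Psi> X Y f))"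
    using \<Psi>[OF o(1,3) gf] \<Psi>[OF o(1,2) f] \<Psi>[OF o(2,3) g] q
     l(4)[OF G[OF o(1)] G[OF o(2)] G[OF o(3)]] by simp
  qed (use \<Psi>[OF o(1,3) gf] \<Psi>[OF o(1,2) f] \<Psi>[OF o(2,3) g] h(2)[OF G[OF o(1)] G[OF o(2)] G[OF o(3)]] in auto)
 qed
 moreover have "natural_iso_from_id C (F \<circ> G) (\<lambda>X Y f. \<Phi> (G X) (G Y) (\<Psi> X Y f)) j"
  unfolding natural_iso_from_id_def using ji qj \<Psi> by simp
 ultimately show ?thesis using that by blast
qed

text \<open>The unit of the composite equivalence is \<open>\<eta>1\<close> followed by the image under \<open>F1\<close> of the lift of \<open>\<eta>2\<close> along
the fully faithful \<open>F2\<close>.\<close>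

lemma span_unit:
 assumes C: "linear_category C" and hc: "homs_closed E"
  and F1: "linear_functor E C F1 \<Phi>1"
  and G1: "linear_functor C E G1 \<Psi>1"
  and n1: "natural_iso_from_id C (F1 \<circ> G1) (\<lambda>X Y f. \<Phi>1 (G1 X) (G1 Y) (\<Psi>1 X Y f)) \<eta>1"
  and F2: "linear_functor E D F2 \<Phi>2" and ff2: "fully_faithful E D F2 \<Phi>2"
  and G2: "linear_functor D E G2 \<Psi>2"
  and n2: "natural_iso_from_id D (F2 \<circ> G2) (\<lambda>X Y f. \<Phi>2 (G2 X) (G2 Y) (\<Psi>2 X Y f)) \<eta>2"
 shows "\<exists>\<eta>. natural_iso_from_id C ((F1 \<circ> G2) \<circ> (F2 \<circ> G1))
   (\<lambda>X Y f. \<Phi>1 (G2 (F2 (G1 X))) (G2 (F2 (G1 Y))) (\<Psi>2 (F2 (G1 X)) (F2 (G1 Y)) (\<Phi>2 (G1 X) (G1 Y) (\<Psi>1 X Y f)))) \<eta>"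
proof -
 interpret linear_category C by (rule C)
 note l1 = linear_functorD[OF F1] and l2 = linear_functorD[OF F2]
  and k1 = linear_functorD[OF G1] and k2 = linear_functorD[OF G2] and h = homs_closedD[OF hc]
 have "\<forall>e\<in>Ob E. \<exists>t. isomorphism E e (G2 (F2 e)) t \<and> \<Phi>2 e (G2 (F2 e)) t = \<eta>2 (F2 e)"
 proof
  fix e assume e: "e \<in> Ob E"
  have "isomorphism D (F2 e) (F2 (G2 (F2 e))) (\<eta>2 (F2 e))"
   using n2 l2(1)[OF e] unfolding natural_iso_from_id_def by simp
  from fully_faithful_isomorphism[OF hc F2 ff2 e k2(1)[OF l2(1)[OF e]] this]
  show "\<exists>t. isomorphism E e (G2 (F2 e)) t \<and> \<Phi>2 e (G2 (F2 e)) t = \<eta>2 (F2 e)" by blast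
 qed
 then obtain t where t: "\<And>e. e \<in> Ob E ==> isomorphism E e (G2 (F2 e)) (t e)"
  and t2: "\<And>e. e \<in> Ob E ==> \<Phi>2 e (G2 (F2 e)) (t e) = \<eta>2 (F2 e)" by metis
 have tin: "t e \<in> Hom E e (G2 (F2 e))" if "e \<in> Ob E" for e using t[OF that] unfolding isomorphism_def by blast
 define H where "H e = G2 (F2 e)" for e
 define \<Theta> where "\<Theta> e e' x = \<Psi>2 (F2 e) (F2 e') (\<Phi>2 e e' x)" for e e' x
 have H: "H e \<in> Ob E" if "e \<in> Ob E" for e using that k2(1) l2(1) by (simp add: H_def)
 have \<Theta>: "\<Theta> e e' x \<in> Hom E (H e) (H e')" if "e \<in> Ob E" "e' \<in> Ob E" "x \<in> Hom E e e'" for e e' x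
  unfolding \<Theta>_def H_def by (rule k2(2)) (use that l2 in auto)
 have tnat: "Comp E e e' (H e') (t e') x = Comp E e (H e) (H e') (\<Theta> e e' x) (t e)"
  if o: "e \<in> Ob E" "e' \<in> Ob E" and x: "x \<in> Hom E e e'" for e e' x
 proof (rule fully_faithful_eqI[OF ff2 o(1) H[OF o(2)]])
  have "Comp D (F2 e) (F2 e') (F2 (H e')) (\<eta>2 (F2 e')) (\<Phi>2 e e' x)
    = Comp D (F2 e) (F2 (H e)) (F2 (H e')) (\<Phi>2 (H e) (H e') (\<Theta> e e' x)) (\<eta>2 (F2 e))"
   using n2 l2(1)[OF o(1)] l2(1)[OF o(2)] l2(2)[OF o x] unfolding natural_iso_from_id_def H_def \<Theta>_def by simp
  then show "\<Phi>2 e (H e') (Comp E e e' (H e') (t e') x) = \<Phi>2 e (H e') (Comp E e (H e) (H e') (\<Theta> e e' x) (t e))"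
   using l2(4)[OF o H[OF o(2)] x] l2(4)[OF o(1) H[OF o(1)] H[OF o(2)] _ \<Theta>[OF o x]] tin[OF o(1)] tin[OF o(2)]
    t2[OF o(1)] t2[OF o(2)] unfolding H_def by simp
 qed (use h(2)[OF o H[OF o(2)] x] h(2)[OF o(1) H[OF o(1)] H[OF o(2)] _ \<Theta>[OF o x]] tin[OF o(1)] tin[OF o(2)] in \<open>auto simp: H_def\<close>)
 define \<eta> where "\<eta> X = Comp C X (F1 (G1 X)) (F1 (H (G1 X))) (\<Phi>1 (G1 X) (H (G1 X)) (t (G1 X))) (\<eta>1 X)" for X
 have n1i: "isomorphism C X (F1 (G1 X)) (\<eta>1 X)" if "X \<in> Ob C" for X
  using n1 that unfolding natural_iso_from_id_def by simp
 have n1h: "\<eta>1 X \<in> Hom C X (F1 (G1 X))" if "X \<in> Ob C" for X using n1i[OF that] unfolding isomorphism_def by blast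
 have "natural_iso_from_id C ((F1 \<circ> G2) \<circ> (F2 \<circ> G1))
   (\<lambda>X Y f. \<Phi>1 (H (G1 X)) (H (G1 Y)) (\<Theta> (G1 X) (G1 Y) (\<Psi>1 X Y f))) \<eta>"
  unfolding natural_iso_from_id_def
 proof (intro conjI ballI)
  fix X assume X: "X \<in> Ob C"
  note g = k1(1)[OF X]
  have "isomorphism C X (F1 (H (G1 X))) (\<eta> X)" unfolding \<eta>_def
   by (rule isomorphism_comp[OF X l1(1)[OF g] l1(1)[OF H[OF g]] n1i[OF X]],
    rule linear_functor_isomorphism[OF F1 g H[OF g]]) (use t[OF g] in \<open>simp add: H_def\<close>)
  then show "isomorphism C X (((F1 \<circ> G2) \<circ> (F2 \<circ> G1)) X) (\<eta> X)" by (simp add: H_def)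
 next
  fix X Y f assume o: "X \<in> Ob C" "Y \<in> Ob C" and f: "f \<in> Hom C X Y"
  note gX = k1(1)[OF o(1)] and gY = k1(1)[OF o(2)]
  let ?tX = "\<Phi>1 (G1 X) (H (G1 X)) (t (G1 X))" and ?tY = "\<Phi>1 (G1 Y) (H (G1 Y)) (t (G1 Y))"
  let ?f = "\<Psi>1 X Y f" and ?h = "\<Phi>1 (H (G1 X)) (H (G1 Y)) (\<Theta> (G1 X) (G1 Y) (\<Psi>1 X Y f))"
  note obs = l1(1)[OF gX] l1(1)[OF gY] l1(1)[OF H[OF gX]] l1(1)[OF H[OF gY]]
  have tX: "?tX \<in> Hom C (F1 (G1 X)) (F1 (H (G1 X)))" and tY: "?tY \<in> Hom C (F1 (G1 Y)) (F1 (H (G1 Y)))"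
   using l1(2)[OF gX H[OF gX]] l1(2)[OF gY H[OF gY]] tin[OF gX] tin[OF gY] by (auto simp: H_def)
  have f': "?f \<in> Hom E (G1 X) (G1 Y)" using k1(2)[OF o f] .
  have pf: "\<Phi>1 (G1 X) (G1 Y) ?f \<in> Hom C (F1 (G1 X)) (F1 (G1 Y))" using l1(2)[OF gX gY f'] .
  have ph: "?h \<in> Hom C (F1 (H (G1 X))) (F1 (H (G1 Y)))" using l1(2)[OF H[OF gX] H[OF gY] \<Theta>[OF gX gY f']] .
  have "Comp C X Y (F1 (H (G1 Y))) (\<eta> Y) f = Comp C X (F1 (G1 Y)) (F1 (H (G1 Y))) ?tY (Comp C X Y (F1 (G1 Y)) (\<eta>1 Y) f)"
   unfolding \<eta>_def using Comp_assoc[OF o obs(2,4) f n1h[OF o(2)] tY] by simp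
  also have "Comp C X Y (F1 (G1 Y)) (\<eta>1 Y) f = Comp C X (F1 (G1 X)) (F1 (G1 Y)) (\<Phi>1 (G1 X) (G1 Y) ?f) (\<eta>1 X)"
   using n1 o f unfolding natural_iso_from_id_def by simp
  also have "Comp C X (F1 (G1 Y)) (F1 (H (G1 Y))) ?tY \<dots>
    = Comp C X (F1 (G1 X)) (F1 (H (G1 Y))) (Comp C (F1 (G1 X)) (F1 (G1 Y)) (F1 (H (G1 Y))) ?tY (\<Phi>1 (G1 X) (G1 Y) ?f)) (\<eta>1 X)"
   using Comp_assoc[OF o(1) obs(1,2,4) n1h[OF o(1)] pf tY] .
  also have "Comp C (F1 (G1 X)) (F1 (G1 Y)) (F1 (H (G1 Y))) ?tY (\<Phi>1 (G1 X) (G1 Y) ?f)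
    = \<Phi>1 (G1 X) (H (G1 Y)) (Comp E (G1 X) (G1 Y) (H (G1 Y)) (t (G1 Y)) ?f)"
   using l1(4)[OF gX gY H[OF gY] f'] tin[OF gY] by (simp add: H_def)
  also have "\<dots> = \<Phi>1 (G1 X) (H (G1 Y)) (Comp E (G1 X) (H (G1 X)) (H (G1 Y)) (\<Theta> (G1 X) (G1 Y) ?f) (t (G1 X)))"
   using tnat[OF gX gY f'] by simp
  also have "\<dots> = Comp C (F1 (G1 X)) (F1 (H (G1 X))) (F1 (H (G1 Y))) ?h ?tX"
   using l1(4)[OF gX H[OF gX] H[OF gY] _ \<Theta>[OF gX gY f']] tin[OF gX] by (simp add: H_def)
  also have "Comp C X (F1 (G1 X)) (F1 (H (G1 Y))) \<dots> (\<eta>1 X) = Comp C X (F1 (H (G1 X))) (F1 (H (G1 Y))) ?h (\<eta> X)"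
   unfolding \<eta>_def using Comp_assoc[OF o(1) obs(1,3,4) n1h[OF o(1)] tX ph] by simp
  finally show "Comp C X Y (((F1 \<circ> G2) \<circ> (F2 \<circ> G1)) Y) (\<eta> Y) f = Comp C X (((F1 \<circ> G2) \<circ> (F2 \<circ> G1)) X)
    (((F1 \<circ> G2) \<circ> (F2 \<circ> G1)) Y) ?h (\<eta> X)" by (simp add: H_def)
 qed
 then show ?thesis unfolding H_def \<Theta>_def by blast
qed

lemma equivalent_categories_span:
 assumes C: "linear_category C" and D: "linear_category D" and hc: "homs_closed E"
  and F1: "linear_functor E C F1 \<Phi>1" "fully_faithful E C F1 \<Phi>1" "essentially_surjective E C F1"
  and F2: "linear_functor E D F2 \<Phi>2" "fully_faithful E D F2 \<Phi>2" "essentially_surjective E D F2"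
 shows "equivalent_categories C D"
proof -
 obtain G1 \<Psi>1 \<eta>1 where G1: "linear_functor C E G1 \<Psi>1"
  "natural_iso_from_id C (F1 \<circ> G1) (\<lambda>X Y f. \<Phi>1 (G1 X) (G1 Y) (\<Psi>1 X Y f)) \<eta>1"
  using quasi_inverse[OF C hc F1] .
 obtain G2 \<Psi>2 \<eta>2 where G2: "linear_functor D E G2 \<Psi>2"
  "natural_iso_from_id D (F2 \<circ> G2) (\<lambda>X Y f. \<Phi>2 (G2 X) (G2 Y) (\<Psi>2 X Y f)) \<eta>2"
  using quasi_inverse[OF D hc F2] .
 show ?thesis
  unfolding equivalent_categories_def
  using linear_functor_comp[OF G1(1) F2(1)] linear_functor_comp[OF G2(1) F1(1)]
   span_unit[OF C hc F1(1) G1 F2(1,2) G2] span_unit[OF D hc F2(1) G2 F1(1,2) G1]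
  by (simp only: o_def) blast
qed

section \<open>Coordinates on vector spaces\<close>

definition (in frame) coord :: "('k, 'b, 'z) module_scheme \<Rightarrow> ('b \<Rightarrow> 'r) \<Rightarrow> bool" where
 "coord V c \<longleftrightarrow> bij_betw c (carrier V) (col I U) \<and>
   (\<forall>x\<in>carrier V. \<forall>y\<in>carrier V. c (x \<oplus>\<^bsub>V\<^esub> y) = c x + c y) \<and>
   (\<forall>a. \<forall>x\<in>carrier V. c (a \<odot>\<^bsub>V\<^esub> x) = sc a (c x))"

lemma (in frame) u_inj: "inj_on u K"
proof (rule inj_onI)
 fix k l assume "k \<in> K" "l \<in> K" "u k = u l"
 then show "k = l" using v_u[of k k] v_u[of k l] U_nonzero by (metis (full_types))
qed

lemma (in frame) coord_dim:
 assumes V: "vectorspace class_ring V" and c: "coord V c"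
 shows "vectorspace.fin_dim class_ring V" "vectorspace.dim class_ring V = card K"
proof -
 interpret V: vectorspace class_ring V by (rule V)
 have bij: "bij_betw c (carrier V) (col I U)"
  and c_add: "\<And>x y. x \<in> carrier V ==> y \<in> carrier V ==> c (x \<oplus>\<^bsub>V\<^esub> y) = c x + c y"
  and c_sc: "\<And>a x. x \<in> carrier V ==> c (a \<odot>\<^bsub>V\<^esub> x) = sc a (c x)"
  using c unfolding coord_def by auto
 have c0: "c \<zero>\<^bsub>V\<^esub> = 0" using c_add[of "\<zero>\<^bsub>V\<^esub>" "\<zero>\<^bsub>V\<^esub>"] by simp
 have smc: "a \<odot>\<^bsub>V\<^esub> x \<in> carrier V" if "x \<in> carrier V" for a x
  using V.smult_closed[of a x] that by simp
 define b where "b k = inv_into (carrier V) c (u k)" for k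
 have cb: "c (b k) = u k" and bV: "b k \<in> carrier V" if "k \<in> K" for k
  using u_col[OF that] bij_betw_imp_surj_on[OF bij] unfolding b_def
  by (auto intro: f_inv_into_f inv_into_into)
 have b_inj: "inj_on b K" using u_inj cb by (metis inj_on_def)
 have clin: "c (\<Oplus>\<^bsub>V\<^esub>x\<in>A. a x \<odot>\<^bsub>V\<^esub> x) = (\<Sum>x\<in>A. sc (a x) (c x))" if "finite A" "A \<subseteq> carrier V" for A a
  using that
 proof (induction A rule: finite_induct)
  case empty show ?case by (simp add: c0)
 next
  case (insert x A)
  then have "(\<Oplus>\<^bsub>V\<^esub>x\<in>A. a x \<odot>\<^bsub>V\<^esub> x) \<in> carrier V" by (intro V.finsum_closed) (auto simp: smc)
  with insert show ?case
   by (subst V.finsum_insert) (auto simp: smc c_add c_sc)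
 qed
 have AV: "b ` K \<subseteq> carrier V" using bV by auto
 have lc: "c (V.lincomb a (b ` K)) = (\<Sum>k\<in>K. sc (a (b k)) (u k))" for a
 proof -
  have "c (V.lincomb a (b ` K)) = (\<Sum>x\<in>b ` K. sc (a x) (c x))"
   unfolding V.lincomb_def by (rule clin) (use AV in auto)
  also have "\<dots> = (\<Sum>k\<in>K. sc (a (b k)) (u k))"
   using b_inj cb by (simp add: sum.reindex)
  finally show ?thesis .
 qed
 have "V.basis (b ` K)"
  unfolding V.basis_criterion[OF finite_imageI[OF finite_K] AV]
 proof (intro allI impI)
  fix x assume x: "x \<in> carrier V"
  define a where "a = (\<lambda>y\<in>b ` K. cf (v (inv_into K b y) * c x))"
  have cx: "c x \<in> col I U" using bij x unfolding bij_betw_def by blast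
  have ab: "a (b k) = cf (v k * c x)" if "k \<in> K" for k using that b_inj by (simp add: a_def)
  have lcl: "V.lincomb a (b ` K) \<in> carrier V" for a by (rule V.lincomb_closed) (use AV in auto)
  have "c (V.lincomb a (b ` K)) = c x"
   unfolding lc using col_expand[OF cx] ab by simp
  then have 1: "V.lincomb a (b ` K) = x"
   using bij lcl x unfolding bij_betw_def inj_on_def by blast
  show "\<exists>!a. a \<in> b ` K \<rightarrow>\<^sub>E carrier class_ring \<and> V.lincomb a (b ` K) = x"
  proof (rule ex1I[of _ a])
   show "a \<in> b ` K \<rightarrow>\<^sub>E carrier class_ring \<and> V.lincomb a (b ` K) = x" using 1 by (simp add: a_def)
   fix a' assume a': "a' \<in> b ` K \<rightarrow>\<^sub>E carrier class_ring \<and> V.lincomb a' (b ` K) = x"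
   show "a' = a"
   proof (rule extensionalityI[of _ "b ` K"])
    fix y assume "y \<in> b ` K"
    then obtain k where k: "k \<in> K" "y = b k" by blast
    have "a' (b k) = cf (v k * (\<Sum>k\<in>K. sc (a' (b k)) (u k)))" by (rule cf_v_sum[symmetric]) (rule k)
    also have "\<dots> = cf (v k * c x)" using lc[of a'] a' by simp
    finally show "a' y = a y" using ab k by simp
   qed (use a' in \<open>auto simp: a_def PiE_def\<close>)
  qed
 qed
 then have bb: "V.basis (b ` K)" .
 then show "vectorspace.fin_dim class_ring V"
  unfolding V.fin_dim_def V.basis_def using finite_imageI[OF finite_K] by blast
 show "vectorspace.dim class_ring V = card K"
  using V.dim_basis[OF finite_imageI[OF finite_K] bb] card_image[OF b_inj] by simp
qed

lemma col1_iff: "x \<in> col (idn {..<n}) U1 \<longleftrightarrow> (\<forall>i j. ent x i j \<noteq> 0 \<longrightarrow> i < n \<and> j = 0)"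
proof
 assume x: "x \<in> col (idn {..<n}) U1"
 then show "\<forall>i j. ent x i j \<noteq> 0 \<longrightarrow> i < n \<and> j = 0"
  by (metis colD ent_idn_times ent_times_eunit U1_def finite_lessThan lessThan_iff)
next
 assume *: "\<forall>i j. ent x i j \<noteq> 0 \<longrightarrow> i < n \<and> j = 0"
 show "x \<in> col (idn {..<n}) U1"
  by (rule colI; rule fmat_eqI) (use * in \<open>auto simp: ent_idn_times U1_def ent_times_eunit\<close>)
qed

lemma coordinates_exist:
 fixes V :: "('k::field, 'b, 'z) module_scheme"
 assumes V: "vectorspace class_ring V" and fd: "vectorspace.fin_dim class_ring V"
 shows "\<exists>c. frame.coord sc1 (idn {..<vectorspace.dim class_ring V}) U1 V c"
proof -
 interpret V: vectorspace class_ring V by (rule V)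
 define n where "n = V.dim"
 interpret frame sc1 "idn {..<n}" U1 "{..<n}" "\<lambda>k. eunit k 0 (1::'k)" "\<lambda>k. eunit 0 k 1" by (rule frame1) simp
 obtain B where B: "finite B" "V.basis B" using V.finite_basis_exists[OF fd] by blast
 have BV: "B \<subseteq> carrier V" using B unfolding V.basis_def by blast
 have "card B = n" using V.dim_basis[OF B] by (simp add: n_def)
 then obtain h where h: "bij_betw h {..<n} B"
  using ex_bij_betw_nat_finite[OF B(1)] by (auto simp: atLeast0LessThan)
 have ex1: "\<exists>!a. a \<in> B \<rightarrow>\<^sub>E UNIV \<and> V.lincomb a B = x" if "x \<in> carrier V" for x
  using V.basis_criterion[OF B(1) BV] B(2) that by simp
 define a where "a x = (THE a. a \<in> B \<rightarrow>\<^sub>E UNIV \<and> V.lincomb a B = x)" for x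
 have aB: "a x \<in> B \<rightarrow>\<^sub>E UNIV" and ax: "V.lincomb (a x) B = x" if "x \<in> carrier V" for x
  using theI'[OF ex1[OF that]] unfolding a_def by auto
 have lccong: "V.lincomb (restrict f B) B = V.lincomb f B" for f
  by (rule V.lincomb_cong[OF refl BV]) auto
 have lccl: "V.lincomb f B \<in> carrier V" for f by (rule V.lincomb_closed) (use BV in auto)
 have aI: "a (V.lincomb f B) = restrict f B" for f
  unfolding a_def by (rule the1_equality[OF ex1]) (use lccl lccong in auto)
 have a_add: "a (x \<oplus>\<^bsub>V\<^esub> y) = (\<lambda>v\<in>B. a x v + a y v)" if "x \<in> carrier V" "y \<in> carrier V" for x y
 proof -
  have "V.lincomb (\<lambda>v. a x v + a y v) B = V.lincomb (a x) B \<oplus>\<^bsub>V\<^esub> V.lincomb (a y) B"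
   using V.lincomb_sum[OF B(1) BV, of "a x" "a y"] by simp
  then show ?thesis using aI[of "\<lambda>v. a x v + a y v"] ax that by simp
 qed
 have a_sc: "a (d \<odot>\<^bsub>V\<^esub> x) = (\<lambda>v\<in>B. d * a x v)" if "x \<in> carrier V" for d x
 proof -
  have "V.lincomb (\<lambda>v. d * a x v) B = d \<odot>\<^bsub>V\<^esub> V.lincomb (a x) B"
   using V.lincomb_smult[OF BV, of "a x" d] by simp
  then show ?thesis using aI[of "\<lambda>v. d * a x v"] ax that by simp
 qed
 define c where "c x = (\<Sum>p<n. eunit p 0 (a x (h p)))" for x
 have ent_c: "ent (c x) i j = (if i < n \<and> j = 0 then a x (h i) else 0)" for x i j
  unfolding c_def by (cases "j = 0") auto
 have hB: "h i \<in> B" if "i < n" for i using h that unfolding bij_betw_def by blast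
 have hinv: "\<exists>i<n. y = h i" if "y \<in> B" for y using h that unfolding bij_betw_def by auto
 have "coord V c"
  unfolding coord_def
 proof (intro conjI ballI allI)
  show "bij_betw c (carrier V) (col (idn {..<n}) U1)"
  proof (rule bij_betw_imageI)
   show "inj_on c (carrier V)"
   proof (rule inj_onI)
    fix x y assume xy: "x \<in> carrier V" "y \<in> carrier V" "c x = c y"
    have "a x = a y"
    proof (rule extensionalityI[of _ B])
     fix z assume "z \<in> B"
     then obtain i where i: "i < n" "z = h i" using hinv by blast
     show "a x z = a y z" using arg_cong[OF xy(3), of "\<lambda>m. ent m i 0"] i by (simp add: ent_c)
    qed (use aB xy in \<open>auto simp: PiE_def\<close>)
    then show "x = y" using ax xy by metis
   qed
   show "c ` carrier V = col (idn {..<n}) U1"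
   proof (intro equalityI subsetI)
    fix z assume "z \<in> c ` carrier V"
    then show "z \<in> col (idn {..<n}) U1" by (auto simp: col1_iff ent_c split: if_splits)
   next
    fix z assume z: "z \<in> col (idn {..<n}) (U1 :: 'k fmat)"
    define f where "f y = ent z (inv_into {..<n} h y) 0" for y
    have "c (V.lincomb f B) = z"
    proof (rule fmat_eqI)
     fix i j
     show "ent (c (V.lincomb f B)) i j = ent z i j"
      using z hB bij_betw_inv_into_left[OF h] unfolding ent_c aI col1_iff by (auto simp: f_def)
    qed
    then show "z \<in> c ` carrier V" using lccl by blast
   qed
  qed
 next
  fix x y assume "x \<in> carrier V" "y \<in> carrier V"
  then show "c (x \<oplus>\<^bsub>V\<^esub> y) = c x + c y"
   by (intro fmat_eqI) (simp add: ent_c a_add hB)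
 next
  fix d x assume "x \<in> carrier V"
  then show "c (d \<odot>\<^bsub>V\<^esub> x) = sc1 d (c x)"
   by (intro fmat_eqI) (simp add: ent_c a_sc hB)
 qed
 then show ?thesis unfolding n_def by blast
qed

text \<open>A module structure carried along an injection of a set of matrices into another type.\<close>

definition cvec :: "('r::ring \<Rightarrow> 'b) \<Rightarrow> 'r set \<Rightarrow> ('a \<Rightarrow> 'r \<Rightarrow> 'r) \<Rightarrow> ('a, 'b) module" where
 "cvec \<iota> C act = \<lparr>carrier = \<iota> ` C, mult = (\<lambda>_ _. \<iota> 0), one = \<iota> 0, zero = \<iota> 0,
   add = (\<lambda>y z. \<iota> (inv_into C \<iota> y + inv_into C \<iota> z)), smult = (\<lambda>a y. \<iota> (act a (inv_into C \<iota> y)))\<rparr>"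

lemma cvec_simps:
 "carrier (cvec \<iota> C act) = \<iota> ` C" "zero (cvec \<iota> C act) = \<iota> 0"
 "[|inj_on \<iota> C; x \<in> C; y \<in> C|] ==> \<iota> x \<oplus>\<^bsub>cvec \<iota> C act\<^esub> \<iota> y = \<iota> (x + y)"
 "[|inj_on \<iota> C; x \<in> C|] ==> a \<odot>\<^bsub>cvec \<iota> C act\<^esub> \<iota> x = \<iota> (act a x)"
 by (simp_all add: cvec_def)

lemma cvec_abelian_group:
 assumes "inj_on \<iota> (col I U)"
 shows "abelian_group (cvec \<iota> (col I U) act)"
proof (rule abelian_groupI)
 fix x assume "x \<in> carrier (cvec \<iota> (col I U) act)"
 then obtain y where y: "x = \<iota> y" "y \<in> col I U" by (auto simp: cvec_simps)
 show "\<exists>z\<in>carrier (cvec \<iota> (col I U) act). z \<oplus>\<^bsub>cvec \<iota> (col I U) act\<^esub> x = \<zero>\<^bsub>cvec \<iota> (col I U) act\<^esub>"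
  by (rule bexI[of _ "\<iota> (- y)"]) (use y assms col_uminus[OF y(2)] in \<open>auto simp: cvec_simps\<close>)
qed (use assms in \<open>auto simp: cvec_simps col_add add.assoc add.commute add.left_commute\<close>)

lemma (in scalars) cvec_vectorspace:
 assumes "inj_on \<iota> (col I U)"
 shows "vectorspace class_ring (cvec \<iota> (col I U) sc)"
proof -
 have "module_axioms class_ring (cvec \<iota> (col I U) sc)"
  by unfold_locales
   (use assms in \<open>auto simp: cvec_simps col_sc col_add sc_add_left sc_add_right sc_sc\<close>)
 with cvec_abelian_group[OF assms] show ?thesis
  unfolding vectorspace_def Module.module_def using class_cring.is_cring class_field by blast
qed

lemma (in frame) cvec_coord:
 assumes "inj_on \<iota> (col I U)"
 shows "coord (cvec \<iota> (col I U) sc) (inv_into (col I U) \<iota>)"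
 unfolding coord_def using assms
 by (auto simp: cvec_simps col_sc col_add intro: bij_betw_inv_into inj_on_imp_bij_betw)

lemmas (in frame) cvec_fin_dim = coord_dim(1)[OF cvec_vectorspace cvec_coord]

text \<open>An infinite field is in bijection with its plane, so tuples of scalars can be coded by scalars.\<close>

lemma tuples_inject:
 fixes K :: "'i set"
 assumes K: "finite K" and inf: "infinite (UNIV :: 'k set)"
 shows "\<exists>g :: ('i \<Rightarrow> 'k) \<Rightarrow> 'k. \<forall>z z'. g z = g z' \<longrightarrow> (\<forall>k\<in>K. z k = z' k)"
 using K
proof (induction K rule: finite_induct)
 case empty show ?case by simp
next
 case (insert k K)
 then obtain g :: "('i \<Rightarrow> 'k) \<Rightarrow> 'k" where g: "\<forall>z z'. g z = g z' \<longrightarrow> (\<forall>k\<in>K. z k = z' k)" by blast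
 obtain e where e: "bij_betw e ((UNIV :: 'k set) \<times> (UNIV :: 'k set)) (UNIV :: 'k set)"
  using card_of_ordIso[THEN iffD2, OF card_of_Times_same_infinite[OF inf]] by blast
 then have einj: "inj e" by (simp add: bij_betw_def)
 show ?case
  by (rule exI[of _ "\<lambda>z. e (z k, g z)"]) (use g einj in \<open>auto dest!: injD\<close>)
qed

lemma infinite_alg_closed_field: "infinite (UNIV :: 'k::alg_closed_field set)"
proof
 assume fin: "finite (UNIV :: 'k set)"
 define p :: "'k poly" where "p = (\<Prod>a\<in>UNIV. [:- a, 1:]) + 1"
 have val: "poly p x = 1" for x
 proof -
  have "(\<Prod>a\<in>UNIV. poly [:- a, 1:] x) = 0"
   by (rule prod_zero) (use fin in \<open>auto intro: bexI[of _ x]\<close>)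
  then show ?thesis by (simp add: p_def poly_prod)
 qed
 have "degree (\<Prod>a\<in>UNIV. [:- a, 1 :: 'k:]) = card (UNIV :: 'k set)"
  by (subst degree_prod_eq_sum_degree) auto
 moreover have "card (UNIV :: 'k set) > 0" using fin by (simp add: card_gt_0_iff)
 ultimately have "degree p > 0" unfolding p_def by (subst degree_add_eq_left) auto
 then obtain x where "poly p x = 0" using alg_closed_imp_poly_has_root by blast
 with val[of x] show False by simp
qed

text \<open>This is how modules constructed from matrices are carried by a type that only has to contain a copy
of the field: a vector is determined by finitely many scalars, and these are coded by one scalar.\<close>

lemma (in frame) col_inject:
 assumes inf: "infinite (UNIV :: 'k set)" and f: "inj (f :: 'k \<Rightarrow> 'b)"
 shows "\<exists>\<iota> :: 'r \<Rightarrow> 'b. inj_on \<iota> (col I U)"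
proof -
 obtain g :: "('i \<Rightarrow> 'k) \<Rightarrow> 'k" where g: "\<forall>z z'. g z = g z' \<longrightarrow> (\<forall>k\<in>K. z k = z' k)"
  using tuples_inject[OF finite_K inf] by blast
 show ?thesis
 proof (rule exI[of _ "\<lambda>x. f (g (\<lambda>k. cf (v k * x)))"], rule inj_onI)
  fix x y assume x: "x \<in> col I U" and y: "y \<in> col I U"
   and e: "f (g (\<lambda>k. cf (v k * x))) = f (g (\<lambda>k. cf (v k * y)))"
  then have "\<forall>k\<in>K. cf (v k * x) = cf (v k * y)" using injD[OF f] g by meson
  then have "(\<Sum>k\<in>K. sc (cf (v k * x)) (u k)) = (\<Sum>k\<in>K. sc (cf (v k * y)) (u k))" by simp
  then show "x = y" using col_expand[OF x] col_expand[OF y] by simp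
 qed
qed

lemma frame_card:
 assumes "frame sc I U (K :: 'i set) u v" "frame sc I U (K' :: 'j set) u' v'"

 shows "card K = card K'"
proof -
 interpret a: frame sc I U K u v by (rule assms(1))
 interpret b: frame sc I U K' u' v' by (rule assms(2))
 have i: "inj_on id (col I U)" by simp
 have cb: "b.coord (cvec id (col I U) sc) (inv_into (col I U) id)"
  using a.cvec_coord[OF i] unfolding a.coord_def b.coord_def .
 show ?thesis
  using a.coord_dim(2)[OF a.cvec_vectorspace[OF i] a.cvec_coord[OF i]]
   b.coord_dim(2)[OF a.cvec_vectorspace[OF i] cb] by simp
qed

section \<open>Composition series\<close>

context left_module
begin

lemma zero_smult: "x \<in> carrier M ==> \<zero> \<odot>\<^bsub>M\<^esub> x = \<zero>\<^bsub>M\<^esub>"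
 using smult_l_distr[of "\<zero>" "\<zero>" x] smult_closed[of "\<zero>" x] by simp

lemma smult_zero: "a \<in> carrier R ==> a \<odot>\<^bsub>M\<^esub> \<zero>\<^bsub>M\<^esub> = \<zero>\<^bsub>M\<^esub>"
 using smult_r_distr[of a "\<zero>\<^bsub>M\<^esub>" "\<zero>\<^bsub>M\<^esub>"] smult_closed[of a "\<zero>\<^bsub>M\<^esub>"] by simp

lemma minus_one_smult: "x \<in> carrier M ==> (\<ominus> \<one>) \<odot>\<^bsub>M\<^esub> x = \<ominus>\<^bsub>M\<^esub> x"
 using smult_l_distr[of "\<ominus> \<one>" "\<one>" x] smult_closed[of "\<ominus> \<one>" x]
 by (intro M.minus_equality[symmetric]) (simp_all add: smult_one zero_smult R.l_neg)

lemma smult_minus: "a \<in> carrier R ==> x \<in> carrier M ==> a \<odot>\<^bsub>M\<^esub> (\<ominus>\<^bsub>M\<^esub> x) = \<ominus>\<^bsub>M\<^esub> (a \<odot>\<^bsub>M\<^esub> x)"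
 using smult_r_distr[of a "\<ominus>\<^bsub>M\<^esub> x" x] smult_closed[of a]
 by (intro M.minus_equality[symmetric]) (simp_all add: M.l_neg smult_zero)

lemma submoduleI:
 assumes "H \<subseteq> carrier M" "\<zero>\<^bsub>M\<^esub> \<in> H" "\<And>x y. x \<in> H ==> y \<in> H ==> x \<oplus>\<^bsub>M\<^esub> y \<in> H"
  "\<And>a x. a \<in> carrier R ==> x \<in> H ==> a \<odot>\<^bsub>M\<^esub> x \<in> H"
 shows "Module.submodule H R M"
proof -
 have "\<ominus>\<^bsub>M\<^esub> x \<in> H" if "x \<in> H" for x
  using assms(4)[of "\<ominus> \<one>" x] minus_one_smult[of x] that assms(1) by auto
 then show ?thesis
  by (intro Module.submodule.intro subgroup.intro Module.submodule_axioms.intro)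
   (use assms in \<open>auto simp: a_inv_def[symmetric]\<close>)
qed

lemma submoduleD:
 assumes "Module.submodule H R M"
 shows "H \<subseteq> carrier M" "\<zero>\<^bsub>M\<^esub> \<in> H" "x \<in> H ==> y \<in> H ==> x \<oplus>\<^bsub>M\<^esub> y \<in> H"
  "a \<in> carrier R ==> x \<in> H ==> a \<odot>\<^bsub>M\<^esub> x \<in> H" "x \<in> H ==> \<ominus>\<^bsub>M\<^esub> x \<in> H"
  "x \<in> H ==> y \<in> H ==> x \<ominus>\<^bsub>M\<^esub> y \<in> H" "abelian_subgroup H M"
proof -
 interpret H: Module.submodule H R M by (rule assms)
 show 1: "H \<subseteq> carrier M" "\<zero>\<^bsub>M\<^esub> \<in> H" "x \<in> H ==> y \<in> H ==> x \<oplus>\<^bsub>M\<^esub> y \<in> H" for x y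
  using H.subset H.one_closed H.m_closed by auto
 show 2: "x \<in> H ==> \<ominus>\<^bsub>M\<^esub> x \<in> H" for x
  using H.m_inv_closed by (simp add: a_inv_def)
 show "x \<in> H ==> y \<in> H ==> x \<ominus>\<^bsub>M\<^esub> y \<in> H"
  unfolding a_minus_def using 1 2 by blast
 show "a \<in> carrier R ==> x \<in> H ==> a \<odot>\<^bsub>M\<^esub> x \<in> H" by simp
 show "abelian_subgroup H M"
  by (rule abelian_subgroupI3[OF additive_subgroup.intro[OF H.subgroup_axioms] M.abelian_group_axioms])
qed

lemma carrier_submodule: "Module.submodule (carrier M) R M"
 by (rule submoduleI) (auto simp: smult_closed)

lemma zero_submodule: "Module.submodule {\<zero>\<^bsub>M\<^esub>} R M"
 by (rule submoduleI) (auto simp: smult_zero)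

lemma minus_zero: "\<ominus>\<^bsub>M\<^esub> \<zero>\<^bsub>M\<^esub> = \<zero>\<^bsub>M\<^esub>"
 by (rule M.minus_equality) auto

lemma cancel_minus: "x \<in> carrier M ==> y \<in> carrier M ==> (x \<ominus>\<^bsub>M\<^esub> y) \<oplus>\<^bsub>M\<^esub> y = x"
 by (simp add: a_minus_def M.a_assoc M.l_neg)

lemma coset_eq_iff:
 assumes H: "Module.submodule H R M" and x: "x \<in> carrier M" and y: "y \<in> carrier M"
 shows "H +>\<^bsub>M\<^esub> x = H +>\<^bsub>M\<^esub> y \<longleftrightarrow> x \<ominus>\<^bsub>M\<^esub> y \<in> H"
proof -
 interpret H: abelian_subgroup H M by (rule submoduleD(7)[OF H])
 show ?thesis
 proof
  assume "H +>\<^bsub>M\<^esub> x = H +>\<^bsub>M\<^esub> y"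
  then have "x \<in> H +>\<^bsub>M\<^esub> y" using H.a_rcos_self[OF x] by simp
  then obtain h where h: "h \<in> H" "x = h \<oplus>\<^bsub>M\<^esub> y" by (auto simp: a_r_coset_def')
  then have "x \<ominus>\<^bsub>M\<^esub> y = h" using submoduleD(1)[OF H] y
   by (auto simp: a_minus_def M.a_assoc M.r_neg)
  with h show "x \<ominus>\<^bsub>M\<^esub> y \<in> H" by simp
 next
  assume d: "x \<ominus>\<^bsub>M\<^esub> y \<in> H"
  have "x \<in> H +>\<^bsub>M\<^esub> y" unfolding a_r_coset_def' using d cancel_minus[OF x y] by force
  then show "H +>\<^bsub>M\<^esub> x = H +>\<^bsub>M\<^esub> y" using H.a_repr_independence' y by metis
 qed
qed

end

locale plain_left_module = left_module R M
 for R :: "('a, 'm) ring_scheme" (structure) and M :: "('a, 'v) module" (structure)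

locale subquotient = plain_left_module +
 fixes H H'
 assumes H: "Module.submodule H R M" and H': "Module.submodule H' R M" and HH': "H \<subseteq> H'"
begin

abbreviation "Q \<equiv> quotient_module (M\<lparr>carrier := H'\<rparr>) H"
abbreviation "cls x \<equiv> H +>\<^bsub>M\<^esub> x"

interpretation Hs: abelian_subgroup H M by (rule submoduleD(7)[OF H])

lemma H'_carrier: "x \<in> H' ==> x \<in> carrier M" using submoduleD(1)[OF H'] by blast

lemma H_carrier: "x \<in> H ==> x \<in> carrier M" using submoduleD(1)[OF H] by blast

lemma Q_carrier: "carrier Q = cls ` H'"
 by (auto simp: quotient_module_def A_RCOSETS_def' a_r_coset_def')

lemma Q_zero: "zero Q = cls \<zero>\<^bsub>M\<^esub>"
 using M.a_coset_join2[OF M.zero_closed _ submoduleD(2)[OF H]] Hs.a_subgroup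
 by (simp add: quotient_module_def)

lemma Q_add: "x \<in> H' ==> y \<in> H' ==> cls x \<oplus>\<^bsub>Q\<^esub> cls y = cls (x \<oplus>\<^bsub>M\<^esub> y)"
proof -
 assume "x \<in> H'" "y \<in> H'"
 then have "cls x <+>\<^bsub>M\<^esub> cls y = cls (x \<oplus>\<^bsub>M\<^esub> y)" by (intro Hs.a_rcos_sum H'_carrier)
 moreover have "add Q = set_add M" by (simp add: quotient_module_def set_add_def set_mult_def fun_eq_iff)
 ultimately show ?thesis by simp
qed

lemma Q_smult:
 assumes a: "a \<in> carrier R" and x: "x \<in> H'"
 shows "a \<odot>\<^bsub>Q\<^esub> cls x = cls (a \<odot>\<^bsub>M\<^esub> x)"
proof -
 have xM: "x \<in> carrier M" using x by (rule H'_carrier)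
 have "cls (a \<odot>\<^bsub>M\<^esub> y) = cls (a \<odot>\<^bsub>M\<^esub> x)" if y: "y \<in> cls x" for y
 proof -
  obtain h where h: "h \<in> H" "y = h \<oplus>\<^bsub>M\<^esub> x" using y by (auto simp: a_r_coset_def')
  have hM: "h \<in> carrier M" using h H_carrier by blast
  have "a \<odot>\<^bsub>M\<^esub> y \<ominus>\<^bsub>M\<^esub> a \<odot>\<^bsub>M\<^esub> x = a \<odot>\<^bsub>M\<^esub> h"
   using a xM hM smult_closed[OF a] by (simp add: h smult_r_distr a_minus_def M.a_assoc M.r_neg)
  then show ?thesis
   using coset_eq_iff[OF H] smult_closed[OF a] xM hM submoduleD(4)[OF H a h(1)] h(2) by simp
 qed
 moreover have "x \<in> cls x" by (rule Hs.a_rcos_self[OF xM])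
 ultimately have "(\<Union>y\<in>cls x. cls (a \<odot>\<^bsub>M\<^esub> y)) = cls (a \<odot>\<^bsub>M\<^esub> x)" by blast
 then show ?thesis by (simp add: quotient_module_def a_r_coset_def')
qed

lemma cls_eq_iff: "x \<in> H' ==> y \<in> H' ==> cls x = cls y \<longleftrightarrow> x \<ominus>\<^bsub>M\<^esub> y \<in> H"
 by (intro coset_eq_iff[OF H] H'_carrier)

lemma cls_zero_iff: "x \<in> H' ==> cls x = zero Q \<longleftrightarrow> x \<in> H"
 unfolding Q_zero using cls_eq_iff[of x "\<zero>\<^bsub>M\<^esub>"] submoduleD(2)[OF H'] H'_carrier[of x]
 by (simp add: a_minus_def minus_zero)

lemma Q_left_module: "left_module R Q"
proof -
 note h = submoduleD[OF H']
 have "abelian_group Q"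
 proof (rule abelian_groupI)
  fix X assume "X \<in> carrier Q"
  then obtain x where x: "x \<in> H'" "X = cls x" by (auto simp: Q_carrier)
  show "\<exists>Y\<in>carrier Q. Y \<oplus>\<^bsub>Q\<^esub> X = \<zero>\<^bsub>Q\<^esub>"
   by (rule bexI[of _ "cls (\<ominus>\<^bsub>M\<^esub> x)"])
    (use x h(5) H'_carrier in \<open>auto simp: Q_carrier Q_add Q_zero M.l_neg\<close>)
 qed (use h H'_carrier in \<open>auto simp: Q_carrier Q_add Q_zero M.a_ac\<close>)
 moreover have "left_module_axioms R Q"
  by unfold_locales
   (use h H'_carrier in \<open>auto simp: Q_carrier Q_add Q_smult smult_l_distr smult_r_distr smult_assoc smult_one\<close>)
 ultimately show ?thesis unfolding left_module_def using R.ring_axioms by blast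
qed

lemma cls_submodule:
 assumes L: "Module.submodule L R M" and "L \<subseteq> H'"
 shows "Module.submodule (cls ` L) R Q"
 by (rule left_module.submoduleI[OF Q_left_module])
  (use submoduleD[OF L] assms(2) in \<open>auto simp: Q_carrier Q_zero Q_add[OF subsetD subsetD] Q_smult[OF _ subsetD]\<close>)

lemma preimage_submodule:
 assumes L: "Module.submodule L R Q"
 shows "Module.submodule {x\<in>H'. cls x \<in> L} R M"
proof -
 interpret q: left_module R Q by (rule Q_left_module)
 note h = submoduleD[OF H'] and l = q.submoduleD[OF L]
 show ?thesis
 proof (rule submoduleI)
  show "\<zero>\<^bsub>M\<^esub> \<in> {x\<in>H'. cls x \<in> L}" using h(2) l(2) by (simp add: Q_zero)
 qed (use h l H'_carrier in \<open>auto simp: Q_add[symmetric] Q_smult[symmetric]\<close>)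
qed

text \<open>Submodules of the quotient correspond to the submodules between \<open>H\<close> and \<open>H'\<close>.\<close>

lemma simple_iff:
 "simple_module R Q \<longleftrightarrow> H \<noteq> H' \<and> (\<forall>L. Module.submodule L R M \<longrightarrow> H \<subseteq> L \<longrightarrow> L \<subseteq> H' \<longrightarrow> L = H \<or> L = H')"
proof
 assume s: "simple_module R Q"
 have "H \<noteq> H'"
 proof
  assume "H = H'"
  then have "cls x = \<zero>\<^bsub>Q\<^esub>" if "x \<in> H'" for x using cls_zero_iff[OF that] that by simp
  then have "carrier Q = {\<zero>\<^bsub>Q\<^esub>}" unfolding Q_carrier using submoduleD(2)[OF H'] by force
  with s show False unfolding simple_module_def by blast
 qed
 moreover have "L = H \<or> L = H'" if L: "Module.submodule L R M" "H \<subseteq> L" "L \<subseteq> H'" for L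
 proof -
  have "cls ` L = {\<zero>\<^bsub>Q\<^esub>} \<or> cls ` L = carrier Q"
   using s cls_submodule[OF L(1,3)] unfolding simple_module_def by blast
  then show ?thesis
  proof
   assume "cls ` L = {\<zero>\<^bsub>Q\<^esub>}"
   then have "x \<in> H" if "x \<in> L" for x using cls_zero_iff[of x] that L(3) by blast
   with L(2) show ?thesis by blast
  next
   assume e: "cls ` L = carrier Q"
   have "x \<in> L" if x: "x \<in> H'" for x
   proof -
    have "cls x \<in> cls ` L" using x e by (auto simp: Q_carrier)
    then obtain y where y: "y \<in> L" "cls x = cls y" by auto
    then have "x \<ominus>\<^bsub>M\<^esub> y \<in> L" using cls_eq_iff[OF x] L by blast
    then have "(x \<ominus>\<^bsub>M\<^esub> y) \<oplus>\<^bsub>M\<^esub> y \<in> L" using submoduleD(3)[OF L(1)] y by blast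
    then show ?thesis using cancel_minus H'_carrier x y L by (metis subsetD)
   qed
   with L(3) show ?thesis by blast
  qed
 qed
 ultimately show "H \<noteq> H' \<and> (\<forall>L. Module.submodule L R M \<longrightarrow> H \<subseteq> L \<longrightarrow> L \<subseteq> H' \<longrightarrow> L = H \<or> L = H')" by blast
next
 assume *: "H \<noteq> H' \<and> (\<forall>L. Module.submodule L R M \<longrightarrow> H \<subseteq> L \<longrightarrow> L \<subseteq> H' \<longrightarrow> L = H \<or> L = H')"
 show "simple_module R Q"
  unfolding simple_module_def
 proof (intro conjI allI impI)
  show "left_module R Q" by (rule Q_left_module)
  obtain x where "x \<in> H'" "x \<notin> H" using * HH' by blast
  then show "carrier Q \<noteq> {\<zero>\<^bsub>Q\<^esub>}" using cls_zero_iff[of x] by (auto simp: Q_carrier)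
  fix L assume L: "Module.submodule L R Q"
  interpret q: left_module R Q by (rule Q_left_module)
  let ?L = "{x\<in>H'. cls x \<in> L}"
  have "H \<subseteq> ?L"
  proof
   fix x assume x: "x \<in> H"
   then have "cls x = \<zero>\<^bsub>Q\<^esub>" using cls_zero_iff HH' by blast
   then show "x \<in> ?L" using q.submoduleD(2)[OF L] x HH' by auto
  qed
  then have "?L = H \<or> ?L = H'" using * preimage_submodule[OF L] by auto
  moreover have "cls ` ?L = L" using q.submoduleD(1)[OF L] by (auto simp: Q_carrier)
  moreover have "cls ` H = {\<zero>\<^bsub>Q\<^esub>}"
  proof -
   have "cls x = \<zero>\<^bsub>Q\<^esub>" if "x \<in> H" for x using cls_zero_iff[of x] HH' that by blast
   then have "cls ` H = (\<lambda>_. \<zero>\<^bsub>Q\<^esub>) ` H" by (rule image_cong[OF refl])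
   then show ?thesis by (simp add: image_constant[OF submoduleD(2)[OF H]])
  qed
  ultimately show "L = {\<zero>\<^bsub>Q\<^esub>} \<or> L = carrier Q"
   by (elim disjE) (simp_all add: Q_carrier)
 qed
qed

lemma isomorphicI:
 assumes cl: "\<And>x. x \<in> H' ==> \<theta> x \<in> carrier S"
  and add: "\<And>x y. x \<in> H' ==> y \<in> H' ==> \<theta> (x \<oplus>\<^bsub>M\<^esub> y) = \<theta> x \<oplus>\<^bsub>S\<^esub> \<theta> y"
  and sm: "\<And>a x. a \<in> carrier R ==> x \<in> H' ==> \<theta> (a \<odot>\<^bsub>M\<^esub> x) = a \<odot>\<^bsub>S\<^esub> \<theta> x"
  and surj: "\<And>y. y \<in> carrier S ==> \<exists>x\<in>H'. \<theta> x = y"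
  and ker: "\<And>x y. x \<in> H' ==> y \<in> H' ==> \<theta> x = \<theta> y \<longleftrightarrow> x \<ominus>\<^bsub>M\<^esub> y \<in> H"
 shows "isomorphic_modules R Q S"
proof -
 define f where "f X = \<theta> (SOME x. x \<in> H' \<and> cls x = X)" for X
 have f: "f (cls x) = \<theta> x" if x: "x \<in> H'" for x
 proof -
  let ?y = "SOME y. y \<in> H' \<and> cls y = cls x"
  have y: "?y \<in> H' \<and> cls ?y = cls x" by (rule someI[of _ x]) (use x in auto)
  then show ?thesis unfolding f_def using ker[of ?y x] cls_eq_iff[of ?y x] x by blast
 qed
 note h = submoduleD[OF H']
 have "f \<in> module_hom R Q S"
  unfolding LinearCombinations.module_hom_def
  using h by (auto simp: Q_carrier f cl add sm Q_add Q_smult)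
 moreover have "bij_betw f (carrier Q) (carrier S)"
 proof (rule bij_betw_imageI)
  show "inj_on f (carrier Q)" unfolding Q_carrier
  proof (rule inj_onI)
   fix X Y assume "X \<in> cls ` H'" "Y \<in> cls ` H'" "f X = f Y"
   then obtain x y where "x \<in> H'" "y \<in> H'" "X = cls x" "Y = cls y" "f (cls x) = f (cls y)" by auto
   then show "X = Y" using f[of x] f[of y] ker[of x y] cls_eq_iff[of x y] by simp
  qed
  show "f ` carrier Q = carrier S" unfolding Q_carrier image_image
   using f cl surj by (force simp: image_iff)
 qed
 ultimately show ?thesis unfolding isomorphic_modules_def by blast
qed

lemma isomorphicE:
 assumes "isomorphic_modules R Q S"
 obtains \<theta> where "\<And>x. x \<in> H' ==> \<theta> x \<in> carrier S"
  "\<And>x y. x \<in> H' ==> y \<in> H' ==> \<theta> (x \<oplus>\<^bsub>M\<^esub> y) = \<theta> x \<oplus>\<^bsub>S\<^esub> \<theta> y"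
  "\<And>a x. a \<in> carrier R ==> x \<in> H' ==> \<theta> (a \<odot>\<^bsub>M\<^esub> x) = a \<odot>\<^bsub>S\<^esub> \<theta> x"
  "\<And>y. y \<in> carrier S ==> \<exists>x\<in>H'. \<theta> x = y"
  "\<And>x y. x \<in> H' ==> y \<in> H' ==> \<theta> x = \<theta> y \<longleftrightarrow> x \<ominus>\<^bsub>M\<^esub> y \<in> H"
proof -
 obtain f where f: "f \<in> module_hom R Q S" and b: "bij_betw f (carrier Q) (carrier S)"
  using assms unfolding isomorphic_modules_def by blast
 have f': "X \<in> carrier Q ==> f X \<in> carrier S"
  "X \<in> carrier Q ==> Y \<in> carrier Q ==> f (X \<oplus>\<^bsub>Q\<^esub> Y) = f X \<oplus>\<^bsub>S\<^esub> f Y"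
  "a \<in> carrier R ==> X \<in> carrier Q ==> f (a \<odot>\<^bsub>Q\<^esub> X) = a \<odot>\<^bsub>S\<^esub> f X" for X Y a
  using f unfolding LinearCombinations.module_hom_def by auto
 have c: "cls x \<in> carrier Q" if "x \<in> H'" for x using that by (simp add: Q_carrier)
 show ?thesis
 proof (rule that[of "\<lambda>x. f (cls x)"])
  show "\<exists>x\<in>H'. f (cls x) = y" if "y \<in> carrier S" for y
  proof -
   have "carrier S = f ` cls ` H'" using b unfolding bij_betw_def Q_carrier by simp
   with that show ?thesis by auto
  qed
  show "f (cls x) = f (cls y) \<longleftrightarrow> x \<ominus>\<^bsub>M\<^esub> y \<in> H" if "x \<in> H'" "y \<in> H'" for x y
   using inj_on_eq_iff[OF bij_betw_imp_inj_on[OF b] c[OF that(1)] c[OF that(2)]] cls_eq_iff[OF that] by simp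
 qed (use f' c in \<open>auto simp: Q_add[symmetric] Q_smult[symmetric]\<close>)
qed

end

text \<open>The half of the Jordan-Hoelder theorem that is needed to see that a module with a given filtration is in
the wide subcategory. Let \<open>H \<subset> H'\<close> be a step of a composition series and \<open>k + 1\<close> the least index for
which \<open>H' \<inter> F (k + 1)\<close> is not contained in \<open>H\<close>. On this intersection both the quotient map to \<open>H' / H\<close>
and the map \<open>\<theta> k\<close> are onto, because their targets are simple, and they have the same kernel.\<close>

lemma (in plain_left_module) factor_of_filtered:
 assumes F0: "F 0 = {\<zero>\<^bsub>M\<^esub>}" and Fn: "F n = carrier M"
  and Fsub: "\<And>k. k \<le> n ==> Module.submodule (F k) R M"
  and T: "\<And>k. k < n ==> simple_module R (T k)"
  and cl: "\<And>k x. k < n ==> x \<in> F (Suc k) ==> \<theta> k x \<in> carrier (T k)"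
  and add: "\<And>k x y. k < n ==> x \<in> F (Suc k) ==> y \<in> F (Suc k) ==> \<theta> k (x \<oplus>\<^bsub>M\<^esub> y) = \<theta> k x \<oplus>\<^bsub>T k\<^esub> \<theta> k y"
  and sm: "\<And>k a x. k < n ==> a \<in> carrier R ==> x \<in> F (Suc k) ==> \<theta> k (a \<odot>\<^bsub>M\<^esub> x) = a \<odot>\<^bsub>T k\<^esub> \<theta> k x"
  and ker: "\<And>k x. k < n ==> x \<in> F (Suc k) ==> \<theta> k x = \<zero>\<^bsub>T k\<^esub> \<longleftrightarrow> x \<in> F k"
  and N: "N \<in> composition_factors R M"
 shows "\<exists>k<n. isomorphic_modules R N (T k)"
proof -
 obtain Hs l where Hs: "composition_series R M Hs" "Suc l < length Hs"
  and N: "N = quotient_module (M\<lparr>carrier := Hs ! Suc l\<rparr>) (Hs ! l)"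
  using N unfolding composition_factors_def by blast
 define H where "H = Hs ! l"
 define H' where "H' = Hs ! Suc l"
 interpret subquotient R M H H'
 proof (intro subquotient.intro subquotient_axioms.intro plain_left_module_axioms)
  have "H \<in> set Hs" "H' \<in> set Hs" using Hs(2) by (simp_all add: H_def H'_def)
  then show "Module.submodule H R M" "Module.submodule H' R M"
   using Hs(1) unfolding composition_series_def by blast+
  show "H \<subseteq> H'" using Hs unfolding composition_series_def H_def H'_def by blast
 qed
 have simpleQ: "simple_module R Q" using Hs unfolding composition_series_def H_def H'_def by blast
 note h = submoduleD[OF H] and h' = submoduleD[OF H']
 have ne: "H \<noteq> H'" and max: "\<And>L. Module.submodule L R M ==> H \<subseteq> L ==> L \<subseteq> H' ==> L = H \<or> L = H'"
  using simpleQ simple_iff by blast+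
 define j where "j = (LEAST j. \<not> H' \<inter> F j \<subseteq> H)"
 have ex: "\<not> H' \<inter> F n \<subseteq> H" using ne HH' h'(1) Fn by blast
 have j: "\<not> H' \<inter> F j \<subseteq> H" unfolding j_def by (rule LeastI[of _ n]) (rule ex)
 have jn: "j \<le> n" unfolding j_def by (rule Least_le) (rule ex)
 have "j \<noteq> 0" using j F0 h(2) by auto
 then obtain k where k: "j = Suc k" by (cases j) auto
 have kn: "k < n" using k jn by simp
 have Hk: "H' \<inter> F k \<subseteq> H" using not_less_Least[of k "\<lambda>j. \<not> H' \<inter> F j \<subseteq> H"] k unfolding j_def by simp
 interpret T: left_module R "T k" using T[OF kn] unfolding simple_module_def by blast
 have Tsub: "L = {\<zero>\<^bsub>T k\<^esub>} \<or> L = carrier (T k)" if "Module.submodule L R (T k)" for L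
  using T[OF kn] that unfolding simple_module_def by blast
 define P where "P = H' \<inter> F (Suc k)"
 note f = submoduleD[OF Fsub[of "Suc k"]]
 have sucn: "Suc k \<le> n" using kn by simp
 note f = f[OF sucn]
 have P: "Module.submodule P R M" unfolding P_def
  by (rule submoduleI) (use h' f in auto)
 note p = submoduleD[OF P]
 have PF: "x \<in> F (Suc k)" if "x \<in> P" for x using that by (simp add: P_def)
 have PH': "x \<in> H'" if "x \<in> P" for x using that by (simp add: P_def)
 have image_sub: "Module.submodule (\<theta> k ` L) R (T k)" if L: "Module.submodule L R M" "L \<subseteq> P" for L
 proof (rule T.submoduleI)
  note ls = submoduleD[OF L(1)]
  show "\<theta> k ` L \<subseteq> carrier (T k)" using L(2) PF cl[OF kn] by blast
  have "\<theta> k \<zero>\<^bsub>M\<^esub> = \<zero>\<^bsub>T k\<^esub>" using ker[OF kn, of "\<zero>\<^bsub>M\<^esub>"] f(2) submoduleD(2)[OF Fsub[of k]] kn by simp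
  then show "\<zero>\<^bsub>T k\<^esub> \<in> \<theta> k ` L" using ls(2) by force
  show "x \<oplus>\<^bsub>T k\<^esub> y \<in> \<theta> k ` L" if "x \<in> \<theta> k ` L" "y \<in> \<theta> k ` L" for x y
  proof -
   obtain a b where ab: "a \<in> L" "b \<in> L" "x = \<theta> k a" "y = \<theta> k b" using \<open>x \<in> _\<close> \<open>y \<in> _\<close> by blast
   then have "x \<oplus>\<^bsub>T k\<^esub> y = \<theta> k (a \<oplus>\<^bsub>M\<^esub> b)" using add[OF kn PF PF] L(2) by (metis subsetD)
   then show ?thesis using ls(3)[OF ab(1,2)] by blast
  qed
  show "a \<odot>\<^bsub>T k\<^esub> x \<in> \<theta> k ` L" if "a \<in> carrier R" "x \<in> \<theta> k ` L" for a x
  proof -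
   obtain b where b: "b \<in> L" "x = \<theta> k b" using \<open>x \<in> _\<close> by blast
   then have "a \<odot>\<^bsub>T k\<^esub> x = \<theta> k (a \<odot>\<^bsub>M\<^esub> b)" using sm[OF kn \<open>a \<in> carrier R\<close> PF] L(2) by (metis subsetD)
   then show ?thesis using ls(4)[OF \<open>a \<in> carrier R\<close> b(1)] by blast
  qed
 qed
 have \<theta>diff: "\<theta> k x = \<theta> k y \<longleftrightarrow> x \<ominus>\<^bsub>M\<^esub> y \<in> F k" if "x \<in> P" "y \<in> P" for x y
 proof -
  have d: "x \<ominus>\<^bsub>M\<^esub> y \<in> P" using p(6) that by blast
  have "\<theta> k x = \<theta> k (x \<ominus>\<^bsub>M\<^esub> y) \<oplus>\<^bsub>T k\<^esub> \<theta> k y"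
   using add[OF kn PF[OF d] PF[OF that(2)]] cancel_minus[of x y] p(1) that by (simp add: subsetD)
  moreover have "\<theta> k (x \<ominus>\<^bsub>M\<^esub> y) \<in> carrier (T k)" "\<theta> k y \<in> carrier (T k)" using cl[OF kn] PF d that by auto
  ultimately have "\<theta> k x = \<theta> k y \<longleftrightarrow> \<theta> k (x \<ominus>\<^bsub>M\<^esub> y) = \<zero>\<^bsub>T k\<^esub>"
   using T.M.add.l_cancel_one[of "\<theta> k y" "\<theta> k (x \<ominus>\<^bsub>M\<^esub> y)"] by simp
  then show ?thesis using ker[OF kn PF[OF d]] by simp
 qed
 obtain p0 where p0: "p0 \<in> P" "p0 \<notin> H" using j unfolding k P_def by blast
 have \<theta>P: "\<theta> k ` P = carrier (T k)"
 proof -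
  have "\<theta> k p0 \<noteq> \<zero>\<^bsub>T k\<^esub>" using ker[OF kn PF[OF p0(1)]] Hk p0 PH' by blast
  then show ?thesis using Tsub[OF image_sub[OF P order_refl]] p0 by blast
 qed
 have PH: "Module.submodule (P \<inter> H) R M" by (rule submoduleI) (use p h in auto)
 have \<theta>PH: "\<theta> k x = \<zero>\<^bsub>T k\<^esub>" if "x \<in> P" "x \<in> H" for x
 proof -
  have "\<theta> k ` (P \<inter> H) \<noteq> carrier (T k)"
  proof
   assume "\<theta> k ` (P \<inter> H) = carrier (T k)"
   then have "\<theta> k p0 \<in> \<theta> k ` (P \<inter> H)" using cl[OF kn PF[OF p0(1)]] by simp
   then obtain y where y: "y \<in> P" "y \<in> H" "\<theta> k p0 = \<theta> k y" by auto
   then have "p0 \<ominus>\<^bsub>M\<^esub> y \<in> H" using \<theta>diff[OF p0(1) y(1)] Hk PH'[OF p(6)[OF p0(1) y(1)]] by blast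
   then have "(p0 \<ominus>\<^bsub>M\<^esub> y) \<oplus>\<^bsub>M\<^esub> y \<in> H" using h(3) y by blast
   then show False using cancel_minus[of p0 y] p0 y p(1) by (simp add: subsetD)
  qed
  then have "\<theta> k ` (P \<inter> H) = {\<zero>\<^bsub>T k\<^esub>}" using Tsub[OF image_sub[OF PH]] by blast
  then show ?thesis using that by blast
 qed
 define L where "L = {x \<oplus>\<^bsub>M\<^esub> y | x y. x \<in> P \<and> y \<in> H}"
 have pc: "x \<in> carrier M" if "x \<in> P" for x using that p(1) by blast
 have LI: "x \<oplus>\<^bsub>M\<^esub> y \<in> L" if "x \<in> P" "y \<in> H" for x y using that unfolding L_def by blast
 have LE: "\<exists>x\<in>P. \<exists>y\<in>H. z = x \<oplus>\<^bsub>M\<^esub> y" if "z \<in> L" for z using that unfolding L_def by blast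
 have "Module.submodule L R M"
 proof (rule submoduleI)
  show "L \<subseteq> carrier M" unfolding L_def using pc H_carrier by auto
  show "\<zero>\<^bsub>M\<^esub> \<in> L" using LI[OF p(2) h(2)] by simp
  show "x \<oplus>\<^bsub>M\<^esub> y \<in> L" if xy: "x \<in> L" "y \<in> L" for x y
  proof -
   obtain a b c d where "a \<in> P" "b \<in> H" "x = a \<oplus>\<^bsub>M\<^esub> b" "c \<in> P" "d \<in> H" "y = c \<oplus>\<^bsub>M\<^esub> d" using LE xy by metis
   moreover from this have "x \<oplus>\<^bsub>M\<^esub> y = (a \<oplus>\<^bsub>M\<^esub> c) \<oplus>\<^bsub>M\<^esub> (b \<oplus>\<^bsub>M\<^esub> d)" using pc H_carrier by (simp add: M.a_ac)
   ultimately show ?thesis using LI p(3) h(3) by simp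
  qed
  show "a \<odot>\<^bsub>M\<^esub> x \<in> L" if a: "a \<in> carrier R" "x \<in> L" for a x
  proof -
   obtain c d where "c \<in> P" "d \<in> H" "x = c \<oplus>\<^bsub>M\<^esub> d" using LE a by metis
   then show ?thesis using LI[OF p(4)[OF a(1)] h(4)[OF a(1)]] smult_r_distr[OF a(1)] pc H_carrier by simp
  qed
 qed
 moreover have "H \<subseteq> L"
 proof
  fix x assume "x \<in> H" then show "x \<in> L" using LI[OF p(2), of x] H_carrier[of x] by simp
 qed
 moreover have "L \<subseteq> H'" unfolding L_def using PH' HH' h'(3) by blast
 moreover have "p0 \<in> L" using LI[OF p0(1) h(2)] pc[OF p0(1)] by simp
 ultimately have LH': "L = H'" using max p0 by blast
 define \<Theta> where "\<Theta> x = \<theta> k (SOME y. y \<in> P \<and> x \<ominus>\<^bsub>M\<^esub> y \<in> H)" for x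
 have rep: "\<exists>y. y \<in> P \<and> x \<ominus>\<^bsub>M\<^esub> y \<in> H" if x: "x \<in> H'" for x
 proof -
  obtain a b where ab: "a \<in> P" "b \<in> H" "x = a \<oplus>\<^bsub>M\<^esub> b" using x LH' LE by metis
  then have "x = b \<oplus>\<^bsub>M\<^esub> a" using pc H_carrier by (simp add: M.a_comm)
  then have "x \<ominus>\<^bsub>M\<^esub> a = b" using pc H_carrier ab by (simp add: a_minus_def M.a_assoc M.r_neg)
  with ab show ?thesis by (intro exI[of _ a]) simp
 qed
 have uniq: "\<theta> k y = \<theta> k y'" if "x \<in> H'" "y \<in> P" "y' \<in> P" "x \<ominus>\<^bsub>M\<^esub> y \<in> H" "x \<ominus>\<^bsub>M\<^esub> y' \<in> H" for x y y'
 proof -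
  have "y \<ominus>\<^bsub>M\<^esub> y' = (x \<ominus>\<^bsub>M\<^esub> y') \<ominus>\<^bsub>M\<^esub> (x \<ominus>\<^bsub>M\<^esub> y)"
   using pc[OF that(2)] pc[OF that(3)] H'_carrier[OF that(1)]
   by (simp add: a_minus_def M.minus_add M.a_ac M.r_neg2 M.r_neg1)
  then have "y \<ominus>\<^bsub>M\<^esub> y' \<in> H" using h(6) that by simp
  then have "\<theta> k (y \<ominus>\<^bsub>M\<^esub> y') = \<zero>\<^bsub>T k\<^esub>" using \<theta>PH p(6) that by blast
  then show ?thesis using \<theta>diff[OF that(2,3)] ker[OF kn PF[OF p(6)[OF that(2,3)]]] by blast
 qed
 have \<Theta>: "\<Theta> x = \<theta> k y" if "x \<in> H'" "y \<in> P" "x \<ominus>\<^bsub>M\<^esub> y \<in> H" for x y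
 proof -
  have "(SOME y. y \<in> P \<and> x \<ominus>\<^bsub>M\<^esub> y \<in> H) \<in> P \<and> x \<ominus>\<^bsub>M\<^esub> (SOME y. y \<in> P \<and> x \<ominus>\<^bsub>M\<^esub> y \<in> H) \<in> H"
   by (rule someI_ex[OF rep[OF that(1)]])
  then show ?thesis unfolding \<Theta>_def using uniq[OF that(1)] that by blast
 qed
 have "isomorphic_modules R Q (T k)"
 proof (rule isomorphicI[of \<Theta>])
  fix x assume x: "x \<in> H'"
  obtain a where a: "a \<in> P" "x \<ominus>\<^bsub>M\<^esub> a \<in> H" using rep[OF x] by blast
  note xc = H'_carrier[OF x] pc[OF a(1)]
  show "\<Theta> x \<in> carrier (T k)" using \<Theta>[OF x a] cl[OF kn PF[OF a(1)]] by simp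
  { fix c assume c: "c \<in> carrier R"
   have "c \<odot>\<^bsub>M\<^esub> x \<ominus>\<^bsub>M\<^esub> c \<odot>\<^bsub>M\<^esub> a = c \<odot>\<^bsub>M\<^esub> (x \<ominus>\<^bsub>M\<^esub> a)"
    using xc c by (simp add: a_minus_def smult_r_distr smult_minus)
   then have "c \<odot>\<^bsub>M\<^esub> x \<ominus>\<^bsub>M\<^esub> c \<odot>\<^bsub>M\<^esub> a \<in> H" using h(4)[OF c a(2)] by simp
   then have "\<Theta> (c \<odot>\<^bsub>M\<^esub> x) = \<theta> k (c \<odot>\<^bsub>M\<^esub> a)" by (intro \<Theta> h'(4) p(4) c x a)
   then show "\<Theta> (c \<odot>\<^bsub>M\<^esub> x) = c \<odot>\<^bsub>T k\<^esub> \<Theta> x" using sm[OF kn c PF[OF a(1)]] \<Theta>[OF x a] by simp }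
  fix y assume y: "y \<in> H'"
  obtain b where b: "b \<in> P" "y \<ominus>\<^bsub>M\<^esub> b \<in> H" using rep[OF y] by blast
  note yc = H'_carrier[OF y] pc[OF b(1)]
  have e: "(x \<oplus>\<^bsub>M\<^esub> y) \<ominus>\<^bsub>M\<^esub> (a \<oplus>\<^bsub>M\<^esub> b) = (x \<ominus>\<^bsub>M\<^esub> a) \<oplus>\<^bsub>M\<^esub> (y \<ominus>\<^bsub>M\<^esub> b)"
   using xc yc by (simp add: a_minus_def M.minus_add M.a_ac)
  have "\<Theta> (x \<oplus>\<^bsub>M\<^esub> y) = \<theta> k (a \<oplus>\<^bsub>M\<^esub> b)"
   by (rule \<Theta>[OF h'(3)[OF x y] p(3)[OF a(1) b(1)]]) (use e h(3)[OF a(2) b(2)] in simp)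
  then show "\<Theta> (x \<oplus>\<^bsub>M\<^esub> y) = \<Theta> x \<oplus>\<^bsub>T k\<^esub> \<Theta> y"
   using add[OF kn PF[OF a(1)] PF[OF b(1)]] \<Theta>[OF x a] \<Theta>[OF y b] by simp
  have d: "a \<ominus>\<^bsub>M\<^esub> b \<in> P" using p(6) a b by blast
  have dH: "(x \<ominus>\<^bsub>M\<^esub> a) \<ominus>\<^bsub>M\<^esub> (y \<ominus>\<^bsub>M\<^esub> b) \<in> H" using h(6) a b by blast
  have dc: "x \<ominus>\<^bsub>M\<^esub> a \<in> carrier M" "y \<ominus>\<^bsub>M\<^esub> b \<in> carrier M" using xc yc by simp_all
  have "x \<ominus>\<^bsub>M\<^esub> y = ((x \<ominus>\<^bsub>M\<^esub> a) \<oplus>\<^bsub>M\<^esub> a) \<ominus>\<^bsub>M\<^esub> ((y \<ominus>\<^bsub>M\<^esub> b) \<oplus>\<^bsub>M\<^esub> b)"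
   using xc yc by (simp add: cancel_minus)
  also have "\<dots> = (a \<ominus>\<^bsub>M\<^esub> b) \<oplus>\<^bsub>M\<^esub> ((x \<ominus>\<^bsub>M\<^esub> a) \<ominus>\<^bsub>M\<^esub> (y \<ominus>\<^bsub>M\<^esub> b))"
   using xc(2) yc(2) dc unfolding a_minus_def[of M "_ \<oplus>\<^bsub>M\<^esub> _"] a_minus_def[of M a b]
    a_minus_def[of M "x \<ominus>\<^bsub>M\<^esub> a"] by (simp add: M.minus_add M.a_ac)
  finally have e1: "x \<ominus>\<^bsub>M\<^esub> y = (a \<ominus>\<^bsub>M\<^esub> b) \<oplus>\<^bsub>M\<^esub> ((x \<ominus>\<^bsub>M\<^esub> a) \<ominus>\<^bsub>M\<^esub> (y \<ominus>\<^bsub>M\<^esub> b))" .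
  have e2: "a \<ominus>\<^bsub>M\<^esub> b = (x \<ominus>\<^bsub>M\<^esub> y) \<ominus>\<^bsub>M\<^esub> ((x \<ominus>\<^bsub>M\<^esub> a) \<ominus>\<^bsub>M\<^esub> (y \<ominus>\<^bsub>M\<^esub> b))"
   using pc[OF d] H_carrier[OF dH] unfolding e1 a_minus_def[of M "(a \<ominus>\<^bsub>M\<^esub> b) \<oplus>\<^bsub>M\<^esub> _"]
   by (simp add: M.a_assoc M.r_neg)
  have "\<Theta> x = \<Theta> y \<longleftrightarrow> \<theta> k a = \<theta> k b" using \<Theta>[OF x a] \<Theta>[OF y b] by simp
  also have "\<dots> \<longleftrightarrow> a \<ominus>\<^bsub>M\<^esub> b \<in> F k" by (rule \<theta>diff[OF a(1) b(1)])
  also have "\<dots> \<longleftrightarrow> a \<ominus>\<^bsub>M\<^esub> b \<in> H"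
   using Hk PH'[OF d] \<theta>PH[OF d] ker[OF kn PF[OF d]] by blast
  also have "\<dots> \<longleftrightarrow> x \<ominus>\<^bsub>M\<^esub> y \<in> H" using e1 e2 dH h(3) h(6) by metis
  finally show "\<Theta> x = \<Theta> y \<longleftrightarrow> x \<ominus>\<^bsub>M\<^esub> y \<in> H" .
 next
  fix y assume "y \<in> carrier (T k)"
  then obtain a where a: "a \<in> P" "\<theta> k a = y" using \<theta>P by (metis imageE)
  have "a \<ominus>\<^bsub>M\<^esub> a = \<zero>\<^bsub>M\<^esub>" using pc[OF a(1)] by (simp add: a_minus_def M.r_neg)
  then have "\<Theta> a = y" using \<Theta>[OF PH'[OF a(1)] a(1)] h(2) a by simp
  then show "\<exists>x\<in>H'. \<Theta> x = y" using PH'[OF a(1)] by blast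
 qed
 with kn show ?thesis unfolding N H_def H'_def by blast
qed

lemma (in plain_left_module) composition_series_exists:
 fixes \<mu> :: "_ set \<Rightarrow> nat"
 assumes mono: "\<And>H H'. Module.submodule H R M ==> Module.submodule H' R M ==> H \<subset> H' ==> \<mu> H < \<mu> H'"
 shows "\<exists>Hs. composition_series R M Hs"
proof -
 let ?step = "\<lambda>Hs. \<forall>l. Suc l < length Hs \<longrightarrow> Hs ! l \<subseteq> Hs ! Suc l \<and>
    simple_module R (quotient_module (M\<lparr>carrier := Hs ! Suc l\<rparr>) (Hs ! l))"
 have "\<exists>Hs. Hs \<noteq> [] \<and> hd Hs = H \<and> last Hs = carrier M \<and> (\<forall>H\<in>set Hs. Module.submodule H R M) \<and> ?step Hs"
  if "Module.submodule H R M" for H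
  using that
 proof (induction "\<mu> (carrier M) - \<mu> H" arbitrary: H rule: less_induct)
  case less
  show ?case
  proof (cases "H = carrier M")
   case True
   then show ?thesis using less.prems by (intro exI[of _ "[H]"]) auto
  next
   case False
   then have H: "H \<subset> carrier M" using submoduleD(1)[OF less.prems] by blast
   let ?P = "\<lambda>L. Module.submodule L R M \<and> H \<subset> L"
   define L where "L = arg_min \<mu> ?P"
   have L: "?P L" and Lmin: "\<And>L'. ?P L' ==> \<mu> L \<le> \<mu> L'"
    using arg_min_nat_lemma[of ?P "carrier M" \<mu>] H carrier_submodule unfolding L_def by blast+
   have "H \<subseteq> L" using L by auto
   then interpret q: subquotient R M H L
    using L less.prems by (intro subquotient.intro subquotient_axioms.intro plain_left_module_axioms) simp_all
   have s: "simple_module R (quotient_module (M\<lparr>carrier := L\<rparr>) H)"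
    unfolding q.simple_iff
   proof (intro conjI allI impI)
    show "H \<noteq> L" using L by blast
    fix L' assume L': "Module.submodule L' R M" "H \<subseteq> L'" "L' \<subseteq> L"
    show "L' = H \<or> L' = L"
    proof (rule ccontr)
     assume "\<not> (L' = H \<or> L' = L)"
     then have "H \<subset> L'" "L' \<subset> L" using L' by auto
     then show False using Lmin[of L'] mono[of L' L] L' L by fastforce
    qed
   qed
   have "\<mu> H < \<mu> (carrier M)" using mono[OF less.prems carrier_submodule H] .
   then have "\<mu> (carrier M) - \<mu> L < \<mu> (carrier M) - \<mu> H"
    using mono[of H L] L less.prems by (intro diff_less_mono2) auto
   from less.hyps[OF this] L obtain Hs where Hs: "Hs \<noteq> []" "hd Hs = L" "last Hs = carrier M"
    "\<forall>H\<in>set Hs. Module.submodule H R M" "?step Hs" by blast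
   have L0: "Hs ! 0 = L" using Hs(1,2) by (simp add: hd_conv_nth)
   have "?step (H # Hs)"
   proof (intro allI impI)
    fix l assume l: "Suc l < length (H # Hs)"
    show "(H # Hs) ! l \<subseteq> (H # Hs) ! Suc l \<and>
     simple_module R (quotient_module (M\<lparr>carrier := (H # Hs) ! Suc l\<rparr>) ((H # Hs) ! l))"
    proof (cases l)
     case 0
     then show ?thesis using L0 s L by auto
    next
     case (Suc l')
     then show ?thesis using Hs(5) l by auto
    qed
   qed
   moreover have "last (H # Hs) = carrier M" "hd (H # Hs) = H" using Hs(1,3) by simp_all
   moreover have "\<forall>L\<in>set (H # Hs). Module.submodule L R M" using Hs(4) less.prems by simp
   ultimately show ?thesis by blast
  qed
 qed
 from this[OF zero_submodule] show ?thesis unfolding composition_series_def by blast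
qed

text \<open>The rank is the largest size of an independent subset. Strict monotonicity bounds the length of chains of
subspaces.\<close>

lemma subspace_rank_exists:
 fixes V :: "('k::field, 'b, 'z) module_scheme"
 assumes V: "vectorspace class_ring V" and fd: "vectorspace.fin_dim class_ring V"
 shows "\<exists>\<mu> :: 'b set \<Rightarrow> nat. \<forall>W W'. W \<subset> W' \<longrightarrow> W' \<subseteq> carrier V \<longrightarrow> \<zero>\<^bsub>V\<^esub> \<in> W \<longrightarrow>
   (\<forall>x\<in>W. \<forall>y\<in>W. x \<oplus>\<^bsub>V\<^esub> y \<in> W) \<longrightarrow> (\<forall>a. \<forall>x\<in>W. a \<odot>\<^bsub>V\<^esub> x \<in> W) \<longrightarrow> \<mu> W < \<mu> W'"
proof -
 interpret V: vectorspace class_ring V by (rule V)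
 \<comment> \<open>bounded by the dimension, and an independent set in \<open>W\<close> extends by any vector outside of \<open>W\<close>\<close>
 define \<mu> where "\<mu> W = Max {card A | A. A \<subseteq> W \<and> A \<subseteq> carrier V \<and> V.lin_indpt A}" for W
 have fin: "finite {card A | A. A \<subseteq> W \<and> A \<subseteq> carrier V \<and> V.lin_indpt A}" for W
  by (rule finite_subset[of _ "{..V.dim}"]) (use V.li_le_dim[OF fd] in auto)
 have e: "V.lin_indpt {}" unfolding V.lin_dep_def by auto
 show ?thesis
 proof (intro exI[of _ \<mu>] allI impI)
  fix W W' assume W: "W \<subset> W'" "W' \<subseteq> carrier V" "\<zero>\<^bsub>V\<^esub> \<in> W"
   "\<forall>x\<in>W. \<forall>y\<in>W. x \<oplus>\<^bsub>V\<^esub> y \<in> W" "\<forall>a. \<forall>x\<in>W. a \<odot>\<^bsub>V\<^esub> x \<in> W"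
  have "\<mu> W \<in> {card A | A. A \<subseteq> W \<and> A \<subseteq> carrier V \<and> V.lin_indpt A}"
   unfolding \<mu>_def by (rule Max_in[OF fin]) (use e in blast)
  then obtain A where A: "A \<subseteq> W" "A \<subseteq> carrier V" "V.lin_indpt A" "\<mu> W = card A" by blast
  have Afin: "finite A" using V.fin_dim_li_fin[OF fd] A V.li_le_dim[OF fd] by blast
  have lc: "V.lincomb a B \<in> W" if "finite B" "B \<subseteq> A" for a B
   using that
  proof (induction B rule: finite_induct)
   case empty show ?case using W(3) by (simp add: V.lincomb_def)
  next
   case (insert x B)
   have smc: "a x \<odot>\<^bsub>V\<^esub> x \<in> carrier V" if "x \<in> carrier V" for x using V.smult_closed[of "a x" x] that by simp
   have "V.lincomb a (insert x B) = a x \<odot>\<^bsub>V\<^esub> x \<oplus>\<^bsub>V\<^esub> V.lincomb a B"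
    unfolding V.lincomb_def using insert A(2) smc by (subst V.finsum_insert) auto
   then show ?case using insert W A(1) by auto
  qed
  obtain x where x: "x \<in> W'" "x \<notin> W" using W(1) by blast
  have "x \<notin> V.span A" using lc x finite_subset unfolding V.span_def by blast
  then have li: "V.lin_indpt (A \<union> {x})"
   using V.lin_dep_iff_in_span[OF A(2) A(3), of x] x W(2) A(1) by blast
  have "card (A \<union> {x}) \<le> \<mu> W'"
   unfolding \<mu>_def by (rule Max_ge[OF fin]) (use A x W li in blast)
  moreover have "x \<notin> A" using A(1) x by blast
  then have "card (A \<union> {x}) = Suc (card A)" using Afin by simp
  ultimately show "\<mu> W < \<mu> W'" using A(4) by simp
 qed
qed

section \<open>Modules as matrix representations\<close>

text \<open>The unit of \<open>A\<close> goes to the idempotent \<open>I\<close>, so a representation takes values in the corner of \<open>I\<close>.\<close>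

definition algebra_rep ::
 "('k::field, 'a, 'm) module_scheme \<Rightarrow> ('k \<Rightarrow> 'r::ring \<Rightarrow> 'r) \<Rightarrow> 'r \<Rightarrow> ('a \<Rightarrow> 'r) \<Rightarrow> bool" where
 "algebra_rep A sc I L \<longleftrightarrow>
   (\<forall>x\<in>carrier A. \<forall>y\<in>carrier A. L (x \<oplus>\<^bsub>A\<^esub> y) = L x + L y \<and> L (x \<otimes>\<^bsub>A\<^esub> y) = L x * L y) \<and>
   (\<forall>c. \<forall>x\<in>carrier A. L (c \<odot>\<^bsub>A\<^esub> x) = sc c (L x)) \<and> L \<one>\<^bsub>A\<^esub> = I"

lemma algebra_repD:
 assumes "algebra_rep A sc I L"
 shows "x \<in> carrier A ==> y \<in> carrier A ==> L (x \<oplus>\<^bsub>A\<^esub> y) = L x + L y"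
  and "x \<in> carrier A ==> y \<in> carrier A ==> L (x \<otimes>\<^bsub>A\<^esub> y) = L x * L y"
  and "x \<in> carrier A ==> L (c \<odot>\<^bsub>A\<^esub> x) = sc c (L x)" and "L \<one>\<^bsub>A\<^esub> = I"
 using assms unfolding algebra_rep_def by blast+

lemma algebra_rep_corner:
 assumes "assoc_algebra A" "algebra_rep A sc I L" "x \<in> carrier A"
 shows "I * L x = L x" "L x * I = L x"
proof -
 interpret assoc_algebra A by (rule assms(1))
 show "I * L x = L x" "L x * I = L x"
  using algebra_repD(2)[OF assms(2) one_closed assms(3)] algebra_repD(2)[OF assms(2) assms(3) one_closed]
   algebra_repD(4)[OF assms(2)] assms(3) by simp_all
qed

lemma corner_algebra:
 assumes "scalars sc" and I: "I * I = (I :: 'r::ring)"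
 shows "assoc_algebra \<lparr>carrier = {x. I * x = x \<and> x * I = x}, mult = (*), one = I, zero = 0, add = (+), smult = sc\<rparr>"
  (is "assoc_algebra ?B")
proof -
 interpret scalars sc by (rule assms(1))
 have "abelian_group ?B"
 proof (rule abelian_groupI)
  fix x assume "x \<in> carrier ?B"
  then show "\<exists>y\<in>carrier ?B. y \<oplus>\<^bsub>?B\<^esub> x = \<zero>\<^bsub>?B\<^esub>" by (intro bexI[of _ "- x"]) auto
 qed (auto simp: algebra_simps)
 moreover have "Group.monoid ?B"
  by (rule monoidI) (auto simp: I mult.assoc, auto simp: mult.assoc[symmetric])
 ultimately have "ring ?B" by (rule ringI) (auto simp: algebra_simps)
 moreover have "module_axioms class_ring ?B"
  by unfold_locales (auto simp: sc_add_left sc_add_right sc_sc sc_mult_left sc_mult_right)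
 moreover have "assoc_algebra_axioms ?B"
  by unfold_locales (auto simp: sc_mult_left sc_mult_right)
 ultimately show ?thesis
  unfolding assoc_algebra_def Module.module_def using class_cring.is_cring by (simp add: ring_def)
qed

context frame
begin

definition mcoord ::
 "('k, 'a, 'm) module_scheme \<Rightarrow> ('a, 'b) module \<Rightarrow> ('b \<Rightarrow> 'r) \<Rightarrow> ('a \<Rightarrow> 'r) \<Rightarrow> bool" where
 "mcoord A M c L \<longleftrightarrow> left_module A M \<and> coord (over_field A M) c \<and> algebra_rep A sc I L \<and>
   (\<forall>a\<in>carrier A. \<forall>x\<in>carrier M. c (a \<odot>\<^bsub>M\<^esub> x) = L a * c x)"

lemma mcoordD:
 assumes "mcoord A M c L"
 shows "left_module A M" "coord (over_field A M) c" "algebra_rep A sc I L"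
  and "a \<in> carrier A ==> x \<in> carrier M ==> c (a \<odot>\<^bsub>M\<^esub> x) = L a * c x"
  and "bij_betw c (carrier M) (col I U)"
  and "x \<in> carrier M ==> y \<in> carrier M ==> c (x \<oplus>\<^bsub>M\<^esub> y) = c x + c y"
  and "x \<in> carrier M ==> c ((d \<odot>\<^bsub>A\<^esub> \<one>\<^bsub>A\<^esub>) \<odot>\<^bsub>M\<^esub> x) = sc d (c x)"
  and "x \<in> carrier M ==> c x \<in> col I U"
  and "z \<in> col I U ==> \<exists>x\<in>carrier M. c x = z"
  and "x \<in> carrier M ==> y \<in> carrier M ==> c x = c y \<longleftrightarrow> x = y"
  and "c \<zero>\<^bsub>M\<^esub> = 0"
proof -
 show 1: "left_module A M" "coord (over_field A M) c" "algebra_rep A sc I L"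
  "a \<in> carrier A ==> x \<in> carrier M ==> c (a \<odot>\<^bsub>M\<^esub> x) = L a * c x" for a x
  using assms unfolding mcoord_def by auto
 show 2: "bij_betw c (carrier M) (col I U)"
  and 3: "x \<in> carrier M ==> y \<in> carrier M ==> c (x \<oplus>\<^bsub>M\<^esub> y) = c x + c y"
  and "x \<in> carrier M ==> c ((d \<odot>\<^bsub>A\<^esub> \<one>\<^bsub>A\<^esub>) \<odot>\<^bsub>M\<^esub> x) = sc d (c x)" for x y d
  using 1(2) unfolding coord_def by auto
 show "x \<in> carrier M ==> c x \<in> col I U"
  "x \<in> carrier M ==> y \<in> carrier M ==> c x = c y \<longleftrightarrow> x = y" for x y
  using 2 unfolding bij_betw_def inj_on_def by auto
 show "\<exists>x\<in>carrier M. c x = z" if "z \<in> col I U" for z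
 proof -
  have "z \<in> c ` carrier M" using 2 that unfolding bij_betw_def by simp
  then show ?thesis by auto
 qed
 interpret left_module A M by (rule 1)
 show "c \<zero>\<^bsub>M\<^esub> = 0" using 3[of "\<zero>\<^bsub>M\<^esub>" "\<zero>\<^bsub>M\<^esub>"] by simp
qed

text \<open>Coordinates of the underlying vector space turn the action into matrices.\<close>

lemma mcoord_exists:
 assumes A: "assoc_algebra A" and M: "left_module A M" and c: "coord (over_field A M) c"
 shows "\<exists>L. mcoord A M c L"
proof -
 interpret A: assoc_algebra A by (rule A)
 interpret left_module A M by (rule M)
 have bij: "bij_betw c (carrier M) (col I U)"
  and add: "\<And>x y. x \<in> carrier M ==> y \<in> carrier M ==> c (x \<oplus>\<^bsub>M\<^esub> y) = c x + c y"
  and scm: "\<And>d x. x \<in> carrier M ==> c ((d \<odot>\<^bsub>A\<^esub> \<one>\<^bsub>A\<^esub>) \<odot>\<^bsub>M\<^esub> x) = sc d (c x)"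
  using c unfolding coord_def by auto
 define b where "b = inv_into (carrier M) c"
 have bM: "b z \<in> carrier M" and cb: "c (b z) = z" if "z \<in> col I U" for z
  using that bij unfolding b_def bij_betw_def by (auto intro: inv_into_into f_inv_into_f)
 have cC: "c x \<in> col I U" if "x \<in> carrier M" for x using that bij unfolding bij_betw_def by blast
 have bc: "b (c x) = x" if "x \<in> carrier M" for x
  using that bij unfolding b_def bij_betw_def by (auto intro: inv_into_f_f)
 have b_add: "b (x + y) = b x \<oplus>\<^bsub>M\<^esub> b y" if "x \<in> col I U" "y \<in> col I U" for x y
  using bc[of "b x \<oplus>\<^bsub>M\<^esub> b y"] add[OF bM[OF that(1)] bM[OF that(2)]] bM cb that by simp
 have oneA: "d \<odot>\<^bsub>A\<^esub> \<one>\<^bsub>A\<^esub> \<in> carrier A" for d by simp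
 have b_sc: "b (sc d x) = (d \<odot>\<^bsub>A\<^esub> \<one>\<^bsub>A\<^esub>) \<odot>\<^bsub>M\<^esub> b x" if "x \<in> col I U" for d x
  using bc[of "(d \<odot>\<^bsub>A\<^esub> \<one>\<^bsub>A\<^esub>) \<odot>\<^bsub>M\<^esub> b x"] scm[OF bM[OF that]] bM cb that smult_closed[OF oneA] by simp
 have "\<exists>T. I * T = T \<and> T * I = T \<and> (\<forall>x\<in>col I U. T * x = c (a \<odot>\<^bsub>M\<^esub> b x))" if a: "a \<in> carrier A" for a
 proof (rule matrix_exists)
  show "c (a \<odot>\<^bsub>M\<^esub> b (x + y)) = c (a \<odot>\<^bsub>M\<^esub> b x) + c (a \<odot>\<^bsub>M\<^esub> b y)" if "x \<in> col I U" "y \<in> col I U" for x y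
   using b_add[OF that] smult_r_distr[OF a bM bM] add smult_closed[OF a] bM that by simp
  show "c (a \<odot>\<^bsub>M\<^esub> b (sc d x)) = sc d (c (a \<odot>\<^bsub>M\<^esub> b x))" if "x \<in> col I U" for d x
  proof -
   have "a \<odot>\<^bsub>M\<^esub> ((d \<odot>\<^bsub>A\<^esub> \<one>\<^bsub>A\<^esub>) \<odot>\<^bsub>M\<^esub> b x) = (d \<odot>\<^bsub>A\<^esub> \<one>\<^bsub>A\<^esub>) \<odot>\<^bsub>M\<^esub> (a \<odot>\<^bsub>M\<^esub> b x)"
    using smult_assoc[OF a oneA bM[OF that]] smult_assoc[OF oneA a bM[OF that]] a
    by (simp add: A.smult_mult A.mult_smult)
   then show ?thesis using b_sc[OF that] scm smult_closed[OF a] bM that by simp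
  qed
  show "c (a \<odot>\<^bsub>M\<^esub> b x) \<in> col I U" if "x \<in> col I U" for x using cC smult_closed[OF a] bM that by simp
 qed
 then obtain L where L: "\<And>a. a \<in> carrier A ==> I * L a = L a" "\<And>a. a \<in> carrier A ==> L a * I = L a"
  "\<And>a x. a \<in> carrier A ==> x \<in> col I U ==> L a * x = c (a \<odot>\<^bsub>M\<^esub> b x)" by metis
 have "algebra_rep A sc I L"
  unfolding algebra_rep_def
 proof (intro conjI ballI allI)
  fix x y assume x: "x \<in> carrier A" and y: "y \<in> carrier A"
  show "L (x \<oplus>\<^bsub>A\<^esub> y) = L x + L y"
   by (rule matrix_unique)
    (use x y L bM in \<open>auto simp: distrib_left distrib_right smult_l_distr add smult_closed\<close>)
  show "L (x \<otimes>\<^bsub>A\<^esub> y) = L x * L y"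
  proof (rule matrix_unique)
   fix z assume z: "z \<in> col I U"
   have "L x * L y * z = L x * c (y \<odot>\<^bsub>M\<^esub> b z)" using L(3)[OF y z] by (simp add: mult.assoc)
   also have "\<dots> = c (x \<odot>\<^bsub>M\<^esub> (y \<odot>\<^bsub>M\<^esub> b z))"
    using L(3)[OF x cC[OF smult_closed[OF y bM[OF z]]]] bc[OF smult_closed[OF y bM[OF z]]] by simp
   also have "\<dots> = L (x \<otimes>\<^bsub>A\<^esub> y) * z"
    using L(3)[of "x \<otimes>\<^bsub>A\<^esub> y" z] x y z bM smult_assoc by simp
   finally show "L (x \<otimes>\<^bsub>A\<^esub> y) * z = L x * L y * z" ..
  qed (use x y L in \<open>auto simp: mult.assoc\<close>)
 next
  fix d x assume x: "x \<in> carrier A"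
  show "L (d \<odot>\<^bsub>A\<^esub> x) = sc d (L x)"
  proof (rule matrix_unique)
   fix z assume z: "z \<in> col I U"
   have "(d \<odot>\<^bsub>A\<^esub> x) \<odot>\<^bsub>M\<^esub> b z = (d \<odot>\<^bsub>A\<^esub> \<one>\<^bsub>A\<^esub>) \<odot>\<^bsub>M\<^esub> (x \<odot>\<^bsub>M\<^esub> b z)"
    using smult_assoc[OF oneA x bM[OF z], of d] x by (simp add: A.smult_mult)
   then show "L (d \<odot>\<^bsub>A\<^esub> x) * z = sc d (L x) * z"
    using L(3)[of "d \<odot>\<^bsub>A\<^esub> x" z] L(3)[OF x z] x z scm[OF smult_closed[OF x bM[OF z]]] by (simp add: sc_mult_left)
  qed (use x L in \<open>auto simp: sc_mult_left\<close>)
 next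
  show "L \<one>\<^bsub>A\<^esub> = I"
   by (rule matrix_unique) (use L I_idem cb bM smult_one in \<open>auto simp: colD\<close>)
 qed
 then show ?thesis
  unfolding mcoord_def using M c L(3)[OF _ cC] bc by (intro exI[of _ L]) simp
qed

text \<open>Conversely, matrices of an algebra act on the column space, on any type that it embeds in.\<close>

lemma cvec_mcoord:
 assumes A: "assoc_algebra A" and L: "algebra_rep A sc I L" and i: "inj_on \<iota> (col I U)"
 shows "mcoord A (cvec \<iota> (col I U) (\<lambda>a x. L a * x)) (inv_into (col I U) \<iota>) L"
  and "vectorspace.fin_dim class_ring (over_field A (cvec \<iota> (col I U) (\<lambda>a x. L a * x)))"
proof -
 interpret A: assoc_algebra A by (rule A)
 let ?M = "cvec \<iota> (col I U) (\<lambda>a x. L a * x)"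
 note l = algebra_repD[OF L] and lc = algebra_rep_corner[OF A L]
 have cl: "L a * x \<in> col I U" if "a \<in> carrier A" "x \<in> col I U" for a x
  by (rule col_mult[OF lc(1)[OF that(1)] that(2)])
 have ax: "left_module_axioms A ?M"
  by unfold_locales
   (use i cl in \<open>auto simp: cvec_simps l col_add distrib_left distrib_right mult.assoc colD\<close>)
 then have M: "left_module A ?M"
  unfolding left_module_def using cvec_abelian_group[OF i] A.ring_axioms by blast
 have one: "L (d \<odot>\<^bsub>A\<^esub> \<one>\<^bsub>A\<^esub>) * x = sc d x" if "x \<in> col I U" for d x
  using that l(3)[of "\<one>\<^bsub>A\<^esub>" d] l(4) by (simp add: sc_mult_left colD)
 have co: "coord (over_field A ?M) (inv_into (col I U) \<iota>)"
  unfolding coord_def using i one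
  by (auto simp: cvec_simps col_sc col_add intro: bij_betw_inv_into inj_on_imp_bij_betw)
 show "mcoord A ?M (inv_into (col I U) \<iota>) L"
  unfolding mcoord_def using M co L i cl by (auto simp: cvec_simps)
 show "vectorspace.fin_dim class_ring (over_field A ?M)"
  by (rule coord_dim(1)[OF over_field_vectorspace[OF A M] co])
qed

end

lemma hom_matrix:
 assumes f1: "frame sc I U (K :: 'i set) u v" and f2: "frame sc J U (K' :: 'j set) u' v'"
  and A: "assoc_algebra A"
  and M: "frame.mcoord sc I U A M c L" and N: "frame.mcoord sc J U A N c' L'"
  and f: "f \<in> module_hom A M N"
 shows "\<exists>T. J * T = T \<and> T * I = T \<and> (\<forall>x\<in>carrier M. c' (f x) = T * c x) \<and> (\<forall>a\<in>carrier A. T * L a = L' a * T)"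
proof -
 interpret a: frame sc I U K u v by (rule f1)
 interpret b: frame sc J U K' u' v' by (rule f2)
 interpret A: assoc_algebra A by (rule A)
 note m = a.mcoordD[OF M] and n = b.mcoordD[OF N]
 interpret M: left_module A M by (rule m(1))
 interpret N: left_module A N by (rule n(1))
 have f': "\<And>x. x \<in> carrier M ==> f x \<in> carrier N" "\<And>x y. x \<in> carrier M ==> y \<in> carrier M ==> f (x \<oplus>\<^bsub>M\<^esub> y) = f x \<oplus>\<^bsub>N\<^esub> f y"
  "\<And>a x. a \<in> carrier A ==> x \<in> carrier M ==> f (a \<odot>\<^bsub>M\<^esub> x) = a \<odot>\<^bsub>N\<^esub> f x"
  using f unfolding LinearCombinations.module_hom_def by auto
 have oneA: "d \<odot>\<^bsub>A\<^esub> \<one>\<^bsub>A\<^esub> \<in> carrier A" for d by simp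
 define b where "b = inv_into (carrier M) c"
 have bM: "b z \<in> carrier M" and cb: "c (b z) = z" if "z \<in> col I U" for z
  using that m(5) unfolding b_def bij_betw_def by (auto intro: inv_into_into f_inv_into_f)
 have bc: "b (c x) = x" if "x \<in> carrier M" for x
  using that m(5) unfolding b_def bij_betw_def by (auto intro: inv_into_f_f)
 have "\<exists>T. J * T = T \<and> T * I = T \<and> (\<forall>x\<in>col I U. T * x = c' (f (b x)))"
 proof (rule a.matrix_exists)
  fix x y assume x: "x \<in> col I U" and y: "y \<in> col I U"
  have "b (x + y) = b x \<oplus>\<^bsub>M\<^esub> b y"
   using bc[of "b x \<oplus>\<^bsub>M\<^esub> b y"] m(6)[OF bM[OF x] bM[OF y]] cb[OF x] cb[OF y] bM[OF x] bM[OF y] by simp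
  then show "c' (f (b (x + y))) = c' (f (b x)) + c' (f (b y))" using f' n(6) bM x y by simp
  fix d
  have "b (sc d x) = (d \<odot>\<^bsub>A\<^esub> \<one>\<^bsub>A\<^esub>) \<odot>\<^bsub>M\<^esub> b x"
   using bc[of "(d \<odot>\<^bsub>A\<^esub> \<one>\<^bsub>A\<^esub>) \<odot>\<^bsub>M\<^esub> b x"] m(7)[OF bM[OF x]] cb[OF x] M.smult_closed[OF oneA bM[OF x]] by simp
  then show "c' (f (b (sc d x))) = sc d (c' (f (b x)))" using f'(3)[OF oneA bM[OF x]] n(7)[OF f'(1)[OF bM[OF x]]] by simp
  show "c' (f (b x)) \<in> col J U" using n(8) f'(1) bM x by simp
 qed
 then obtain T where T: "J * T = T" "T * I = T" "\<And>x. x \<in> col I U ==> T * x = c' (f (b x))" by blast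
 have Tf: "c' (f x) = T * c x" if "x \<in> carrier M" for x using T(3)[OF m(8)[OF that]] bc[OF that] by simp
 have "T * L a = L' a * T" if a: "a \<in> carrier A" for a
 proof (rule a.matrix_unique)
  note la = algebra_rep_corner[OF A m(3) a]
  show "T * L a * I = T * L a" using la by (simp add: mult.assoc)
  show "L' a * T * I = L' a * T" using T(2) by (simp add: mult.assoc)
  fix z assume z: "z \<in> col I U"
  have "T * L a * z = T * c (a \<odot>\<^bsub>M\<^esub> b z)" using m(4)[OF a bM[OF z]] cb[OF z] by (simp add: mult.assoc)
  also have "\<dots> = c' (f (a \<odot>\<^bsub>M\<^esub> b z))" using Tf M.smult_closed[OF a bM[OF z]] by simp
  also have "\<dots> = L' a * (T * z)" using f'(3)[OF a bM[OF z]] n(4)[OF a f'(1)[OF bM[OF z]]] Tf[OF bM[OF z]] cb[OF z] by simp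
  finally show "T * L a * z = L' a * T * z" by (simp add: mult.assoc)
 qed
 with T Tf show ?thesis by blast
qed

lemma matrix_hom:
 assumes f1: "frame sc I U (K :: 'i set) u v" and f2: "frame sc J U (K' :: 'j set) u' v'"
  and M: "frame.mcoord sc I U A M c L" and N: "frame.mcoord sc J U A N c' L'"
  and T: "J * T = T" "T * I = T" "\<forall>a\<in>carrier A. T * L a = L' a * T"
 shows "(\<lambda>x\<in>carrier M. inv_into (carrier N) c' (T * c x)) \<in> module_hom A M N \<inter> extensional (carrier M)"
  and "\<And>x. x \<in> carrier M ==> c' (inv_into (carrier N) c' (T * c x)) = T * c x"
  and "\<And>x. x \<in> carrier M ==> inv_into (carrier N) c' (T * c x) \<in> carrier N"
proof -
 interpret a: frame sc I U K u v by (rule f1)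
 interpret b: frame sc J U K' u' v' by (rule f2)
 note m = a.mcoordD[OF M] and n = b.mcoordD[OF N]
 interpret M: left_module A M by (rule m(1))
 interpret N: left_module A N by (rule n(1))
 let ?g = "inv_into (carrier N) c'"
 have gN: "?g z \<in> carrier N" and cg: "c' (?g z) = z" if "z \<in> col J U" for z
  using that n(5) unfolding bij_betw_def by (auto intro: inv_into_into f_inv_into_f)
 have Tc: "T * c x \<in> col J U" if "x \<in> carrier M" for x using col_mult[OF T(1) m(8)[OF that]] .
 show 1: "c' (?g (T * c x)) = T * c x" and 2: "?g (T * c x) \<in> carrier N" if "x \<in> carrier M" for x
  using gN cg Tc[OF that] by auto
 have "?g (T * c (x \<oplus>\<^bsub>M\<^esub> y)) = ?g (T * c x) \<oplus>\<^bsub>N\<^esub> ?g (T * c y)" if x: "x \<in> carrier M" and y: "y \<in> carrier M" for x y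
 proof -
  have "c' (?g (T * c (x \<oplus>\<^bsub>M\<^esub> y))) = T * c (x \<oplus>\<^bsub>M\<^esub> y)" by (rule 1) (use x y in simp)
  also have "\<dots> = c' (?g (T * c x) \<oplus>\<^bsub>N\<^esub> ?g (T * c y))"
   using m(6)[OF x y] n(6)[OF 2[OF x] 2[OF y]] 1[OF x] 1[OF y] by (simp add: distrib_left)
  finally show ?thesis
   using n(10)[OF 2[of "x \<oplus>\<^bsub>M\<^esub> y"] N.M.add.m_closed[OF 2[OF x] 2[OF y]]] x y by simp
 qed
 moreover have "?g (T * c (a \<odot>\<^bsub>M\<^esub> x)) = a \<odot>\<^bsub>N\<^esub> ?g (T * c x)" if a: "a \<in> carrier A" and x: "x \<in> carrier M" for a x
 proof -
  note ax = M.smult_closed[OF a x]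
  have "T * c (a \<odot>\<^bsub>M\<^esub> x) = L' a * (T * c x)" using m(4)[OF a x] bspec[OF T(3) a] by (simp add: mult.assoc[symmetric])
  then have "c' (?g (T * c (a \<odot>\<^bsub>M\<^esub> x))) = c' (a \<odot>\<^bsub>N\<^esub> ?g (T * c x))"
   using 1[OF ax] n(4)[OF a 2[OF x]] 1[OF x] by simp
  then show ?thesis using n(10)[OF 2[OF ax] N.smult_closed[OF a 2[OF x]]] by simp
 qed
 ultimately show "(\<lambda>x\<in>carrier M. ?g (T * c x)) \<in> module_hom A M N \<inter> extensional (carrier M)"
  unfolding LinearCombinations.module_hom_def using 2 M.smult_closed by auto
qed

section \<open>Matrix units in the free product\<close>

lemma matrix_unit_closed: "matrix_unit r w j p q \<in> carrier (matrix_product_algebra r w)"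
 by (auto simp: matrix_unit_def matrix_product_algebra_def)

lemma matrix_unit_mult:
 assumes "j < r" "p < w j" "q < w j" "j' < r" "p' < w j'" "q' < w j'"
 shows "(matrix_unit r w j p q :: 'k::field mat list) \<otimes>\<^bsub>matrix_product_algebra r w\<^esub> matrix_unit r w j' p' q'
  = (if j = j' \<and> q = p' then matrix_unit r w j p q' else \<zero>\<^bsub>matrix_product_algebra r w\<^esub>)"
  (is "?L = ?R")
proof (rule nth_equalityI)
 show "length ?L = length ?R" by (simp add: matrix_unit_def matrix_product_algebra_def)
 fix l assume "l < length ?L"
 then have l: "l < r" by (simp add: matrix_unit_def matrix_product_algebra_def)
 show "?L ! l = ?R ! l"
 proof (rule eq_matI)
  fix a b
  assume "a < dim_row (?R ! l)" "b < dim_col (?R ! l)"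
  then have ab: "a < w l" "b < w l" using l by (auto simp: matrix_unit_def matrix_product_algebra_def split: if_splits)
  let ?x = "\<lambda>i. if l = j \<and> a = p \<and> i = q then 1 else (0::'k)" and ?y = "\<lambda>i. if l = j' \<and> i = p' \<and> b = q' then 1 else (0::'k)"
  have "?L ! l $$ (a, b) = (\<Sum>i<w l. ?x i * ?y i)"
   using l ab by (simp add: matrix_unit_def matrix_product_algebra_def scalar_prod_def atLeast0LessThan)
  also have "\<dots> = (\<Sum>i<w l. if i = q then (if l = j \<and> a = p \<and> l = j' \<and> q = p' \<and> b = q' then 1 else 0) else 0)"
   by (rule sum.cong) auto
  also have "\<dots> = (if l = j \<and> a = p \<and> l = j' \<and> q = p' \<and> b = q' then 1 else 0)"
   using assms(3) by (auto simp: sum.delta)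
  also have "\<dots> = ?R ! l $$ (a, b)"
   using l ab by (auto simp: matrix_unit_def matrix_product_algebra_def)
  finally show "?L ! l $$ (a, b) = ?R ! l $$ (a, b)" .
 qed (use l in \<open>auto simp: matrix_unit_def matrix_product_algebra_def\<close>)
qed

definition unit_index :: "nat \<Rightarrow> (nat \<Rightarrow> nat) \<Rightarrow> (nat \<times> nat \<times> nat) set" where
 "unit_index r w = (SIGMA j:{..<r}. {..<w j} \<times> {..<w j})"

lemma finite_unit_index [simp]: "finite (unit_index r w)" by (simp add: unit_index_def)

lemma unit_index_iff [simp]: "(j, p, q) \<in> unit_index r w \<longleftrightarrow> j < r \<and> p < w j \<and> q < w j"
 by (auto simp: unit_index_def)

lemma sum_unit_index:
 "(\<Sum>(j, p, q)\<in>unit_index r w. g j p q) = (\<Sum>j<r. \<Sum>p<w j. \<Sum>q<w j. g j p q)"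
proof -
 have "(\<Sum>j<r. \<Sum>p<w j. \<Sum>q<w j. g j p q) = (\<Sum>j<r. \<Sum>(p, q)\<in>{..<w j} \<times> {..<w j}. g j p q)"
  by (simp add: sum.cartesian_product)
 also have "\<dots> = (\<Sum>(j, p, q)\<in>unit_index r w. g j p q)"
  unfolding unit_index_def by (subst sum.Sigma) auto
 finally show ?thesis ..
qed

definition mentry :: "'k mat list \<Rightarrow> nat \<times> nat \<times> nat \<Rightarrow> 'k" where
 "mentry a t = (case t of (j, p, q) \<Rightarrow> (a ! j) $$ (p, q))"

lemma (in scalars) matrix_expand:
 fixes F :: "'k mat list \<Rightarrow> 'r"
 assumes add: "\<And>a b. a \<in> carrier (matrix_product_algebra r w) ==> b \<in> carrier (matrix_product_algebra r w)
   ==> F (a \<oplus>\<^bsub>matrix_product_algebra r w\<^esub> b) = F a + F b"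
  and hom: "\<And>c a. a \<in> carrier (matrix_product_algebra r w) ==> F (c \<odot>\<^bsub>matrix_product_algebra r w\<^esub> a) = sc c (F a)"
  and a: "a \<in> carrier (matrix_product_algebra r w)"
 shows "F a = (\<Sum>t\<in>unit_index r w. sc (mentry a t) (case t of (j, p, q) \<Rightarrow> F (matrix_unit r w j p q)))"
proof -
 let ?A = "matrix_product_algebra r w :: ('k, 'k mat list) module"
 interpret A: assoc_algebra ?A by (rule matrix_product_assoc_algebra)
 \<comment> \<open>an element is built up from its entries one at a time\<close>
 define cut where "cut S = map (\<lambda>j. mat (w j) (w j) (\<lambda>(p, q). if (j, p, q) \<in> S then (a ! j) $$ (p, q) else 0)) [0..<r]" for S
 have cutA: "cut S \<in> carrier ?A" for S by (auto simp: cut_def matrix_product_algebra_def)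
 have "F (cut S) = (\<Sum>t\<in>S. sc (mentry a t) (case t of (j, p, q) \<Rightarrow> F (matrix_unit r w j p q)))"
  if "finite S" "S \<subseteq> unit_index r w" for S
  using that
 proof (induction S rule: finite_induct)
  case empty
  have "cut {} = \<zero>\<^bsub>?A\<^esub>" by (auto simp: cut_def matrix_product_algebra_def intro!: nth_equalityI eq_matI)
  then show ?case using add[of "\<zero>\<^bsub>?A\<^esub>" "\<zero>\<^bsub>?A\<^esub>"] by simp
 next
  case (insert t S)
  obtain j p q where t: "t = (j, p, q)" by (cases t)
  have r: "j < r" "p < w j" "q < w j" using insert.prems t by auto
  have "cut (insert t S) = (mentry a t \<odot>\<^bsub>?A\<^esub> matrix_unit r w j p q) \<oplus>\<^bsub>?A\<^esub> cut S"
   by (rule nth_equalityI)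
    (use insert.hyps t r in \<open>auto simp: cut_def matrix_product_algebra_def matrix_unit_def mentry_def intro!: eq_matI\<close>)
  then have "F (cut (insert t S)) = sc (mentry a t) (F (matrix_unit r w j p q)) + F (cut S)"
   using add[of "mentry a t \<odot>\<^bsub>?A\<^esub> matrix_unit r w j p q" "cut S"] hom[OF matrix_unit_closed] cutA
    A.scal_closed[OF matrix_unit_closed] by simp
  then show ?case using insert t by simp
 qed
 from this[of "unit_index r w"] have "F (cut (unit_index r w)) = (\<Sum>t\<in>unit_index r w. sc (mentry a t) (case t of (j, p, q) \<Rightarrow> F (matrix_unit r w j p q)))" by simp
 moreover have "cut (unit_index r w) = a"
  by (rule nth_equalityI) (use a in \<open>auto simp: cut_def matrix_product_algebra_def intro!: eq_matI\<close>)
 ultimately show ?thesis by simp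
qed

lemma (in scalars) unit_sum_one:
 "(\<Sum>t\<in>unit_index r w. sc (mentry \<one>\<^bsub>matrix_product_algebra r w\<^esub> t) (case t of (j, p, q) \<Rightarrow> E j p q))
  = (\<Sum>(j, p)\<in>(SIGMA j:{..<r}. {..<w j}). E j p p)"
proof -
 have "(\<Sum>t\<in>unit_index r w. sc (mentry \<one>\<^bsub>matrix_product_algebra r w\<^esub> t) (case t of (j, p, q) \<Rightarrow> E j p q))
  = (\<Sum>t\<in>unit_index r w. case t of (j, p, q) \<Rightarrow> if q = p then E j p p else 0)"
  by (rule sum.cong) (auto simp: mentry_def matrix_product_algebra_def)
 also have "\<dots> = (\<Sum>j<r. \<Sum>p<w j. \<Sum>q<w j. if q = p then E j p p else 0)"
  unfolding unit_index_def by (subst sum.Sigma[symmetric], simp, simp, subst sum.Sigma[symmetric], simp_all)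
 also have "\<dots> = (\<Sum>j<r. \<Sum>p<w j. E j p p)" by simp
 finally show ?thesis by (simp add: sum.Sigma)
qed

context
 fixes m :: nat and r :: "nat \<Rightarrow> nat" and w :: "nat \<Rightarrow> nat \<Rightarrow> nat"
begin

abbreviation "fp \<equiv> semisimple_free_product m r w :: ('k::field, 'k coprod) module"
abbreviation "fpu \<equiv> free_product_matrix_unit m r w"
abbreviation "factor i \<equiv> matrix_product_algebra (r i) (w i) :: ('k::field, 'k mat list) module"
abbreviation "incl \<equiv> free_product_incl {..<m} (\<lambda>i. matrix_product_algebra (r i) (w i))"

lemma incl_hom: "i < m ==> incl i \<in> alg_hom (factor i) (fp :: ('k::field, 'k coprod) module)"
 unfolding semisimple_free_product_def
 by (rule free_product_incl_hom) (auto intro: matrix_product_assoc_algebra)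

lemma incl_facts:
 assumes "i < m"
 shows "a \<in> carrier (factor i :: ('k::field, 'k mat list) module) ==> incl i a \<in> carrier fp"
  and "a \<in> carrier (factor i) ==> b \<in> carrier (factor i) ==> incl i (a \<oplus>\<^bsub>factor i\<^esub> b) = incl i a \<oplus>\<^bsub>fp\<^esub> incl i b"
  and "a \<in> carrier (factor i) ==> b \<in> carrier (factor i) ==> incl i (a \<otimes>\<^bsub>factor i\<^esub> b) = incl i a \<otimes>\<^bsub>fp\<^esub> incl i b"
  and "a \<in> carrier (factor i) ==> incl i (c \<odot>\<^bsub>factor i\<^esub> a) = c \<odot>\<^bsub>fp\<^esub> incl i a"
  and "incl i \<one>\<^bsub>factor i :: ('k, 'k mat list) module\<^esub> = \<one>\<^bsub>fp\<^esub>"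
 using incl_hom[OF assms, where 'k = 'k] unfolding alg_hom_def
 by (auto simp: ring_hom_closed ring_hom_add ring_hom_mult ring_hom_one)

lemma fpu_closed: "i < m ==> fpu i j p q \<in> carrier (fp :: ('k::field, 'k coprod) module)"
 unfolding free_product_matrix_unit_def by (rule incl_facts(1)) (auto intro: matrix_unit_closed)

lemma rep_incl:
 assumes "scalars sc" and L: "algebra_rep (fp :: ('k::field, 'k coprod) module) sc I L" and i: "i < m"
  and a: "a \<in> carrier (factor i)"
 shows "L (incl i a) = (\<Sum>t\<in>unit_index (r i) (w i). sc (mentry a t) (case t of (j, p, q) \<Rightarrow> L (fpu i j p q)))"
proof -
 interpret scalars sc by (rule assms(1))
 show ?thesis unfolding free_product_matrix_unit_def
  by (rule matrix_expand[where F = "\<lambda>a. L (incl i a)", OF _ _ a])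
   (use algebra_repD[OF L] incl_facts[OF i, where 'k = 'k] in auto)
qed

lemma rep_units:
 assumes sc: "scalars sc" and L: "algebra_rep (fp :: ('k::field, 'k coprod) module) sc I L" and i: "i < m"
 shows "[|j < r i; p < w i j; q < w i j; j' < r i; p' < w i j'; q' < w i j'|] ==>
   L (fpu i j p q) * L (fpu i j' p' q') = (if j = j' \<and> q = p' then L (fpu i j p q') else 0)"
  and "(\<Sum>(j, p)\<in>(SIGMA j:{..<r i}. {..<w i j}). L (fpu i j p p)) = I"
proof -
 interpret scalars sc by (rule sc)
 interpret A: assoc_algebra "factor i :: ('k, 'k mat list) module" by (rule matrix_product_assoc_algebra)
 interpret F: assoc_algebra "fp :: ('k, 'k coprod) module" by (rule semisimple_free_product_assoc_algebra)
 note f = incl_facts[OF i, where 'k = 'k]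
 have L0: "L \<zero>\<^bsub>fp\<^esub> = 0" using algebra_repD(1)[OF L F.zero_closed F.zero_closed] by simp
 have i0: "incl i \<zero>\<^bsub>factor i\<^esub> = (\<zero>\<^bsub>fp\<^esub> :: 'k coprod)"
  using f(2)[OF A.zero_closed A.zero_closed] f(1)[OF A.zero_closed] by (simp add: F.add.l_cancel_one')
 show "L (fpu i j p q) * L (fpu i j' p' q') = (if j = j' \<and> q = p' then L (fpu i j p q') else 0)"
  if "j < r i" "p < w i j" "q < w i j" "j' < r i" "p' < w i j'" "q' < w i j'"
 proof -
  have "L (fpu i j p q) * L (fpu i j' p' q') = L (incl i (matrix_unit (r i) (w i) j p q \<otimes>\<^bsub>factor i\<^esub> matrix_unit (r i) (w i) j' p' q'))"
   unfolding free_product_matrix_unit_def f(3)[OF matrix_unit_closed matrix_unit_closed]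
   by (rule algebra_repD(2)[OF L, symmetric]) (auto intro: f(1) matrix_unit_closed)
  then show ?thesis
   unfolding matrix_unit_mult[OF that] free_product_matrix_unit_def by (auto simp: i0 L0)
 qed
 show "(\<Sum>(j, p)\<in>(SIGMA j:{..<r i}. {..<w i j}). L (fpu i j p p)) = I"
  using rep_incl[OF sc L i A.one_closed] algebra_repD(4)[OF L] f(5)
  by (simp add: unit_sum_one)
qed

lemma fp_carrier:
 "carrier (fp :: ('k::field, 'k coprod) module) = free_product_class {..<m} (\<lambda>i. factor i) ` carrier (free_algebra (Sigma {..<m} (\<lambda>i. carrier (factor i))))"
 unfolding semisimple_free_product_def
 by (rule free_product_carrier_class) (rule matrix_product_assoc_algebra)

text \<open>The elements \<open>x\<close> with \<open>T * L x = L' x * T\<close> form a subalgebra, and the matrix units generate.\<close>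

lemma rep_commute:
 assumes sc: "scalars sc" and L: "algebra_rep (fp :: ('k::field, 'k coprod) module) sc I L"
  and L': "algebra_rep (fp :: ('k::field, 'k coprod) module) sc J L'"
  and T: "J * T = T" "T * I = T"
  and units: "\<And>i j p q. [|i < m; j < r i; p < w i j; q < w i j|] ==> T * L (fpu i j p q) = L' (fpu i j p q) * T"
  and x: "x \<in> carrier fp"
 shows "T * L x = L' x * T"
proof -
 interpret scalars sc by (rule sc)
 interpret F: assoc_algebra "fp :: ('k, 'k coprod) module" by (rule semisimple_free_product_assoc_algebra)
 let ?X = "Sigma {..<m} (\<lambda>i. carrier (factor i :: ('k, 'k mat list) module))"
 let ?cl = "free_product_class {..<m} (\<lambda>i. factor i :: ('k, 'k mat list) module)"
 have alg: "assoc_algebra (factor i :: ('k, 'k mat list) module)" for i by (rule matrix_product_assoc_algebra)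
 note l = algebra_repD[OF L] and l' = algebra_repD[OF L']
 note ops = free_product_class_ops[where I = "{..<m}" and A = "\<lambda>i. factor i :: ('k, 'k mat list) module", OF alg, folded semisimple_free_product_def]
 have cl: "?cl p \<in> carrier fp" if "p \<in> carrier (free_algebra ?X)" for p using that fp_carrier by blast
 have o: "1 \<in> carrier (free_algebra ?X)" using const_closed[of 1] by (simp add: const_simps)
 obtain p where p: "p \<in> carrier (free_algebra ?X)" "x = ?cl p" using x fp_carrier by blast
 have "T * L (?cl p) = L' (?cl p) * T" using p(1)
 proof (induction p rule: free_algebra_induct)
  case (const c)
  have "?cl (const c) = c \<odot>\<^bsub>fp\<^esub> \<one>\<^bsub>fp\<^esub>" using ops(3)[OF o o] ops(4)[OF o o] by simp
  then show ?case using l(3)[OF F.one_closed] l'(3)[OF F.one_closed] l(4) l'(4) T by (simp add: sc_mult_left sc_mult_right)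
 next
  case (gen y)
  then obtain i a where y: "y = (i, a)" "i < m" "a \<in> carrier (factor i)" by auto
  have "?cl (gen y) = incl i a" by (simp add: y(1) free_product_incl_def)
  moreover have "T * L (incl i a) = L' (incl i a) * T"
   unfolding rep_incl[OF sc L y(2,3)] rep_incl[OF sc L' y(2,3)] sum_distrib_left sum_distrib_right
   by (rule sum.cong) (auto simp: sc_mult_left sc_mult_right units y(2))
  ultimately show ?case by simp
 next
  case (add p q)
  have "?cl (p + q) = ?cl p \<oplus>\<^bsub>fp\<^esub> ?cl q" using ops(1)[OF add(1,2)] by simp
  then show ?case using add l(1)[OF cl[OF add(1)] cl[OF add(2)]] l'(1)[OF cl[OF add(1)] cl[OF add(2)]]
   by (simp add: distrib_left distrib_right)
 next
  case (mult p q)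
  have e: "?cl (p * q) = ?cl p \<otimes>\<^bsub>fp\<^esub> ?cl q" using ops(2)[OF mult(1,2)] by simp
  have "T * (L (?cl p) * L (?cl q)) = L' (?cl p) * (T * L (?cl q))" using mult(3) by (simp add: mult.assoc[symmetric])
  then show ?case using e mult l(2)[OF cl[OF mult(1)] cl[OF mult(2)]] l'(2)[OF cl[OF mult(1)] cl[OF mult(2)]]
   by (simp add: mult.assoc)
 qed
 with p show ?thesis by simp
qed

text \<open>By the universal property, systems of matrix units, one for each factor, define representations.\<close>

lemma rep_from_units:
 fixes E :: "nat \<Rightarrow> nat \<Rightarrow> nat \<Rightarrow> nat \<Rightarrow> 'r::ring" and sc :: "'k::field \<Rightarrow> 'r \<Rightarrow> 'r"
 assumes sc: "scalars sc" and I: "I * I = I"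
  and corner: "\<And>i j p q. [|i < m; j < r i; p < w i j; q < w i j|] ==> I * E i j p q = E i j p q \<and> E i j p q * I = E i j p q"
  and mult: "\<And>i j p q j' p' q'. [|i < m; j < r i; p < w i j; q < w i j; j' < r i; p' < w i j'; q' < w i j'|] ==>
   E i j p q * E i j' p' q' = (if j = j' \<and> q = p' then E i j p q' else 0)"
  and one: "\<And>i. i < m ==> (\<Sum>(j, p)\<in>(SIGMA j:{..<r i}. {..<w i j}). E i j p p) = I"
 shows "\<exists>L. algebra_rep fp sc I L \<and> (\<forall>i j p q. i < m \<longrightarrow> j < r i \<longrightarrow> p < w i j \<longrightarrow> q < w i j \<longrightarrow> L (fpu i j p q) = E i j p q)"
proof -
 interpret scalars sc by (rule sc)
 let ?B = "\<lparr>carrier = {x. I * x = x \<and> x * I = x}, mult = (*), one = I, zero = 0, add = (+), smult = sc\<rparr>"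
 interpret B: assoc_algebra ?B by (rule corner_algebra[OF sc I])
 define f where "f i a = (\<Sum>t\<in>unit_index (r i) (w i). sc (mentry a t) (case t of (j, p, q) \<Rightarrow> E i j p q))" for i a
 have fB: "f i a \<in> carrier ?B" if "i < m" for i a
  using that corner unfolding f_def
  by (auto simp: sum_distrib_left sum_distrib_right sc_mult_left sc_mult_right intro!: sum.cong)
 have f_hom: "f i \<in> alg_hom (factor i) ?B" if i: "i < m" for i
  unfolding alg_hom_def
 proof (intro CollectI conjI ballI allI ring_hom_memI)
  fix a assume a: "a \<in> carrier (factor i :: ('k, 'k mat list) module)"
  show "f i a \<in> carrier ?B" by (rule fB[OF i])
  show "f i (c \<odot>\<^bsub>factor i\<^esub> a) = c \<odot>\<^bsub>?B\<^esub> f i a" for c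
  proof -
   have "mentry (c \<odot>\<^bsub>factor i\<^esub> a) t = c * mentry a t" if "t \<in> unit_index (r i) (w i)" for t
    using a that by (cases t) (auto simp: mentry_def matrix_product_algebra_def)
   then show ?thesis by (simp add: f_def sc_sum_right sc_sc)
  qed
  fix b assume b: "b \<in> carrier (factor i :: ('k, 'k mat list) module)"
  have "mentry (a \<oplus>\<^bsub>factor i\<^esub> b) t = mentry a t + mentry b t" if "t \<in> unit_index (r i) (w i)" for t
   using a b that by (cases t) (auto simp: mentry_def matrix_product_algebra_def)
  then show "f i (a \<oplus>\<^bsub>factor i\<^esub> b) = f i a \<oplus>\<^bsub>?B\<^esub> f i b" by (simp add: f_def sc_add_left sum.distrib)
  have mab: "mentry (a \<otimes>\<^bsub>factor i\<^esub> b) (j, p, q) = (\<Sum>z<w i j. mentry a (j, p, z) * mentry b (j, z, q))"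
   if "(j, p, q) \<in> unit_index (r i) (w i)" for j p q
  proof -
   have "dim_row (a ! j) = w i j" "dim_col (a ! j) = w i j" "dim_row (b ! j) = w i j" "dim_col (b ! j) = w i j"
    using a b that by (auto simp: matrix_product_algebra_def)
   then show ?thesis using a b that
    by (auto simp: mentry_def matrix_product_algebra_def scalar_prod_def atLeast0LessThan)
  qed
  have "f i a * f i b = (\<Sum>t\<in>unit_index (r i) (w i). \<Sum>s\<in>unit_index (r i) (w i).
    sc (mentry a t * mentry b s) ((case t of (j, p, q) \<Rightarrow> E i j p q) * (case s of (j, p, q) \<Rightarrow> E i j p q)))"
   unfolding f_def sum_product by (intro sum.cong refl) (simp add: sc_mult_left sc_mult_right sc_sc[symmetric] mult.commute)
  also have "\<dots> = (\<Sum>(j, p, z)\<in>unit_index (r i) (w i). \<Sum>q<w i j. sc (mentry a (j, p, z) * mentry b (j, z, q)) (E i j p q))"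
  proof (rule sum.cong[OF refl])
   fix t assume "t \<in> unit_index (r i) (w i)"
   moreover obtain j p z where tt: "t = (j, p, z)" by (cases t)
   ultimately have t: "(j, p, z) \<in> unit_index (r i) (w i)" by simp
   have "(\<Sum>s\<in>unit_index (r i) (w i). sc (mentry a (j, p, z) * mentry b s) (E i j p z * (case s of (j, p, q) \<Rightarrow> E i j p q)))
    = (\<Sum>s\<in>(\<lambda>q. (j, z, q)) ` {..<w i j}. sc (mentry a (j, p, z) * mentry b s) (E i j p z * (case s of (j, p, q) \<Rightarrow> E i j p q)))"
    by (rule sum.mono_neutral_right) (use t i in \<open>auto simp: mult image_iff split: if_splits\<close>)
   also have "\<dots> = (\<Sum>q<w i j. sc (mentry a (j, p, z) * mentry b (j, z, q)) (E i j p q))"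
    by (subst sum.reindex) (use t i in \<open>auto simp: inj_on_def mult intro!: sum.cong\<close>)
   finally show "(\<Sum>s\<in>unit_index (r i) (w i). sc (mentry a t * mentry b s)
     ((case t of (j, p, q) \<Rightarrow> E i j p q) * (case s of (j, p, q) \<Rightarrow> E i j p q)))
    = (case t of (j, p, z) \<Rightarrow> \<Sum>q<w i j. sc (mentry a (j, p, z) * mentry b (j, z, q)) (E i j p q))"
    unfolding tt prod.case .
  qed
  also have "\<dots> = (\<Sum>j<r i. \<Sum>p<w i j. \<Sum>z<w i j. \<Sum>q<w i j. sc (mentry a (j, p, z) * mentry b (j, z, q)) (E i j p q))"
   by (rule sum_unit_index)
  also have "\<dots> = (\<Sum>j<r i. \<Sum>p<w i j. \<Sum>q<w i j. \<Sum>z<w i j. sc (mentry a (j, p, z) * mentry b (j, z, q)) (E i j p q))"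
   by (rule sum.cong[OF refl], rule sum.cong[OF refl], rule sum.swap)
  also have "\<dots> = (\<Sum>(j, p, q)\<in>unit_index (r i) (w i). sc (mentry (a \<otimes>\<^bsub>factor i\<^esub> b) (j, p, q)) (E i j p q))"
   unfolding sum_unit_index by (simp add: mab sc_sum_left)
  also have "\<dots> = f i (a \<otimes>\<^bsub>factor i\<^esub> b)" unfolding f_def by (rule sum.cong) auto
  finally show "f i (a \<otimes>\<^bsub>factor i\<^esub> b) = f i a \<otimes>\<^bsub>?B\<^esub> f i b" by simp
 next
  show "f i \<one>\<^bsub>factor i\<^esub> = \<one>\<^bsub>?B\<^esub>"
   unfolding f_def by (simp add: unit_sum_one one[OF i])
 qed
 have alg: "assoc_algebra (factor i :: ('k, 'k mat list) module)" for i by (rule matrix_product_assoc_algebra)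
 have f_hom': "f i \<in> alg_hom (factor i) ?B" if "i \<in> {..<m}" for i using f_hom that by simp
 have "\<exists>h. h \<in> alg_hom (free_product {..<m} (\<lambda>i. factor i :: ('k, 'k mat list) module)) ?B \<inter>
   extensional (carrier (free_product {..<m} (\<lambda>i. factor i :: ('k, 'k mat list) module))) \<and>
   (\<forall>i\<in>{..<m}. \<forall>a\<in>carrier (factor i). h (incl i a) = f i a)"
  by (rule ex1_implies_ex[OF free_product_universal[OF alg B.assoc_algebra_axioms f_hom']])
 then obtain h where "h \<in> alg_hom (free_product {..<m} (\<lambda>i. factor i :: ('k, 'k mat list) module)) ?B \<inter>
   extensional (carrier (free_product {..<m} (\<lambda>i. factor i :: ('k, 'k mat list) module))) \<and>
   (\<forall>i\<in>{..<m}. \<forall>a\<in>carrier (factor i). h (incl i a) = f i a)" by (elim exE)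
 then have h: "h \<in> alg_hom fp ?B" "\<And>i a. i < m ==> a \<in> carrier (factor i) ==> h (incl i a) = f i a"
  by (simp_all add: semisimple_free_product_def)
 have hr: "h \<in> Ring.ring_hom fp ?B" using h(1) by (simp add: alg_hom_def)
 have "algebra_rep fp sc I h"
  unfolding algebra_rep_def using h(1) ring_hom_add[OF hr] ring_hom_mult[OF hr] ring_hom_one[OF hr]
  by (simp add: alg_hom_def)
 moreover have "h (fpu i j p q) = E i j p q" if "i < m" "j < r i" "p < w i j" "q < w i j" for i j p q
 proof -
  have "h (fpu i j p q) = f i (matrix_unit (r i) (w i) j p q)"
   unfolding free_product_matrix_unit_def by (rule h(2)[OF that(1) matrix_unit_closed])
  also have "\<dots> = (\<Sum>t\<in>unit_index (r i) (w i). if t = (j, p, q) then E i j p q else 0)"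
   unfolding f_def by (rule sum.cong) (auto simp: mentry_def matrix_unit_def split: if_splits)
  also have "\<dots> = E i j p q" using that by simp
  finally show ?thesis .
 qed
 ultimately show ?thesis by blast
qed

end

declare dimension_vector.simps [simp del]

section \<open>A complement of the image of a linear map\<close>

text \<open>Extend a basis of the image of \<open>\<delta>\<close> to one of the target. By rank and nullity \<open>card BC + card B0 - card BD\<close>
vectors are added, and these are the \<open>X k\<close>.\<close>

lemma (in vector_space) cokernel_complement:
 assumes add: "\<And>x y. \<delta> (x + y) = \<delta> x + \<delta> y" and hom: "\<And>c x. \<delta> (scale c x) = scale c (\<delta> x)"
  and BD: "finite BD" "independent BD" and BC: "finite BC" "independent BC"
  and maps: "\<And>x. x \<in> span BD ==> \<delta> x \<in> span BC"
  and B0: "finite B0" "independent B0" and ker: "{x \<in> span BD. \<delta> x = 0} = span B0"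
 shows "card BD \<le> card BC + card B0 \<and> (\<exists>X :: nat \<Rightarrow> 'b.
  (\<forall>k < card BC + card B0 - card BD. X k \<in> span BC) \<and>
  (\<forall>y\<in>span BC. \<exists>x\<in>span BD. \<exists>\<xi>. y = \<delta> x + (\<Sum>k < card BC + card B0 - card BD. scale (\<xi> k) (X k))) \<and>
  (\<forall>x\<in>span BD. \<forall>\<xi>. \<delta> x + (\<Sum>k < card BC + card B0 - card BD. scale (\<xi> k) (X k)) = 0 \<longrightarrow>
   (\<forall>k < card BC + card B0 - card BD. \<xi> k = 0)))"
proof -
 interpret vp: vector_space_pair scale scale ..
 have lin: "Vector_Spaces.linear scale scale \<delta>"
  by unfold_locales (auto simp: add hom)
 have \<delta>sum: "\<delta> (\<Sum>v\<in>S. scale (u v) (f v)) = (\<Sum>v\<in>S. scale (u v) (\<delta> (f v)))" for S u and f :: "'z \<Rightarrow> 'b"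
 proof (induction S rule: infinite_finite_induct)
  case empty show ?case using hom[of 0 0] by simp
  case (infinite A) show ?case using hom[of 0 0] infinite by simp
 qed (auto simp: add hom)
 have B0D: "B0 \<subseteq> span BD" using ker span_superset[of B0] by blast
 obtain B where B: "B0 \<subseteq> B" "B \<subseteq> span BD" "independent B" "span BD \<subseteq> span B"
  using maximal_independent_subset_extend[OF B0D B0(2)] .
 have finB: "finite B" using independent_span_bound[OF BD(1) B(3,2)] by blast
 have cardB: "card B = card BD"
  using basis_card_eq_dim[OF B(2,4,3)] dim_span_eq_card_independent[OF BD(2)] by simp
 define G where "G = B - B0"
 have finG: "finite G" using finB by (simp add: G_def)
 have GD: "G \<subseteq> span BD" using B by (auto simp: G_def)
 have cardG: "card G + card B0 = card BD"
  using card_Diff_subset[OF B0(1) B(1)] card_mono[OF finB B(1)] cardB by (simp add: G_def)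
 have zero: "\<forall>v\<in>G. u v = 0" if s: "\<delta> (\<Sum>v\<in>G. scale (u v) v) = 0" for u
 proof -
  have "(\<Sum>v\<in>G. scale (u v) v) \<in> span BD" using GD by (intro span_sum span_scale) blast
  then have "(\<Sum>v\<in>G. scale (u v) v) \<in> span B0" using s ker by blast
  then obtain t where t: "(\<Sum>v\<in>G. scale (u v) v) = (\<Sum>v\<in>B0. scale (t v) v)"
   unfolding span_finite[OF B0(1)] by blast
  define y where "y v = (if v \<in> G then u v else - t v)" for v
  have "B = G \<union> B0" "G \<inter> B0 = {}" using B(1) by (auto simp: G_def)
  then have "(\<Sum>v\<in>B. scale (y v) v) = (\<Sum>v\<in>G. scale (y v) v) + (\<Sum>v\<in>B0. scale (y v) v)"
   using finG B0(1) by (simp add: sum.union_disjoint)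
  also have "(\<Sum>v\<in>G. scale (y v) v) = (\<Sum>v\<in>G. scale (u v) v)" by (simp add: y_def)
  also have "(\<Sum>v\<in>B0. scale (y v) v) = (\<Sum>v\<in>B0. - scale (t v) v)"
   by (rule sum.cong) (auto simp: y_def G_def)
  finally have "(\<Sum>v\<in>B. scale (y v) v) = 0" using t by (simp add: sum_negf)
  then have "y v = 0" if "v \<in> B" for v using independentD[OF B(3) finB order_refl] that by blast
  then show ?thesis using G_def y_def by (metis DiffE)
 qed
 have inj: "inj_on \<delta> (span G)"
 proof (rule inj_onI)
  fix x y assume xy: "x \<in> span G" "y \<in> span G" "\<delta> x = \<delta> y"
  obtain u where u: "x - y = (\<Sum>v\<in>G. scale (u v) v)"
   using span_diff[OF xy(1,2)] unfolding span_finite[OF finG] by blast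
  have "\<delta> x = \<delta> (x - y) + \<delta> y" using add[of "x - y" y] by simp
  then have "\<forall>v\<in>G. u v = 0" using zero[of u] xy(3) u by simp
  then have "x - y = 0" unfolding u by simp
  then show "x = y" by simp
 qed
 define E where "E = \<delta> ` G"
 have Eind: "independent E" unfolding E_def
  by (rule vp.linear_independent_injective_image[OF lin independent_mono[OF B(3)] inj]) (auto simp: G_def)
 have injG: "inj_on \<delta> G" by (rule inj_on_subset[OF inj span_superset])
 have cardE: "card E = card G" unfolding E_def by (rule card_image[OF injG])
 have finE: "finite E" using finG by (simp add: E_def)
 have EC: "E \<subseteq> span BC" using maps GD by (auto simp: E_def)
 obtain F where F: "E \<subseteq> F" "F \<subseteq> span BC" "independent F" "span BC \<subseteq> span F"
  using maximal_independent_subset_extend[OF EC Eind] .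
 have finF: "finite F" using independent_span_bound[OF BC(1) F(3,2)] by blast
 have cardF: "card F = card BC"
  using basis_card_eq_dim[OF F(2,4,3)] dim_span_eq_card_independent[OF BC(2)] by simp
 define n where "n = card BC + card B0 - card BD"
 have le: "card G \<le> card BC" using card_mono[OF finF F(1)] cardE cardF by simp
 have "card (F - E) = n"
  using card_Diff_subset[OF finE F(1)] cardE cardF cardG le by (simp add: n_def)
 then obtain X where X: "bij_betw X {..<n} (F - E)"
  using ex_bij_betw_nat_finite[of "F - E"] finF by (auto simp: atLeast0LessThan)
 have Xsum: "(\<Sum>k<n. g (X k)) = (\<Sum>v\<in>F - E. g v)" for g :: "'b \<Rightarrow> 'b"
  by (rule sum.reindex_bij_betw[OF X])
 have FE: "F = E \<union> (F - E)" using F(1) by blast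
 have "X k \<in> span BC" if "k < n" for k using X F(2) that unfolding bij_betw_def by blast
 moreover have "\<exists>x\<in>span BD. \<exists>\<xi>. y = \<delta> x + (\<Sum>k<n. scale (\<xi> k) (X k))" if "y \<in> span BC" for y
 proof -
  obtain u where u: "y = (\<Sum>v\<in>F. scale (u v) v)" using F(4) \<open>y \<in> span BC\<close> unfolding span_finite[OF finF] by blast
  have "y = (\<Sum>v\<in>E. scale (u v) v) + (\<Sum>v\<in>F - E. scale (u v) v)"
   unfolding u by (subst FE, subst sum.union_disjoint) (use finF finE in auto)
  also have "(\<Sum>v\<in>E. scale (u v) v) = \<delta> (\<Sum>v\<in>G. scale (u (\<delta> v)) v)"
   unfolding E_def \<delta>sum by (simp add: sum.reindex[OF injG])
  also have "(\<Sum>v\<in>F - E. scale (u v) v) = (\<Sum>k<n. scale (u (X k)) (X k))" by (rule Xsum[symmetric])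
  finally have "y = \<delta> (\<Sum>v\<in>G. scale (u (\<delta> v)) v) + (\<Sum>k<n. scale (u (X k)) (X k))" .
  moreover have "(\<Sum>v\<in>G. scale (u (\<delta> v)) v) \<in> span BD" using GD by (intro span_sum span_scale) blast
  ultimately show ?thesis by (intro bexI exI)
 qed
 moreover have "\<xi> k = 0" if x: "x \<in> span BD" and s: "\<delta> x + (\<Sum>k<n. scale (\<xi> k) (X k)) = 0" and k: "k < n" for x \<xi> k
 proof -
  have "x \<in> span B" using x B(4) by blast
  then obtain u where u: "x = (\<Sum>v\<in>B. scale (u v) v)" unfolding span_finite[OF finB] by blast
  have "\<delta> x = (\<Sum>v\<in>B. scale (u v) (\<delta> v))" unfolding u \<delta>sum ..
  also have "\<dots> = (\<Sum>v\<in>G. scale (u v) (\<delta> v))"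
   by (rule sum.mono_neutral_right) (use finB ker span_base[of _ B0] in \<open>auto simp: G_def\<close>)
  also have "\<dots> = (\<Sum>v\<in>E. scale (u (the_inv_into G \<delta> v)) v)"
   unfolding E_def by (simp add: sum.reindex[OF injG] the_inv_into_f_f[OF injG])
  finally have dx: "\<delta> x = (\<Sum>v\<in>E. scale (u (the_inv_into G \<delta> v)) v)" .
  define y where "y v = (if v \<in> E then u (the_inv_into G \<delta> v) else \<xi> (the_inv_into {..<n} X v))" for v
  have injX: "inj_on X {..<n}" using X unfolding bij_betw_def by blast
  have XF: "X l \<in> F - E" if "l < n" for l using X that unfolding bij_betw_def by blast
  have yX: "y (X l) = \<xi> l" if "l < n" for l using XF[OF that] that by (simp add: y_def the_inv_into_f_f[OF injX])
  have "(\<Sum>v\<in>F. scale (y v) v) = (\<Sum>v\<in>E. scale (y v) v) + (\<Sum>v\<in>F - E. scale (y v) v)"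
   by (subst FE, subst sum.union_disjoint) (use finF finE in auto)
  also have "(\<Sum>v\<in>F - E. scale (y v) v) = (\<Sum>k<n. scale (y (X k)) (X k))" by (rule Xsum[symmetric])
  also have "\<dots> = (\<Sum>k<n. scale (\<xi> k) (X k))" by (simp add: yX)
  also have "(\<Sum>v\<in>E. scale (y v) v) = \<delta> x" unfolding dx by (simp add: y_def)
  finally have "(\<Sum>v\<in>F. scale (y v) v) = 0" using s by simp
  then have "y (X k) = 0" using independentD[OF F(3) finF order_refl] XF[OF k] by blast
  then show ?thesis using yX[OF k] by simp
 qed
 ultimately show ?thesis using cardG le unfolding n_def by (intro conjI exI[of _ X]) auto
qed

interpretation vs2: vector_space "sc2 :: 'k::field \<Rightarrow> 'k fmat fmat \<Rightarrow> 'k fmat fmat"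
 by unfold_locales (auto simp: sc2.sc_add_left sc2.sc_add_right sc2.sc_sc)

text \<open>The standard basis of the block matrices, indexed by block and position in the block.\<close>

definition e4 :: "(nat \<times> nat) \<times> (nat \<times> nat) \<Rightarrow> 'k::field fmat fmat" where
 "e4 t = (case t of ((a, b), (p, q)) \<Rightarrow> eunit a b (eunit p q 1))"

lemma ent_e4: "ent (ent (e4 t) a b) p q = (if t = ((a, b), (p, q)) then 1 else 0)"
 by (cases t) (auto simp: e4_def split: if_splits)

lemma e4_sum:
 assumes "finite W"
 shows "ent (ent (\<Sum>t\<in>W. sc2 (z t) (e4 t)) a b) p q = (if ((a, b), (p, q)) \<in> W then z ((a, b), (p, q)) else 0)"
proof -
 have "ent (ent (\<Sum>t\<in>W. sc2 (z t) (e4 t)) a b) p q = (\<Sum>t\<in>W. if t = ((a, b), (p, q)) then z ((a, b), (p, q)) else 0)"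
  by (auto simp: ent_e4 intro!: sum.cong)
 then show ?thesis using assms by simp
qed

lemma e4_inj: "inj_on (e4 :: _ \<Rightarrow> 'k::field fmat fmat) W"
proof (rule inj_onI)
 fix s t assume "(e4 s :: 'k fmat fmat) = e4 t"
 moreover obtain a b p q where "s = ((a, b), (p, q))" by (metis surj_pair)
 ultimately show "s = t" using ent_e4[of t a b p q, where 'a = 'k] ent_e4[of s a b p q, where 'a = 'k]
  by (auto split: if_splits)
qed

lemma e4_independent:
 assumes "finite W"
 shows "vs2.independent (e4 ` W :: 'k::field fmat fmat set)"
proof (rule vs2.independent_if_scalars_zero)
 fix f :: "'k fmat fmat \<Rightarrow> 'k" and x :: "'k fmat fmat"
 assume s: "(\<Sum>x\<in>e4 ` W. sc2 (f x) x) = 0" and x: "x \<in> e4 ` W"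
 have z: "(\<Sum>t\<in>W. sc2 (f (e4 t)) (e4 t)) = 0" using s by (simp add: sum.reindex[OF e4_inj])
 obtain a b p q where t: "((a, b), (p, q)) \<in> W" "x = e4 ((a, b), (p, q))"
  using x by (metis imageE surj_pair)
 show "f x = 0" using e4_sum[OF assms, of "\<lambda>t. f (e4 t)" a b p q] t unfolding z by simp
qed (use assms in simp)

lemma e4_span:
 assumes "finite W"
 shows "(x :: 'k::field fmat fmat) \<in> vs2.span (e4 ` W) \<longleftrightarrow> (\<forall>a b p q. ent (ent x a b) p q \<noteq> 0 \<longrightarrow> ((a, b), (p, q)) \<in> W)"
proof
 assume "x \<in> vs2.span (e4 ` W)"
 then obtain u where "x = (\<Sum>v\<in>e4 ` W. sc2 (u v) v)" unfolding vs2.span_finite[OF finite_imageI[OF assms]] by blast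
 then have x: "x = (\<Sum>t\<in>W. sc2 (u (e4 t)) (e4 t))" by (simp add: sum.reindex[OF e4_inj])
 show "\<forall>a b p q. ent (ent x a b) p q \<noteq> 0 \<longrightarrow> ((a, b), (p, q)) \<in> W"
  unfolding x e4_sum[OF assms] by auto
next
 assume *: "\<forall>a b p q. ent (ent x a b) p q \<noteq> 0 \<longrightarrow> ((a, b), (p, q)) \<in> W"
 define z where "z t = (case t of ((a, b), (p, q)) \<Rightarrow> ent (ent x a b) p q)" for t
 have "x = (\<Sum>t\<in>W. sc2 (z t) (e4 t))"
  by (rule fmat_eqI, rule fmat_eqI, subst e4_sum[OF assms]) (use * in \<open>auto simp: z_def\<close>)
 also have "\<dots> \<in> vs2.span (e4 ` W)" by (intro vs2.span_sum vs2.span_scale vs2.span_base) auto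
 finally show "x \<in> vs2.span (e4 ` W)" .
qed

lemma corner_iff:
 fixes x :: "'k::field fmat"
 shows "(idn {..<a} * x = x \<and> x * idn {..<b} = x) \<longleftrightarrow> (\<forall>i j. ent x i j \<noteq> 0 \<longrightarrow> i < a \<and> j < b)"
proof
 assume "idn {..<a} * x = x \<and> x * idn {..<b} = x"
 then show "\<forall>i j. ent x i j \<noteq> 0 \<longrightarrow> i < a \<and> j < b"
  by (metis ent_idn_times ent_times_idn finite_lessThan lessThan_iff)
next
 assume "\<forall>i j. ent x i j \<noteq> 0 \<longrightarrow> i < a \<and> j < b"
 then show "idn {..<a} * x = x \<and> x * idn {..<b} = x"
  by (intro conjI; intro fmat_eqI) (auto simp: ent_idn_times ent_times_idn)
qed

section \<open>Eigenvectors\<close>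

lemma eigenvector_exists:
 fixes T :: "'k::alg_closed_field fmat"
 assumes d: "d > 0" and T: "idn {..<d} * T = T" "T * idn {..<d} = T"
 shows "\<exists>c. \<exists>x\<in>col (idn {..<d}) U1. x \<noteq> 0 \<and> T * x = sc1 c x"
proof -
 define A where "A = mat d d (\<lambda>(i, j). ent T i j)"
 have A: "A \<in> carrier_mat d d" by (simp add: A_def)
 have "degree (char_poly A) > 0" using degree_monic_char_poly[OF A] d by simp
 then obtain c where "poly (char_poly A) c = 0" using alg_closed_imp_poly_has_root by blast
 then obtain v where v: "eigenvector A v c" using eigenvalue_root_char_poly[OF A] unfolding eigenvalue_def by blast
 then have vd: "v \<in> carrier_vec d" "v \<noteq> 0\<^sub>v d" "A *\<^sub>v v = c \<cdot>\<^sub>v v" using A unfolding eigenvector_def by auto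
 define x where "x = fm d 1 (\<lambda>i _. v $ i)"
 have x: "x \<in> col (idn {..<d}) U1" by (simp add: col1_iff x_def)
 obtain i where i: "i < d" "v $ i \<noteq> 0" using vd(1,2) by (metis carrier_vecD eq_vecI index_zero_vec)
 then have "ent x i 0 \<noteq> 0" by (simp add: x_def)
 then have "x \<noteq> 0" by auto
 moreover have "T * x = sc1 c x"
 proof (rule fmat_eqI)
  fix i j
  have Tx: "ent (T * x) i j = (\<Sum>l<d. ent T i l * ent x l j)"
   by (rule ent_times_right) (auto simp: x_def split: if_splits)
  show "ent (T * x) i j = ent (sc1 c x) i j"
  proof (cases "i < d \<and> j = 0")
   case True
   then have "(A *\<^sub>v v) $ i = (\<Sum>l<d. ent T i l * v $ l)"
    using vd(1) by (simp add: A_def scalar_prod_def atLeast0LessThan)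
   also have "\<dots> = ent (T * x) i j" unfolding Tx using True by (simp add: x_def)
   finally show ?thesis using vd(1,3) True by (simp add: x_def)
  next
   case False
   have "idn {..<d} * (T * x) = T * x" using T(1) by (simp add: mult.assoc[symmetric])
   then have "ent (T * x) i j = ent (idn {..<d} * (T * x)) i j" by simp
   then show ?thesis using False unfolding Tx by (auto simp: ent_idn_times x_def Tx)
  qed
 qed
 ultimately show ?thesis using x by blast
qed

section \<open>The simple modules\<close>

text \<open>Throughout, \<open>c S\<close> are coordinates on the simple module \<open>S\<close>, and \<open>L S\<close> is the action of the algebra in
these coordinates.\<close>

locale simples =
 fixes m :: nat and r :: "nat \<Rightarrow> nat" and w :: "nat \<Rightarrow> nat \<Rightarrow> nat"
  and \<S> :: "('k::alg_closed_field coprod, 'v) module set"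
  and c :: "('k coprod, 'v) module \<Rightarrow> 'v \<Rightarrow> 'k fmat" and L :: "('k coprod, 'v) module \<Rightarrow> 'k coprod \<Rightarrow> 'k fmat"
 assumes w_pos: "\<And>i j. [|i < m; j < r i|] ==> w i j \<ge> 1"
  and fin: "finite \<S>"
  and fin_dim: "\<And>S. S \<in> \<S> ==> vectorspace.fin_dim class_ring (over_field (semisimple_free_product m r w) S)"
  and simple: "\<And>S. S \<in> \<S> ==> simple_module (semisimple_free_product m r w) S"
  and noniso: "\<And>S T. [|S \<in> \<S>; T \<in> \<S>; S \<noteq> T|] ==> \<not> isomorphic_modules (semisimple_free_product m r w) S T"
  and mc: "\<And>S. S \<in> \<S> ==> frame.mcoord sc1 (idn {..<dimension_vector m r w S Sink}) U1
    (semisimple_free_product m r w) S (c S) (L S)"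
begin

abbreviation "A \<equiv> semisimple_free_product m r w :: ('k, 'k coprod) module"
abbreviation "e \<equiv> free_product_matrix_unit m r w :: nat \<Rightarrow> nat \<Rightarrow> nat \<Rightarrow> nat \<Rightarrow> 'k coprod"
abbreviation "d S \<equiv> dimension_vector m r w S Sink"
abbreviation "\<rho> S i j \<equiv> dimension_vector m r w S (Source i j)"
abbreviation "I S \<equiv> idn {..<d S} :: 'k fmat"
abbreviation "E S i j p q \<equiv> L S (e i j p q)"

lemma A_alg: "assoc_algebra A" by (rule semisimple_free_product_assoc_algebra)

lemma fr: "frame sc1 (I S) U1 {..<d S} (\<lambda>k. eunit k 0 1) (\<lambda>k. eunit 0 k (1 :: 'k))"
 by (rule frame1) simp

lemmas S_mcoord = frame.mcoordD[OF fr mc]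

lemma S_rep: "S \<in> \<S> ==> algebra_rep A sc1 (I S) (L S)" by (rule S_mcoord(3))

lemma S_left_module: "S \<in> \<S> ==> left_module A S" by (rule S_mcoord(1))

lemma I_idem: "I S * I S = I S" by (rule frame.I_idem[OF fr])

lemma d_pos: assumes S: "S \<in> \<S>" shows "d S > 0"
proof (rule ccontr)
 assume "\<not> d S > 0"
 then have "I S = 0" by (intro fmat_eqI) (simp add: ent_idn)
 then have "col (I S) U1 = {0}" by (auto simp: col_def)
 then have z: "c S x = 0" if "x \<in> carrier S" for x using S_mcoord(8)[OF S that] by simp
 interpret left_module A S by (rule S_left_module[OF S])
 have "x = \<zero>\<^bsub>S\<^esub>" if "x \<in> carrier S" for x
  using S_mcoord(10)[OF S that M.zero_closed] z that by simp
 then have "carrier S = {\<zero>\<^bsub>S\<^esub>}" using M.zero_closed by blast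
 then show False using simple[OF S] unfolding simple_module_def by simp
qed

lemma I_nonzero: "S \<in> \<S> ==> I S \<noteq> 0"
 using d_pos[of S] ent_idn[of "{..<d S}" 0 0, where 'a = 'k] by auto

text \<open>A nonzero homomorphism between simple modules is an isomorphism, and an endomorphism has an eigenvalue,
so subtracting this multiple of the identity leaves a homomorphism with a kernel.\<close>

lemma schur:
 assumes S: "S \<in> \<S>" and T: "T \<in> \<S>" and X: "I T * X = X" "X * I S = X"
  and comm: "\<And>i j p q. [|i < m; j < r i; p < w i j; q < w i j|] ==> X * E S i j p q = E T i j p q * X"
 shows "S = T ==> \<exists>a. X = sc1 a (I S)" and "S \<noteq> T ==> X = 0"
proof -
 interpret S: left_module A S by (rule S_left_module[OF S])
 interpret T: left_module A T by (rule S_left_module[OF T])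
 have hom: "X = 0" if XT: "I T * X = X" "X * I S = X"
  and com: "\<And>i j p q. [|i < m; j < r i; p < w i j; q < w i j|] ==> X * E S i j p q = E T i j p q * X"
  and nb: "\<And>f. f \<in> module_hom A S T ==> \<forall>x\<in>carrier S. c T (f x) = X * c S x ==> \<not> bij_betw f (carrier S) (carrier T)" for X
 proof -
  have XL: "\<forall>a\<in>carrier A. X * L S a = L T a * X"
   using rep_commute[OF sc1.scalars_axioms S_rep[OF S] S_rep[OF T] XT com] by blast
  define f where "f = (\<lambda>x\<in>carrier S. inv_into (carrier T) (c T) (X * c S x))"
  note mh = matrix_hom[OF fr fr mc[OF S] mc[OF T] XT XL]
  have f: "f \<in> module_hom A S T" using mh(1) by (simp add: f_def)
  have cf: "c T (f x) = X * c S x" if "x \<in> carrier S" for x using mh(2)[OF that] that by (simp add: f_def)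
  have f': "\<And>x. x \<in> carrier S ==> f x \<in> carrier T" "\<And>x y. x \<in> carrier S ==> y \<in> carrier S ==> f (x \<oplus>\<^bsub>S\<^esub> y) = f x \<oplus>\<^bsub>T\<^esub> f y"
   "\<And>a x. a \<in> carrier A ==> x \<in> carrier S ==> f (a \<odot>\<^bsub>S\<^esub> x) = a \<odot>\<^bsub>T\<^esub> f x"
   using f unfolding LinearCombinations.module_hom_def by auto
  have f0: "f \<zero>\<^bsub>S\<^esub> = \<zero>\<^bsub>T\<^esub>"
   using f'(2)[OF S.M.zero_closed S.M.zero_closed] f'(1)[OF S.M.zero_closed] by simp
  have ker: "Module.submodule {x\<in>carrier S. f x = \<zero>\<^bsub>T\<^esub>} A S"
   by (rule S.submoduleI) (auto simp: f' f0 S.smult_closed T.smult_zero)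
  have im: "Module.submodule (f ` carrier S) A T"
   by (rule T.submoduleI)
    (use f0 in \<open>auto simp: f'(1) f'(2)[symmetric] f'(3)[symmetric] S.smult_closed intro: image_eqI[of _ _ "\<zero>\<^bsub>S\<^esub>"]\<close>)
  show "X = 0"
  proof (cases "{x\<in>carrier S. f x = \<zero>\<^bsub>T\<^esub>} = carrier S")
   case True
   have "X * z = 0" if z: "z \<in> col (I S) U1" for z
   proof -
    obtain x where x: "x \<in> carrier S" "c S x = z" using S_mcoord(9)[OF S z] by blast
    then have "f x = \<zero>\<^bsub>T\<^esub>" using True by blast
    then show ?thesis using cf[OF x(1)] S_mcoord(11)[OF T] x by simp
   qed
   then show ?thesis using frame.matrix_unique[OF fr XT(2), of 0] by simp
  next
   case False
   then have k0: "{x\<in>carrier S. f x = \<zero>\<^bsub>T\<^esub>} = {\<zero>\<^bsub>S\<^esub>}" using simple[OF S] ker unfolding simple_module_def by blast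
   have "f ` carrier S \<noteq> {\<zero>\<^bsub>T\<^esub>}" using False by force
   then have surj: "f ` carrier S = carrier T" using simple[OF T] im unfolding simple_module_def by blast
   have "inj_on f (carrier S)"
   proof (rule inj_onI)
    fix x y assume xy: "x \<in> carrier S" "y \<in> carrier S" "f x = f y"
    have "f x = f (x \<ominus>\<^bsub>S\<^esub> y) \<oplus>\<^bsub>T\<^esub> f y" using f'(2)[of "x \<ominus>\<^bsub>S\<^esub> y" y] xy S.cancel_minus by simp
    then have "f (x \<ominus>\<^bsub>S\<^esub> y) = \<zero>\<^bsub>T\<^esub>" using xy f'(1) by simp
    then have "x \<ominus>\<^bsub>S\<^esub> y = \<zero>\<^bsub>S\<^esub>" using k0 xy by blast
    then show "x = y" using S.cancel_minus[OF xy(1,2)] xy by simp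
   qed
   then have "bij_betw f (carrier S) (carrier T)" using surj by (simp add: bij_betw_def)
   then show ?thesis using nb[OF f] cf by blast
  qed
 qed
 show "S \<noteq> T ==> X = 0"
  using hom[OF X comm] noniso[OF S T] unfolding isomorphic_modules_def by blast
 assume ST: "S = T"
 obtain a x where x: "x \<in> col (I S) U1" "x \<noteq> 0" "X * x = sc1 a x"
  using eigenvector_exists[OF d_pos[OF S]] X ST by blast
 have "X - sc1 a (I S) = 0"
 proof (rule hom)
  show "(X - sc1 a (I S)) * E S i j p q = E T i j p q * (X - sc1 a (I S))"
   if "i < m" "j < r i" "p < w i j" "q < w i j" for i j p q
   using comm[OF that] algebra_rep_corner[OF A_alg S_rep[OF S] fpu_closed[OF that(1)]] ST
   by (simp add: left_diff_distrib right_diff_distrib sc1.sc_mult_left sc1.sc_mult_right)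
  fix f assume f: "\<forall>x\<in>carrier S. c T (f x) = (X - sc1 a (I S)) * c S x"
  show "\<not> bij_betw f (carrier S) (carrier T)"
  proof
   assume b: "bij_betw f (carrier S) (carrier T)"
   obtain y where y: "y \<in> carrier S" "c S y = x" using S_mcoord(9)[OF S x(1)] by blast
   have e1: "c T (f y) = 0" using f y x by (simp add: left_diff_distrib sc1.sc_mult_left colD)
   have e2: "c T (f \<zero>\<^bsub>S\<^esub>) = 0" using f S_mcoord(11)[OF S] by simp
   have "f y = f \<zero>\<^bsub>S\<^esub>"
    using S_mcoord(10)[OF T, of "f y" "f \<zero>\<^bsub>S\<^esub>"] e1 e2 b y unfolding bij_betw_def by auto
   then have "y = \<zero>\<^bsub>S\<^esub>" using b y unfolding bij_betw_def inj_on_def by auto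
   then show False using y x S_mcoord(11)[OF S] by simp
  qed
 qed (use X ST in \<open>auto simp: left_diff_distrib right_diff_distrib sc1.sc_mult_left sc1.sc_mult_right I_idem\<close>)
 then show "\<exists>a. X = sc1 a (I S)" by (intro exI[of _ a]) simp
qed

end

section \<open>Homomorphisms over one factor\<close>

context simples
begin

lemma E_corner: "S \<in> \<S> ==> i < m ==> I S * E S i j p q = E S i j p q"
 "S \<in> \<S> ==> i < m ==> E S i j p q * I S = E S i j p q"
 using algebra_rep_corner[OF A_alg S_rep fpu_closed] by blast+

lemma E_mult:
 "[|S \<in> \<S>; i < m; j < r i; p < w i j; q < w i j; j' < r i; p' < w i j'; q' < w i j'|] ==>
   E S i j p q * E S i j' p' q' = (if j = j' \<and> q = p' then E S i j p q' else 0)"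
 by (rule rep_units(1)[OF sc1.scalars_axioms S_rep])

abbreviation "JP i \<equiv> SIGMA j:{..<r i}. {..<w i j}"

lemma E_sum: "S \<in> \<S> ==> i < m ==> (\<Sum>(j, p)\<in>JP i. E S i j p p) = I S"
 by (rule rep_units(2)[OF sc1.scalars_axioms S_rep])

text \<open>The idempotent \<open>E S i j 0 0\<close> factors through coordinates on its image, whose dimension is an entry of the
dimension vector by definition.\<close>

lemma idempotent_splits:
 assumes S: "S \<in> \<S>" and i: "i < m" and j: "j < r i"
 shows "\<exists>P R. I S * P = P \<and> P * idn {..<\<rho> S i j} = P \<and> idn {..<\<rho> S i j} * R = R \<and> R * I S = R \<and>
  P * R = E S i j 0 0 \<and> R * P = idn {..<\<rho> S i j}"
proof -
 interpret A: assoc_algebra A by (rule A_alg)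
 interpret left_module A S by (rule S_left_module[OF S])
 let ?V = "over_field A S" and ?\<epsilon> = "e i j 0 0"
 interpret V: vectorspace class_ring ?V by (rule over_field_vectorspace[OF A_alg S_left_module[OF S]])
 have \<epsilon>: "?\<epsilon> \<in> carrier A" by (rule fpu_closed[OF i])
 have oneA: "a \<odot>\<^bsub>A\<^esub> \<one>\<^bsub>A\<^esub> \<in> carrier A" for a by simp
 have \<epsilon>sc: "?\<epsilon> \<odot>\<^bsub>S\<^esub> ((a \<odot>\<^bsub>A\<^esub> \<one>\<^bsub>A\<^esub>) \<odot>\<^bsub>S\<^esub> x) = (a \<odot>\<^bsub>A\<^esub> \<one>\<^bsub>A\<^esub>) \<odot>\<^bsub>S\<^esub> (?\<epsilon> \<odot>\<^bsub>S\<^esub> x)" if "x \<in> carrier S" for a x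
  using smult_assoc[OF \<epsilon> oneA that, of a] smult_assoc[OF oneA \<epsilon> that, of a] \<epsilon>
  by (simp add: A.smult_mult A.mult_smult)
 define T where "T x = ?\<epsilon> \<odot>\<^bsub>S\<^esub> x" for x
 have Tcl: "T x \<in> carrier S" if "x \<in> carrier S" for x using smult_closed[OF \<epsilon> that] by (simp add: T_def)
 have T_hom: "T \<in> module_hom class_ring ?V ?V"
  unfolding LinearCombinations.module_hom_def by (auto simp: T_def \<epsilon>sc smult_closed[OF \<epsilon>] smult_r_distr[OF \<epsilon>])
 interpret lm: linear_map class_ring ?V ?V T
  by (intro linear_map.intro mod_hom.intro mod_hom_axioms.intro V.vectorspace_axioms V.module_axioms T_hom)
 let ?W = "?V\<lparr>carrier := T ` carrier S\<rparr>"
 have W: "vectorspace class_ring ?W"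
  using V.subspace_is_vs[OF lm.imT_is_subspace] by (simp add: lm.im_def)
 interpret W: vectorspace class_ring ?W by (rule W)
 have T_hom': "T \<in> module_hom class_ring ?V ?W"
  using T_hom unfolding LinearCombinations.module_hom_def by auto
 interpret lm': linear_map class_ring ?V ?W T
  by (intro linear_map.intro mod_hom.intro mod_hom_axioms.intro V.vectorspace_axioms V.module_axioms
    W.vectorspace_axioms W.module_axioms T_hom')
 have Wfd: "W.fin_dim" by (rule lm'.rank_nullity_main(2)[OF fin_dim[OF S]]) simp
 have dimW: "W.dim = \<rho> S i j" by (simp add: dimension_vector.simps T_def)
 obtain c' where c': "frame.coord sc1 (idn {..<\<rho> S i j}) U1 ?W c'"
  using coordinates_exist[OF W Wfd] unfolding dimW by blast
 let ?J = "idn {..<\<rho> S i j} :: 'k fmat"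
 have fJ: "frame sc1 ?J U1 {..<\<rho> S i j} (\<lambda>k. eunit k 0 1) (\<lambda>k. eunit 0 k (1 :: 'k))" by (rule frame1) simp
 have bij': "bij_betw c' (T ` carrier S) (col ?J U1)"
  and c'_add: "\<And>x y. x \<in> T ` carrier S ==> y \<in> T ` carrier S ==> c' (x \<oplus>\<^bsub>S\<^esub> y) = c' x + c' y"
  and c'_sc: "\<And>a x. x \<in> T ` carrier S ==> c' ((a \<odot>\<^bsub>A\<^esub> \<one>\<^bsub>A\<^esub>) \<odot>\<^bsub>S\<^esub> x) = sc1 a (c' x)"
  using c' unfolding frame.coord_def[OF fJ] by auto
 define b' where "b' = inv_into (T ` carrier S) c'"
 have b'W: "b' z \<in> T ` carrier S" and cb': "c' (b' z) = z" if "z \<in> col ?J U1" for z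
  using that bij' unfolding b'_def bij_betw_def by (auto intro: inv_into_into f_inv_into_f)
 have bc': "b' (c' x) = x" if "x \<in> T ` carrier S" for x
  using that bij' unfolding b'_def bij_betw_def by (auto intro: inv_into_f_f)
 have c'C: "c' x \<in> col ?J U1" if "x \<in> T ` carrier S" for x using that bij' unfolding bij_betw_def by blast
 have WS: "x \<in> carrier S" if "x \<in> T ` carrier S" for x using that Tcl by blast
 have TT: "T (T x) = T x" if "x \<in> carrier S" for x
 proof -
  have "c S (T (T x)) = c S (T x)"
   using S_mcoord(4)[OF S \<epsilon>] that Tcl E_mult[OF S i j, of 0 0 j 0 0] w_pos[OF i j] j
   by (simp add: T_def smult_closed[OF \<epsilon>] mult.assoc[symmetric])
  then show ?thesis using S_mcoord(10)[OF S] Tcl that by simp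
 qed
 have TW: "T x = x" if "x \<in> T ` carrier S" for x using that TT by blast
 have W_add: "x \<oplus>\<^bsub>S\<^esub> y \<in> T ` carrier S" if "x \<in> T ` carrier S" "y \<in> T ` carrier S" for x y
  using W.add.m_closed[of x y] that by simp
 have W_sc: "(a \<odot>\<^bsub>A\<^esub> \<one>\<^bsub>A\<^esub>) \<odot>\<^bsub>S\<^esub> x \<in> T ` carrier S" if "x \<in> T ` carrier S" for a x
  using W.smult_closed[of a x] that by simp
 have b'_add: "b' (x + y) = b' x \<oplus>\<^bsub>S\<^esub> b' y" if "x \<in> col ?J U1" "y \<in> col ?J U1" for x y
  using bc'[OF W_add[OF b'W[OF that(1)] b'W[OF that(2)]]] c'_add[OF b'W[OF that(1)] b'W[OF that(2)]] cb' that by simp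
 have b'_sc: "b' (sc1 a x) = (a \<odot>\<^bsub>A\<^esub> \<one>\<^bsub>A\<^esub>) \<odot>\<^bsub>S\<^esub> b' x" if "x \<in> col ?J U1" for a x
  using bc'[OF W_sc[OF b'W[OF that]]] c'_sc[OF b'W[OF that]] cb' that by simp
 have "\<exists>P. I S * P = P \<and> P * ?J = P \<and> (\<forall>z\<in>col ?J U1. P * z = c S (b' z))"
 proof (rule frame.matrix_exists[OF fJ])
  show "c S (b' (x + y)) = c S (b' x) + c S (b' y)" if "x \<in> col ?J U1" "y \<in> col ?J U1" for x y
   using b'_add[OF that] S_mcoord(6)[OF S] WS b'W that by simp
  show "c S (b' (sc1 a x)) = sc1 a (c S (b' x))" if "x \<in> col ?J U1" for a x
   using b'_sc[OF that] S_mcoord(7)[OF S] WS b'W that by simp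
  show "c S (b' x) \<in> col (I S) U1" if "x \<in> col ?J U1" for x
   using S_mcoord(8)[OF S] WS b'W that by simp
 qed
 then obtain P where P: "I S * P = P" "P * ?J = P" "\<And>z. z \<in> col ?J U1 ==> P * z = c S (b' z)" by blast
 define b where "b = inv_into (carrier S) (c S)"
 have bS: "b z \<in> carrier S" and cb: "c S (b z) = z" if "z \<in> col (I S) U1" for z
  using that S_mcoord(5)[OF S] unfolding b_def bij_betw_def by (auto intro: inv_into_into f_inv_into_f)
 have bc: "b (c S x) = x" if "x \<in> carrier S" for x
  using that S_mcoord(5)[OF S] unfolding b_def bij_betw_def by (auto intro: inv_into_f_f)
 have b_add: "b (x + y) = b x \<oplus>\<^bsub>S\<^esub> b y" if "x \<in> col (I S) U1" "y \<in> col (I S) U1" for x y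
  using bc[of "b x \<oplus>\<^bsub>S\<^esub> b y"] S_mcoord(6)[OF S bS[OF that(1)] bS[OF that(2)]] bS cb that by simp
 have b_sc: "b (sc1 a x) = (a \<odot>\<^bsub>A\<^esub> \<one>\<^bsub>A\<^esub>) \<odot>\<^bsub>S\<^esub> b x" if "x \<in> col (I S) U1" for a x
  using bc[of "(a \<odot>\<^bsub>A\<^esub> \<one>\<^bsub>A\<^esub>) \<odot>\<^bsub>S\<^esub> b x"] S_mcoord(7)[OF S bS[OF that]] bS cb that smult_closed[OF oneA] by simp
 have "\<exists>R. ?J * R = R \<and> R * I S = R \<and> (\<forall>z\<in>col (I S) U1. R * z = c' (T (b z)))"
 proof (rule frame.matrix_exists[OF fr])
  show "c' (T (b (x + y))) = c' (T (b x)) + c' (T (b y))" if "x \<in> col (I S) U1" "y \<in> col (I S) U1" for x y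
   using b_add[OF that] c'_add bS that by (simp add: T_def smult_r_distr[OF \<epsilon>])
  show "c' (T (b (sc1 a x))) = sc1 a (c' (T (b x)))" if "x \<in> col (I S) U1" for a x
   using b_sc[OF that] c'_sc bS that by (simp add: T_def \<epsilon>sc)
  show "c' (T (b x)) \<in> col ?J U1" if "x \<in> col (I S) U1" for x
   using c'C bS that by simp
 qed
 then obtain R where R: "?J * R = R" "R * I S = R" "\<And>z. z \<in> col (I S) U1 ==> R * z = c' (T (b z))" by blast
 have "P * R = E S i j 0 0"
 proof (rule frame.matrix_unique[OF fr])
  fix z assume z: "z \<in> col (I S) U1"
  have "P * R * z = P * c' (T (b z))" using R(3)[OF z] by (simp add: mult.assoc)
  also have "\<dots> = c S (T (b z))" using P(3)[OF c'C] bc' bS[OF z] by simp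
  also have "\<dots> = E S i j 0 0 * z" using S_mcoord(4)[OF S \<epsilon> bS[OF z]] cb[OF z] by (simp add: T_def)
  finally show "P * R * z = E S i j 0 0 * z" .
 qed (use P R E_corner[OF S i] in \<open>auto simp: mult.assoc\<close>)
 moreover have "R * P = ?J"
 proof (rule frame.matrix_unique[OF fJ])
  fix z assume z: "z \<in> col ?J U1"
  have "R * P * z = R * c S (b' z)" using P(3)[OF z] by (simp add: mult.assoc)
  also have "\<dots> = c' (T (b' z))" using R(3)[OF S_mcoord(8)[OF S WS[OF b'W[OF z]]]] bc[OF WS[OF b'W[OF z]]] by simp
  also have "\<dots> = ?J * z" using TW[OF b'W[OF z]] cb'[OF z] colD(1)[OF z] by simp
  finally show "R * P * z = ?J * z" .
 qed (use P frame.I_idem[OF fJ] in \<open>auto simp: mult.assoc\<close>)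
 ultimately show ?thesis using P R by blast
qed

definition "splitting S i j PR \<longleftrightarrow> I S * fst PR = fst PR \<and> fst PR * idn {..<\<rho> S i j} = fst PR \<and>
  idn {..<\<rho> S i j} * snd PR = snd PR \<and> snd PR * I S = snd PR \<and>
  fst PR * snd PR = E S i j 0 0 \<and> snd PR * fst PR = idn {..<\<rho> S i j}"

definition "P S i j = fst (SOME PR. splitting S i j PR)"
definition "R S i j = snd (SOME PR. splitting S i j PR)"

lemma PR:
 assumes "S \<in> \<S>" "i < m" "j < r i"
 shows "I S * P S i j = P S i j" "P S i j * idn {..<\<rho> S i j} = P S i j"
  "idn {..<\<rho> S i j} * R S i j = R S i j" "R S i j * I S = R S i j"
  "P S i j * R S i j = E S i j 0 0" "R S i j * P S i j = idn {..<\<rho> S i j}"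
proof -
 have "\<exists>PR. splitting S i j PR" using idempotent_splits[OF assms] unfolding splitting_def by auto
 from someI_ex[OF this] show "I S * P S i j = P S i j" "P S i j * idn {..<\<rho> S i j} = P S i j"
  "idn {..<\<rho> S i j} * R S i j = R S i j" "R S i j * I S = R S i j"
  "P S i j * R S i j = E S i j 0 0" "R S i j * P S i j = idn {..<\<rho> S i j}"
  unfolding splitting_def P_def R_def by auto
qed

lemma R_E_P:
 assumes S: "S \<in> \<S>" and i: "i < m" and j: "j < r i"
 shows "R S i j * E S i j 0 0 = R S i j" "E S i j 0 0 * P S i j = P S i j"
proof -
 show 1: "R S i j * E S i j 0 0 = R S i j"
  using PR[OF S i j] by (metis mult.assoc)
 show 2: "E S i j 0 0 * P S i j = P S i j"
  using PR[OF S i j] by (metis mult.assoc)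
qed

lemma R_E:
 assumes S: "S \<in> \<S>" and i: "i < m" and j: "j < r i" and q: "q < w i j" and j': "j' < r i" "p' < w i j'" "q' < w i j'"
 shows "R S i j * E S i j 0 q * E S i j' p' q' = (if j = j' \<and> q = p' then R S i j * E S i j 0 q' else 0)"
  and "E S i j' p' q' * (E S i j q 0 * P S i j) = (if j = j' \<and> q' = q then E S i j p' 0 * P S i j else 0)"
proof -
 have w0: "0 < w i j" using w_pos[OF i j] by simp
 show "R S i j * E S i j 0 q * E S i j' p' q' = (if j = j' \<and> q = p' then R S i j * E S i j 0 q' else 0)"
  using E_mult[OF S i j w0 q j'] by (simp add: mult.assoc)
 show "E S i j' p' q' * (E S i j q 0 * P S i j) = (if j = j' \<and> q' = q then E S i j p' 0 * P S i j else 0)"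
  using E_mult[OF S i j' j q w0] by (simp add: mult.assoc[symmetric])
qed

text \<open>The images of the idempotents \<open>E S i j p p\<close> add up to \<open>S\<close>, and for fixed \<open>j\<close> the matrix units identify
them with each other. Summed over \<open>i\<close>, this turns the arrow term of the Euler form into \<open>m * d S * d T\<close>.\<close>

lemma dimension_factor:
 assumes S: "S \<in> \<S>" and i: "i < m"
 shows "(\<Sum>j<r i. w i j * \<rho> S i j) = d S"
proof -
 let ?K = "SIGMA j:{..<r i}. {..<w i j} \<times> {..<\<rho> S i j}"
 let ?u = "\<lambda>(j, p, l). E S i j p 0 * P S i j * eunit l 0 1" and ?v = "\<lambda>(j, p, l). eunit 0 l 1 * R S i j * E S i j 0 p"
 have U1: "U1 = eunit 0 0 (1 :: 'k)" by (simp add: U1_def)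
 have w0: "0 < w i j" if "j < r i" for j using w_pos[OF i that] by simp
 have uu: "eunit 0 l 1 * idn {..<n} * eunit l' 0 (1 :: 'k) = (if l = l' then U1 else 0)" if "l < n" "l' < n" for l l' n :: nat
  by (rule fmat_eqI) (use that in \<open>auto simp: ent_times_eunit ent_times_idn U1\<close>)
 interpret F: frame sc1 "I S" U1 "{..<d S}" "\<lambda>k. eunit k 0 1" "\<lambda>k. eunit 0 k (1 :: 'k)" by (rule fr)
 have "frame sc1 (I S) U1 ?K ?u ?v"
 proof
  show "finite ?K" by simp
  have "(\<Sum>k\<in>?K. ?u k * ?v k) = (\<Sum>j<r i. \<Sum>p<w i j. \<Sum>l<\<rho> S i j. E S i j p 0 * (P S i j * (eunit l l 1 * (R S i j * E S i j 0 p))))"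
   by (simp add: sum.Sigma sum.cartesian_product split_def mult.assoc eunit_times flip: mult.assoc[of "eunit _ 0 1" "eunit 0 _ 1"])
  also have "\<dots> = (\<Sum>j<r i. \<Sum>p<w i j. E S i j p p)"
  proof (intro sum.cong refl)
   fix j p assume jp: "j \<in> {..<r i}" "p \<in> {..<w i j}"
   then have j: "j < r i" and p: "p < w i j" by auto
   have "(\<Sum>l<\<rho> S i j. E S i j p 0 * (P S i j * (eunit l l 1 * (R S i j * E S i j 0 p))))
    = E S i j p 0 * (P S i j * (idn {..<\<rho> S i j} * (R S i j * E S i j 0 p)))"
    by (simp add: idn_def diag_def sum_distrib_left sum_distrib_right)
   also have "\<dots> = E S i j p 0 * (P S i j * R S i j) * E S i j 0 p"
    using PR[OF S i j] by (simp add: mult.assoc[symmetric])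
   also have "\<dots> = E S i j p p"
    using PR(5)[OF S i j] E_mult[OF S i j p w0[OF j] j w0[OF j] w0[OF j]] E_mult[OF S i j p w0[OF j] j w0[OF j] p] by simp
   finally show "(\<Sum>l<\<rho> S i j. E S i j p 0 * (P S i j * (eunit l l 1 * (R S i j * E S i j 0 p)))) = E S i j p p" .
  qed
  also have "\<dots> = I S" using E_sum[OF S i] by (simp add: sum.Sigma)
  finally show "I S = (\<Sum>k\<in>?K. ?u k * ?v k)" ..
  show "U1 * U1 = (U1 :: 'k fmat)" "U1 \<noteq> (0 :: 'k fmat)" by (fact F.U_idem F.U_nonzero)+
  show "\<exists>a. U1 * x * U1 = sc1 a (U1 :: 'k fmat)" for x by (rule F.U_scalar)
 next
  fix k assume "k \<in> ?K"
  show "?u k * U1 = ?u k" by (cases k) (simp add: mult.assoc U1 eunit_times)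
  show "U1 * ?v k = ?v k" by (cases k) (simp add: mult.assoc[symmetric] U1 eunit_times)
 next
  fix k k' assume kk: "k \<in> ?K" "k' \<in> ?K"
  obtain j p l j' p' l' where k: "k = (j, p, l)" "k' = (j', p', l')" by (metis surj_pair)
  have b: "j < r i" "p < w i j" "l < \<rho> S i j" "j' < r i" "p' < w i j'" "l' < \<rho> S i j'" using kk k by auto
  have "?v k * ?u k' = eunit 0 l 1 * (R S i j * E S i j 0 p * E S i j' p' 0) * P S i j' * eunit l' 0 1"
   by (simp add: k mult.assoc)
  also have "\<dots> = (if j = j' \<and> p = p' then eunit 0 l 1 * (R S i j * E S i j 0 0 * P S i j) * eunit l' 0 1 else 0)"
   using R_E(1)[OF S i b(1,2,4,5) w0[OF b(4)]] by (simp add: mult.assoc)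
  also have "\<dots> = (if k = k' then U1 else 0)"
  proof -
   have "R S i j * E S i j 0 0 * P S i j = idn {..<\<rho> S i j}" using R_E_P[OF S i b(1)] PR(6)[OF S i b(1)] by simp
   then show ?thesis using uu b k by auto
  qed
  finally show "?v k * ?u k' = (if k = k' then U1 else 0)" .
 qed
 from frame_card[OF F.frame_axioms this] show ?thesis by simp
qed

text \<open>The maps \<open>S \<rightarrow> T\<close> that are linear over the \<open>i\<close>-th factor correspond to families of linear maps
 between the spaces cut out by the first diagonal matrix units.\<close>

definition expand where
 "expand S T i z = (\<Sum>(j, p)\<in>JP i. E T i j p 0 * P T i j * z j * (R S i j * E S i j 0 p))"

lemma expand_linear:
 "expand S T i (\<lambda>j. y j + z j) = expand S T i y + expand S T i z"
 "expand S T i (\<lambda>j. sc1 a (z j)) = sc1 a (expand S T i z)"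
 by (simp_all add: expand_def distrib_left distrib_right sum.distrib sc1.sc_sum_right split_def
   sc1.sc_mult_left sc1.sc_mult_right)

definition "factor_linear S T i k \<longleftrightarrow> I T * k = k \<and> k * I S = k \<and>
  (\<forall>j p q. j < r i \<longrightarrow> p < w i j \<longrightarrow> q < w i j \<longrightarrow> k * E S i j p q = E T i j p q * k)"

lemma expand_factor_linear:
 assumes S: "S \<in> \<S>" and T: "T \<in> \<S>" and i: "i < m"
 shows "factor_linear S T i (expand S T i z)"
 unfolding factor_linear_def
proof (intro conjI allI impI)
 show "I T * expand S T i z = expand S T i z" "expand S T i z * I S = expand S T i z"
  unfolding expand_def sum_distrib_left sum_distrib_right
  by (rule sum.cong; use E_corner[OF S i] E_corner[OF T i] in \<open>auto simp: mult.assoc\<close>;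
   use E_corner[OF T i] in \<open>auto simp: mult.assoc[symmetric]\<close>)+
 fix j p q assume b: "j < r i" "p < w i j" "q < w i j"
 have "expand S T i z * E S i j p q = (\<Sum>(j', p')\<in>JP i. E T i j' p' 0 * P T i j' * z j' * (R S i j' * E S i j' 0 p' * E S i j p q))"
  by (simp add: expand_def sum_distrib_right split_def mult.assoc)
 also have "\<dots> = (\<Sum>k\<in>JP i. if k = (j, p) then E T i j p 0 * P T i j * z j * (R S i j * E S i j 0 q) else 0)"
  by (rule sum.cong) (auto simp: R_E(1)[OF S i _ _ b] split: if_splits)
 also have "\<dots> = E T i j p 0 * P T i j * z j * (R S i j * E S i j 0 q)" using b by simp
 also have "\<dots> = (\<Sum>k\<in>JP i. if k = (j, q) then E T i j p 0 * P T i j * z j * (R S i j * E S i j 0 q) else 0)" using b by simp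
 also have "\<dots> = (\<Sum>(j', p')\<in>JP i. E T i j p q * (E T i j' p' 0 * P T i j') * z j' * (R S i j' * E S i j' 0 p'))"
  by (rule sum.cong) (auto simp: R_E(2)[OF T i _ _ b] split: if_splits)
 also have "\<dots> = E T i j p q * expand S T i z"
  by (simp add: expand_def sum_distrib_left split_def mult.assoc)
 finally show "expand S T i z * E S i j p q = E T i j p q * expand S T i z" .
qed

lemma expand_inverse:
 assumes S: "S \<in> \<S>" and T: "T \<in> \<S>" and i: "i < m" and j: "j < r i"
  and z: "idn {..<\<rho> T i j} * z j = z j" "z j * idn {..<\<rho> S i j} = z j"
 shows "R T i j * expand S T i z * P S i j = z j"
proof -
 have w0: "0 < w i j" using w_pos[OF i j] by simp
 have "expand S T i z * P S i j = expand S T i z * E S i j 0 0 * P S i j"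
  using R_E_P(2)[OF S i j] by (simp add: mult.assoc)
 also have "expand S T i z * E S i j 0 0 = (\<Sum>(j', p')\<in>JP i. E T i j' p' 0 * P T i j' * z j' * (R S i j' * E S i j' 0 p' * E S i j 0 0))"
  by (simp add: expand_def sum_distrib_right split_def mult.assoc)
 also have "\<dots> = (\<Sum>k\<in>JP i. if k = (j, 0) then E T i j 0 0 * P T i j * z j * (R S i j * E S i j 0 0) else 0)"
  by (rule sum.cong) (auto simp: R_E(1)[OF S i _ _ j w0 w0] split: if_splits)
 also have "\<dots> = P T i j * z j * R S i j" using j w0 R_E_P[OF S i j] R_E_P[OF T i j] by simp
 finally have "R T i j * expand S T i z * P S i j = (R T i j * P T i j) * z j * (R S i j * P S i j)"
  by (simp add: mult.assoc)
 then show ?thesis using PR(6)[OF S i j] PR(6)[OF T i j] z by simp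
qed

lemma factor_linear_expand:
 assumes S: "S \<in> \<S>" and T: "T \<in> \<S>" and i: "i < m" and k: "factor_linear S T i k"
 shows "expand S T i (\<lambda>j. R T i j * k * P S i j) = k"
proof -
 have "expand S T i (\<lambda>j. R T i j * k * P S i j) = (\<Sum>(j, p)\<in>JP i. k * E S i j p p)"
  unfolding expand_def
 proof (rule sum.cong[OF refl], clarsimp)
  fix j p assume j: "j < r i" and p: "p < w i j"
  have w0: "0 < w i j" using p by simp
  have kE: "k * E S i j a b = E T i j a b * k" if "a < w i j" "b < w i j" for a b
   using k that j unfolding factor_linear_def by blast
  have "E T i j p 0 * P T i j * (R T i j * k * P S i j) * (R S i j * E S i j 0 p)
   = E T i j p 0 * (P T i j * R T i j) * k * (P S i j * R S i j) * E S i j 0 p" by (simp add: mult.assoc)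
  also have "\<dots> = E T i j p 0 * k * E S i j 0 p"
   using PR(5)[OF S i j] PR(5)[OF T i j] E_mult[OF T i j p w0 j w0 w0] E_mult[OF S i j w0 w0 j w0 p]
   by (simp add: mult.assoc)
  also have "\<dots> = k * (E S i j p 0 * E S i j 0 p)" using kE[OF p w0] by (simp add: mult.assoc[symmetric])
  finally show "E T i j p 0 * P T i j * (R T i j * k * P S i j) * (R S i j * E S i j 0 p) = k * E S i j p p"
   using E_mult[OF S i j p w0 j w0 p] by simp
 qed
 also have "\<dots> = k * (\<Sum>(j, p)\<in>JP i. E S i j p p)" by (simp add: sum_distrib_left split_def)
 also have "\<dots> = k * I S" using E_sum[OF S i] by simp
 finally show ?thesis using k by (simp add: factor_linear_def)
qed

end

context simples
begin

definition count :: "('k coprod, 'v) module \<Rightarrow> ('k coprod, 'v) module \<Rightarrow> nat" where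
 "count S T = nat (let e = euler_form (gamma_quiver m r w) (dimension_vector m r w S) (dimension_vector m r w T)
   in if S = T then 1 - e else - e)"

lemma euler_form_simples:
 assumes S: "S \<in> \<S>" and T: "T \<in> \<S>"
 shows "euler_form (gamma_quiver m r w) (dimension_vector m r w S) (dimension_vector m r w T)
  = int (d S * d T) + int (\<Sum>i<m. \<Sum>j<r i. \<rho> S i j * \<rho> T i j) - int (m * d S * d T)"
proof -
 let ?JJ = "SIGMA i:{..<m}. {..<r i}"
 have verts: "verts (gamma_quiver m r w) = insert Sink ((\<lambda>(i, j). Source i j) ` ?JJ)"
  by (auto simp: gamma_quiver_def)
 have vsum: "(\<Sum>v\<in>verts (gamma_quiver m r w). int (dimension_vector m r w S v) * int (dimension_vector m r w T v))
   = int (d S) * int (d T) + (\<Sum>(i, j)\<in>?JJ. int (\<rho> S i j) * int (\<rho> T i j))"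
  unfolding verts
  by (subst sum.insert) (auto simp: sum.reindex inj_on_def split_def)
 have arcs: "arcs (gamma_quiver m r w) = (SIGMA i:{..<m}. SIGMA j:{..<r i}. {..<w i j})"
  by (auto simp: gamma_quiver_def)
 have "(\<Sum>a\<in>arcs (gamma_quiver m r w). int (dimension_vector m r w S (tail (gamma_quiver m r w) a)) *
   int (dimension_vector m r w T (head (gamma_quiver m r w) a)))
   = (\<Sum>(i, j, k)\<in>(SIGMA i:{..<m}. SIGMA j:{..<r i}. {..<w i j}). int (\<rho> S i j) * int (d T))"
  unfolding arcs by (simp add: gamma_quiver_def split_def)
 also have "\<dots> = (\<Sum>i<m. \<Sum>(j, k)\<in>JP i. int (\<rho> S i j) * int (d T))"
  by (subst sum.Sigma) (auto simp: split_def)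
 also have "\<dots> = (\<Sum>i<m. \<Sum>j<r i. \<Sum>k<w i j. int (\<rho> S i j) * int (d T))"
  by (rule sum.cong[OF refl], subst sum.Sigma) auto
 also have "\<dots> = (\<Sum>i<m. int (\<Sum>j<r i. w i j * \<rho> S i j) * int (d T))"
  by (simp add: sum_distrib_right mult.assoc)
 also have "\<dots> = (\<Sum>i<m. int (d S) * int (d T))" using dimension_factor[OF S] by simp
 finally have asum: "(\<Sum>a\<in>arcs (gamma_quiver m r w). int (dimension_vector m r w S (tail (gamma_quiver m r w) a)) *
   int (dimension_vector m r w T (head (gamma_quiver m r w) a))) = int m * int (d S) * int (d T)" by simp
 show ?thesis unfolding euler_form_def vsum asum by (simp add: sum.Sigma split_def)
qed

text \<open>An extension of \<open>S\<close> by \<open>T\<close> is given by a family of linear maps from \<open>S\<close> to \<open>T\<close>, one for each factor, because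
each factor alone is semisimple. Changing the splitting by a linear map \<open>f\<close>, and the splittings over the factors
by maps \<open>h i\<close> that are linear over the \<open>i\<close>-th factor, alters it by the coboundary, the family of all \<open>f - h i\<close>.
A pair of \<open>f\<close> and \<open>h\<close> is stored in one block matrix: the entry \<open>(0, 0)\<close> is \<open>f\<close>, and the entries \<open>(i + 1, j)\<close> are
the family that corresponds to \<open>h i\<close> under \<open>expand\<close>.\<close>

definition coboundary where
 "coboundary S T x = (\<Sum>i<m. eunit i 0 (ent x 0 0 - expand S T i (\<lambda>j. ent x (Suc i) j)))"

definition cochain_index where
 "cochain_index S T = (\<lambda>(q, p). ((0, 0), (q, p))) ` ({..<d T} \<times> {..<d S}) \<union>
   (\<lambda>(i, j, q, p). ((Suc i, j), (q, p))) ` (SIGMA i:{..<m}. SIGMA j:{..<r i}. {..<\<rho> T i j} \<times> {..<\<rho> S i j})"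

definition cocycle_index where
 "cocycle_index S T = (\<lambda>(i, q, p). ((i, 0 :: nat), (q, p))) ` ({..<m} \<times> {..<d T} \<times> {..<d S})"

lemma index_finite: "finite (cochain_index S T)" "finite (cocycle_index S T)"
 by (auto simp: cochain_index_def cocycle_index_def)

lemma card_cochain_index: "card (cochain_index S T) = d T * d S + (\<Sum>i<m. \<Sum>j<r i. \<rho> T i j * \<rho> S i j)"
proof -
 have "card (cochain_index S T) = card ((\<lambda>(q, p). ((0 :: nat, 0 :: nat), (q, p))) ` ({..<d T} \<times> {..<d S}))
  + card ((\<lambda>(i, j, q, p). ((Suc i, j), (q, p))) ` (SIGMA i:{..<m}. SIGMA j:{..<r i}. {..<\<rho> T i j} \<times> {..<\<rho> S i j}))"
  unfolding cochain_index_def by (rule card_Un_disjoint) auto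
 also have "\<dots> = d T * d S + (\<Sum>i<m. \<Sum>j<r i. \<rho> T i j * \<rho> S i j)"
  by (subst card_image, force simp: inj_on_def, subst card_image, force simp: inj_on_def) simp
 finally show ?thesis .
qed

lemma card_cocycle_index: "card (cocycle_index S T) = m * (d T * d S)"
 unfolding cocycle_index_def by (subst card_image) (auto simp: inj_on_def)

lemma cochain_iff:
 "x \<in> vs2.span (e4 ` cochain_index S T) \<longleftrightarrow> (I T * ent x 0 0 = ent x 0 0 \<and> ent x 0 0 * I S = ent x 0 0) \<and>
  (\<forall>i<m. \<forall>j<r i. idn {..<\<rho> T i j} * ent x (Suc i) j = ent x (Suc i) j \<and> ent x (Suc i) j * idn {..<\<rho> S i j} = ent x (Suc i) j) \<and>
  (\<forall>a b. ent x a b \<noteq> 0 \<longrightarrow> (a = 0 \<and> b = 0) \<or> (\<exists>i<m. a = Suc i \<and> b < r i))"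
proof -
 have mem: "((a, b), (p, q)) \<in> cochain_index S T \<longleftrightarrow>
  (a = 0 \<and> b = 0 \<and> p < d T \<and> q < d S) \<or> (\<exists>i<m. a = Suc i \<and> b < r i \<and> p < \<rho> T i b \<and> q < \<rho> S i b)" for a b p q
  by (auto simp: cochain_index_def image_iff)
 have nz: "y \<noteq> 0 \<longleftrightarrow> (\<exists>p q. ent y p q \<noteq> 0)" for y :: "'k fmat"
  by (metis ent_simps(1) fmat_eqI)
 show ?thesis
  unfolding e4_span[OF index_finite(1)] mem corner_iff
 proof (rule iffI)
  assume l: "\<forall>a b p q. ent (ent x a b) p q \<noteq> 0 \<longrightarrow> (a = 0 \<and> b = 0 \<and> p < d T \<and> q < d S) \<or>
    (\<exists>i<m. a = Suc i \<and> b < r i \<and> p < \<rho> T i b \<and> q < \<rho> S i b)"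
  have 1: "\<forall>i j. ent (ent x 0 0) i j \<noteq> 0 \<longrightarrow> i < d T \<and> j < d S" using l by blast
  have 2: "\<forall>i<m. \<forall>j<r i. \<forall>ia ja. ent (ent x (Suc i) j) ia ja \<noteq> 0 \<longrightarrow> ia < \<rho> T i j \<and> ja < \<rho> S i j"
   using l by blast
  have 3: "\<forall>a b. ent x a b \<noteq> 0 \<longrightarrow> a = 0 \<and> b = 0 \<or> (\<exists>i<m. a = Suc i \<and> b < r i)"
   using l unfolding nz by blast
  show "(\<forall>i j. ent (ent x 0 0) i j \<noteq> 0 \<longrightarrow> i < d T \<and> j < d S) \<and>
   (\<forall>i<m. \<forall>j<r i. \<forall>ia ja. ent (ent x (Suc i) j) ia ja \<noteq> 0 \<longrightarrow> ia < \<rho> T i j \<and> ja < \<rho> S i j) \<and>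
   (\<forall>a b. ent x a b \<noteq> 0 \<longrightarrow> a = 0 \<and> b = 0 \<or> (\<exists>i<m. a = Suc i \<and> b < r i))"
   using 1 2 3 by (intro conjI)
 next
  assume h: "(\<forall>i j. ent (ent x 0 0) i j \<noteq> 0 \<longrightarrow> i < d T \<and> j < d S) \<and>
   (\<forall>i<m. \<forall>j<r i. \<forall>ia ja. ent (ent x (Suc i) j) ia ja \<noteq> 0 \<longrightarrow> ia < \<rho> T i j \<and> ja < \<rho> S i j) \<and>
   (\<forall>a b. ent x a b \<noteq> 0 \<longrightarrow> a = 0 \<and> b = 0 \<or> (\<exists>i<m. a = Suc i \<and> b < r i))"
  show "\<forall>a b p q. ent (ent x a b) p q \<noteq> 0 \<longrightarrow> (a = 0 \<and> b = 0 \<and> p < d T \<and> q < d S) \<or>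
    (\<exists>i<m. a = Suc i \<and> b < r i \<and> p < \<rho> T i b \<and> q < \<rho> S i b)"
  proof (intro allI impI)
   fix a b p q assume e: "ent (ent x a b) p q \<noteq> 0"
   then have "ent x a b \<noteq> 0" by auto
   with h e show "(a = 0 \<and> b = 0 \<and> p < d T \<and> q < d S) \<or> (\<exists>i<m. a = Suc i \<and> b < r i \<and> p < \<rho> T i b \<and> q < \<rho> S i b)"
    by blast
  qed
 qed
qed

lemma cocycle_iff:
 "x \<in> vs2.span (e4 ` cocycle_index S T) \<longleftrightarrow> (\<forall>i<m. I T * ent x i 0 = ent x i 0 \<and> ent x i 0 * I S = ent x i 0) \<and>
  (\<forall>a b. ent x a b \<noteq> 0 \<longrightarrow> a < m \<and> b = 0)"
proof -
 have mem: "((a, b), (p, q)) \<in> cocycle_index S T \<longleftrightarrow> a < m \<and> b = 0 \<and> p < d T \<and> q < d S" for a b p q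
  by (auto simp: cocycle_index_def image_iff)
 have nz: "y \<noteq> 0 \<longleftrightarrow> (\<exists>p q. ent y p q \<noteq> 0)" for y :: "'k fmat"
  by (metis ent_simps(1) fmat_eqI)
 show ?thesis
  unfolding e4_span[OF index_finite(2)] mem corner_iff nz by blast
qed

lemma ent_coboundary: "ent (coboundary S T x) a b = (if a < m \<and> b = 0 then ent x 0 0 - expand S T a (\<lambda>j. ent x (Suc a) j) else 0)"
 unfolding coboundary_def by (cases "b = 0") auto

lemma expand_cong: "(\<And>j. j < r i ==> y j = z j) ==> expand S T i y = expand S T i z"
 unfolding expand_def by (rule sum.cong) auto

text \<open>The kernel of the coboundary map consists of the homomorphisms \<open>S \<rightarrow> T\<close>, so by Schur's lemma
 its dimension is \<open>1\<close> or \<open>0\<close>.\<close>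

definition scalar_cochain where
 "scalar_cochain S = eunit 0 0 (I S) + (\<Sum>(i, j)\<in>(SIGMA i:{..<m}. {..<r i}). eunit (Suc i) j (idn {..<\<rho> S i j}))"

lemma ent_scalar_cochain:
 "ent (scalar_cochain S) 0 0 = I S"
 "i < m ==> j < r i ==> ent (scalar_cochain S) (Suc i) j = idn {..<\<rho> S i j}"
 "\<not> (a = 0 \<and> b = 0) ==> \<not> (\<exists>i<m. a = Suc i \<and> b < r i) ==> ent (scalar_cochain S) a b = 0"
proof -
 let ?JJ = "SIGMA i:{..<m}. {..<r i}"
 have s: "ent (\<Sum>(i, j)\<in>?JJ. eunit (Suc i) j (idn {..<\<rho> S i j} :: 'k fmat)) a b
  = (\<Sum>k\<in>?JJ. if k = (a - 1, b) \<and> a \<noteq> 0 then idn {..<\<rho> S (a - 1) b} else 0)" for a b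
  by (simp add: split_def) (rule sum.cong; auto)
 have s': "ent (\<Sum>(i, j)\<in>?JJ. eunit (Suc i) j (idn {..<\<rho> S i j} :: 'k fmat)) a b
  = (if a \<noteq> 0 \<and> (a - 1, b) \<in> ?JJ then idn {..<\<rho> S (a - 1) b} else 0)" for a b
  unfolding s by (cases "a = 0") simp_all
 show "ent (scalar_cochain S) 0 0 = I S" unfolding scalar_cochain_def ent_simps s' by simp
 show "ent (scalar_cochain S) (Suc i) j = idn {..<\<rho> S i j}" if "i < m" "j < r i"
  unfolding scalar_cochain_def ent_simps s' using that by simp
 show "ent (scalar_cochain S) a b = 0" if "\<not> (a = 0 \<and> b = 0)" "\<not> (\<exists>i<m. a = Suc i \<and> b < r i)"
  unfolding scalar_cochain_def ent_simps s' using that by (cases a) auto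
qed

lemma I_factor_linear: "S \<in> \<S> ==> i < m ==> factor_linear S S i (I S)"
 unfolding factor_linear_def using E_corner by (simp add: I_idem)

lemma expand_idn:
 assumes "S \<in> \<S>" "i < m"
 shows "expand S S i (\<lambda>j. idn {..<\<rho> S i j}) = I S"
proof -
 have "expand S S i (\<lambda>j. idn {..<\<rho> S i j}) = expand S S i (\<lambda>j. R S i j * I S * P S i j)"
  by (rule expand_cong) (use PR[OF assms] in \<open>simp add: mult.assoc\<close>)
 also have "\<dots> = I S" by (rule factor_linear_expand[OF assms(1,1,2) I_factor_linear[OF assms]])
 finally show ?thesis .
qed

lemma coboundary_kernel:
 assumes S: "S \<in> \<S>" and T: "T \<in> \<S>" and x: "x \<in> vs2.span (e4 ` cochain_index S T)" and z: "coboundary S T x = 0"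
 shows "if S = T then \<exists>a. x = sc2 a (scalar_cochain S) else x = 0"
proof -
 note xc = x[unfolded cochain_iff]
 define f where "f = ent x 0 0"
 have fe: "f = expand S T i (\<lambda>j. ent x (Suc i) j)" if "i < m" for i
  using ent_coboundary[of S T x i 0] z that by (simp add: f_def)
 have fl: "factor_linear S T i f" if "i < m" for i
  using fe[OF that] expand_factor_linear[OF S T that] by metis
 have fS: "if S = T then \<exists>a. f = sc1 a (I S) else f = 0"
  using schur[OF S T, of f] fl xc unfolding factor_linear_def f_def by auto
 have zij: "ent x (Suc i) j = R T i j * f * P S i j" if "i < m" "j < r i" for i j
  using expand_inverse[OF S T that, of "\<lambda>j. ent x (Suc i) j"] xc that fe[OF that(1)] by simp
 have x0: "ent x a b = 0" if "\<not> (a = 0 \<and> b = 0)" "\<not> (\<exists>i<m. a = Suc i \<and> b < r i)" for a b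
  using xc that by blast
 show ?thesis
 proof (cases "S = T")
  case True
  then obtain a where a: "f = sc1 a (I S)" using fS by auto
  have "x = sc2 a (scalar_cochain S)"
  proof (rule fmat_eqI)
   fix p q
   consider "p = 0 \<and> q = 0" | i where "i < m" "p = Suc i" "q < r i" | "\<not> (p = 0 \<and> q = 0)" "\<not> (\<exists>i<m. p = Suc i \<and> q < r i)"
    by blast
   then show "ent x p q = ent (sc2 a (scalar_cochain S)) p q"
   proof cases
    case 1 then show ?thesis using a by (simp add: f_def ent_scalar_cochain)
   next
    case 2
    then have "ent x p q = sc1 a (R S i q * I S * P S i q)"
     using zij[of i q] a True by (simp add: sc1.sc_mult_left sc1.sc_mult_right)
    then show ?thesis using PR[OF S, of i q] 2 by (simp add: ent_scalar_cochain)
   next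
    case 3 then show ?thesis using x0 by (simp add: ent_scalar_cochain)
   qed
  qed
  with True show ?thesis by auto
 next
  case False
  then have f0: "f = 0" using fS by simp
  have "x = 0"
  proof (rule fmat_eqI)
   fix p q
   consider "p = 0 \<and> q = 0" | i where "i < m" "p = Suc i" "q < r i" | "\<not> (p = 0 \<and> q = 0)" "\<not> (\<exists>i<m. p = Suc i \<and> q < r i)"
    by blast
   then show "ent x p q = ent 0 p q" by cases (use f0 zij x0 in \<open>auto simp: f_def\<close>)
  qed
  with False show ?thesis by simp
 qed
qed

lemma scalar_cochain:
 assumes S: "S \<in> \<S>"
 shows "scalar_cochain S \<in> vs2.span (e4 ` cochain_index S S)" "coboundary S S (scalar_cochain S) = 0"
  "scalar_cochain S \<noteq> 0"
proof -
 have ii: "idn {..<n} * idn {..<n} = (idn {..<n} :: 'k fmat)" for n by (rule frame.I_idem[OF frame1]) simp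
 show "scalar_cochain S \<in> vs2.span (e4 ` cochain_index S S)"
  unfolding cochain_iff
 proof (intro conjI allI impI)
  show "a = 0 \<and> b = 0 \<or> (\<exists>i<m. a = Suc i \<and> b < r i)" if "ent (scalar_cochain S) a b \<noteq> 0" for a b
   using ent_scalar_cochain(3)[of a b S] that by blast
 qed (simp_all add: ent_scalar_cochain(1,2) ii)
 show "coboundary S S (scalar_cochain S) = 0"
 proof (rule fmat_eqI)
  fix a b
  show "ent (coboundary S S (scalar_cochain S)) a b = ent 0 a b"
  proof (cases "a < m \<and> b = 0")
   case True
   then have "expand S S a (\<lambda>j. ent (scalar_cochain S) (Suc a) j) = expand S S a (\<lambda>j. idn {..<\<rho> S a j})"
    by (intro expand_cong) (simp add: ent_scalar_cochain)
   then show ?thesis using True expand_idn[OF S] by (simp add: ent_coboundary ent_scalar_cochain)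
  qed (auto simp: ent_coboundary)
 qed
 have "ent (scalar_cochain S) 0 0 \<noteq> 0" using I_nonzero[OF S] by (simp add: ent_scalar_cochain)
 then show "scalar_cochain S \<noteq> 0" by auto
qed

definition ext_basis ::
 "('k coprod, 'v) module \<Rightarrow> ('k coprod, 'v) module \<Rightarrow> (nat \<Rightarrow> nat \<Rightarrow> 'k fmat) \<Rightarrow> bool" where
 "ext_basis S T X \<longleftrightarrow>
  (\<forall>k < count S T. \<forall>i<m. I T * X k i = X k i \<and> X k i * I S = X k i) \<and>
  (\<forall>y. (\<forall>i<m. I T * y i = y i \<and> y i * I S = y i) \<longrightarrow> (\<exists>f h \<xi>. I T * f = f \<and> f * I S = f \<and>
    (\<forall>i<m. factor_linear S T i (h i)) \<and> (\<forall>i<m. y i = f - h i + (\<Sum>k < count S T. sc1 (\<xi> k) (X k i))))) \<and>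
  (\<forall>f h \<xi>. I T * f = f \<longrightarrow> f * I S = f \<longrightarrow> (\<forall>i<m. factor_linear S T i (h i)) \<longrightarrow>
    (\<forall>i<m. f - h i + (\<Sum>k < count S T. sc1 (\<xi> k) (X k i)) = 0) \<longrightarrow> (\<forall>k < count S T. \<xi> k = 0))"

text \<open>The cokernel of the coboundary map is the space of extensions of \<open>S\<close> by \<open>T\<close>. Its dimension
 follows from the ranks, and \<open>X\<close> runs through representatives of a basis.\<close>

lemma extension_basis:
 assumes S: "S \<in> \<S>" and T: "T \<in> \<S>"
 shows "\<exists>X. ext_basis S T X"
proof -
 let ?BD = "e4 ` cochain_index S T :: 'k fmat fmat set" and ?BC = "e4 ` cocycle_index S T :: 'k fmat fmat set"
 define B0 where "B0 = (if S = T then {scalar_cochain S} else {})"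
 have ker: "{x \<in> vs2.span ?BD. coboundary S T x = 0} = vs2.span B0"
 proof (intro equalityI subsetI)
  fix x assume "x \<in> {x \<in> vs2.span ?BD. coboundary S T x = 0}"
  then have k: "if S = T then \<exists>a. x = sc2 a (scalar_cochain S) else x = 0" using coboundary_kernel[OF S T] by blast
  show "x \<in> vs2.span B0"
  proof (cases "S = T")
   case True
   then obtain a where "x = sc2 a (scalar_cochain S)" using k by auto
   then show ?thesis using True by (auto simp: B0_def intro: vs2.span_scale vs2.span_base)
  qed (use k in \<open>simp add: vs2.span_zero\<close>)
 next
  have add: "coboundary S T (x + y) = coboundary S T x + coboundary S T y" for x y
   by (rule fmat_eqI) (simp add: ent_coboundary expand_linear)
  have hom: "coboundary S T (sc2 a x) = sc2 a (coboundary S T x)" for a x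
   by (rule fmat_eqI) (simp add: ent_coboundary expand_linear sc1.sc_diff_right)
  fix x assume x: "x \<in> vs2.span B0"
  show "x \<in> {x \<in> vs2.span ?BD. coboundary S T x = 0}"
  proof (cases "S = T")
   case True
   have "vs2.span B0 = range (\<lambda>u. \<Sum>v\<in>B0. sc2 (u v) v)" by (rule vs2.span_finite) (simp add: B0_def)
   then obtain a where "x = sc2 a (scalar_cochain S)" using x True by (auto simp: B0_def)
   then show ?thesis using True scalar_cochain[OF S] hom by (auto intro: vs2.span_scale)
  next
   case False
   then have "x = 0" using x by (simp add: B0_def)
   then show ?thesis using hom[of 0 0] by (simp add: vs2.span_zero)
  qed
 qed
 have B0: "finite B0" "vs2.independent B0"
  using scalar_cochain(3)[OF S] by (auto simp: B0_def vs2.independent_empty)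
 have maps: "coboundary S T x \<in> vs2.span ?BC" if "x \<in> vs2.span ?BD" for x
  using that expand_factor_linear[OF S T] unfolding cochain_iff cocycle_iff ent_coboundary factor_linear_def
  by (auto simp: left_diff_distrib right_diff_distrib)
 have add: "coboundary S T (x + y) = coboundary S T x + coboundary S T y" for x y
  by (rule fmat_eqI) (simp add: ent_coboundary expand_linear)
 have hom: "coboundary S T (sc2 a x) = sc2 a (coboundary S T x)" for a x
  by (rule fmat_eqI) (simp add: ent_coboundary expand_linear sc1.sc_diff_right)
 have cardD: "card ?BD = d T * d S + (\<Sum>i<m. \<Sum>j<r i. \<rho> T i j * \<rho> S i j)"
  by (simp add: card_image[OF e4_inj] card_cochain_index)
 have cardC: "card ?BC = m * (d T * d S)" by (simp add: card_image[OF e4_inj] card_cocycle_index)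
 note coker = vs2.cokernel_complement[where \<delta> = "coboundary S T", OF add hom finite_imageI[OF index_finite(1)] e4_independent[OF index_finite(1)]
  finite_imageI[OF index_finite(2)] e4_independent[OF index_finite(2)] maps B0 ker]
 have le: "card ?BD \<le> card ?BC + card B0" using coker by blast
 have N: "card ?BC + card B0 - card ?BD = count S T"
 proof -
  have "int (card ?BC + card B0 - card ?BD) = int (card ?BC) + int (card B0) - int (card ?BD)" using le by simp
  also have "\<dots> = (let e = euler_form (gamma_quiver m r w) (dimension_vector m r w S) (dimension_vector m r w T)
    in if S = T then 1 - e else - e)"
   unfolding cardD cardC euler_form_simples[OF S T] by (simp add: B0_def Let_def mult.commute mult.left_commute)
  finally show ?thesis unfolding count_def by (metis nat_int)
 qed
 obtain X where X: "\<forall>k < count S T. X k \<in> vs2.span ?BC"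
  "\<forall>y\<in>vs2.span ?BC. \<exists>x\<in>vs2.span ?BD. \<exists>\<xi>. y = coboundary S T x + (\<Sum>k < count S T. sc2 (\<xi> k) (X k))"
  "\<forall>x\<in>vs2.span ?BD. \<forall>\<xi>. coboundary S T x + (\<Sum>k < count S T. sc2 (\<xi> k) (X k)) = 0 \<longrightarrow> (\<forall>k < count S T. \<xi> k = 0)"
  using coker unfolding N by blast
 show ?thesis unfolding ext_basis_def
 proof (intro exI[of _ "\<lambda>k i. ent (X k) i 0"] conjI allI impI)
  fix k i assume "k < count S T" "i < m"
  then show "I T * ent (X k) i 0 = ent (X k) i 0" "ent (X k) i 0 * I S = ent (X k) i 0"
   using X(1) unfolding cocycle_iff by auto
 next
  fix y assume y: "\<forall>i<m. I T * y i = y i \<and> y i * I S = y i"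
  define Y where "Y = fm m 1 (\<lambda>i _. y i)"
  have "Y \<in> vs2.span ?BC" unfolding cocycle_iff using y by (auto simp: Y_def split: if_splits)
  then obtain x \<xi> where x: "x \<in> vs2.span ?BD" "Y = coboundary S T x + (\<Sum>k < count S T. sc2 (\<xi> k) (X k))"
   using X(2) by blast
  have "y i = ent x 0 0 - expand S T i (\<lambda>j. ent x (Suc i) j) + (\<Sum>k < count S T. sc1 (\<xi> k) (ent (X k) i 0))" if "i < m" for i
   using arg_cong[OF x(2), of "\<lambda>M. ent M i 0"] that by (simp add: Y_def ent_coboundary)
  then show "\<exists>f h \<xi>. I T * f = f \<and> f * I S = f \<and> (\<forall>i<m. factor_linear S T i (h i)) \<and>
   (\<forall>i<m. y i = f - h i + (\<Sum>k < count S T. sc1 (\<xi> k) (ent (X k) i 0)))"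
   using x(1) expand_factor_linear[OF S T] unfolding cochain_iff
   by (intro exI[of _ "ent x 0 0"] exI[of _ "\<lambda>i. expand S T i (\<lambda>j. ent x (Suc i) j)"] exI[of _ \<xi>]) simp
 next
  fix f h \<xi> k
  assume f: "I T * f = f" "f * I S = f" and h: "\<forall>i<m. factor_linear S T i (h i)"
   and z: "\<forall>i<m. f - h i + (\<Sum>k < count S T. sc1 (\<xi> k) (ent (X k) i 0)) = 0" and k: "k < count S T"
  define n where "n = (\<Sum>i<m. r i)"
  have rn: "r i \<le> n" if "i < m" for i unfolding n_def by (rule member_le_sum) (use that in auto)
  define x where "x = eunit 0 0 f + fm (Suc m) n (\<lambda>a j. if a \<noteq> 0 \<and> j < r (a - 1) then R T (a - 1) j * h (a - 1) * P S (a - 1) j else 0)"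
  have x0: "ent x 0 0 = f" by (simp add: x_def)
  have xi: "ent x (Suc i) j = R T i j * h i * P S i j" if "i < m" "j < r i" for i j
   using that rn[of i] by (simp add: x_def)
  have xD: "x \<in> vs2.span ?BD"
   unfolding cochain_iff
  proof (intro conjI allI impI)
   show "I T * ent x 0 0 = ent x 0 0" "ent x 0 0 * I S = ent x 0 0" using f x0 by simp_all
   fix i j assume ij: "i < m" "j < r i"
   show "idn {..<\<rho> T i j} * ent x (Suc i) j = ent x (Suc i) j"
    using PR(3)[OF T ij] xi[OF ij] by (simp add: mult.assoc[symmetric])
   show "ent x (Suc i) j * idn {..<\<rho> S i j} = ent x (Suc i) j"
    using PR(2)[OF S ij] xi[OF ij] by (simp add: mult.assoc)
  next
   fix a b assume "ent x a b \<noteq> 0"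
   then show "a = 0 \<and> b = 0 \<or> (\<exists>i<m. a = Suc i \<and> b < r i)"
    by (cases a) (auto simp: x_def split: if_splits)
  qed
  have "coboundary S T x + (\<Sum>k < count S T. sc2 (\<xi> k) (X k)) = 0"
  proof (rule fmat_eqI)
   fix a b
   show "ent (coboundary S T x + (\<Sum>k < count S T. sc2 (\<xi> k) (X k))) a b = ent 0 a b"
   proof (cases "a < m \<and> b = 0")
    case True
    then have "expand S T a (\<lambda>j. ent x (Suc a) j) = expand S T a (\<lambda>j. R T a j * h a * P S a j)"
     by (intro expand_cong) (simp add: xi)
    also have "\<dots> = h a" using factor_linear_expand[OF S T] h True by simp
    finally show ?thesis using z True x0 by (simp add: ent_coboundary)
   next
    case False
    then have "ent (X k) a b = 0" if "k < count S T" for k using X(1) that unfolding cocycle_iff by blast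
    then show ?thesis using False by (auto simp: ent_coboundary intro!: sum.neutral)
   qed
  qed
  then show "\<xi> k = 0" using X(3) xD k by blast
 qed
qed

end

section \<open>Strictly triangular representations of a quiver\<close>

record (overloaded) ('w, 'e, 'k) tri_rep =
 tsize :: nat
 label :: "nat \<Rightarrow> 'w"
 amat :: "'e \<Rightarrow> 'k fmat"

text \<open>A representation of the quiver on the basis \<open>0, \<dots>, tsize V - 1\<close>. The basis vector \<open>a\<close> sits at the
vertex \<open>label V a\<close>, and an arrow maps it into the span of the basis vectors before it. The last condition
makes the representation nilpotent and makes recursion along the basis possible.\<close>

definition is_tri_rep :: "('w, 'e) pre_digraph \<Rightarrow> ('w, 'e, 'k::field) tri_rep \<Rightarrow> bool" where
 "is_tri_rep Q V \<longleftrightarrow> (\<forall>a<tsize V. label V a \<in> verts Q) \<and>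
   (\<forall>\<alpha>\<in>arcs Q. \<forall>b a. ent (amat V \<alpha>) b a \<noteq> 0 \<longrightarrow>
    b < a \<and> a < tsize V \<and> label V a = tail Q \<alpha> \<and> label V b = head Q \<alpha>)"

definition tri_hom :: "('w, 'e) pre_digraph \<Rightarrow> ('w, 'e, 'k::field) tri_rep \<Rightarrow> ('w, 'e, 'k) tri_rep \<Rightarrow> 'k fmat set" where
 "tri_hom Q V W = {\<phi>. (\<forall>b a. ent \<phi> b a \<noteq> 0 \<longrightarrow> a < tsize V \<and> b < tsize W \<and> label V a = label W b) \<and>
   (\<forall>\<alpha>\<in>arcs Q. \<phi> * amat V \<alpha> = amat W \<alpha> * \<phi>)}"

definition tri_cat :: "('w, 'e) pre_digraph \<Rightarrow> (('w, 'e, 'k::field) tri_rep, 'k fmat, 'k) lincat" where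
 "tri_cat Q = \<lparr>Ob = {V. is_tri_rep Q V}, Hom = tri_hom Q, Ident = (\<lambda>V. idn {..<tsize V}),
   Comp = (\<lambda>_ _ _ \<psi> \<phi>. \<psi> * \<phi>), Plus = (\<lambda>_ _. (+)), Scale = (\<lambda>_ _. sc1)\<rparr>"

lemma tri_cat_simps [simp]:
 "Ob (tri_cat Q) = {V. is_tri_rep Q V}" "Hom (tri_cat Q) = tri_hom Q"
 "Ident (tri_cat Q) V = idn {..<tsize V}" "Comp (tri_cat Q) V W W' \<psi> \<phi> = \<psi> * \<phi>"
 "Plus (tri_cat Q) V W \<phi> \<psi> = \<phi> + \<psi>" "Scale (tri_cat Q) V W a \<phi> = sc1 a \<phi>"
 by (simp_all add: tri_cat_def)

lemma ent_times_nz: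
 fixes A B :: "'r::ring fmat"
 assumes "ent (A * B) i k \<noteq> 0"
 shows "\<exists>j. ent A i j \<noteq> 0 \<and> ent B j k \<noteq> 0"
proof -
 obtain n where n: "\<forall>i j. ent A i j \<noteq> 0 \<longrightarrow> i < n \<and> j < n" using ent_bound by blast
 have "ent (A * B) i k = (\<Sum>j<n. ent A i j * ent B j k)" by (rule ent_times_left) (use n in auto)
 with assms have "(\<Sum>j<n. ent A i j * ent B j k) \<noteq> 0" by simp
 then obtain j where "ent A i j * ent B j k \<noteq> 0" by (rule sum.not_neutral_contains_not_neutral)
 then show ?thesis by (intro exI[of _ j]) auto
qed

lemma tri_homs_closed: "homs_closed (tri_cat Q)"
 unfolding homs_closed_def
proof (intro conjI ballI allI; simp only: tri_cat_simps mem_Collect_eq)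
 fix V :: "('a, 'b, 'c) tri_rep" assume V: "is_tri_rep Q V"
 have "idn {..<tsize V} * amat V \<alpha> = amat V \<alpha> \<and> amat V \<alpha> * idn {..<tsize V} = amat V \<alpha>" if "\<alpha> \<in> arcs Q" for \<alpha>
  unfolding corner_iff using V that unfolding is_tri_rep_def by (meson less_trans)
 then show "idn {..<tsize V} \<in> tri_hom Q V V" unfolding tri_hom_def by (auto simp: ent_idn split: if_splits)
next
 fix V W W' :: "('a, 'b, 'c) tri_rep" and f g
 assume f: "f \<in> tri_hom Q V W" and g: "g \<in> tri_hom Q W W'"
 have "g * f * amat V \<alpha> = amat W' \<alpha> * (g * f)" if "\<alpha> \<in> arcs Q" for \<alpha>
 proof -
  have "g * f * amat V \<alpha> = g * amat W \<alpha> * f" using f that unfolding tri_hom_def by (simp add: mult.assoc)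
  also have "g * amat W \<alpha> = amat W' \<alpha> * g" using g that unfolding tri_hom_def by simp
  finally show ?thesis by (simp add: mult.assoc)
 qed
 moreover have "a < tsize V \<and> b < tsize W' \<and> label V a = label W' b" if "ent (g * f) b a \<noteq> 0" for b a
  using ent_times_nz[OF that] f g unfolding tri_hom_def by fastforce
 ultimately show "g * f \<in> tri_hom Q V W'" unfolding tri_hom_def by blast
next
 fix V W :: "('a, 'b, 'c) tri_rep" and f g
 assume f: "f \<in> tri_hom Q V W" and g: "g \<in> tri_hom Q V W"
 have "a < tsize V \<and> b < tsize W \<and> label V a = label W b" if "ent (f + g) b a \<noteq> 0" for b a
 proof -
  have "ent f b a \<noteq> 0 \<or> ent g b a \<noteq> 0" using that by auto
  then show ?thesis using f g unfolding tri_hom_def by blast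
 qed
 then show "f + g \<in> tri_hom Q V W" using f g unfolding tri_hom_def by (simp add: distrib_left distrib_right)
next
 fix V W :: "('a, 'b, 'c) tri_rep" and f c
 assume "f \<in> tri_hom Q V W"
 then show "sc1 c f \<in> tri_hom Q V W" unfolding tri_hom_def by (auto simp: sc1.sc_mult_left sc1.sc_mult_right)
qed

text \<open>Correcting an approximate inverse \<open>G\<close> by the error \<open>M\<close> moves the support of the error by one diagonal, so
after \<open>n\<close> corrections it is gone.\<close>

lemma unipotent_inverse:
 fixes N :: "'r::ring fmat"
 assumes J: "J * J = J" and N: "J * N = N" "N * J = N"
  and tri: "\<And>b a. ent N b a \<noteq> 0 ==> b < a \<and> a < n"
 shows "\<exists>G. J * G = G \<and> G * J = G \<and> (J + N) * G = J \<and> G * (J + N) = J"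
proof -
 have right: "\<exists>G M. J * G = G \<and> G * J = G \<and> J * M = M \<and> M * J = M \<and> (J + N) * G = J + M \<and> (\<forall>b a. ent M b a \<noteq> 0 \<longrightarrow> b + k < n)" for k
 proof (induction k)
  case 0
  show ?case by (rule exI[of _ J], rule exI[of _ N]) (use J N tri in \<open>fastforce simp: distrib_right\<close>)
 next
  case (Suc k)
  then obtain G M where G: "J * G = G" "G * J = G" "J * M = M" "M * J = M" "(J + N) * G = J + M"
   "\<forall>b a. ent M b a \<noteq> 0 \<longrightarrow> b + k < n" by blast
  have "b + Suc k < n" if nz: "ent (- (N * M)) b a \<noteq> 0" for b a
  proof -
   have "ent (N * M) b a \<noteq> 0" using nz by simp
   from ent_times_nz[OF this] obtain c where c: "ent N b c \<noteq> 0" "ent M c a \<noteq> 0" by blast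
   then show ?thesis using tri[OF c(1)] G(6) by fastforce
  qed
  moreover have "(J + N) * (G - M) = J + - (N * M)" using G by (simp add: algebra_simps)
  moreover have "J * (N * M) = N * M" using N by (simp add: mult.assoc[symmetric])
  moreover have "N * M * J = N * M" using G by (simp add: mult.assoc)
  ultimately show ?case using G by (intro exI[of _ "G - M"] exI[of _ "- (N * M)"]) (auto simp: algebra_simps)
 qed
 have left: "\<exists>G M. J * G = G \<and> G * J = G \<and> J * M = M \<and> M * J = M \<and> G * (J + N) = J + M \<and> (\<forall>b a. ent M b a \<noteq> 0 \<longrightarrow> k \<le> a \<and> a < n)" for k
 proof (induction k)
  case 0
  show ?case by (rule exI[of _ J], rule exI[of _ N]) (use J N tri in \<open>fastforce simp: distrib_left\<close>)
 next
  case (Suc k)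
  then obtain G M where G: "J * G = G" "G * J = G" "J * M = M" "M * J = M" "G * (J + N) = J + M"
   "\<forall>b a. ent M b a \<noteq> 0 \<longrightarrow> k \<le> a \<and> a < n" by blast
  have "Suc k \<le> a \<and> a < n" if nz: "ent (- (M * N)) b a \<noteq> 0" for b a
  proof -
   have "ent (M * N) b a \<noteq> 0" using nz by simp
   from ent_times_nz[OF this] obtain c where c: "ent M b c \<noteq> 0" "ent N c a \<noteq> 0" by blast
   then show ?thesis using tri[OF c(2)] G(6) by fastforce
  qed
  moreover have "(G - M) * (J + N) = J + - (M * N)" using G by (simp add: algebra_simps)
  moreover have "J * (M * N) = M * N" using G by (simp add: mult.assoc[symmetric])
  moreover have "M * N * J = M * N" using N by (simp add: mult.assoc)
  ultimately show ?case using G by (intro exI[of _ "G - M"] exI[of _ "- (M * N)"]) (auto simp: algebra_simps)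
 qed
 obtain G M where G: "J * G = G" "G * J = G" "(J + N) * G = J + M" "\<forall>b a. ent M b a \<noteq> 0 \<longrightarrow> b + n < n"
  using right[of n] by blast
 obtain G' M' where G': "J * G' = G'" "G' * J = G'" "G' * (J + N) = J + M'" "\<forall>b a. ent M' b a \<noteq> 0 \<longrightarrow> n \<le> a \<and> a < n"
  using left[of n] by blast
 have M0: "M = 0" "M' = 0" by (rule fmat_eqI, use G(4) in force, rule fmat_eqI, use G'(4) in force)
 have "G' = G' * ((J + N) * G)" using G(3) G'(2) M0 by simp
 also have "\<dots> = G" using G(1) G'(3) M0 by (simp add: mult.assoc[symmetric])
 finally have "G' = G" .
 then show ?thesis using G G' M0 by auto
qed

section \<open>Gluing the simple modules along a triangular representation\<close>

type_synonym ('k, 'v) smod = "('k coprod, 'v) module"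
type_synonym ('k, 'v) trirep = "(('k, 'v) smod, ('k, 'v) smod \<times> ('k, 'v) smod \<times> nat, 'k) tri_rep"

context simples
begin

definition X :: "('k, 'v) smod \<Rightarrow> ('k, 'v) smod \<Rightarrow> nat \<Rightarrow> nat \<Rightarrow> 'k fmat" where
 "X S T = (SOME X. ext_basis S T X)"

lemma X_basis: "S \<in> \<S> ==> T \<in> \<S> ==> ext_basis S T (X S T)"
 unfolding X_def by (rule someI_ex[OF extension_basis])

lemma X_corner: "[|S \<in> \<S>; T \<in> \<S>; k < count S T; i < m|] ==> I T * X S T k i = X S T k i"
 "[|S \<in> \<S>; T \<in> \<S>; k < count S T; i < m|] ==> X S T k i * I S = X S T k i"
 using X_basis unfolding ext_basis_def by blast+

lemma X_span:
 assumes "S \<in> \<S>" "T \<in> \<S>" "\<And>i. i < m ==> I T * y i = y i" "\<And>i. i < m ==> y i * I S = y i"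
 obtains f h \<xi> where "I T * f = f" "f * I S = f" "\<And>i. i < m ==> factor_linear S T i (h i)"
  "\<And>i. i < m ==> y i = f - h i + (\<Sum>k < count S T. sc1 (\<xi> k) (X S T k i))"
proof -
 have "\<exists>f h \<xi>. I T * f = f \<and> f * I S = f \<and>
    (\<forall>i<m. factor_linear S T i (h i)) \<and> (\<forall>i<m. y i = f - h i + (\<Sum>k < count S T. sc1 (\<xi> k) (X S T k i)))"
  by (rule X_basis[OF assms(1,2), unfolded ext_basis_def, THEN conjunct2, THEN conjunct1, THEN spec[of _ y], THEN mp])
   (simp add: assms(3,4))
 then show ?thesis using that by blast
qed

lemma X_independent:
 assumes "S \<in> \<S>" "T \<in> \<S>" "I T * f = f" "f * I S = f" "\<And>i. i < m ==> factor_linear S T i (h i)"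
  "\<And>i. i < m ==> f - h i + (\<Sum>k < count S T. sc1 (\<xi> k) (X S T k i)) = 0" "k < count S T"
 shows "\<xi> k = 0"
proof -
 have "\<forall>f h \<xi>. I T * f = f \<longrightarrow> f * I S = f \<longrightarrow> (\<forall>i<m. factor_linear S T i (h i)) \<longrightarrow>
    (\<forall>i<m. f - h i + (\<Sum>k < count S T. sc1 (\<xi> k) (X S T k i)) = 0) \<longrightarrow> (\<forall>k < count S T. \<xi> k = 0)"
  using X_basis[OF assms(1,2)] unfolding ext_basis_def by (elim conjE)
 from this[rule_format, OF assms(3-6) assms(7)] show ?thesis .
qed

abbreviation "Q \<equiv> simples_quiver m r w \<S>"

lemma Q_simps: "verts Q = \<S>" "tail Q (S, T, k) = S" "head Q (S, T, k) = T"
 "(S, T, k) \<in> arcs Q \<longleftrightarrow> S \<in> \<S> \<and> T \<in> \<S> \<and> k < count S T"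
 by (auto simp: simples_quiver_def count_def Let_def)

definition BI :: "('k, 'v) trirep \<Rightarrow> 'k fmat fmat" where "BI V = bidn (tsize V) (\<lambda>a. d (label V a))"

definition DL :: "('k, 'v) trirep \<Rightarrow> 'k coprod \<Rightarrow> 'k fmat fmat" where
 "DL V x = diag {..<tsize V} (\<lambda>a. L (label V a) x)"

text \<open>The part above the diagonal of the change of basis \<open>g V i\<close> below. The matrices of the arrows from \<open>S\<close> to
\<open>T\<close> are the coefficients with respect to the basis of extensions of \<open>S\<close> by \<open>T\<close>.\<close>

definition N :: "('k, 'v) trirep \<Rightarrow> nat \<Rightarrow> 'k fmat fmat" where
 "N V i = fm (tsize V) (tsize V) (\<lambda>b a. \<Sum>k < count (label V a) (label V b).
   sc1 (ent (amat V (label V a, label V b, k)) b a) (X (label V a) (label V b) k i))"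

lemma labelD: "is_tri_rep Q V ==> a < tsize V ==> label V a \<in> \<S>"
 unfolding is_tri_rep_def Q_simps by blast

lemma amatD:
 assumes "is_tri_rep Q V" "ent (amat V (S, T, k)) b a \<noteq> 0" "S \<in> \<S>" "T \<in> \<S>" "k < count S T"
 shows "b < a" "a < tsize V" "label V a = S" "label V b = T"
proof -
 have "(S, T, k) \<in> arcs Q" using assms(3-5) by (simp add: Q_simps)
 with assms(1) have "\<forall>b a. ent (amat V (S, T, k)) b a \<noteq> 0 \<longrightarrow>
   b < a \<and> a < tsize V \<and> label V a = tail Q (S, T, k) \<and> label V b = head Q (S, T, k)"
  unfolding is_tri_rep_def by (elim conjE bspec)
 with assms(2) show "b < a" "a < tsize V" "label V a = S" "label V b = T" by (simp_all add: Q_simps)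
qed

lemma ent_BI: "ent (BI V) b a = (if a = b \<and> a < tsize V then I (label V a) else 0)"
 by (simp add: BI_def bidn_def ent_diag)

lemma ent_BI_times: "ent (BI V * x) b a = (if b < tsize V then I (label V b) * ent x b a else 0)"
 by (simp add: BI_def bidn_def ent_diag_times)

lemma ent_times_BI: "ent (x * BI V) b a = (if a < tsize V then ent x b a * I (label V a) else 0)"
 by (simp add: BI_def bidn_def ent_times_diag)

lemma frame_BI: "frame sc2 (BI V) U2 (SIGMA a:{..<tsize V}. {..<d (label V a)})
  (\<lambda>(a, p). eunit a 0 (eunit p 0 (1 :: 'k))) (\<lambda>(a, p). eunit 0 a (eunit 0 p 1))"
 unfolding BI_def by (rule frame2)

lemma BI_idem: "BI V * BI V = BI V" by (rule frame.I_idem[OF frame_BI])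

lemma DL_rep:
 assumes V: "is_tri_rep Q V"
 shows "algebra_rep A sc2 (BI V) (DL V)"
 unfolding algebra_rep_def DL_def
proof (intro conjI ballI allI)
 fix x y assume xy: "x \<in> carrier A" "y \<in> carrier A"
 note l = algebra_repD[OF S_rep[OF labelD[OF V]]]
 show "diag {..<tsize V} (\<lambda>a. L (label V a) (x \<oplus>\<^bsub>A\<^esub> y)) = diag {..<tsize V} (\<lambda>a. L (label V a) x) + diag {..<tsize V} (\<lambda>a. L (label V a) y)"
  by (rule fmat_eqI) (use l xy in \<open>simp add: ent_diag\<close>)
 show "diag {..<tsize V} (\<lambda>a. L (label V a) (x \<otimes>\<^bsub>A\<^esub> y)) = diag {..<tsize V} (\<lambda>a. L (label V a) x) * diag {..<tsize V} (\<lambda>a. L (label V a) y)"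
  by (rule fmat_eqI) (use l xy in \<open>simp add: ent_diag_times ent_diag\<close>)
next
 fix c x assume x: "x \<in> carrier A"
 note l = algebra_repD[OF S_rep[OF labelD[OF V]]]
 show "diag {..<tsize V} (\<lambda>a. L (label V a) (c \<odot>\<^bsub>A\<^esub> x)) = sc2 c (diag {..<tsize V} (\<lambda>a. L (label V a) x))"
  by (rule fmat_eqI) (use l x in \<open>simp add: ent_diag\<close>)
next
 note l = algebra_repD[OF S_rep[OF labelD[OF V]]]
 show "diag {..<tsize V} (\<lambda>a. L (label V a) \<one>\<^bsub>A\<^esub>) = BI V"
  by (rule fmat_eqI) (use l in \<open>simp add: ent_diag ent_BI\<close>)
qed

lemma ent_N_nz:
 assumes V: "is_tri_rep Q V" and nz: "ent (N V i) b a \<noteq> 0"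
 shows "b < a" "a < tsize V"
proof -
 have ab: "b < tsize V" "a < tsize V" using nz by (auto simp: N_def split: if_splits)
 have "(\<Sum>k < count (label V a) (label V b). sc1 (ent (amat V (label V a, label V b, k)) b a) (X (label V a) (label V b) k i)) \<noteq> 0"
  using nz ab by (simp add: N_def)
 then obtain k where "k < count (label V a) (label V b)" "ent (amat V (label V a, label V b, k)) b a \<noteq> 0"
  by (metis (no_types, lifting) lessThan_iff sc1.sc_zero_left sum.neutral)
 then show "b < a" "a < tsize V" using amatD[OF V _ labelD[OF V ab(2)] labelD[OF V ab(1)]] by blast+
qed

lemma N_corner:
 assumes V: "is_tri_rep Q V" and i: "i < m"
 shows "BI V * N V i = N V i" "N V i * BI V = N V i"
proof -
 show "BI V * N V i = N V i"
  by (rule fmat_eqI)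
   (use X_corner labelD[OF V] i in \<open>simp add: ent_BI_times N_def sum_distrib_left sc1.sc_mult_right\<close>)
 show "N V i * BI V = N V i"
  by (rule fmat_eqI)
   (use X_corner labelD[OF V] i in \<open>simp add: ent_times_BI N_def sum_distrib_right sc1.sc_mult_left\<close>)
qed

definition "g V i = BI V + N V i"

definition "ginv V i = (SOME G. BI V * G = G \<and> G * BI V = G \<and> g V i * G = BI V \<and> G * g V i = BI V)"

lemma ginv:
 assumes V: "is_tri_rep Q V" and i: "i < m"
 shows "BI V * ginv V i = ginv V i" "ginv V i * BI V = ginv V i" "g V i * ginv V i = BI V" "ginv V i * g V i = BI V"
proof -
 have "\<exists>G. BI V * G = G \<and> G * BI V = G \<and> (BI V + N V i) * G = BI V \<and> G * (BI V + N V i) = BI V"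
  by (rule unipotent_inverse[where n = "tsize V", OF BI_idem N_corner[OF V i]]) (use ent_N_nz[OF V] in blast)
 from someI_ex[OF this[folded g_def]]
 show "BI V * ginv V i = ginv V i" "ginv V i * BI V = ginv V i" "g V i * ginv V i = BI V" "ginv V i * g V i = BI V"
  unfolding ginv_def by blast+
qed

lemma g_corner:
 assumes V: "is_tri_rep Q V" and i: "i < m"
 shows "BI V * g V i = g V i" "g V i * BI V = g V i"
 unfolding g_def using N_corner[OF V i] BI_idem by (simp_all add: distrib_left distrib_right)

text \<open>The \<open>i\<close>-th factor acts by the conjugate of its diagonal action by \<open>g V i\<close>; by the universal
 property of the free product these actions together define a representation.\<close>

definition "GL V = (SOME M. algebra_rep A sc2 (BI V) M \<and> (\<forall>i j p q. i < m \<longrightarrow> j < r i \<longrightarrow> p < w i j \<longrightarrow> q < w i j \<longrightarrow>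
  M (e i j p q) = g V i * DL V (e i j p q) * ginv V i))"

lemma GL:
 assumes V: "is_tri_rep Q V"
 shows "algebra_rep A sc2 (BI V) (GL V)"
  and "[|i < m; j < r i; p < w i j; q < w i j|] ==> GL V (e i j p q) = g V i * DL V (e i j p q) * ginv V i"
proof -
 note DLc = algebra_rep_corner[OF A_alg DL_rep[OF V] fpu_closed]
 have "\<exists>M. algebra_rep A sc2 (BI V) M \<and> (\<forall>i j p q. i < m \<longrightarrow> j < r i \<longrightarrow> p < w i j \<longrightarrow> q < w i j \<longrightarrow>
  M (e i j p q) = g V i * DL V (e i j p q) * ginv V i)"
 proof (rule rep_from_units[OF sc2.scalars_axioms BI_idem])
  fix i j p q assume i: "i < m"
  show "BI V * (g V i * DL V (e i j p q) * ginv V i) = g V i * DL V (e i j p q) * ginv V i \<and>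
   g V i * DL V (e i j p q) * ginv V i * BI V = g V i * DL V (e i j p q) * ginv V i"
   using g_corner[OF V i] ginv[OF V i] by (simp add: mult.assoc) (simp add: mult.assoc[symmetric])
 next
  fix i j p q j' p' q' assume b: "i < m" "j < r i" "p < w i j" "q < w i j" "j' < r i" "p' < w i j'" "q' < w i j'"
  have "g V i * DL V (e i j p q) * ginv V i * (g V i * DL V (e i j' p' q') * ginv V i)
   = g V i * (DL V (e i j p q) * (ginv V i * g V i)) * (DL V (e i j' p' q') * ginv V i)" by (simp add: mult.assoc)
  also have "\<dots> = g V i * (DL V (e i j p q) * DL V (e i j' p' q')) * ginv V i"
   using ginv(4)[OF V b(1)] DLc(2)[OF b(1)] by (simp add: mult.assoc)
  also have "\<dots> = (if j = j' \<and> q = p' then g V i * DL V (e i j p q') * ginv V i else 0)"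
   using rep_units(1)[OF sc2.scalars_axioms DL_rep[OF V] b] by simp
  finally show "g V i * DL V (e i j p q) * ginv V i * (g V i * DL V (e i j' p' q') * ginv V i)
   = (if j = j' \<and> q = p' then g V i * DL V (e i j p q') * ginv V i else 0)" .
 next
  fix i assume i: "i < m"
  have "(\<Sum>(j, p)\<in>JP i. g V i * DL V (e i j p p) * ginv V i) = g V i * (\<Sum>(j, p)\<in>JP i. DL V (e i j p p)) * ginv V i"
   by (simp add: sum_distrib_left sum_distrib_right split_def)
  also have "\<dots> = BI V" using rep_units(2)[OF sc2.scalars_axioms DL_rep[OF V] i] g_corner[OF V i] ginv[OF V i] by simp
  finally show "(\<Sum>(j, p)\<in>JP i. g V i * DL V (e i j p p) * ginv V i) = BI V" .
 qed
 from someI_ex[OF this] show "algebra_rep A sc2 (BI V) (GL V)"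
  "[|i < m; j < r i; p < w i j; q < w i j|] ==> GL V (e i j p q) = g V i * DL V (e i j p q) * ginv V i"
  unfolding GL_def by blast+
qed

text \<open>A matrix of scalars, as a block matrix with scalar blocks.\<close>

definition lift :: "('k, 'v) trirep \<Rightarrow> ('k, 'v) trirep \<Rightarrow> 'k fmat \<Rightarrow> 'k fmat fmat" where
 "lift V W \<phi> = fm (tsize W) (tsize V) (\<lambda>b a. sc1 (ent \<phi> b a) (I (label V a)))"

text \<open>This and the next lemma compute products of \<open>N V i\<close> with a matrix whose relevant blocks are scalar: the
result is a combination of the \<open>X S T k i\<close> with coefficients that do not depend on \<open>i\<close>.\<close>

lemma N_column_sum:
 assumes V: "is_tri_rep Q V" and a: "a < tsize V" and T: "T \<in> \<S>" and i: "i < m"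
  and M: "\<And>c. c < a ==> M c = sc1 (l c) (I (label V c))" and l: "\<And>c. c < a ==> label V c \<noteq> T ==> l c = 0"
 shows "(\<Sum>c<tsize V. M c * ent (N V i) c a)
  = (\<Sum>k < count (label V a) T. sc1 (\<Sum>c<tsize V. l c * ent (amat V (label V a, T, k)) c a) (X (label V a) T k i))"
proof -
 let ?S = "label V a"
 have S: "?S \<in> \<S>" by (rule labelD[OF V a])
 have "M c * ent (N V i) c a = (\<Sum>k < count ?S T. sc1 (l c * ent (amat V (?S, T, k)) c a) (X ?S T k i))" if c: "c < tsize V" for c
 proof (cases "c < a")
  case True
  show ?thesis
  proof (cases "label V c = T")
   case lT: True
   have "M c * ent (N V i) c a = (\<Sum>k < count ?S T. sc1 (l c) (sc1 (ent (amat V (?S, T, k)) c a) (I T * X ?S T k i)))"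
    using c a lT M[OF True] by (simp add: N_def sum_distrib_left sc1.sc_mult_left sc1.sc_mult_right sc1.sc_sc[symmetric] mult.commute)
   then show ?thesis using X_corner(1)[OF S T _ i] by (simp add: sc1.sc_sc)
  next
   case False
   then have "l c = 0" using l[OF True] by blast
   then show ?thesis using M[OF True] by simp
  qed
 next
  case False
  have "ent (N V i) c a = 0" using ent_N_nz(1)[OF V, of i c a] False by blast
  moreover have "ent (amat V (?S, T, k)) c a = 0" if "k < count ?S T" for k
   using amatD(1)[OF V _ S T that, of c a] False by blast
  ultimately show ?thesis by simp
 qed
 then have "(\<Sum>c<tsize V. M c * ent (N V i) c a) = (\<Sum>c<tsize V. \<Sum>k < count ?S T. sc1 (l c * ent (amat V (?S, T, k)) c a) (X ?S T k i))"
  by simp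
 also have "\<dots> = (\<Sum>k < count ?S T. \<Sum>c<tsize V. sc1 (l c * ent (amat V (?S, T, k)) c a) (X ?S T k i))" by (rule sum.swap)
 finally show ?thesis by (simp add: sc1.sc_sum_left)
qed

lemma N_row_sum:
 assumes V: "is_tri_rep Q V" and b: "b < tsize V" and S: "S \<in> \<S>" and i: "i < m"
  and M: "\<And>c. b < c ==> c < tsize V ==> M c = sc1 (l c) (I (label V c))"
  and l: "\<And>c. b < c ==> c < tsize V ==> label V c \<noteq> S ==> l c = 0"
 shows "(\<Sum>c<tsize V. ent (N V i) b c * M c)
  = (\<Sum>k < count S (label V b). sc1 (\<Sum>c<tsize V. ent (amat V (S, label V b, k)) b c * l c) (X S (label V b) k i))"
proof -
 let ?T = "label V b"
 have T: "?T \<in> \<S>" by (rule labelD[OF V b])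
 have "ent (N V i) b c * M c = (\<Sum>k < count S ?T. sc1 (ent (amat V (S, ?T, k)) b c * l c) (X S ?T k i))" if c: "c < tsize V" for c
 proof (cases "b < c")
  case True
  show ?thesis
  proof (cases "label V c = S")
   case lS: True
   have "ent (N V i) b c * M c = (\<Sum>k < count S ?T. sc1 (l c) (sc1 (ent (amat V (S, ?T, k)) b c) (X S ?T k i * I S)))"
    using c b lS M[OF True c] by (simp add: N_def sum_distrib_right sc1.sc_mult_left sc1.sc_mult_right sc1.sc_sum_right sc1.sc_sc mult.commute)
   then show ?thesis using X_corner(2)[OF S T _ i] by (simp add: sc1.sc_sc[symmetric] mult.commute)
  next
   case False
   then have "l c = 0" using l[OF True c] by blast
   then show ?thesis using M[OF True c] by simp
  qed
 next
  case False
  have "ent (N V i) b c = 0" using ent_N_nz(1)[OF V, of i b c] False by blast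
  moreover have "ent (amat V (S, ?T, k)) b c = 0" if "k < count S ?T" for k
   using amatD(1)[OF V _ S T that, of b c] False by blast
  ultimately show ?thesis by simp
 qed
 then have "(\<Sum>c<tsize V. ent (N V i) b c * M c) = (\<Sum>c<tsize V. \<Sum>k < count S ?T. sc1 (ent (amat V (S, ?T, k)) b c * l c) (X S ?T k i))"
  by simp
 also have "\<dots> = (\<Sum>k < count S ?T. \<Sum>c<tsize V. sc1 (ent (amat V (S, ?T, k)) b c * l c) (X S ?T k i))" by (rule sum.swap)
 finally show ?thesis by (simp add: sc1.sc_sum_left)
qed

lemma ent_times_N: "is_tri_rep Q V ==> ent (M * N V i) b a = (\<Sum>c<tsize V. ent M b c * ent (N V i) c a)"
 by (rule ent_times_right) (use ent_N_nz in fastforce)+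

lemma ent_N_times: "is_tri_rep Q V ==> ent (N V i * M) b a = (\<Sum>c<tsize V. ent (N V i) b c * ent M c a)"
 by (rule ent_times_left) (use ent_N_nz in fastforce)+

lemma ent_times_amat:
 assumes "is_tri_rep Q V" "\<alpha> \<in> arcs Q"
 shows "ent (M * amat V \<alpha>) b a = (\<Sum>c<tsize V. ent M b c * ent (amat V \<alpha>) c a)"
  "ent (amat V \<alpha> * M) b a = (\<Sum>c<tsize V. ent (amat V \<alpha>) b c * ent M c a)"
proof -
 have *: "c < tsize V \<and> a < tsize V" if "ent (amat V \<alpha>) c a \<noteq> 0" for c a
  using assms that unfolding is_tri_rep_def by (meson less_trans)
 show "ent (M * amat V \<alpha>) b a = (\<Sum>c<tsize V. ent M b c * ent (amat V \<alpha>) c a)"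
  by (rule ent_times_right) (use * in auto)
 show "ent (amat V \<alpha> * M) b a = (\<Sum>c<tsize V. ent (amat V \<alpha>) b c * ent M c a)"
  by (rule ent_times_left) (use * in auto)
qed

lemma tri_homD:
 assumes "\<phi> \<in> tri_hom Q V W"
 shows "ent \<phi> b a \<noteq> 0 ==> a < tsize V \<and> b < tsize W \<and> label V a = label W b"
  and "[|S \<in> \<S>; T \<in> \<S>; k < count S T|] ==> \<phi> * amat V (S, T, k) = amat W (S, T, k) * \<phi>"
 using assms Q_simps(4) unfolding tri_hom_def by blast+

lemma ent_lift: "\<phi> \<in> tri_hom Q V W ==> ent (lift V W \<phi>) b a = sc1 (ent \<phi> b a) (I (label V a))"
 unfolding lift_def using tri_homD(1) by fastforce

lemma lift_corner:
 assumes "\<phi> \<in> tri_hom Q V W"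
 shows "BI W * lift V W \<phi> = lift V W \<phi>" "lift V W \<phi> * BI V = lift V W \<phi>"
proof -
 show "BI W * lift V W \<phi> = lift V W \<phi>"
 proof (rule fmat_eqI)
  fix b a
  show "ent (BI W * lift V W \<phi>) b a = ent (lift V W \<phi>) b a"
   using tri_homD(1)[OF assms, of b a] by (cases "ent \<phi> b a = 0") (auto simp: ent_BI_times ent_lift[OF assms] sc1.sc_mult_right I_idem)
 qed
 show "lift V W \<phi> * BI V = lift V W \<phi>"
 proof (rule fmat_eqI)
  fix b a
  show "ent (lift V W \<phi> * BI V) b a = ent (lift V W \<phi>) b a"
   using tri_homD(1)[OF assms, of b a] by (cases "ent \<phi> b a = 0") (auto simp: ent_times_BI ent_lift[OF assms] sc1.sc_mult_left I_idem)
 qed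
qed

lemma lift_N:
 assumes V: "is_tri_rep Q V" and W: "is_tri_rep Q W" and \<phi>: "\<phi> \<in> tri_hom Q V W" and i: "i < m"
 shows "lift V W \<phi> * N V i = N W i * lift V W \<phi>"
proof (rule fmat_eqI)
 fix b a
 note nz = tri_homD(1)[OF \<phi>]
 show "ent (lift V W \<phi> * N V i) b a = ent (N W i * lift V W \<phi>) b a"
 proof (cases "b < tsize W \<and> a < tsize V")
  case True
  then have b: "b < tsize W" and a: "a < tsize V" by auto
  let ?S = "label V a" and ?T = "label W b"
  have S: "?S \<in> \<S>" and T: "?T \<in> \<S>" using labelD V W a b by auto
  have "ent (lift V W \<phi> * N V i) b a = (\<Sum>k < count ?S ?T. sc1 (\<Sum>c<tsize V. ent \<phi> b c * ent (amat V (?S, ?T, k)) c a) (X ?S ?T k i))"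
   unfolding ent_times_N[OF V] by (rule N_column_sum[OF V a T i]) (use nz ent_lift[OF \<phi>] in auto)
  also have "\<dots> = (\<Sum>k < count ?S ?T. sc1 (\<Sum>c<tsize W. ent (amat W (?S, ?T, k)) b c * ent \<phi> c a) (X ?S ?T k i))"
  proof (rule sum.cong[OF refl])
   fix k assume "k \<in> {..<count ?S ?T}"
   then have k: "(?S, ?T, k) \<in> arcs Q" using S T Q_simps(4) by simp
   have "(\<Sum>c<tsize V. ent \<phi> b c * ent (amat V (?S, ?T, k)) c a) = ent (\<phi> * amat V (?S, ?T, k)) b a"
    using ent_times_amat(1)[OF V k] by simp
   also have "\<dots> = ent (amat W (?S, ?T, k) * \<phi>) b a" using \<phi> k unfolding tri_hom_def by simp
   also have "\<dots> = (\<Sum>c<tsize W. ent (amat W (?S, ?T, k)) b c * ent \<phi> c a)" by (rule ent_times_amat(2)[OF W k])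
   finally show "sc1 (\<Sum>c<tsize V. ent \<phi> b c * ent (amat V (?S, ?T, k)) c a) (X ?S ?T k i)
    = sc1 (\<Sum>c<tsize W. ent (amat W (?S, ?T, k)) b c * ent \<phi> c a) (X ?S ?T k i)" by simp
  qed
  also have "\<dots> = ent (N W i * lift V W \<phi>) b a"
   unfolding ent_N_times[OF W]
  proof (rule N_row_sum[OF W b S i, symmetric])
   show "ent (lift V W \<phi>) c a = sc1 (ent \<phi> c a) (I (label W c))" for c
    using nz[of c a] by (cases "ent \<phi> c a = 0") (auto simp: ent_lift[OF \<phi>])
   show "ent \<phi> c a = 0" if "label W c \<noteq> ?S" for c using nz[of c a] that by auto
  qed
  finally show ?thesis .
 next
  case False
  have "lift V W \<phi> * N V i = BI W * (lift V W \<phi> * N V i) * BI V"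
   "N W i * lift V W \<phi> = BI W * (N W i * lift V W \<phi>) * BI V"
   using lift_corner[OF \<phi>] N_corner[OF V i] N_corner[OF W i] by (simp_all add: mult.assoc) (simp_all add: mult.assoc[symmetric])
  moreover have "ent (BI W * y * BI V) b a = 0" for y using False by (auto simp: ent_times_BI ent_BI_times)
  ultimately show ?thesis by metis
 qed
qed

lemma lift_DL:
 assumes V: "is_tri_rep Q V" and W: "is_tri_rep Q W" and \<phi>: "\<phi> \<in> tri_hom Q V W" and x: "x \<in> carrier A"
 shows "lift V W \<phi> * DL V x = DL W x * lift V W \<phi>"
proof (rule fmat_eqI)
 fix b a
 show "ent (lift V W \<phi> * DL V x) b a = ent (DL W x * lift V W \<phi>) b a"
 proof (cases "ent \<phi> b a = 0")
  case False
  then have "a < tsize V" "b < tsize W" "label V a = label W b" using tri_homD(1)[OF \<phi>] by auto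
  then show ?thesis
   using algebra_rep_corner[OF A_alg S_rep[OF labelD[OF W \<open>b < tsize W\<close>]] x]
   by (simp add: DL_def ent_times_diag ent_diag_times ent_lift[OF \<phi>] sc1.sc_mult_left sc1.sc_mult_right)
 qed (simp add: DL_def ent_times_diag ent_diag_times ent_lift[OF \<phi>])
qed

lemma lift_GL:
 assumes V: "is_tri_rep Q V" and W: "is_tri_rep Q W" and \<phi>: "\<phi> \<in> tri_hom Q V W" and x: "x \<in> carrier A"
 shows "lift V W \<phi> * GL V x = GL W x * lift V W \<phi>"
proof (rule rep_commute[OF sc2.scalars_axioms GL(1)[OF V] GL(1)[OF W] lift_corner[OF \<phi>] _ x])
 fix i j p q assume b: "i < m" "j < r i" "p < w i j" "q < w i j"
 let ?f = "lift V W \<phi>" and ?x = "e i j p q"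
 note gV = ginv[OF V b(1)] and gW = ginv[OF W b(1)] and lc = lift_corner[OF \<phi>]
 have fg: "?f * g V i = g W i * ?f"
  unfolding g_def using lift_N[OF V W \<phi> b(1)] lc by (simp add: distrib_left distrib_right)
 have "?f * ginv V i = ginv W i * g W i * ?f * ginv V i"
  using gW lc by (simp add: mult.assoc)
 also have "\<dots> = ginv W i * (?f * g V i) * ginv V i" using fg by (simp add: mult.assoc)
 also have "\<dots> = ginv W i * ?f" using gV lc by (simp add: mult.assoc)
 finally have fginv: "?f * ginv V i = ginv W i * ?f" .
 have "?f * GL V ?x = (?f * g V i) * DL V ?x * ginv V i" using GL(2)[OF V b] by (simp add: mult.assoc)
 also have "\<dots> = g W i * (?f * DL V ?x) * ginv V i" using fg by (simp add: mult.assoc)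
 also have "\<dots> = g W i * DL W ?x * (?f * ginv V i)" using lift_DL[OF V W \<phi> fpu_closed[OF b(1)]] by (simp add: mult.assoc)
 also have "\<dots> = GL W ?x * ?f" using fginv GL(2)[OF W b] by (simp add: mult.assoc)
 finally show "?f * GL V ?x = GL W ?x * ?f" .
qed

end

section \<open>Full faithfulness of gluing\<close>

context simples
begin

lemma lift_ident: "lift V V (idn {..<tsize V}) = BI V"
 by (rule fmat_eqI) (auto simp: lift_def ent_BI ent_idn)

lemma lift_add: "lift V W (\<phi> + \<psi>) = lift V W \<phi> + lift V W \<psi>"
 by (rule fmat_eqI) (simp add: lift_def sc1.sc_add_left)

lemma lift_scale: "lift V W (sc1 a \<phi>) = sc2 a (lift V W \<phi>)"
 by (rule fmat_eqI) (simp add: lift_def sc1.sc_sc)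

lemma lift_comp:
 assumes \<phi>: "\<phi> \<in> tri_hom Q V V'" and \<psi>: "\<psi> \<in> tri_hom Q V' W"
 shows "lift V W (\<psi> * \<phi>) = lift V' W \<psi> * lift V V' \<phi>"
proof (rule fmat_eqI)
 fix b a
 have l: "ent (\<psi> * \<phi>) b a = (\<Sum>c<tsize V'. ent \<psi> b c * ent \<phi> c a)"
  by (rule ent_times_left) (use tri_homD(1)[OF \<psi>] in auto)
 have r: "ent (lift V' W \<psi> * lift V V' \<phi>) b a = (\<Sum>c<tsize V'. ent (lift V' W \<psi>) b c * ent (lift V V' \<phi>) c a)"
  by (rule ent_times_left) (auto simp: lift_def split: if_splits)
 have t: "ent (lift V' W \<psi>) b c * ent (lift V V' \<phi>) c a = sc1 (ent \<psi> b c * ent \<phi> c a) (I (label V a))" for c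
 proof (cases "ent \<phi> c a = 0")
  case False
  then have "label V a = label V' c" using tri_homD(1)[OF \<phi>] by blast
  then show ?thesis by (simp add: ent_lift[OF \<phi>] ent_lift[OF \<psi>] sc1.sc_mult_left sc1.sc_mult_right I_idem sc1.sc_sc mult.commute)
 qed (simp add: ent_lift[OF \<phi>])
 show "ent (lift V W (\<psi> * \<phi>)) b a = ent (lift V' W \<psi> * lift V V' \<phi>) b a"
 proof (cases "b < tsize W \<and> a < tsize V")
  case True
  then show ?thesis by (simp add: r t lift_def[of V W] l sc1.sc_sum_left)
 next
  case False
  then have "ent \<phi> c a = 0 \<or> ent \<psi> b c = 0" for c using tri_homD(1)[OF \<phi>] tri_homD(1)[OF \<psi>] by blast
  then have "ent \<psi> b c * ent \<phi> c a = 0" for c by (metis mult_zero_left mult_zero_right)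
  then have "(\<Sum>c<tsize V'. sc1 (ent \<psi> b c * ent \<phi> c a) (I (label V a))) = 0" by (intro sum.neutral) simp
  then show ?thesis using False by (simp only: r t lift_def[of V W] ent_fm if_False)
 qed
qed

lemma lift_inject:
 assumes V: "is_tri_rep Q V" and \<phi>: "\<phi> \<in> tri_hom Q V W" and \<psi>: "\<psi> \<in> tri_hom Q V W"
  and eq: "lift V W \<phi> = lift V W \<psi>"
 shows "\<phi> = \<psi>"
proof (rule fmat_eqI)
 fix b a
 show "ent \<phi> b a = ent \<psi> b a"
 proof (cases "a < tsize V")
  case True
  have "sc1 (ent \<phi> b a) (I (label V a)) = sc1 (ent \<psi> b a) (I (label V a))"
   using ent_lift[OF \<phi>] ent_lift[OF \<psi>] eq by metis
  then show ?thesis using sc1.sc_cancel[OF I_nonzero[OF labelD[OF V True]]] by blast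
 qed (use tri_homD(1)[OF \<phi>] tri_homD(1)[OF \<psi>] in metis)
qed

text \<open>Let \<open>\<psi> i\<close> be the conjugate of \<open>T\<close> by the changes of basis, so that it commutes with the diagonal action of
the \<open>i\<close>-th factor. The equation \<open>g W i * \<psi> i = T * g V i\<close> is solved blockwise, from the lower left corner
on. If the blocks further left and further down are known to be scalar, the equation for one block says that
\<open>T - \<psi> i\<close> there is a combination of the \<open>X S T k i\<close>. Independence modulo coboundaries makes the
coefficients vanish, which is the compatibility of the scalars with the arrows, and leaves \<open>T = \<psi> i\<close> for
all \<open>i\<close>, so the block of \<open>T\<close> is linear over the algebra, hence scalar by Schur's lemma.\<close>

lemma lift_full:
 assumes V: "is_tri_rep Q V" and W: "is_tri_rep Q W"
  and T: "BI W * T = T" "T * BI V = T" and comm: "\<forall>x\<in>carrier A. T * GL V x = GL W x * T"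
 shows "\<exists>\<phi>\<in>tri_hom Q V W. lift V W \<phi> = T"
proof -
 define \<psi> where "\<psi> i = ginv W i * T * g V i" for i
 define f where "f b a = (if b < tsize W \<and> a < tsize V \<and> label V a = label W b
   then SOME s. ent T b a = sc1 s (I (label V a)) else 0)" for b a
 define \<xi> where "\<xi> b a k = (\<Sum>c<tsize V. f b c * ent (amat V (label V a, label W b, k)) c a)
   - (\<Sum>c<tsize W. ent (amat W (label V a, label W b, k)) b c * f c a)" for b a k
 have \<psi>c: "BI W * \<psi> i = \<psi> i" "\<psi> i * BI V = \<psi> i" if i: "i < m" for i
  unfolding \<psi>_def using ginv[OF W i] g_corner[OF V i] by (simp_all add: mult.assoc) (simp add: mult.assoc[symmetric])
 have g\<psi>: "g W i * \<psi> i = T * g V i" if i: "i < m" for i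
 proof -
  have "g W i * \<psi> i = (g W i * ginv W i) * T * g V i" by (simp add: \<psi>_def mult.assoc)
  then show ?thesis using ginv(3)[OF W i] T by simp
 qed
 have \<psi>D: "\<psi> i * DL V (e i j p q) = DL W (e i j p q) * \<psi> i" if b: "i < m" "j < r i" "p < w i j" "q < w i j" for i j p q
 proof -
  let ?x = "e i j p q"
  have x: "?x \<in> carrier A" by (rule fpu_closed[OF b(1)])
  note DV = algebra_rep_corner[OF A_alg DL_rep[OF V] x] and DW = algebra_rep_corner[OF A_alg DL_rep[OF W] x]
  have "\<psi> i * DL V ?x = ginv W i * (T * (g V i * DL V ?x * (ginv V i * g V i)))"
   using ginv(4)[OF V b(1)] DV by (simp add: \<psi>_def mult.assoc)
  also have "\<dots> = ginv W i * (T * GL V ?x) * g V i" using GL(2)[OF V b] by (simp add: mult.assoc)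
  also have "\<dots> = ginv W i * (GL W ?x * T) * g V i" using comm x by simp
  also have "\<dots> = (ginv W i * g W i) * DL W ?x * (ginv W i * T * g V i)" using GL(2)[OF W b] by (simp add: mult.assoc)
  also have "\<dots> = DL W ?x * \<psi> i" using ginv(4)[OF W b(1)] DW by (simp add: \<psi>_def)
  finally show ?thesis .
 qed
 have entry: "ent T b a = sc1 (f b a) (I (label V a)) \<and> (label V a \<noteq> label W b \<longrightarrow> ent T b a = 0) \<and>
   (\<forall>i<m. ent (\<psi> i) b a = ent T b a) \<and> (\<forall>k<count (label V a) (label W b). \<xi> b a k = 0)"
  if "b < tsize W" "a < tsize V" for b a
  using that
 proof (induction "(tsize W - b) + a" arbitrary: b a rule: less_induct)
  case less
  note b = less.prems(1) and a = less.prems(2)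
  let ?S = "label V a" and ?T = "label W b"
  have S: "?S \<in> \<S>" and T': "?T \<in> \<S>" using labelD V W a b by auto
  have cornT: "I ?T * ent T b a = ent T b a" "ent T b a * I ?S = ent T b a"
   using arg_cong[OF T(1), of "\<lambda>z. ent z b a"] arg_cong[OF T(2), of "\<lambda>z. ent z b a"] a b
   by (simp_all add: ent_BI_times ent_times_BI)
  have corn\<psi>: "I ?T * ent (\<psi> i) b a = ent (\<psi> i) b a" "ent (\<psi> i) b a * I ?S = ent (\<psi> i) b a" if i: "i < m" for i
   using arg_cong[OF \<psi>c(1)[OF i], of "\<lambda>z. ent z b a"] arg_cong[OF \<psi>c(2)[OF i], of "\<lambda>z. ent z b a"] a b
   by (simp_all add: ent_BI_times ent_times_BI)
  have fl: "factor_linear ?S ?T i (ent (\<psi> i) b a)" if i: "i < m" for i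
  proof -
   have "ent (\<psi> i) b a * E ?S i j p q = E ?T i j p q * ent (\<psi> i) b a" if "j < r i" "p < w i j" "q < w i j" for j p q
    using arg_cong[OF \<psi>D[OF i that], of "\<lambda>z. ent z b a"] a b by (simp add: DL_def ent_times_diag ent_diag_times)
   then show ?thesis unfolding factor_linear_def using corn\<psi>[OF i] by blast
  qed
  have ihT: "ent T b c = sc1 (f b c) (I (label V c))" if "c < a" for c
   using less.hyps[of b c] that a b by simp
  have ih\<psi>: "ent (\<psi> i) c a = sc1 (f c a) (I (label W c))" if "b < c" "c < tsize W" "i < m" for c i
  proof -
   have "ent (\<psi> i) c a = sc1 (f c a) (I (label V a))" using less.hyps[of c a] that a b by simp
   moreover have "f c a = 0" if "label V a \<noteq> label W c" using that by (simp add: f_def)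
   ultimately show ?thesis by (cases "label V a = label W c") simp_all
  qed
  have eqn: "ent T b a - ent (\<psi> i) b a + (\<Sum>k<count ?S ?T. sc1 (\<xi> b a k) (X ?S ?T k i)) = 0" if i: "i < m" for i
  proof -
   have "ent (\<psi> i) b a + ent (N W i * \<psi> i) b a = ent T b a + ent (T * N V i) b a"
    using arg_cong[OF g\<psi>[OF i], of "\<lambda>z. ent z b a"] T \<psi>c[OF i] unfolding g_def by (simp add: distrib_left distrib_right)
   moreover have "ent (T * N V i) b a = (\<Sum>k<count ?S ?T. sc1 (\<Sum>c<tsize V. f b c * ent (amat V (?S, ?T, k)) c a) (X ?S ?T k i))"
    unfolding ent_times_N[OF V] by (rule N_column_sum[OF V a T' i ihT]) (simp_all add: f_def)
   moreover have "ent (N W i * \<psi> i) b a = (\<Sum>k<count ?S ?T. sc1 (\<Sum>c<tsize W. ent (amat W (?S, ?T, k)) b c * f c a) (X ?S ?T k i))"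
    unfolding ent_N_times[OF W] by (rule N_row_sum[OF W b S i ih\<psi>]) (simp_all add: f_def i)
   ultimately show ?thesis by (simp add: \<xi>_def sc1.sc_diff_left sum_subtractf algebra_simps)
  qed
  have \<xi>0: "\<xi> b a k = 0" if "k < count ?S ?T" for k
   by (rule X_independent[OF S T' cornT fl eqn that])
  have T\<psi>: "ent (\<psi> i) b a = ent T b a" if i: "i < m" for i
   using eqn[OF i] \<xi>0 by simp
  have units: "ent T b a * E ?S i j p q = E ?T i j p q * ent T b a" if "i < m" "j < r i" "p < w i j" "q < w i j" for i j p q
   using fl[OF that(1)] T\<psi>[OF that(1)] that unfolding factor_linear_def by metis
  have "ent T b a = sc1 (f b a) (I ?S) \<and> (?S \<noteq> ?T \<longrightarrow> ent T b a = 0)"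
  proof (cases "?S = ?T")
   case True
   then have "\<exists>s. ent T b a = sc1 s (I ?S)" using schur(1)[OF S T' cornT units] by blast
   from someI_ex[OF this] show ?thesis using True a b by (simp add: f_def)
  next
   case False
   then show ?thesis using schur(2)[OF S T' cornT units] by (simp add: f_def)
  qed
  then show ?case using T\<psi> \<xi>0 by blast
 qed
 define \<phi> where "\<phi> = fm (tsize W) (tsize V) f"
 have \<phi>: "\<phi> \<in> tri_hom Q V W"
  unfolding tri_hom_def
 proof (intro CollectI conjI allI impI ballI)
  show "a < tsize V" "b < tsize W" "label V a = label W b" if "ent \<phi> b a \<noteq> 0" for b a
   using that by (auto simp: \<phi>_def f_def split: if_splits)
 next
  fix \<alpha> assume \<alpha>: "\<alpha> \<in> arcs Q"
  obtain S T' k where \<alpha>e: "\<alpha> = (S, T', k)" by (cases \<alpha>)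
  note am = amatD[OF V, of S T' k] amatD[OF W, of S T' k] and st = \<alpha>[unfolded \<alpha>e Q_simps]
  show "\<phi> * amat V \<alpha> = amat W \<alpha> * \<phi>"
  proof (rule fmat_eqI)
   fix b a
   have l: "ent (\<phi> * amat V \<alpha>) b a = (\<Sum>c<tsize V. ent \<phi> b c * ent (amat V \<alpha>) c a)" by (rule ent_times_amat(1)[OF V \<alpha>])
   have rr: "ent (amat W \<alpha> * \<phi>) b a = (\<Sum>c<tsize W. ent (amat W \<alpha>) b c * ent \<phi> c a)" by (rule ent_times_amat(2)[OF W \<alpha>])
   show "ent (\<phi> * amat V \<alpha>) b a = ent (amat W \<alpha> * \<phi>) b a"
   proof (cases "b < tsize W \<and> a < tsize V \<and> label V a = S \<and> label W b = T'")
    case True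
    then have "\<xi> b a k = 0" using entry st by blast
    then show ?thesis using True unfolding l rr by (simp add: \<xi>_def \<phi>_def \<alpha>e)
   next
    case False
    have "ent \<phi> b c * ent (amat V \<alpha>) c a = 0" for c
     using False am(2,3,4)[of c a] st by (auto simp: \<phi>_def f_def \<alpha>e)
    moreover have "ent (amat W \<alpha>) b c * ent \<phi> c a = 0" for c
     using False am(5,6,7,8)[of b c] st by (auto simp: \<phi>_def f_def \<alpha>e)
    ultimately show ?thesis unfolding l rr by simp
   qed
  qed
 qed
 have "lift V W \<phi> = T"
 proof (rule fmat_eqI)
  fix b a
  show "ent (lift V W \<phi>) b a = ent T b a"
  proof (cases "b < tsize W \<and> a < tsize V")
   case True
   then show ?thesis using entry[of b a] by (simp add: lift_def \<phi>_def)
  next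
   case False
   have "ent T b a = ent (BI W * T * BI V) b a" using T by simp
   also have "\<dots> = 0" using False by (auto simp: ent_times_BI ent_BI_times)
   finally show ?thesis using False by (auto simp: lift_def)
  qed
 qed
 with \<phi> show ?thesis by blast
qed

text \<open>The subrepresentation spanned by the first \<open>k\<close> basis vectors.\<close>

definition truncation :: "('k, 'v) trirep \<Rightarrow> nat \<Rightarrow> ('k, 'v) trirep" where
 "truncation V k = V\<lparr>tsize := k, amat := (\<lambda>\<alpha>. fm k k (\<lambda>b a. ent (amat V \<alpha>) b a))\<rparr>"

lemma truncation_simps [simp]:
 "tsize (truncation V k) = k" "label (truncation V k) = label V"
 "ent (amat (truncation V k) \<alpha>) b a = (if b < k \<and> a < k then ent (amat V \<alpha>) b a else 0)"
 by (simp_all add: truncation_def)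

lemma truncation:
 assumes V: "is_tri_rep Q V" and k: "k \<le> tsize V"
 shows "is_tri_rep Q (truncation V k)" "idn {..<k} \<in> tri_hom Q (truncation V k) V"
proof -
 have nz: "b < a" if "\<alpha> \<in> arcs Q" "ent (amat V \<alpha>) b a \<noteq> 0" for \<alpha> b a
  using V that unfolding is_tri_rep_def by blast
 show "is_tri_rep Q (truncation V k)"
  using V k unfolding is_tri_rep_def by (auto simp del: Q_simps)
 have "idn {..<k} * amat (truncation V k) \<alpha> = amat V \<alpha> * idn {..<k}" if "\<alpha> \<in> arcs Q" for \<alpha>
  by (rule fmat_eqI) (use nz[OF that] in \<open>force simp: ent_idn_times ent_times_idn\<close>)
 then show "idn {..<k} \<in> tri_hom Q (truncation V k) V"
  using k unfolding tri_hom_def by (auto simp: ent_idn split: if_splits)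
qed

definition simple_rep :: "('k, 'v) smod \<Rightarrow> ('k, 'v) trirep" where
 "simple_rep S = \<lparr>tsize = 1, label = (\<lambda>_. S), amat = (\<lambda>_. 0)\<rparr>"

lemma simple_rep:
 assumes S: "S \<in> \<S>"
 shows "is_tri_rep Q (simple_rep S)" "x \<in> carrier A ==> ent (GL (simple_rep S) x) 0 0 = L S x"
proof -
 let ?W = "simple_rep S"
 show W: "is_tri_rep Q ?W" using S unfolding is_tri_rep_def by (simp add: simple_rep_def Q_simps(1))
 assume x: "x \<in> carrier A"
 have N0: "N ?W i = 0" for i by (rule fmat_eqI) (simp add: N_def simple_rep_def)
 have g: "g ?W i = BI ?W" for i by (simp add: g_def N0)
 have gi: "ginv ?W i = BI ?W" if "i < m" for i using ginv(2,4)[OF W that] g by metis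
 have "BI ?W * GL ?W x = DL ?W x * BI ?W"
 proof (rule rep_commute[OF sc2.scalars_axioms GL(1)[OF W] DL_rep[OF W] BI_idem BI_idem _ x])
  fix i j p q assume b: "i < m" "j < r i" "p < w i j" "q < w i j"
  show "BI ?W * GL ?W (e i j p q) = DL ?W (e i j p q) * BI ?W"
   using algebra_rep_corner[OF A_alg DL_rep[OF W] fpu_closed[OF b(1)]] GL(2)[OF W b] g gi[OF b(1)]
   by (simp add: BI_idem mult.assoc)
 qed
 then have "GL ?W x = DL ?W x"
  using algebra_rep_corner[OF A_alg DL_rep[OF W] x] algebra_rep_corner[OF A_alg GL(1)[OF W] x] by simp
 then show "ent (GL ?W x) 0 0 = L S x" by (simp add: DL_def ent_diag simple_rep_def)
qed

text \<open>Naturality of \<open>GL\<close> under the inclusion of a truncation gives the zeros below the diagonal, and under the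
projection of a truncation to its last basis vector it gives the diagonal blocks.\<close>

lemma GL_triangular:
 assumes V: "is_tri_rep Q V" and x: "x \<in> carrier A" and k: "k < tsize V"
 shows "a < k ==> ent (GL V x) k a = 0" and "ent (GL V x) k k = L (label V k) x"
proof -
 have corner: "ent (GL V x) b a * I (label V a) = ent (GL V x) b a" if "a < tsize V" for b a
  using arg_cong[OF algebra_rep_corner(2)[OF A_alg GL(1)[OF V] x], of "\<lambda>z. ent z b a"] that by (simp add: ent_times_BI)
 have inc: "ent (GL V x) b a = (if b < l then ent (GL (truncation V l) x) b a else 0)" if l: "l \<le> tsize V" "a < l" for l b a
 proof -
  let ?V = "truncation V l" and ?f = "lift (truncation V l) V (idn {..<l})"
  have f: "?f = diag {..<l} (\<lambda>a. I (label V a))"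
   by (rule fmat_eqI) (use l in \<open>auto simp: lift_def ent_idn ent_diag\<close>)
  have l': "ent (GL ?V x) b a = I (label V b) * ent (GL ?V x) b a" if "b < l"
   using arg_cong[OF algebra_rep_corner(1)[OF A_alg GL(1)[OF truncation(1)[OF V l(1)]] x], of "\<lambda>z. ent z b a"] that
   by (simp add: ent_BI_times)
  have "ent (?f * GL ?V x) b a = ent (GL V x * ?f) b a"
   using lift_GL[OF truncation(1)[OF V l(1)] V truncation(2)[OF V l(1)] x] by simp
  then show ?thesis using l l' corner[of a b] by (auto simp: f ent_diag_times ent_times_diag)
 qed
 show "a < k ==> ent (GL V x) k a = 0" using inc[of k a k] k by simp
 let ?V = "truncation V (Suc k)" and ?W = "simple_rep (label V k)"
 have Sk: "Suc k \<le> tsize V" using k by simp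
 note tV = truncation(1)[OF V Sk] and S = labelD[OF V k]
 have "eunit 0 k 1 * amat ?V \<alpha> = amat ?W \<alpha> * eunit 0 k 1" if \<alpha>: "\<alpha> \<in> arcs Q" for \<alpha>
 proof -
  have "k < a \<and> a < tsize ?V" if "ent (amat ?V \<alpha>) k a \<noteq> 0" for a
   using tV \<alpha> that unfolding is_tri_rep_def by blast
  then have "ent (amat ?V \<alpha>) k a = 0" for a by fastforce
  then show ?thesis by (intro fmat_eqI) (simp only: ent_eunit_times ent_times_eunit simple_rep_def tri_rep.simps ent_simps, simp)
 qed
 then have h: "eunit 0 k 1 \<in> tri_hom Q ?V ?W"
  unfolding tri_hom_def by (auto simp: simple_rep_def split: if_splits)
 have f: "lift ?V ?W (eunit 0 k 1) = eunit 0 k (I (label V k))"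
  by (rule fmat_eqI) (auto simp: lift_def simple_rep_def)
 have "ent (lift ?V ?W (eunit 0 k 1) * GL ?V x) 0 k = ent (GL ?W x * lift ?V ?W (eunit 0 k 1)) 0 k"
  using lift_GL[OF tV simple_rep(1)[OF S] h x] by simp
 then have "I (label V k) * ent (GL ?V x) k k = L (label V k) x * I (label V k)"
  by (simp add: f ent_eunit_times ent_times_eunit simple_rep(2)[OF S x])
 moreover have "I (label V k) * ent (GL ?V x) k k = ent (GL ?V x) k k"
  using arg_cong[OF algebra_rep_corner(1)[OF A_alg GL(1)[OF tV] x], of "\<lambda>z. ent z k k"] by (simp add: ent_BI_times)
 ultimately show "ent (GL V x) k k = L (label V k) x"
  using algebra_rep_corner(2)[OF A_alg S_rep[OF S] x] inc[of "Suc k" k k] Sk by simp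
qed

end

section \<open>The glued modules\<close>

locale coded_simples = simples m r w \<S> c L
 for m r w and \<S> :: "('k::alg_closed_field coprod, 'v) module set" and c L +
 assumes scalars_inject: "\<exists>f :: 'k \<Rightarrow> 'v. inj f"
begin

definition code :: "('k, 'v) trirep \<Rightarrow> 'k fmat fmat \<Rightarrow> 'v" where
 "code V = (SOME \<iota>. inj_on \<iota> (col (BI V) U2))"

lemma code_inj: "inj_on (code V) (col (BI V) U2)"
proof -
 obtain f :: "'k \<Rightarrow> 'v" where "inj f" using scalars_inject by blast
 from someI_ex[OF frame.col_inject[OF frame_BI infinite_alg_closed_field this]] show ?thesis unfolding code_def .
qed

definition glued :: "('k, 'v) trirep \<Rightarrow> ('k, 'v) smod" where
 "glued V = cvec (code V) (col (BI V) U2) (\<lambda>x y. GL V x * y)"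

definition cF :: "('k, 'v) trirep \<Rightarrow> 'v \<Rightarrow> 'k fmat fmat" where
 "cF V = inv_into (col (BI V) U2) (code V)"

definition glued_hom :: "('k, 'v) trirep \<Rightarrow> ('k, 'v) trirep \<Rightarrow> 'k fmat \<Rightarrow> 'v \<Rightarrow> 'v" where
 "glued_hom V W \<phi> = (\<lambda>x\<in>carrier (glued V). inv_into (carrier (glued W)) (cF W) (lift V W \<phi> * cF V x))"

lemma glued_mcoord:
 assumes V: "is_tri_rep Q V"
 shows "frame.mcoord sc2 (BI V) U2 A (glued V) (cF V) (GL V)"
  and "vectorspace.fin_dim class_ring (over_field A (glued V))"
 unfolding glued_def cF_def by (rule frame.cvec_mcoord[OF frame_BI A_alg GL(1)[OF V] code_inj])+

lemmas glued_D = frame.mcoordD[OF frame_BI glued_mcoord(1)]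

lemma glued_hom_eqI:
 assumes W: "is_tri_rep Q W" and h: "h \<in> extensional (carrier (glued V))"
  and hx: "\<And>x. x \<in> carrier (glued V) ==> h x \<in> carrier (glued W) \<and> cF W (h x) = lift V W \<phi> * cF V x"
 shows "h = glued_hom V W \<phi>"
proof (rule extensionalityI[OF h])
 show "glued_hom V W \<phi> \<in> extensional (carrier (glued V))" by (simp add: glued_hom_def)
 fix x assume x: "x \<in> carrier (glued V)"
 have inj: "inj_on (cF W) (carrier (glued W))" using glued_D(5)[OF W] by (rule bij_betw_imp_inj_on)
 have "inv_into (carrier (glued W)) (cF W) (cF W (h x)) = h x"
  by (rule inv_into_f_f[OF inj]) (use hx[OF x] in blast)
 then show "h x = glued_hom V W \<phi> x" using hx[OF x] x by (simp add: glued_hom_def)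
qed

lemma glued_hom:
 assumes V: "is_tri_rep Q V" and W: "is_tri_rep Q W" and \<phi>: "\<phi> \<in> tri_hom Q V W"
 shows "glued_hom V W \<phi> \<in> module_hom A (glued V) (glued W) \<inter> extensional (carrier (glued V))"
  and "x \<in> carrier (glued V) ==> cF W (glued_hom V W \<phi> x) = lift V W \<phi> * cF V x"
  and "x \<in> carrier (glued V) ==> glued_hom V W \<phi> x \<in> carrier (glued W)"
proof -
 note mh = matrix_hom[OF frame_BI frame_BI glued_mcoord(1)[OF V] glued_mcoord(1)[OF W] lift_corner[OF \<phi>]]
 have comm: "\<forall>x\<in>carrier A. lift V W \<phi> * GL V x = GL W x * lift V W \<phi>" using lift_GL[OF V W \<phi>] by blast
 show "glued_hom V W \<phi> \<in> module_hom A (glued V) (glued W) \<inter> extensional (carrier (glued V))"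
  using mh(1)[OF comm] unfolding glued_hom_def .
 show "x \<in> carrier (glued V) ==> cF W (glued_hom V W \<phi> x) = lift V W \<phi> * cF V x"
  "x \<in> carrier (glued V) ==> glued_hom V W \<phi> x \<in> carrier (glued W)"
  using mh(2,3)[OF comm] unfolding glued_hom_def by simp_all
qed

text \<open>By triangularity the vectors supported in the first \<open>k\<close> blocks form a submodule, and the \<open>k\<close>-th block
is a homomorphism from the next step of this filtration to the simple module that labels it.\<close>

lemma glued_factors:
 assumes V: "is_tri_rep Q V" and Z: "Z \<in> composition_factors A (glued V)"
 shows "\<exists>S\<in>\<S>. isomorphic_modules A Z S"
proof -
 let ?M = "glued V"
 interpret M: left_module A ?M by (rule glued_D(1)[OF V])
 interpret M: plain_left_module A ?M by (intro plain_left_module.intro M.left_module_axioms)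
 note D = glued_D[OF V]
 define F where "F k = {y \<in> carrier ?M. \<forall>a\<ge>k. ent (cF V y) a 0 = 0}" for k
 define \<theta> where "\<theta> k y = inv_into (carrier (label V k)) (c (label V k)) (ent (cF V y) k 0)" for k y
 have big: "ent (cF V y) a 0 = 0" if "y \<in> carrier ?M" "\<not> a < tsize V" for y a
  using arg_cong[OF colD(1)[OF D(8)[OF that(1)]], of "\<lambda>z. ent z a 0"] that(2) by (simp add: ent_BI_times)
 have zero: "cF V y = 0" if "y \<in> carrier ?M" "\<forall>a. ent (cF V y) a 0 = 0" for y
 proof (rule fmat_eqI)
  fix a b
  show "ent (cF V y) a b = ent 0 a b"
   using arg_cong[OF colD(2)[OF D(8)[OF that(1)]], of "\<lambda>z. ent z a b"] that(2)
   by (simp add: U2_def ent_times_eunit split: if_splits)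
 qed
 have act: "ent (cF V (x \<odot>\<^bsub>?M\<^esub> y)) a 0 = (\<Sum>b<tsize V. ent (GL V x) a b * ent (cF V y) b 0)"
  if "x \<in> carrier A" "y \<in> carrier ?M" for x y a
  unfolding D(4)[OF that] by (rule ent_times_right) (use big that in auto)
 have actF: "ent (cF V (x \<odot>\<^bsub>?M\<^esub> y)) a 0 = (if a = k then L (label V k) x * ent (cF V y) k 0 else 0)"
  if x: "x \<in> carrier A" and y: "y \<in> F (Suc k)" and a: "k \<le> a" "a < tsize V" for x y a k
 proof -
  have y': "y \<in> carrier ?M" "ent (cF V y) b 0 = 0" if "Suc k \<le> b" for b using y that by (auto simp: F_def)
  have yM: "y \<in> carrier ?M" using y by (simp add: F_def)
  have "ent (GL V x) a b * ent (cF V y) b 0 = (if b = a then if a = k then L (label V k) x * ent (cF V y) k 0 else 0 else 0)"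
   if "b < tsize V" for b
   using GL_triangular[OF V x a(2)] y'(2)[of b] a by (cases "b < a"; cases "a < b") (auto split: if_splits)
  then show ?thesis unfolding act[OF x yM] using a(2) by simp
 qed
 have sub: "Module.submodule (F k) A ?M" if k: "k \<le> tsize V" for k
 proof (rule M.submoduleI)
  show "F k \<subseteq> carrier ?M" by (auto simp: F_def)
  show "\<zero>\<^bsub>?M\<^esub> \<in> F k" using D(11) by (simp add: F_def)
  show "x \<oplus>\<^bsub>?M\<^esub> y \<in> F k" if "x \<in> F k" "y \<in> F k" for x y
   using that D(6) by (auto simp: F_def)
  fix x y assume x: "x \<in> carrier A" and y: "y \<in> F k"
  have yM: "y \<in> carrier ?M" using y by (simp add: F_def)
  have "ent (cF V (x \<odot>\<^bsub>?M\<^esub> y)) a 0 = 0" if a: "a \<ge> k" for a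
  proof (cases "a < tsize V")
   case True
   have "ent (GL V x) a b * ent (cF V y) b 0 = 0" for b
    using GL_triangular(1)[OF V x True, of b] y a by (cases "b < a") (auto simp: F_def)
   then show ?thesis unfolding act[OF x yM] by simp
  qed (use big M.smult_closed[OF x yM] in auto)
  then show "x \<odot>\<^bsub>?M\<^esub> y \<in> F k" using M.smult_closed[OF x yM] by (auto simp: F_def)
 qed
 have colL: "ent (cF V y) k 0 \<in> col (I (label V k)) U1" if "k < tsize V" "y \<in> carrier ?M" for k y
 proof (rule colI)
  show "I (label V k) * ent (cF V y) k 0 = ent (cF V y) k 0"
   using arg_cong[OF colD(1)[OF D(8)[OF that(2)]], of "\<lambda>z. ent z k 0"] that(1) by (simp add: ent_BI_times)
  show "ent (cF V y) k 0 * U1 = ent (cF V y) k 0"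
   using arg_cong[OF colD(2)[OF D(8)[OF that(2)]], of "\<lambda>z. ent z k 0"] by (simp add: U2_def ent_times_eunit)
 qed
 have \<theta>: "\<theta> k y \<in> carrier (label V k)" "c (label V k) (\<theta> k y) = ent (cF V y) k 0" if k: "k < tsize V" and y: "y \<in> carrier ?M" for k y
 proof -
  have b: "bij_betw (c (label V k)) (carrier (label V k)) (col (I (label V k)) U1)"
   by (rule S_mcoord(5)[OF labelD[OF V k]])
  then have im: "ent (cF V y) k 0 \<in> c (label V k) ` carrier (label V k)" using colL[OF k y] by (simp add: bij_betw_def)
  show "\<theta> k y \<in> carrier (label V k)" unfolding \<theta>_def by (rule inv_into_into[OF im])
  show "c (label V k) (\<theta> k y) = ent (cF V y) k 0" unfolding \<theta>_def by (rule f_inv_into_f[OF im])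
 qed
 have "\<exists>k<tsize V. isomorphic_modules A Z (label V k)"
 proof (rule M.factor_of_filtered[of F "tsize V" "label V" \<theta>, OF _ _ sub _ _ _ _ _ Z])
  show "F 0 = {\<zero>\<^bsub>?M\<^esub>}"
  proof -
   have "y = \<zero>\<^bsub>?M\<^esub>" if "y \<in> F 0" for y
    using zero[of y] D(10)[of y "\<zero>\<^bsub>?M\<^esub>"] D(11) that by (simp add: F_def)
   moreover have "\<zero>\<^bsub>?M\<^esub> \<in> F 0" by (simp add: F_def D(11))
   ultimately show ?thesis by blast
  qed
  show "F (tsize V) = carrier ?M" using big by (auto simp: F_def)
 next
  fix k assume k: "k < tsize V"
  let ?S = "label V k"
  have S: "?S \<in> \<S>" by (rule labelD[OF V k])
  interpret S: left_module A ?S by (rule S_left_module[OF S])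
  show "simple_module A ?S" by (rule simple[OF S])
  fix y assume "y \<in> F (Suc k)"
  then have y: "y \<in> F (Suc k)" "y \<in> carrier ?M" by (auto simp: F_def)
  show "\<theta> k y \<in> carrier ?S" using \<theta>[OF k y(2)] by blast
  have "\<theta> k y = \<zero>\<^bsub>?S\<^esub> \<longleftrightarrow> ent (cF V y) k 0 = 0"
   using S_mcoord(10)[OF S \<theta>(1)[OF k y(2)] S.M.zero_closed] S_mcoord(11)[OF S] \<theta>(2)[OF k y(2)] by simp
  moreover have "y \<in> F k \<longleftrightarrow> ent (cF V y) k 0 = 0"
   using y by (auto simp: F_def not_less_eq_eq[symmetric] Suc_le_eq dest: le_neq_implies_less)
  ultimately show "\<theta> k y = \<zero>\<^bsub>?S\<^esub> \<longleftrightarrow> y \<in> F k" by blast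
  show "\<theta> k (x \<odot>\<^bsub>?M\<^esub> y) = x \<odot>\<^bsub>?S\<^esub> \<theta> k y" if x: "x \<in> carrier A" for x
  proof -
   note xy = M.smult_closed[OF x y(2)]
   have "c ?S (\<theta> k (x \<odot>\<^bsub>?M\<^esub> y)) = c ?S (x \<odot>\<^bsub>?S\<^esub> \<theta> k y)"
    using S_mcoord(4)[OF S x \<theta>(1)[OF k y(2)]] \<theta>(2)[OF k xy] \<theta>(2)[OF k y(2)] actF[OF x y(1), of k] k by simp
   then show ?thesis using S_mcoord(10)[OF S \<theta>(1)[OF k xy] S.smult_closed[OF x \<theta>(1)[OF k y(2)]]] by simp
  qed
  fix y' assume "y' \<in> F (Suc k)"
  then have y': "y' \<in> carrier ?M" by (simp add: F_def)
  note s = M.M.a_closed[OF y(2) y']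
  have "c ?S (\<theta> k (y \<oplus>\<^bsub>?M\<^esub> y')) = c ?S (\<theta> k y \<oplus>\<^bsub>?S\<^esub> \<theta> k y')"
   using S_mcoord(6)[OF S \<theta>(1)[OF k y(2)] \<theta>(1)[OF k y']] \<theta>(2)[OF k s] \<theta>(2)[OF k y(2)] \<theta>(2)[OF k y'] D(6)[OF y(2) y'] by simp
  then show "\<theta> k (y \<oplus>\<^bsub>?M\<^esub> y') = \<theta> k y \<oplus>\<^bsub>?S\<^esub> \<theta> k y'"
   using S_mcoord(10)[OF S \<theta>(1)[OF k s] S.M.a_closed[OF \<theta>(1)[OF k y(2)] \<theta>(1)[OF k y']]] by simp
 qed
 then show ?thesis using labelD[OF V] by blast
qed

lemma wide_simps:
 "Ob (wide A \<S>) = {M. left_module A M \<and> vectorspace.fin_dim class_ring (over_field A M) \<and>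
   (\<forall>Z\<in>composition_factors A M. \<exists>S\<in>\<S>. isomorphic_modules A Z S)}"
 "Hom (wide A \<S>) M Z = module_hom A M Z \<inter> extensional (carrier M)"
 "Ident (wide A \<S>) M = (\<lambda>x\<in>carrier M. x)"
 "Comp (wide A \<S>) M Z Z' h f = compose (carrier M) h f"
 "Plus (wide A \<S>) M Z f h = (\<lambda>x\<in>carrier M. f x \<oplus>\<^bsub>Z\<^esub> h x)"
 "Scale (wide A \<S>) M Z a f = (\<lambda>x\<in>carrier M. (a \<odot>\<^bsub>A\<^esub> \<one>\<^bsub>A\<^esub>) \<odot>\<^bsub>Z\<^esub> f x)"
 by (auto simp: wide_def full_subcategory_def rep_def over_field_def)

lemma glued_functor: "linear_functor (tri_cat Q) (wide A \<S>) glued glued_hom"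
 unfolding linear_functor_def
proof (intro conjI ballI allI; simp only: tri_cat_simps mem_Collect_eq wide_simps)
 fix V :: "('k, 'v) trirep" assume V: "is_tri_rep Q V"
 show "left_module A (glued V) \<and> vectorspace.fin_dim class_ring (over_field A (glued V)) \<and>
   (\<forall>Z\<in>composition_factors A (glued V). \<exists>S\<in>\<S>. isomorphic_modules A Z S)"
  using glued_D(1)[OF V] glued_mcoord(2)[OF V] glued_factors[OF V] by blast
 show "glued_hom V V (idn {..<tsize V}) = (\<lambda>x\<in>carrier (glued V). x)"
  by (rule glued_hom_eqI[OF V, symmetric]) (use colD(1)[OF glued_D(8)[OF V]] in \<open>simp_all add: lift_ident\<close>)
next
 fix V W :: "('k, 'v) trirep" and \<phi> assume "is_tri_rep Q V" "is_tri_rep Q W" "\<phi> \<in> tri_hom Q V W"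
 then show "glued_hom V W \<phi> \<in> module_hom A (glued V) (glued W) \<inter> extensional (carrier (glued V))" by (rule glued_hom(1))
next
 fix V W W' :: "('k, 'v) trirep" and \<phi> \<psi> assume V: "is_tri_rep Q V" and W: "is_tri_rep Q W" and W': "is_tri_rep Q W'"
  and \<phi>: "\<phi> \<in> tri_hom Q V W" and \<psi>: "\<psi> \<in> tri_hom Q W W'"
 show "glued_hom V W' (\<psi> * \<phi>) = compose (carrier (glued V)) (glued_hom W W' \<psi>) (glued_hom V W \<phi>)"
  by (rule glued_hom_eqI[OF W', symmetric])
   (simp_all add: compose_def glued_hom(2,3)[OF V W \<phi>] glued_hom(2,3)[OF W W' \<psi>] lift_comp[OF \<phi> \<psi>] mult.assoc)
next
 fix V W :: "('k, 'v) trirep" and \<phi> \<psi> assume V: "is_tri_rep Q V" and W: "is_tri_rep Q W"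
  and \<phi>: "\<phi> \<in> tri_hom Q V W" and \<psi>: "\<psi> \<in> tri_hom Q V W"
 interpret W: left_module A "glued W" by (rule glued_D(1)[OF W])
 show "glued_hom V W (\<phi> + \<psi>) = (\<lambda>x\<in>carrier (glued V). glued_hom V W \<phi> x \<oplus>\<^bsub>glued W\<^esub> glued_hom V W \<psi> x)"
  by (rule glued_hom_eqI[OF W, symmetric])
   (simp_all add: glued_hom(2,3)[OF V W \<phi>] glued_hom(2,3)[OF V W \<psi>] lift_add glued_D(6)[OF W] distrib_right)
next
 fix V W :: "('k, 'v) trirep" and \<phi> a assume V: "is_tri_rep Q V" and W: "is_tri_rep Q W" and \<phi>: "\<phi> \<in> tri_hom Q V W"
 interpret W: left_module A "glued W" by (rule glued_D(1)[OF W])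
 interpret A: assoc_algebra A by (rule A_alg)
 show "glued_hom V W (sc1 a \<phi>) = (\<lambda>x\<in>carrier (glued V). (a \<odot>\<^bsub>A\<^esub> \<one>\<^bsub>A\<^esub>) \<odot>\<^bsub>glued W\<^esub> glued_hom V W \<phi> x)"
  by (rule glued_hom_eqI[OF W, symmetric])
   (simp_all add: glued_hom(2,3)[OF V W \<phi>] lift_scale glued_D(7)[OF W] sc2.sc_mult_left W.smult_closed A.vec.smult_closed)
qed

lemma glued_fully_faithful: "fully_faithful (tri_cat Q) (wide A \<S>) glued glued_hom"
 unfolding fully_faithful_def
proof (intro ballI; simp only: tri_cat_simps mem_Collect_eq wide_simps)
 fix V W :: "('k, 'v) trirep" assume V: "is_tri_rep Q V" and W: "is_tri_rep Q W"
 show "bij_betw (glued_hom V W) (tri_hom Q V W) (module_hom A (glued V) (glued W) \<inter> extensional (carrier (glued V)))"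
  unfolding bij_betw_def
 proof (intro conjI inj_onI equalityI subsetI)
  fix \<phi> \<psi> assume \<phi>: "\<phi> \<in> tri_hom Q V W" and \<psi>: "\<psi> \<in> tri_hom Q V W" and eq: "glued_hom V W \<phi> = glued_hom V W \<psi>"
  have "lift V W \<phi> = lift V W \<psi>"
  proof (rule frame.matrix_unique[OF frame_BI lift_corner(2)[OF \<phi>] lift_corner(2)[OF \<psi>]])
   fix y assume "y \<in> col (BI V) U2"
   then obtain x where x: "x \<in> carrier (glued V)" "cF V x = y" using glued_D(9)[OF V] by blast
   show "lift V W \<phi> * y = lift V W \<psi> * y"
    using glued_hom(2)[OF V W \<phi> x(1)] glued_hom(2)[OF V W \<psi> x(1)] eq x(2) by simp
  qed
  then show "\<phi> = \<psi>" by (rule lift_inject[OF V \<phi> \<psi>])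
 next
  fix h assume "h \<in> glued_hom V W ` tri_hom Q V W"
  then show "h \<in> module_hom A (glued V) (glued W) \<inter> extensional (carrier (glued V))" using glued_hom(1)[OF V W] by blast
 next
  fix h assume h: "h \<in> module_hom A (glued V) (glued W) \<inter> extensional (carrier (glued V))"
  have hm: "h \<in> module_hom A (glued V) (glued W)" using h by blast
  obtain T where T: "BI W * T = T" "T * BI V = T" "\<forall>x\<in>carrier (glued V). cF W (h x) = T * cF V x"
   "\<forall>x\<in>carrier A. T * GL V x = GL W x * T"
   using hom_matrix[OF frame_BI frame_BI A_alg glued_mcoord(1)[OF V] glued_mcoord(1)[OF W] hm] by blast
  obtain \<phi> where \<phi>: "\<phi> \<in> tri_hom Q V W" "lift V W \<phi> = T" using lift_full[OF V W T(1,2,4)] by blast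
  have "h = glued_hom V W \<phi>"
   by (rule glued_hom_eqI[OF W]) (use h T(3) \<phi>(2) in \<open>auto simp: LinearCombinations.module_hom_def\<close>)
  then show "h \<in> glued_hom V W ` tri_hom Q V W" using \<phi>(1) by blast
 qed
qed

end

section \<open>Extending by one simple module\<close>

lemma (in frame) linear_section:
 assumes Z: "0 \<in> Z" "\<And>x y. x \<in> Z ==> y \<in> Z ==> x + y \<in> Z" "\<And>a x. x \<in> Z ==> sc a x \<in> Z" "Z \<subseteq> col J U"
  and p: "p 0 = 0" "\<And>x y. x \<in> Z ==> y \<in> Z ==> p (x + y) = p x + p y" "\<And>a x. x \<in> Z ==> p (sc a x) = sc a (p x)"
  and surj: "\<And>y. y \<in> col I U ==> \<exists>x\<in>Z. p x = y"
 shows "\<exists>t. J * t = t \<and> t * I = t \<and> (\<forall>x\<in>col I U. t * x \<in> Z \<and> p (t * x) = x)"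
proof -
 have "\<forall>k\<in>K. \<exists>x\<in>Z. p x = u k" using surj u_col by blast
 then obtain s where s: "\<And>k. k \<in> K ==> s k \<in> Z" "\<And>k. k \<in> K ==> p (s k) = u k" by metis
 define f where "f x = (\<Sum>k\<in>K. sc (cf (v k * x)) (s k))" for x
 have f: "f x \<in> Z \<and> p (f x) = x" if x: "x \<in> col I U" for x
 proof -
  have "(\<Sum>k\<in>B. sc (z k) (s k)) \<in> Z \<and> p (\<Sum>k\<in>B. sc (z k) (s k)) = (\<Sum>k\<in>B. sc (z k) (u k))" if "B \<subseteq> K" for B z
   using finite_subset[OF that finite_K] that
   by (induction B rule: finite_induct) (use Z p s in auto)
  from this[OF order_refl, of "\<lambda>k. cf (v k * x)"] show ?thesis
   unfolding f_def using col_expand[OF x] by simp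
 qed
 have "\<exists>t. J * t = t \<and> t * I = t \<and> (\<forall>x\<in>col I U. t * x = f x)"
 proof (rule matrix_exists)
  show "f (x + y) = f x + f y" for x y
   by (simp add: f_def distrib_left cf_add sc_add_left sum.distrib)
  show "f (sc a x) = sc a (f x)" for a x
   by (simp add: f_def sc_mult_right cf_sc sc_sc sc_sum_right)
  show "f x \<in> col J U" if "x \<in> col I U" for x using f[OF that] Z(4) by blast
 qed
 then show ?thesis using f by metis
qed

context simples
begin

lemma factor_linear_uminus: "factor_linear S T i k ==> factor_linear S T i (- k)"
 unfolding factor_linear_def by simp

text \<open>The new last column of the changes of basis starts as \<open>u\<close>, and \<open>F\<close> and \<open>K\<close> are the corrections of the
splitting and of the factorwise splittings. The block in row \<open>b\<close> involves only blocks of \<open>K\<close> in later rows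
\<open>c\<close>, so the rows are treated from the last one upwards, each by an expansion in the basis of extensions.\<close>

lemma normalize_column:
 assumes V: "is_tri_rep Q V" and S: "S \<in> \<S>"
  and u: "\<And>i b. i < m ==> b < tsize V ==> I (label V b) * u i b = u i b \<and> u i b * I S = u i b"
 obtains F K \<xi> where "\<And>b. b < tsize V ==> I (label V b) * F b = F b"
  "\<And>b. b < tsize V ==> F b * I S = F b"
  "\<And>b i. b < tsize V ==> i < m ==> factor_linear S (label V b) i (K i b)"
  "\<And>b i. b < tsize V ==> i < m ==> u i b + F b - (K i b + (\<Sum>c<tsize V. ent (N V i) b c * K i c))
    = (\<Sum>k < count S (label V b). sc1 (\<xi> b k) (X S (label V b) k i))"
proof -
 let ?n = "tsize V"
 define good where "good F K \<xi> b \<longleftrightarrow> I (label V b) * F b = F b \<and> F b * I S = F b \<and>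
   (\<forall>i<m. factor_linear S (label V b) i (K i b)) \<and>
   (\<forall>i<m. u i b + F b - (K i b + (\<Sum>c<?n. ent (N V i) b c * K i c))
     = (\<Sum>k < count S (label V b). sc1 (\<xi> b k) (X S (label V b) k i)))"
  for F and K :: "nat \<Rightarrow> nat \<Rightarrow> 'k fmat" and \<xi> :: "nat \<Rightarrow> nat \<Rightarrow> 'k" and b
 have low: "ent (N V i) b c = 0" if "c \<le> b" for i b c
  using ent_N_nz(1)[OF V, of i b c] that by fastforce
 have "j \<le> ?n ==> \<exists>F K \<xi>. \<forall>b<?n. ?n \<le> b + j \<longrightarrow> good F K \<xi> b" for j
 proof (induction j)
  case 0
  then show ?case by simp
 next
  case (Suc j)
  then obtain F K \<xi> where IH: "\<forall>b<?n. ?n \<le> b + j \<longrightarrow> good F K \<xi> b" by auto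
  define b where "b = ?n - Suc j"
  have b: "b < ?n" "b + Suc j = ?n" using Suc.prems by (auto simp: b_def)
  define y where "y i = u i b - (\<Sum>c\<in>{c. b < c \<and> c < ?n}. ent (N V i) b c * K i c)" for i
  have T: "label V b \<in> \<S>" by (rule labelD[OF V b(1)])
  have Kc: "K i c * I S = K i c" if "b < c" "c < ?n" "i < m" for i c
  proof -
   have "good F K \<xi> c" using IH that b by simp
   then show ?thesis using that unfolding good_def factor_linear_def by blast
  qed
  have Nc: "I (label V b) * ent (N V i) b c = ent (N V i) b c" if "i < m" for i c
   using arg_cong[OF N_corner(1)[OF V that], of "\<lambda>z. ent z b c"] b by (simp add: ent_BI_times)
  have y: "I (label V b) * y i = y i" "y i * I S = y i" if i: "i < m" for i
  proof -
   show "I (label V b) * y i = y i"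
    using u[OF i b(1)] Nc[OF i] by (simp add: y_def right_diff_distrib sum_distrib_left mult.assoc[symmetric])
   have "ent (N V i) b c * K i c * I S = ent (N V i) b c * K i c" if "c \<in> {c. b < c \<and> c < ?n}" for c
    using Kc[OF _ _ i, of c] that by (simp add: mult.assoc)
   then show "y i * I S = y i"
    using u[OF i b(1)] by (simp add: y_def left_diff_distrib sum_distrib_right)
  qed
  have "\<exists>f h z. (I (label V b) * f = f \<and> f * I S = f) \<and> (\<forall>i<m. factor_linear S (label V b) i (h i)) \<and>
   (\<forall>i<m. y i = f - h i + (\<Sum>k < count S (label V b). sc1 (z k) (X S (label V b) k i)))"
   by (rule X_span[OF S T, where y = y, OF y]; (intro exI conjI allI impI)?; (assumption | simp)?)
  then obtain f h z where fhz: "I (label V b) * f = f \<and> f * I S = f" "\<forall>i<m. factor_linear S (label V b) i (h i)"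
   "\<forall>i<m. y i = f - h i + (\<Sum>k < count S (label V b). sc1 (z k) (X S (label V b) k i))"
   by (elim exE conjE) (rule that, (rule conjI)?, assumption+)
  define F' where "F' = F(b := - f)"
  define K' where "K' i = (K i)(b := - h i)" for i
  define \<xi>' where "\<xi>' = \<xi>(b := z)"
  have sums: "(\<Sum>c<?n. ent (N V i) b' c * K' i c) = (\<Sum>c\<in>{c. b' < c \<and> c < ?n}. ent (N V i) b' c * K i c)" if "b \<le> b'" for i b'
   by (rule sum.mono_neutral_cong_right) (use that low in \<open>auto simp: K'_def\<close>, metis low mult_zero_left not_le)
  have sums0: "(\<Sum>c<?n. ent (N V i) b' c * K i c) = (\<Sum>c\<in>{c. b' < c \<and> c < ?n}. ent (N V i) b' c * K i c)" for i b'
   by (rule sum.mono_neutral_cong_right) (auto, metis low mult_zero_left not_le)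
  have "good F' K' \<xi>' b"
   unfolding good_def using fhz sums[OF order_refl] factor_linear_uminus
   by (simp add: F'_def K'_def \<xi>'_def y_def algebra_simps)
  moreover have "good F' K' \<xi>' b'" if "b' < ?n" "?n \<le> b' + j" for b'
  proof -
   have "good F K \<xi> b'" "b < b'" using IH that b by auto
   then show ?thesis using sums[of b'] sums0[of _ b'] unfolding good_def by (simp add: F'_def K'_def \<xi>'_def)
  qed
  ultimately have "\<forall>b'<?n. ?n \<le> b' + Suc j \<longrightarrow> good F' K' \<xi>' b'"
   using b by (metis Suc_leI add_Suc_right add_le_cancel_right le_neq_implies_less not_less_eq_eq)
  then show ?case by blast
 qed
 from this[OF order_refl] obtain F K \<xi> where "\<forall>b<?n. good F K \<xi> b" by auto
 then show ?thesis using that[of F K \<xi>] unfolding good_def by blast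
qed

text \<open>Adjoining to \<open>V\<close> a last basis vector labelled by \<open>S\<close>, with prescribed last column.\<close>

definition adjoin :: "('k, 'v) trirep \<Rightarrow> ('k, 'v) smod \<Rightarrow> (nat \<Rightarrow> nat \<Rightarrow> 'k) \<Rightarrow> ('k, 'v) trirep" where
 "adjoin V S \<xi> = \<lparr>tsize = Suc (tsize V), label = (label V)(tsize V := S),
   amat = (\<lambda>(S', T, k). fm (tsize V) (Suc (tsize V)) (\<lambda>b a. if a < tsize V then ent (amat V (S', T, k)) b a
    else if S' = S \<and> label V b = T then \<xi> b k else 0))\<rparr>"

lemma adjoin_simps:
 "tsize (adjoin V S \<xi>) = Suc (tsize V)" "label (adjoin V S \<xi>) a = (if a = tsize V then S else label V a)"
 "ent (amat (adjoin V S \<xi>) (S', T, k)) b a = (if b < tsize V \<and> a < tsize V then ent (amat V (S', T, k)) b a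
   else if b < tsize V \<and> a = tsize V \<and> S' = S \<and> label V b = T then \<xi> b k else 0)"
 by (auto simp: adjoin_def)

lemma adjoin:
 assumes V: "is_tri_rep Q V" and S: "S \<in> \<S>"
 shows "is_tri_rep Q (adjoin V S \<xi>)"
  and "BI (adjoin V S \<xi>) = BI V + eunit (tsize V) (tsize V) (I S)"
  and "DL (adjoin V S \<xi>) x = DL V x + eunit (tsize V) (tsize V) (L S x)"
  and "N (adjoin V S \<xi>) i = N V i + fm (tsize V) (Suc (tsize V)) (\<lambda>b a. if a = tsize V
    then \<Sum>k < count S (label V b). sc1 (\<xi> b k) (X S (label V b) k i) else 0)"
proof -
 let ?V = "adjoin V S \<xi>"
 show "is_tri_rep Q ?V"
  unfolding is_tri_rep_def
 proof (intro conjI allI impI ballI)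
  show "label ?V a \<in> verts Q" if "a < tsize ?V" for a
   using that S labelD[OF V] by (auto simp: adjoin_simps Q_simps(1) less_Suc_eq)
 next
  fix \<alpha> b a assume \<alpha>: "\<alpha> \<in> arcs Q" and nz: "ent (amat ?V \<alpha>) b a \<noteq> 0"
  obtain S' T k where e: "\<alpha> = (S', T, k)" by (cases \<alpha>)
  note st = \<alpha>[unfolded e Q_simps]
  consider "b < tsize V" "a < tsize V" "ent (amat V (S', T, k)) b a \<noteq> 0"
   | "b < tsize V" "a = tsize V" "S' = S" "label V b = T"
   using nz by (auto simp: e adjoin_simps split: if_splits)
  then have "b < a \<and> a < tsize ?V \<and> label ?V a = S' \<and> label ?V b = T"
  proof cases
   case 1
   have "S' \<in> \<S>" "T \<in> \<S>" "k < count S' T" using st by auto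
   from amatD[OF V 1(3) this] show ?thesis using 1 by (simp add: adjoin_simps)
  qed (simp add: adjoin_simps)
  then show "b < a" "a < tsize ?V" "label ?V a = tail Q \<alpha>" "label ?V b = head Q \<alpha>"
   by (simp_all add: e Q_simps(2,3))
 qed
 show "BI ?V = BI V + eunit (tsize V) (tsize V) (I S)"
  by (rule fmat_eqI) (auto simp: ent_BI adjoin_simps)
 show "DL ?V x = DL V x + eunit (tsize V) (tsize V) (L S x)"
  by (rule fmat_eqI) (auto simp: DL_def ent_diag adjoin_simps)
 show "N ?V i = N V i + fm (tsize V) (Suc (tsize V)) (\<lambda>b a. if a = tsize V
    then \<Sum>k < count S (label V b). sc1 (\<xi> b k) (X S (label V b) k i) else 0)"
  by (rule fmat_eqI) (auto simp: N_def adjoin_simps)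
qed

text \<open>Read \<open>LM\<close> as the action on a module of dimension \<open>n\<close> in coordinates and \<open>Z\<close> as a submodule. Then \<open>\<Theta>\<close> is an
isomorphism from the module glued along \<open>V\<close> to \<open>Z\<close>; its values are block matrices with the single block
\<open>(0, 0)\<close>.\<close>

definition modelled :: "nat \<Rightarrow> ('k coprod \<Rightarrow> 'k fmat) \<Rightarrow> 'k fmat set \<Rightarrow> ('k, 'v) trirep \<Rightarrow> 'k fmat fmat \<Rightarrow> bool" where
 "modelled n LM Z V \<Theta> \<longleftrightarrow> is_tri_rep Q V \<and> eunit 0 0 (idn {..<n}) * \<Theta> = \<Theta> \<and> \<Theta> * BI V = \<Theta> \<and>
   (\<forall>x\<in>carrier A. \<Theta> * GL V x = eunit 0 0 (LM x) * \<Theta>) \<and>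
   (\<forall>y\<in>col (BI V) U2. \<Theta> * y = 0 \<longrightarrow> y = 0) \<and>
   (\<forall>z. z \<in> Z \<longleftrightarrow> (\<exists>y\<in>col (BI V) U2. \<Theta> * y = eunit 0 0 z))"

lemma column_lift:
 assumes mod: "modelled n LM Z V \<Theta>" and y: "y * I S = y" "\<And>x. x \<in> col (I S) U1 ==> y * x \<in> Z"
 obtains u where "BI V * u = u" "u * eunit l l (I S) = u" "\<Theta> * u = eunit 0 l y"
proof -
 have "\<forall>k<d S. \<exists>x\<in>col (BI V) U2. \<Theta> * x = eunit 0 0 (y * eunit k 0 1)"
 proof (intro allI impI)
  fix k assume "k < d S"
  then have "y * eunit k 0 1 \<in> Z" by (intro y(2) frame.u_col[OF fr]) simp
  then show "\<exists>x\<in>col (BI V) U2. \<Theta> * x = eunit 0 0 (y * eunit k 0 1)" using mod unfolding modelled_def by blast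
 qed
 then obtain x where x: "\<And>k. k < d S ==> x k \<in> col (BI V) U2"
  "\<And>k. k < d S ==> \<Theta> * x k = eunit 0 0 (y * eunit k 0 1)" by metis
 define u where "u = (\<Sum>k<d S. x k * eunit 0 l (eunit 0 k 1))"
 have "BI V * u = u" unfolding u_def sum_distrib_left
  by (rule sum.cong) (use colD(1)[OF x(1)] in \<open>simp_all add: mult.assoc[symmetric]\<close>)
 moreover have "u * eunit l l (I S) = u" unfolding u_def sum_distrib_right
  by (rule sum.cong) (use frame.v_I[OF fr, of _ S] in \<open>simp_all add: mult.assoc eunit_times\<close>)
 moreover have "\<Theta> * u = eunit 0 l y"
 proof -
  have s: "(\<Sum>k\<in>B. eunit 0 l (f k)) = (eunit 0 l (\<Sum>k\<in>B. f k) :: 'k fmat fmat)" for f :: "nat \<Rightarrow> 'k fmat" and B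
   by (rule fmat_eqI) simp
  have "\<Theta> * u = (\<Sum>k<d S. eunit 0 l (y * eunit k 0 1 * eunit 0 k 1))"
   unfolding u_def sum_distrib_left by (rule sum.cong) (simp_all add: mult.assoc[symmetric] x(2) eunit_times)
  also have "\<dots> = eunit 0 l (y * (\<Sum>k<d S. eunit k 0 1 * eunit 0 k 1))" by (simp only: s sum_distrib_left mult.assoc)
  also have "\<dots> = eunit 0 l y" using frame.I_sum[OF fr, of S] y(1) by simp
  finally show ?thesis .
 qed
 ultimately show ?thesis by (rule that)
qed

end

context simples
begin

text \<open>Here \<open>p\<close> is the projection of \<open>Z'\<close> to \<open>S\<close> with kernel \<open>Z\<close>. A linear section \<open>t\<close> of \<open>p\<close> can be averaged to a
section \<open>\<tau> i\<close> that is linear over the \<open>i\<close>-th factor. The differences \<open>\<tau> i - t\<close> have values in \<open>Z\<close> and, pulled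
back along \<open>\<Theta>\<close>, form a column for each \<open>i\<close>. Normalizing these columns gives the coefficients \<open>\<xi>\<close> for
the arrows out of the new basis vector, and replaces \<open>t\<close> by \<open>t - \<Theta> * f\<close>.\<close>

lemma extension_step:
 assumes S: "S \<in> \<S>" and LM: "algebra_rep A sc1 (idn {..<n}) LM" and mod: "modelled n LM Z V \<Theta>"
  and Z0: "0 \<in> Z'" and Zadd: "\<And>x y. x \<in> Z' ==> y \<in> Z' ==> x + y \<in> Z'"
  and Zact: "\<And>x z. x \<in> carrier A ==> z \<in> Z' ==> LM x * z \<in> Z'"
  and Zcol: "Z' \<subseteq> col (idn {..<n}) U1" and ZZ': "Z \<subseteq> Z'"
  and p: "\<And>z. z \<in> Z' ==> p z \<in> col (I S) U1" and padd: "\<And>x y. x \<in> Z' ==> y \<in> Z' ==> p (x + y) = p x + p y"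
  and pact: "\<And>x z. x \<in> carrier A ==> z \<in> Z' ==> p (LM x * z) = L S x * p z"
  and psurj: "\<And>y. y \<in> col (I S) U1 ==> \<exists>z\<in>Z'. p z = y"
  and pker: "\<And>z. z \<in> Z' ==> p z = 0 \<longleftrightarrow> z \<in> Z"
 shows "\<exists>V' \<Theta>'. modelled n LM Z' V' \<Theta>'"
proof -
 interpret A: assoc_algebra A by (rule A_alg)
 note mod' = mod[unfolded modelled_def]
 have V: "is_tri_rep Q V" and J\<Theta>: "eunit 0 0 (idn {..<n}) * \<Theta> = \<Theta>" and \<Theta>BI: "\<Theta> * BI V = \<Theta>"
  and \<Theta>GL: "\<And>x. x \<in> carrier A ==> \<Theta> * GL V x = eunit 0 0 (LM x) * \<Theta>"
  and \<Theta>inj: "\<And>y. y \<in> col (BI V) U2 ==> \<Theta> * y = 0 ==> y = 0"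
  and \<Theta>im: "\<And>z. z \<in> Z \<longleftrightarrow> (\<exists>y\<in>col (BI V) U2. \<Theta> * y = eunit 0 0 z)"
  using mod' by blast+
 define l where "l = tsize V"
 \<comment> \<open>the identity of the new last block\<close>
 define B where "B = eunit l l (I S)"
 have one: "a \<odot>\<^bsub>A\<^esub> \<one>\<^bsub>A\<^esub> \<in> carrier A" for a by simp
 have scLM: "LM (a \<odot>\<^bsub>A\<^esub> \<one>\<^bsub>A\<^esub>) * z = sc1 a z" if "z \<in> Z'" for a z
  using algebra_repD(3)[OF LM, of "\<one>\<^bsub>A\<^esub>" a] algebra_repD(4)[OF LM] colD(1)[of z "idn {..<n}" U1] Zcol that by (auto simp: sc1.sc_mult_left)
 have scL: "L S (a \<odot>\<^bsub>A\<^esub> \<one>\<^bsub>A\<^esub>) * z = sc1 a z" if "z \<in> col (I S) U1" for a z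
  using algebra_repD(3)[OF S_rep[OF S], of "\<one>\<^bsub>A\<^esub>" a] algebra_repD(4)[OF S_rep[OF S]] colD(1)[OF that] by (auto simp: sc1.sc_mult_left)
 have Zsc: "sc1 a z \<in> Z'" if "z \<in> Z'" for a z using Zact[OF one that] scLM[OF that] by metis
 have psc: "p (sc1 a z) = sc1 a (p z)" if "z \<in> Z'" for a z
  using pact[OF one that] scLM[OF that] scL[OF p[OF that]] by metis
 have p0: "p 0 = 0" using psc[OF Z0, of 0] by simp
 have Zdiff: "x - y \<in> Z'" "p (x - y) = p x - p y" if "x \<in> Z'" "y \<in> Z'" for x y
  using Zadd[OF that(1) Zsc[OF that(2), of "-1"]] padd[OF that(1) Zsc[OF that(2), of "-1"]] psc[OF that(2), of "-1"]
  by (simp_all add: sc1.sc_minus_left)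
 obtain t where t: "idn {..<n} * t = t" "t * I S = t" "\<And>x. x \<in> col (I S) U1 ==> t * x \<in> Z'"
  "\<And>x. x \<in> col (I S) U1 ==> p (t * x) = x"
  using frame.linear_section[OF fr Z0 Zadd Zsc Zcol p0 padd psc psurj] by blast
 \<comment> \<open>averaging the section over the \<open>i\<close>-th factor makes it linear over this factor\<close>
 define \<tau> where "\<tau> i = (\<Sum>(j, q)\<in>JP i. LM (e i j q 0) * t * E S i j 0 q)" for i
 have \<tau>c: "idn {..<n} * \<tau> i = \<tau> i" "\<tau> i * I S = \<tau> i" if i: "i < m" for i
 proof -
  show "idn {..<n} * \<tau> i = \<tau> i"
   using algebra_rep_corner(1)[OF A_alg LM fpu_closed[OF i]]
   by (simp add: \<tau>_def sum_distrib_left split_def mult.assoc[symmetric])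
  have "LM (e i j q 0) * t * E S i j 0 q * I S = LM (e i j q 0) * t * E S i j 0 q" for j q
   using E_corner(2)[OF S i] by (simp add: mult.assoc)
  then show "\<tau> i * I S = \<tau> i" by (simp add: \<tau>_def sum_distrib_right split_def)
 qed
 have \<tau>comm: "\<tau> i * E S i j a b = LM (e i j a b) * \<tau> i" if i: "i < m" "j < r i" "a < w i j" "b < w i j" for i j a b
 proof -
  have wp: "0 < w i j'" if "j' < r i" for j' using w_pos[OF i(1) that] by simp
  have "\<tau> i * E S i j a b = (\<Sum>jq\<in>JP i. if jq = (j, a) then LM (e i j a 0) * t * E S i j 0 b else 0)"
   unfolding \<tau>_def sum_distrib_right
   by (rule sum.cong) (use E_mult[OF S i(1)] i wp in \<open>auto simp: mult.assoc split: if_splits\<close>)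
  also have "\<dots> = LM (e i j a 0) * t * E S i j 0 b" using i by simp
  also have "\<dots> = (\<Sum>jq\<in>JP i. if jq = (j, b) then LM (e i j a 0) * t * E S i j 0 b else 0)"
   using i by simp
  also have "\<dots> = LM (e i j a b) * \<tau> i"
   unfolding \<tau>_def sum_distrib_left
   by (rule sum.cong) (use rep_units(1)[OF sc1.scalars_axioms LM i(1)] i wp in \<open>auto simp: mult.assoc[symmetric] split: if_splits\<close>)
  finally show ?thesis .
 qed
 have \<tau>p: "\<tau> i * x \<in> Z' \<and> p (\<tau> i * x) = x" if i: "i < m" and x: "x \<in> col (I S) U1" for i x
 proof -
  have ec: "E S i j a b * x \<in> col (I S) U1" for j a b using E_corner(1)[OF S i] x by (rule col_mult)
  have "(\<Sum>(j, q)\<in>B. LM (e i j q 0) * t * E S i j 0 q * x) \<in> Z' \<and>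
   p (\<Sum>(j, q)\<in>B. LM (e i j q 0) * t * E S i j 0 q * x) = (\<Sum>(j, q)\<in>B. E S i j q q * x)" if "B \<subseteq> JP i" for B
  proof -
   have "finite B" by (rule finite_subset[OF that]) simp
   then show ?thesis using that
   proof (induction B rule: finite_induct)
    case empty
    then show ?case using Z0 p0 by simp
   next
    case (insert jq B)
    obtain j q where jq: "jq = (j, q)" by (cases jq)
    have b: "j < r i" "q < w i j" "0 < w i j" using insert.prems by (auto simp: jq)
    let ?z = "LM (e i j q 0) * (t * (E S i j 0 q * x))"
    have z: "?z \<in> Z'" "p ?z = E S i j q q * x"
     using Zact[OF fpu_closed[OF i] t(3)[OF ec]] pact[OF fpu_closed[OF i] t(3)[OF ec]] t(4)[OF ec]
      E_mult[OF S i, of j q 0 j 0 q] b by (simp_all add: mult.assoc[symmetric])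
    show ?case using insert z Zadd padd by (simp add: jq mult.assoc)
   qed
  qed
  from this[OF order_refl] show ?thesis
   using E_sum[OF S i] colD(1)[OF x] by (simp add: \<tau>_def sum_distrib_right[symmetric] split_def)
 qed
 have "\<forall>i<m. \<exists>u. BI V * u = u \<and> u * B = u \<and> \<Theta> * u = eunit 0 l (\<tau> i - t)"
 proof (intro allI impI)
  fix i assume i: "i < m"
  have h1: "(\<tau> i - t) * x \<in> Z" if x: "x \<in> col (I S) U1" for x
   using Zdiff[OF conjunct1[OF \<tau>p[OF i x]] t(3)[OF x]] \<tau>p[OF i x] t(4)[OF x] pker by (simp add: left_diff_distrib)
  have h2: "(\<tau> i - t) * I S = \<tau> i - t" using \<tau>c(2)[OF i] t(2) by (simp add: left_diff_distrib)
  show "\<exists>u. BI V * u = u \<and> u * B = u \<and> \<Theta> * u = eunit 0 l (\<tau> i - t)"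
   unfolding B_def by (rule column_lift[OF mod h2 h1, of l]) (assumption, intro exI conjI)
 qed
 then obtain u where u: "\<And>i. i < m ==> BI V * u i = u i" "\<And>i. i < m ==> u i * B = u i"
  "\<And>i. i < m ==> \<Theta> * u i = eunit 0 l (\<tau> i - t)" by metis
 have ub: "I (label V b) * ent (u i) b l = ent (u i) b l \<and> ent (u i) b l * I S = ent (u i) b l" if "i < m" "b < tsize V" for i b
  using arg_cong[OF u(1)[OF that(1)], of "\<lambda>z. ent z b l"] arg_cong[OF u(2)[OF that(1)], of "\<lambda>z. ent z b l"] that
  by (simp add: ent_BI_times B_def ent_times_eunit)
 obtain F K \<xi> where F: "\<And>b. b < l ==> I (label V b) * F b = F b" "\<And>b. b < l ==> F b * I S = F b"
  and K: "\<And>b i. b < l ==> i < m ==> factor_linear S (label V b) i (K i b)"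
  and eqn: "\<And>b i. b < l ==> i < m ==> ent (u i) b l + F b - (K i b + (\<Sum>c<l. ent (N V i) b c * K i c))
    = (\<Sum>k < count S (label V b). sc1 (\<xi> b k) (X S (label V b) k i))"
  using normalize_column[OF V S, of "\<lambda>i b. ent (u i) b l", OF ub, folded l_def] by blast
 define f where "f = fm l (Suc l) (\<lambda>b a. if a = l then F b else 0)"
 define k where "k i = fm l (Suc l) (\<lambda>b a. if a = l then K i b else 0)" for i
 \<comment> \<open>by \<open>eqn\<close> the new column \<open>Y i\<close> of \<open>g V' i\<close> is \<open>u i + f - g V i * k i\<close>\<close>
 define V' where "V' = adjoin V S \<xi>"
 define Y where "Y i = fm l (Suc l) (\<lambda>b a. if a = l then \<Sum>k < count S (label V b). sc1 (\<xi> b k) (X S (label V b) k i) else 0)" for i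
 define \<Theta>' where "\<Theta>' = \<Theta> + eunit 0 l t - \<Theta> * f"
 note adj = adjoin[OF V S, of \<xi>, folded V'_def l_def]
 have V': "is_tri_rep Q V'" by (rule adj(1))
 have BI': "BI V' = BI V + B" by (simp add: adj(2) B_def)
 have N': "N V' i = N V i + Y i" for i by (simp add: adj(4) Y_def)
 have BB: "BI V * B = 0" "B * BI V = 0" "B * B = B"
  by (rule fmat_eqI; simp add: ent_BI_times ent_times_BI B_def l_def I_idem eunit_times)+
 have fB: "BI V * f = f" "f * B = f"
  by (rule fmat_eqI; use F in \<open>simp add: ent_BI_times B_def ent_times_eunit f_def l_def\<close>)+
 have kB: "BI V * k i = k i" "k i * B = k i" if i: "i < m" for i
  by (rule fmat_eqI; use K[OF _ i] in \<open>simp add: factor_linear_def ent_BI_times B_def ent_times_eunit k_def l_def\<close>)+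
 have tB: "eunit 0 l t * B = eunit 0 l t" using t(2) by (simp add: B_def eunit_times)
 have Yeq: "Y i = u i + f - g V i * k i" if i: "i < m" for i
 proof (rule fmat_eqI)
  fix b a
  have uz: "ent (u i) b a = 0" if "\<not> (b < l \<and> a = l)"
  proof -
   have "ent (u i) b a = ent (BI V * u i * B) b a" using u[OF i] by simp
   then show ?thesis using that by (auto simp: ent_times_eunit B_def ent_BI_times l_def)
  qed
  have gk: "ent (g V i * k i) b a = ent (k i) b a + (\<Sum>c<l. ent (N V i) b c * ent (k i) c a)"
   using kB(1)[OF i] by (simp add: g_def distrib_right ent_N_times[OF V] l_def)
  show "ent (Y i) b a = ent (u i + f - g V i * k i) b a"
  proof (cases "b < l \<and> a = l")
   case True
   then show ?thesis unfolding ent_simps gk using eqn[of b i] i by (simp add: Y_def f_def k_def)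
  next
   case False
   have "ent (N V i) b c * ent (k i) c a = 0" if "c < l" for c
    using False ent_N_nz[OF V, of i b c] that by (cases "ent (N V i) b c = 0") (auto simp: k_def)
   then have "(\<Sum>c<l. ent (N V i) b c * ent (k i) c a) = 0" by (intro sum.neutral) simp
   moreover have "ent (Y i) b a = 0" "ent f b a = 0" "ent (k i) b a = 0" using False by (auto simp: Y_def f_def k_def)
   ultimately show ?thesis unfolding ent_simps gk using uz[OF False] by simp
  qed
 qed
 have Yc: "BI V * Y i = Y i" "Y i * B = Y i" if i: "i < m" for i
  unfolding Yeq[OF i] using u[OF i] fB kB[OF i] g_corner[OF V i]
  by (simp_all add: distrib_left distrib_right left_diff_distrib right_diff_distrib mult.assoc) (simp add: mult.assoc[symmetric])
 have zero: "x * y = 0" if "x * B = x" "BI V * y = y" for x y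
 proof -
  have "x * y = x * (B * BI V) * y" using that by (simp only: mult.assoc) (simp only: mult.assoc[symmetric])
  then show ?thesis using BB by simp
 qed
 have zero': "x * y = 0" if "x * BI V = x" "B * y = y" for x y
 proof -
  have "x * y = x * (BI V * B) * y" using that by (simp only: mult.assoc) (simp only: mult.assoc[symmetric])
  then show ?thesis using BB by simp
 qed
 have \<Theta>'B: "\<Theta>' * BI V = \<Theta>" "\<Theta>' * B = eunit 0 l t - \<Theta> * f"
  using \<Theta>BI tB fB(2) zero[OF tB BI_idem] zero[OF fB(2) BI_idem] zero'[OF \<Theta>BI BB(3)]
  by (simp_all add: \<Theta>'_def distrib_right left_diff_distrib mult.assoc)
 have \<Theta>'g: "\<Theta>' * g V' i = \<Theta> * g V i + eunit 0 l (\<tau> i) - \<Theta> * g V i * k i" if i: "i < m" for i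
 proof -
  have x: "x * g V' i = x * g V i + x * Y i" if "x * BI V = x" for x
   using zero'[OF that BB(3)] by (simp add: g_def BI' N' distrib_left)
  have y: "x * g V' i = x" if "x * B = x" for x
   using zero[OF that g_corner(1)[OF V i]] zero[OF that Yc(1)[OF i]] that
   by (simp add: g_def[of V'] BI' N' distrib_left) (simp add: g_def distrib_left)
  have "\<Theta>' * g V' i = \<Theta> * g V i + \<Theta> * Y i + eunit 0 l t - \<Theta> * f"
   unfolding \<Theta>'_def using x[OF \<Theta>BI] y[OF tB] y[OF fB(2)] by (simp add: distrib_right left_diff_distrib mult.assoc)
  also have "\<Theta> * Y i = eunit 0 l (\<tau> i - t) + \<Theta> * f - \<Theta> * g V i * k i"
   unfolding Yeq[OF i] using u(3)[OF i] by (simp add: distrib_left right_diff_distrib mult.assoc)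
  finally show ?thesis by (simp add: eunit_simps)
 qed
 have LM': "algebra_rep A sc2 (eunit 0 0 (idn {..<n})) (\<lambda>x. eunit 0 0 (LM x))"
  using LM unfolding algebra_rep_def by (simp add: eunit_simps eunit_times sc2_eunit)
 have J\<Theta>': "eunit 0 0 (idn {..<n}) * \<Theta>' = \<Theta>'"
  using J\<Theta> t(1) by (simp add: \<Theta>'_def distrib_left right_diff_distrib eunit_times mult.assoc[symmetric])
 have \<Theta>'BI: "\<Theta>' * BI V' = \<Theta>'" using \<Theta>'B by (simp add: BI' distrib_left) (simp add: \<Theta>'_def)
 have \<Theta>'GL: "\<Theta>' * GL V' x = eunit 0 0 (LM x) * \<Theta>'" if x: "x \<in> carrier A" for x
 proof (rule rep_commute[OF sc2.scalars_axioms GL(1)[OF V'] LM' J\<Theta>' \<Theta>'BI _ x])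
  fix i j a b assume ij: "i < m" "j < r i" "a < w i j" "b < w i j"
  let ?x = "e i j a b" and ?M = "eunit 0 0 (LM (e i j a b)) :: 'k fmat fmat"
  have xA: "?x \<in> carrier A" by (rule fpu_closed[OF ij(1)])
  note DLc = algebra_rep_corner[OF A_alg DL_rep[OF V] xA]
  have D': "DL V' ?x = DL V ?x + eunit l l (E S i j a b)" by (rule adj(3))
  have ED: "B * eunit l l (E S i j a b) = eunit l l (E S i j a b)"
   using E_corner(1)[OF S ij(1)] by (simp add: B_def eunit_times)
  have x: "x * DL V' ?x = x * DL V ?x" if "x * BI V = x" for x
   using zero'[OF that ED] by (simp add: D' distrib_left)
  have y: "x * DL V' ?x = x * eunit l l (E S i j a b)" if "x * B = x" for x
   using zero[OF that DLc(1)] by (simp add: D' distrib_left)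
  have \<Theta>g: "\<Theta> * g V i * DL V ?x = ?M * (\<Theta> * g V i)"
  proof -
   have "\<Theta> * g V i * DL V ?x = \<Theta> * (g V i * DL V ?x * (ginv V i * g V i))"
    using ginv(4)[OF V ij(1)] DLc(2) by (simp add: mult.assoc)
   also have "\<dots> = (\<Theta> * GL V ?x) * g V i" using GL(2)[OF V ij] by (simp add: mult.assoc)
   finally show ?thesis using \<Theta>GL[OF xA] by (simp add: mult.assoc)
  qed
  have kD: "k i * eunit l l (E S i j a b) = DL V ?x * k i"
   by (rule fmat_eqI) (use K[OF _ ij(1)] ij in \<open>auto simp: k_def DL_def ent_diag_times ent_times_eunit factor_linear_def l_def\<close>)
  have "\<Theta>' * g V' i * DL V' ?x = \<Theta> * g V i * DL V ?x + eunit 0 l (\<tau> i) * eunit l l (E S i j a b) - \<Theta> * g V i * k i * eunit l l (E S i j a b)"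
  proof -
   have "\<Theta> * g V i * BI V = \<Theta> * g V i" using g_corner(2)[OF V ij(1)] by (simp add: mult.assoc)
   moreover have "eunit 0 l (\<tau> i) * B = eunit 0 l (\<tau> i)" using \<tau>c(2)[OF ij(1)] by (simp add: B_def eunit_times)
   moreover have "\<Theta> * g V i * k i * B = \<Theta> * g V i * k i" using kB(2)[OF ij(1)] by (simp add: mult.assoc)
   ultimately show ?thesis unfolding \<Theta>'g[OF ij(1)] using x y by (simp only: distrib_right left_diff_distrib)
  qed
  also have "eunit 0 l (\<tau> i) * eunit l l (E S i j a b) = ?M * eunit 0 l (\<tau> i)"
   using \<tau>comm[OF ij] by (simp add: eunit_times)
  also have "\<Theta> * g V i * k i * eunit l l (E S i j a b) = ?M * (\<Theta> * g V i * k i)"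
  proof -
   have "\<Theta> * g V i * k i * eunit l l (E S i j a b) = \<Theta> * g V i * DL V ?x * k i"
    using kD by (simp add: mult.assoc)
   then show ?thesis unfolding \<Theta>g by (simp only: mult.assoc)
  qed
  finally have \<Theta>'D: "\<Theta>' * g V' i * DL V' ?x = ?M * (\<Theta>' * g V' i)"
   unfolding \<Theta>'g[OF ij(1)] using \<Theta>g by (simp add: distrib_left right_diff_distrib)
  have "\<Theta>' * GL V' ?x = \<Theta>' * g V' i * DL V' ?x * ginv V' i" using GL(2)[OF V' ij] by (simp add: mult.assoc)
  also have "\<dots> = ?M * (\<Theta>' * (g V' i * ginv V' i))" using \<Theta>'D by (simp add: mult.assoc)
  also have "\<dots> = ?M * \<Theta>'" using ginv(3)[OF V' ij(1)] \<Theta>'BI by simp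
  finally show "\<Theta>' * GL V' ?x = ?M * \<Theta>'" .
 qed
 have colS: "ent y l 0 \<in> col (I S) U1" "B * y = eunit l 0 (ent y l 0)" if y: "y \<in> col (BI V') U2" for y
 proof -
  have "ent (BI V' * y) l 0 = I S * ent y l 0"
   by (simp add: BI' distrib_right ent_BI_times B_def ent_eunit_times l_def)
  moreover have "ent (y * U2) l 0 = ent y l 0 * U1" by (simp add: U2_def ent_times_eunit)
  ultimately show s: "ent y l 0 \<in> col (I S) U1" using colD[OF y] by (intro colI) metis+
  show "B * y = eunit l 0 (ent y l 0)"
  proof (rule fmat_eqI)
   fix b a
   have "ent y l a = 0" if "a \<noteq> 0"
    using arg_cong[OF colD(2)[OF y], of "\<lambda>z. ent z l a"] that by (simp add: U2_def ent_times_eunit)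
   then show "ent (B * y) b a = ent (eunit l 0 (ent y l 0)) b a"
    using colD(1)[OF s] by (auto simp: B_def ent_eunit_times)
  qed
 qed
 have im1: "\<exists>z\<in>Z. \<Theta>' * y = eunit 0 0 (z + t * ent y l 0) \<and> \<Theta> * (BI V * y - f * y) = eunit 0 0 z"
  if y: "y \<in> col (BI V') U2" for y
 proof -
  have c: "BI V * y - f * y \<in> col (BI V) U2"
   using colD(2)[OF y] BI_idem fB(1) by (intro colI) (simp_all add: right_diff_distrib left_diff_distrib mult.assoc mult.assoc[symmetric, of "BI V"])
  have "\<Theta> * (BI V * y - f * y) = eunit 0 0 (ent (\<Theta> * (BI V * y - f * y)) 0 0)"
  proof (rule fmat_eqI)
   fix b a
   have "\<Theta> * (BI V * y - f * y) = eunit 0 0 (idn {..<n}) * (\<Theta> * (BI V * y - f * y)) * U2"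
    using J\<Theta> colD(2)[OF c] by (simp add: mult.assoc[symmetric]) (simp add: mult.assoc)
   then have "ent (\<Theta> * (BI V * y - f * y)) b a = ent (eunit 0 0 (idn {..<n}) * (\<Theta> * (BI V * y - f * y)) * U2) b a" by simp
   also have "\<dots> = 0" if "\<not> (b = 0 \<and> a = 0)" using that by (auto simp: U2_def ent_times_eunit ent_eunit_times)
   finally show "ent (\<Theta> * (BI V * y - f * y)) b a = ent (eunit 0 0 (ent (\<Theta> * (BI V * y - f * y)) 0 0)) b a" by auto
  qed
  then obtain z where z: "\<Theta> * (BI V * y - f * y) = eunit 0 0 z" by blast
  have "\<Theta>' * y = \<Theta>' * BI V' * y" using \<Theta>'BI by simp
  also have "\<dots> = \<Theta> * y + \<Theta>' * (B * y)" by (simp only: BI' distrib_left \<Theta>'B(1) distrib_right) (simp only: mult.assoc)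
  also have "\<Theta>' * (B * y) = eunit 0 l t * (B * y) - \<Theta> * (f * y)"
  proof -
   have "\<Theta>' * (B * y) = \<Theta>' * B * y" by (simp only: mult.assoc)
   moreover have "eunit 0 l t * (B * y) = eunit 0 l t * B * y" by (simp only: mult.assoc)
   ultimately show ?thesis unfolding \<Theta>'B(2) tB by (simp only: left_diff_distrib mult.assoc)
  qed
  also have "eunit 0 l t * (B * y) = eunit 0 0 (t * ent y l 0)" by (simp add: colS(2)[OF y] eunit_times)
  also have "\<Theta> * y = \<Theta> * (BI V * y)" using \<Theta>BI by (simp add: mult.assoc[symmetric])
  finally have "\<Theta>' * y = eunit 0 0 (z + t * ent y l 0)" using z by (simp add: eunit_simps right_diff_distrib)
  moreover have "z \<in> Z" using \<Theta>im c z by blast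
  ultimately show ?thesis using z by blast
 qed
 have e00: "z = z'" if "eunit 0 0 z = (eunit 0 0 z' :: 'k fmat fmat)" for z z'
  using arg_cong[OF that, of "\<lambda>z. ent z 0 0"] by simp
 have "modelled n LM Z' V' \<Theta>'"
  unfolding modelled_def
 proof (intro conjI ballI allI impI V' J\<Theta>' \<Theta>'BI \<Theta>'GL)
  fix y assume y: "y \<in> col (BI V') U2" and 0: "\<Theta>' * y = 0"
  obtain z where z: "z \<in> Z" "\<Theta>' * y = eunit 0 0 (z + t * ent y l 0)" "\<Theta> * (BI V * y - f * y) = eunit 0 0 z"
   using im1[OF y] by blast
  have zs: "z + t * ent y l 0 = 0" using z(2) 0 e00[of _ 0] by (simp add: eunit_simps)
  have "p (z + t * ent y l 0) = ent y l 0"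
   using padd[of z "t * ent y l 0"] z(1) ZZ' t(3,4)[OF colS(1)[OF y]] pker by auto
  then have s0: "ent y l 0 = 0" using zs p0 by simp
  then have By: "B * y = 0" using colS(2)[OF y] by (simp add: eunit_simps)
  have "f * y = f * (B * y)" using fB(2) by (simp add: mult.assoc[symmetric])
  then have fy: "f * y = 0" using By by simp
  have "\<Theta> * (BI V * y) = 0" using z(3) fy zs s0 by (simp add: eunit_simps)
  moreover have "BI V * y \<in> col (BI V) U2"
   using BI_idem colD(2)[OF y] by (intro colI) (simp_all add: mult.assoc[symmetric], simp add: mult.assoc)
  ultimately have "BI V * y = 0" using \<Theta>inj by blast
  then show "y = 0" using By colD(1)[OF y] by (simp add: BI' distrib_right)
 next
  fix z
  show "z \<in> Z' \<longleftrightarrow> (\<exists>y\<in>col (BI V') U2. \<Theta>' * y = eunit 0 0 z)"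
  proof
   assume "\<exists>y\<in>col (BI V') U2. \<Theta>' * y = eunit 0 0 z"
   then obtain y z' where y: "y \<in> col (BI V') U2" "z' \<in> Z" "eunit 0 0 z = (eunit 0 0 (z' + t * ent y l 0) :: 'k fmat fmat)"
    using im1 by metis
   from e00[OF y(3)] show "z \<in> Z'" using Zadd[of z' "t * ent y l 0"] y(2) ZZ' t(3)[OF colS(1)[OF y(1)]] by auto
  next
   assume z: "z \<in> Z'"
   let ?s = "p z"
   have ts: "t * ?s \<in> Z'" "p (t * ?s) = ?s" using t(3,4)[OF p[OF z]] by auto
   have "z - t * ?s \<in> Z" using Zdiff[OF z ts(1)] ts(2) pker by simp
   then obtain x where x: "x \<in> col (BI V) U2" "\<Theta> * x = eunit 0 0 (z - t * ?s)" using \<Theta>im by blast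
   define s where "s = (eunit l 0 ?s :: 'k fmat fmat)"
   have Bs: "B * s = s" using colD(1)[OF p[OF z]] by (simp add: s_def B_def eunit_times)
   have sU: "s * U2 = s" using colD(2)[OF p[OF z]] by (simp add: s_def U2_def eunit_times)
   let ?y = "x + f * s + s"
   have BIy: "BI V * (x + f * s) = x + f * s" using colD(1)[OF x(1)] fB(1) by (simp add: distrib_left mult.assoc[symmetric])
   have By0: "B * (x + f * s) = 0" by (rule zero[OF BB(3) BIy])
   have BIs: "BI V * s = 0" by (rule zero'[OF BI_idem Bs])
   have y: "?y \<in> col (BI V') U2"
   proof (rule colI)
    have "BI V' * ?y = (BI V * (x + f * s) + BI V * s) + (B * (x + f * s) + B * s)"
     by (simp add: BI' distrib_right distrib_left)
    then show "BI V' * ?y = ?y" unfolding BIy By0 BIs Bs by simp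
    show "?y * U2 = ?y" using colD(2)[OF x(1)] sU by (simp add: distrib_right mult.assoc)
   qed
   have "\<Theta>' * (x + f * s) = \<Theta> * (x + f * s)" using \<Theta>'B(1)[symmetric] BIy by (simp only: mult.assoc)
   moreover have "\<Theta>' * s = (eunit 0 l t - \<Theta> * f) * s" using \<Theta>'B(2)[symmetric] Bs by (simp only: mult.assoc)
   ultimately have "\<Theta>' * ?y = \<Theta> * x + eunit 0 l t * s"
    by (simp add: distrib_left left_diff_distrib mult.assoc)
   also have "\<dots> = eunit 0 0 z" using x(2) by (simp add: s_def eunit_times eunit_simps)
   finally show "\<exists>y\<in>col (BI V') U2. \<Theta>' * y = eunit 0 0 z" using y by blast
  qed
 qed
 then show ?thesis by blast
qed

end

section \<open>Essential surjectivity of gluing\<close>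

lemma inverse_module_hom:
 assumes cl: "\<And>x y. x \<in> carrier M ==> y \<in> carrier M ==> x \<oplus>\<^bsub>M\<^esub> y \<in> carrier M"
  "\<And>a x. a \<in> carrier R ==> x \<in> carrier M ==> a \<odot>\<^bsub>M\<^esub> x \<in> carrier M"
  and h: "h \<in> module_hom R M N" and b: "bij_betw h (carrier M) (carrier N)"
 shows "restrict (inv_into (carrier M) h) (carrier N) \<in> module_hom R N M"
proof -
 let ?g = "inv_into (carrier M) h"
 have hadd: "h (x \<oplus>\<^bsub>M\<^esub> y) = h x \<oplus>\<^bsub>N\<^esub> h y" if "x \<in> carrier M" "y \<in> carrier M" for x y
  using h that by (simp add: LinearCombinations.module_hom_def)
 have hsm: "h (a \<odot>\<^bsub>M\<^esub> x) = a \<odot>\<^bsub>N\<^esub> h x" if "a \<in> carrier R" "x \<in> carrier M" for a x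
  using h that by (simp add: LinearCombinations.module_hom_def)
 have hc: "h x \<in> carrier N" if "x \<in> carrier M" for x using b that by (auto simp: bij_betw_def)
 have g: "?g y \<in> carrier M" "h (?g y) = y" if "y \<in> carrier N" for y
  using b that by (auto simp: bij_betw_def inv_into_into f_inv_into_f)
 have gh: "?g (h x) = x" if "x \<in> carrier M" for x using b that by (simp add: bij_betw_def)
 have a: "y \<oplus>\<^bsub>N\<^esub> y' \<in> carrier N \<and> ?g (y \<oplus>\<^bsub>N\<^esub> y') = ?g y \<oplus>\<^bsub>M\<^esub> ?g y'" if "y \<in> carrier N" "y' \<in> carrier N" for y y'
  using hadd[OF g(1)[OF that(1)] g(1)[OF that(2)]] g(2)[OF that(1)] g(2)[OF that(2)]
   gh[OF cl(1)[OF g(1)[OF that(1)] g(1)[OF that(2)]]] hc[OF cl(1)[OF g(1)[OF that(1)] g(1)[OF that(2)]]] by simp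
 have s: "x \<odot>\<^bsub>N\<^esub> y \<in> carrier N \<and> ?g (x \<odot>\<^bsub>N\<^esub> y) = x \<odot>\<^bsub>M\<^esub> ?g y" if "x \<in> carrier R" "y \<in> carrier N" for x y
  using hsm[OF that(1) g(1)[OF that(2)]] g(2)[OF that(2)] gh[OF cl(2)[OF that(1) g(1)[OF that(2)]]]
   hc[OF cl(2)[OF that(1) g(1)[OF that(2)]]] by simp
 show ?thesis using g(1) a s by (simp add: LinearCombinations.module_hom_def)
qed

context simples
begin

lemma modelled_zero: "\<exists>V \<Theta>. modelled n LM {0} V \<Theta>"
proof -
 define V :: "('k, 'v) trirep" where "V = \<lparr>tsize = 0, label = undefined, amat = (\<lambda>_. 0)\<rparr>"
 have BI: "BI V = 0" by (rule fmat_eqI) (simp add: ent_BI V_def)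
 have "modelled n LM {0} V 0"
  unfolding modelled_def BI
 proof (intro conjI allI)
  show "is_tri_rep Q V" by (simp add: is_tri_rep_def V_def)
  show "z \<in> {0} \<longleftrightarrow> (\<exists>y\<in>col 0 U2. 0 * y = (eunit 0 0 z :: 'k fmat fmat))" for z :: "'k fmat"
  proof -
   have "eunit 0 0 z = (0 :: 'k fmat fmat) \<longleftrightarrow> z = 0"
    by (metis ent_eunit ent_simps(1) eunit_simps(2))
   then show ?thesis using col_zero[of "0 :: 'k fmat fmat" U2] by (auto intro: exI[of _ 0])
  qed
 qed (auto simp: col_def)
 then show ?thesis by blast
qed

text \<open>Starting from the zero module, each step of the composition series adjoins one basis vector.\<close>

lemma composition_series_modelled:
 assumes M: "frame.mcoord sc1 (idn {..<n}) U1 A M cM LM" and Hs: "composition_series A M Hs"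
  and fac: "\<And>Z. Z \<in> composition_factors A M ==> \<exists>S\<in>\<S>. isomorphic_modules A Z S"
  and l: "l < length Hs"
 shows "\<exists>V \<Theta>. modelled n LM (cM ` (Hs ! l)) V \<Theta>"
 using l
proof (induction l)
 case 0
 have "Hs ! 0 = {\<zero>\<^bsub>M\<^esub>}" using Hs unfolding composition_series_def by (metis hd_conv_nth)
 then show ?case using modelled_zero frame.mcoordD(11)[OF frame1 M] by simp
next
 case (Suc l)
 note D = frame.mcoordD[OF frame1[OF finite_lessThan] M]
 interpret M: left_module A M by (rule D(1))
 interpret M: plain_left_module A M by (intro plain_left_module.intro M.left_module_axioms)
 let ?H = "Hs ! l" and ?H' = "Hs ! Suc l"
 have l: "l < length Hs" using Suc.prems by simp
 have sub: "Module.submodule ?H A M" "Module.submodule ?H' A M" "?H \<subseteq> ?H'"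
  using Hs Suc.prems l unfolding composition_series_def by auto
 interpret sq: subquotient A M ?H ?H' by (intro subquotient.intro subquotient_axioms.intro M.plain_left_module_axioms sub)
 note H = M.submoduleD[OF sub(2)]
 have "quotient_module (M\<lparr>carrier := ?H'\<rparr>) ?H \<in> composition_factors A M"
  using Hs Suc.prems unfolding composition_factors_def by blast
 then obtain S where S: "S \<in> \<S>" and iso: "isomorphic_modules A (quotient_module (M\<lparr>carrier := ?H'\<rparr>) ?H) S"
  using fac by blast
 interpret S: left_module A S by (rule S_left_module[OF S])
 obtain \<theta> where \<theta>: "\<And>x. x \<in> ?H' ==> \<theta> x \<in> carrier S"
  "\<And>x y. x \<in> ?H' ==> y \<in> ?H' ==> \<theta> (x \<oplus>\<^bsub>M\<^esub> y) = \<theta> x \<oplus>\<^bsub>S\<^esub> \<theta> y"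
  "\<And>a x. a \<in> carrier A ==> x \<in> ?H' ==> \<theta> (a \<odot>\<^bsub>M\<^esub> x) = a \<odot>\<^bsub>S\<^esub> \<theta> x"
  "\<And>y. y \<in> carrier S ==> \<exists>x\<in>?H'. \<theta> x = y"
  "\<And>x y. x \<in> ?H' ==> y \<in> ?H' ==> \<theta> x = \<theta> y \<longleftrightarrow> x \<ominus>\<^bsub>M\<^esub> y \<in> ?H"
 proof (rule sq.isomorphicE[OF iso], goal_cases)
  case (1 \<theta>)
  show ?case by (rule 1(1)[of \<theta>]) (rule 1(2-6); assumption)+
 qed
 have cl: "x \<in> carrier M" if "x \<in> ?H'" for x using H(1) that by blast
 have \<theta>0: "\<theta> \<zero>\<^bsub>M\<^esub> = \<zero>\<^bsub>S\<^esub>"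
  using \<theta>(2)[OF H(2) H(2)] S.M.add.l_cancel_one[OF \<theta>(1)[OF H(2)] \<theta>(1)[OF H(2)]] cl[OF H(2)] by simp
 have ker: "\<theta> x = \<zero>\<^bsub>S\<^esub> \<longleftrightarrow> x \<in> ?H" if x: "x \<in> ?H'" for x
  using \<theta>(5)[OF x H(2)] \<theta>0 cl[OF x] by (simp add: M.M.minus_eq M.minus_zero)
 define p where "p z = c S (\<theta> (inv_into (carrier M) cM z))" for z
 have inj: "inj_on cM (carrier M)" using D(5) by (simp add: bij_betw_def)
 have p: "p (cM x) = c S (\<theta> x)" if "x \<in> ?H'" for x
  unfolding p_def using inv_into_f_f[OF inj cl[OF that]] by simp
 obtain V \<Theta> where mod: "modelled n LM (cM ` ?H) V \<Theta>" using Suc.IH l by blast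
 show ?case
 proof (rule extension_step[OF S D(3) mod, where p = p])
  show "0 \<in> cM ` ?H'" using D(11) H(2) by (metis imageI)
  show "cM ` ?H' \<subseteq> col (idn {..<n}) U1" using D(8) cl by blast
  show "cM ` ?H \<subseteq> cM ` ?H'" using sub(3) by blast
 next
  fix y z assume "y \<in> cM ` ?H'" "z \<in> cM ` ?H'"
  then obtain x x' where x: "x \<in> ?H'" "y = cM x" "x' \<in> ?H'" "z = cM x'" by blast
  have s: "y + z = cM (x \<oplus>\<^bsub>M\<^esub> x')" using D(6) cl x by simp
  show "y + z \<in> cM ` ?H'" unfolding s using H(3) x by blast
  show "p (y + z) = p y + p z"
   unfolding s using p x H(3) \<theta>(1,2) S_mcoord(6)[OF S] by simp
 next
  fix a z assume a: "a \<in> carrier A" and "z \<in> cM ` ?H'"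
  then obtain x where x: "x \<in> ?H'" "z = cM x" by blast
  have s: "LM a * z = cM (a \<odot>\<^bsub>M\<^esub> x)" using D(4) cl x a by simp
  show "LM a * z \<in> cM ` ?H'" unfolding s using H(4) x a by blast
  show "p (LM a * z) = L S a * p z"
   unfolding s using p x a H(4) \<theta>(1,3) S_mcoord(4)[OF S] by simp
 next
  fix z assume "z \<in> cM ` ?H'"
  then obtain x where x: "x \<in> ?H'" "z = cM x" by blast
  show "p z \<in> col (I S) U1" using x p \<theta>(1) S_mcoord(8)[OF S] by simp
  have "p z = 0 \<longleftrightarrow> \<theta> x = \<zero>\<^bsub>S\<^esub>"
   using S_mcoord(10)[OF S \<theta>(1)[OF x(1)] S.M.zero_closed] S_mcoord(11)[OF S] p x by simp
  moreover have "z \<in> cM ` ?H \<longleftrightarrow> x \<in> ?H"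
   unfolding x(2) using inj_on_image_mem_iff[OF inj cl[OF x(1)]] M.submoduleD(1)[OF sub(1)] by blast
  ultimately show "p z = 0 \<longleftrightarrow> z \<in> cM ` ?H" using ker[OF x(1)] by blast
 next
  fix y assume "y \<in> col (I S) U1"
  then obtain s where s: "s \<in> carrier S" "c S s = y" using S_mcoord(9)[OF S] by blast
  obtain x where x: "x \<in> ?H'" "\<theta> x = s" using \<theta>(4)[OF s(1)] by blast
  then show "\<exists>z\<in>cM ` ?H'. p z = y" using p[OF x(1)] s(2) by (intro bexI[of _ "cM x"]) auto
 qed
qed

end

context coded_simples
begin

lemma glued_essentially_surjective: "essentially_surjective (tri_cat Q) (wide A \<S>) glued"
 unfolding essentially_surjective_def
proof (intro ballI)
 fix M assume Mw: "M \<in> Ob (wide A \<S>)"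
 then have M: "left_module A M" and fdM: "vectorspace.fin_dim class_ring (over_field A M)"
  and fac: "\<And>Z. Z \<in> composition_factors A M ==> \<exists>S\<in>\<S>. isomorphic_modules A Z S"
  by (auto simp: wide_simps)
 interpret A: assoc_algebra A by (rule A_alg)
 interpret M: left_module A M by (rule M)
 interpret M: plain_left_module A M by (intro plain_left_module.intro M)
 have vs: "vectorspace class_ring (over_field A M)" by (rule over_field_vectorspace[OF A_alg M])
 define n where "n = vectorspace.dim class_ring (over_field A M)"
 obtain cM where "frame.coord sc1 (idn {..<n}) U1 (over_field A M) cM"
  using coordinates_exist[OF vs fdM] unfolding n_def by blast
 then obtain LM where mc: "frame.mcoord sc1 (idn {..<n}) U1 A M cM LM"
  using frame.mcoord_exists[OF frame1[OF finite_lessThan] A_alg M] by blast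
 note D = frame.mcoordD[OF frame1[OF finite_lessThan] mc]
 obtain \<mu> :: "'v set \<Rightarrow> nat" where \<mu>: "\<And>W W'. W \<subset> W' ==> W' \<subseteq> carrier (over_field A M) ==> \<zero>\<^bsub>over_field A M\<^esub> \<in> W ==>
   (\<forall>x\<in>W. \<forall>y\<in>W. x \<oplus>\<^bsub>over_field A M\<^esub> y \<in> W) ==> (\<forall>a. \<forall>x\<in>W. a \<odot>\<^bsub>over_field A M\<^esub> x \<in> W) ==> \<mu> W < \<mu> W'"
  using subspace_rank_exists[OF vs fdM] by blast
 have "\<exists>Hs. composition_series A M Hs"
 proof (rule M.composition_series_exists)
  fix H H' assume H: "Module.submodule H A M" and H': "Module.submodule H' A M" and lt: "H \<subset> H'"
  show "\<mu> H < \<mu> H'"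
   by (rule \<mu>[OF lt]) (use M.submoduleD[OF H] M.submoduleD(1)[OF H'] in \<open>auto simp: over_field_def\<close>)
 qed
 then obtain Hs where Hs: "composition_series A M Hs" by blast
 have len: "length Hs - 1 < length Hs" and last: "Hs ! (length Hs - 1) = carrier M"
  using Hs by (auto simp: composition_series_def last_conv_nth)
 obtain V \<Theta> where mod: "modelled n LM (cM ` carrier M) V \<Theta>"
  using composition_series_modelled[OF mc Hs fac len] unfolding last by blast
 note mod' = mod[unfolded modelled_def]
 have V: "is_tri_rep Q V" using mod' by blast
 have \<Theta>GL: "\<And>x. x \<in> carrier A ==> \<Theta> * GL V x = eunit 0 0 (LM x) * \<Theta>"
  and \<Theta>inj: "\<And>y. y \<in> col (BI V) U2 ==> \<Theta> * y = 0 ==> y = 0"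
  and \<Theta>im: "\<And>z. z \<in> cM ` carrier M \<longleftrightarrow> (\<exists>y\<in>col (BI V) U2. \<Theta> * y = eunit 0 0 z)"
  and J\<Theta>: "eunit 0 0 (idn {..<n}) * \<Theta> = \<Theta>"
  using mod' by blast+
 note G = glued_D[OF V]
 interpret G: left_module A "glued V" by (rule G(1))
 have e00: "z = z'" if "eunit 0 0 z = (eunit 0 0 z' :: 'k fmat fmat)" for z z'
  using arg_cong[OF that, of "\<lambda>z. ent z 0 0"] by simp
 have "\<forall>y\<in>carrier (glued V). \<exists>x\<in>carrier M. \<Theta> * cF V y = eunit 0 0 (cM x)"
 proof
  fix y assume y: "y \<in> carrier (glued V)"
  have "\<Theta> * cF V y = eunit 0 0 (idn {..<n}) * (\<Theta> * cF V y) * U2"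
   using J\<Theta> colD(2)[OF G(8)[OF y]] by (simp add: mult.assoc[symmetric]) (simp add: mult.assoc)
  from arg_cong[OF this] have eq: "ent (\<Theta> * cF V y) b a = ent (eunit 0 0 (idn {..<n}) * (\<Theta> * cF V y) * U2) b a" for b a .
  have zz: "ent (eunit 0 0 (idn {..<n}) * (\<Theta> * cF V y) * U2) b a = 0" if "\<not> (b = 0 \<and> a = 0)" for b a
   using that by (auto simp: U2_def ent_times_eunit ent_eunit_times)
  have z: "ent (\<Theta> * cF V y) b a = 0" if "\<not> (b = 0 \<and> a = 0)" for b a by (rule trans[OF eq zz[OF that]])
  have e: "\<Theta> * cF V y = eunit 0 0 (ent (\<Theta> * cF V y) 0 0)"
   by (rule fmat_eqI) (use z in auto)
  then have "ent (\<Theta> * cF V y) 0 0 \<in> cM ` carrier M" using \<Theta>im G(8)[OF y] by blast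
  then obtain x where x: "x \<in> carrier M" "ent (\<Theta> * cF V y) 0 0 = cM x" by (rule imageE) (rule that)
  show "\<exists>x\<in>carrier M. \<Theta> * cF V y = eunit 0 0 (cM x)"
   by (rule bexI[OF _ x(1)]) (rule e[unfolded x(2)])
 qed
 then obtain h where hall: "\<forall>y\<in>carrier (glued V). h y \<in> carrier M \<and> \<Theta> * cF V y = eunit 0 0 (cM (h y))"
  unfolding Bex_def by (elim bchoice[THEN exE])
 have h: "h y \<in> carrier M" "\<Theta> * cF V y = eunit 0 0 (cM (h y))" if "y \<in> carrier (glued V)" for y
  using hall that by blast+
 have eqI: "h y = x" if "y \<in> carrier (glued V)" "x \<in> carrier M" "\<Theta> * cF V y = eunit 0 0 (cM x)" for x y
  using e00[OF trans[OF h(2)[OF that(1), symmetric] that(3)]] D(10)[OF h(1)[OF that(1)] that(2)] by blast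
 define h' where "h' = restrict h (carrier (glued V))"
 have add: "h (x \<oplus>\<^bsub>glued V\<^esub> y) = h x \<oplus>\<^bsub>M\<^esub> h y" if "x \<in> carrier (glued V)" "y \<in> carrier (glued V)" for x y
  by (rule eqI) (use that h D(6) G(6) in \<open>simp_all add: distrib_left eunit_simps\<close>)
 have sm: "h (a \<odot>\<^bsub>glued V\<^esub> y) = a \<odot>\<^bsub>M\<^esub> h y" if "a \<in> carrier A" "y \<in> carrier (glued V)" for a y
 proof (rule eqI)
  have "\<Theta> * cF V (a \<odot>\<^bsub>glued V\<^esub> y) = \<Theta> * GL V a * cF V y" using G(4)[OF that] by (simp add: mult.assoc)
  also have "\<dots> = eunit 0 0 (LM a) * (\<Theta> * cF V y)" using \<Theta>GL[OF that(1)] by (simp add: mult.assoc)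
  also have "\<dots> = eunit 0 0 (cM (a \<odot>\<^bsub>M\<^esub> h y))" using h(2)[OF that(2)] D(4)[OF that(1) h(1)[OF that(2)]] by (simp add: eunit_times)
  finally show "\<Theta> * cF V (a \<odot>\<^bsub>glued V\<^esub> y) = eunit 0 0 (cM (a \<odot>\<^bsub>M\<^esub> h y))" .
 qed (use that h(1) G.smult_closed M.smult_closed in auto)
 have hom: "h' \<in> module_hom A (glued V) M"
  using h(1) add sm G.smult_closed by (simp add: LinearCombinations.module_hom_def h'_def)
 have bij: "bij_betw h' (carrier (glued V)) (carrier M)"
  unfolding bij_betw_def
 proof (intro conjI inj_onI equalityI subsetI)
  fix x y assume x: "x \<in> carrier (glued V)" and y: "y \<in> carrier (glued V)" and "h' x = h' y"
  then have hxy: "h x = h y" using x y by (simp add: h'_def)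
  have "\<Theta> * (cF V x - cF V y) = \<Theta> * cF V x - \<Theta> * cF V y" by (rule right_diff_distrib)
  then have "\<Theta> * (cF V x - cF V y) = 0" unfolding h(2)[OF x] h(2)[OF y] hxy by (simp only: diff_self)
  then have "cF V x - cF V y = 0" by (rule \<Theta>inj[OF col_diff[OF G(8)[OF x] G(8)[OF y]]])
  then show "x = y" using G(10)[OF x y] by simp
 next
  fix x assume "x \<in> h' ` carrier (glued V)" then show "x \<in> carrier M" using h(1) by (auto simp: h'_def)
 next
  fix x assume x: "x \<in> carrier M"
  then obtain z where z: "z \<in> col (BI V) U2" "\<Theta> * z = eunit 0 0 (cM x)" using \<Theta>im by blast
  obtain y where y: "y \<in> carrier (glued V)" "cF V y = z" using G(9)[OF z(1)] by blast
  then have "h' y = x" using eqI[OF y(1) x] z(2) by (simp add: h'_def)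
  then show "x \<in> h' ` carrier (glued V)" using y(1) by blast
 qed
 define k where "k = restrict (inv_into (carrier (glued V)) h') (carrier M)"
 have k: "k \<in> module_hom A M (glued V)" unfolding k_def by (rule inverse_module_hom[OF G.M.a_closed G.smult_closed hom bij])
 have "isomorphism (wide A \<S>) M (glued V) k"
  unfolding isomorphism_def wide_simps
 proof (intro conjI bexI[of _ h'] IntI k hom)
  show "k \<in> extensional (carrier M)" "h' \<in> extensional (carrier (glued V))" by (simp_all add: k_def h'_def)
  have "h' (k x) = x" if "x \<in> carrier M" for x
   using bij that by (simp add: k_def bij_betw_def f_inv_into_f)
  then show "compose (carrier M) h' k = (\<lambda>x\<in>carrier M. x)" by (auto simp: compose_def)
  have "k (h' y) = y" if "y \<in> carrier (glued V)" for y
   using bij that by (auto simp: k_def bij_betw_def)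
  then show "compose (carrier (glued V)) k h' = (\<lambda>x\<in>carrier (glued V). x)" by (auto simp: compose_def)
 qed
 then show "\<exists>X\<in>Ob (tri_cat Q). \<exists>f. isomorphism (wide A \<S>) M (glued X) f" using V by auto
qed

end

section \<open>Nilpotent representations from triangular ones\<close>

locale coded_quiver = wf_digraph Q
 for Q :: "('w, 'e) pre_digraph" +
 fixes f :: "'k::alg_closed_field \<Rightarrow> 'u"
 assumes f: "inj f" and fin_verts: "finite (verts Q)"
begin

text \<open>The basis vectors at a vertex; their span \<open>vx V v\<close> is the space at this vertex, which is then coded in \<open>'u\<close>.\<close>

definition places :: "('w, 'e, 'k) tri_rep \<Rightarrow> 'w \<Rightarrow> nat set" where "places V v = {a. a < tsize V \<and> label V a = v}"

lemma finite_places [simp]: "finite (places V v)" by (simp add: places_def)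

definition vx :: "('w, 'e, 'k) tri_rep \<Rightarrow> 'w \<Rightarrow> 'k fmat set" where "vx V v = col (idn (places V v)) U1"

definition vc :: "('w, 'e, 'k) tri_rep \<Rightarrow> 'w \<Rightarrow> 'k fmat \<Rightarrow> 'u" where
 "vc V v = (SOME \<iota>. inj_on \<iota> (vx V v))"

definition vd :: "('w, 'e, 'k) tri_rep \<Rightarrow> 'w \<Rightarrow> 'u \<Rightarrow> 'k fmat" where "vd V v = inv_into (vx V v) (vc V v)"

definition sp :: "('w, 'e, 'k) tri_rep \<Rightarrow> 'w \<Rightarrow> ('k, 'u) module" where "sp V v = cvec (vc V v) (vx V v) sc1"

definition qrep :: "('w, 'e, 'k) tri_rep \<Rightarrow> ('w, 'e, 'k, 'u) quiver_rep" where
 "qrep V = \<lparr>space = sp V, arrow = (\<lambda>\<alpha> y. vc V (head Q \<alpha>) (amat V \<alpha> * vd V (tail Q \<alpha>) y))\<rparr>"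

definition qhom :: "('w, 'e, 'k) tri_rep \<Rightarrow> ('w, 'e, 'k) tri_rep \<Rightarrow> 'k fmat \<Rightarrow> 'w \<Rightarrow> 'u \<Rightarrow> 'u" where
 "qhom V W \<phi> = (\<lambda>v\<in>verts Q. \<lambda>y\<in>carrier (sp V v). vc W v (\<phi> * vd V v y))"

lemma qrep_simps [simp]: "space (qrep V) = sp V"
 "arrow (qrep V) \<alpha> y = vc V (head Q \<alpha>) (amat V \<alpha> * vd V (tail Q \<alpha>) y)"
 by (simp_all add: qrep_def)

lemma vc_inj: "inj_on (vc V v) (vx V v)"
 using someI_ex[OF frame.col_inject[OF frame1[OF finite_places] infinite_alg_closed_field f]]
 unfolding vc_def vx_def .

lemma sp_vectorspace: "vectorspace class_ring (sp V v)" "vectorspace.fin_dim class_ring (sp V v)"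
 using sc1.cvec_vectorspace[OF vc_inj[unfolded vx_def]] frame.cvec_fin_dim[OF frame1[OF finite_places] vc_inj[unfolded vx_def] vc_inj[unfolded vx_def]]
 unfolding sp_def vx_def by auto

lemma vd:
 shows "z \<in> vx V v ==> vc V v z \<in> carrier (sp V v)" "z \<in> vx V v ==> vd V v (vc V v z) = z"
  "y \<in> carrier (sp V v) ==> vd V v y \<in> vx V v" "y \<in> carrier (sp V v) ==> vc V v (vd V v y) = y"
  "[|y \<in> carrier (sp V v); y' \<in> carrier (sp V v)|] ==> vd V v (y \<oplus>\<^bsub>sp V v\<^esub> y') = vd V v y + vd V v y'"
  "y \<in> carrier (sp V v) ==> vd V v (a \<odot>\<^bsub>sp V v\<^esub> y) = sc1 a (vd V v y)"
  "[|y \<in> carrier (sp V v); y' \<in> carrier (sp V v)|] ==> vd V v y = vd V v y' \<longleftrightarrow> y = y'"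
  "\<zero>\<^bsub>sp V v\<^esub> = vc V v 0"
proof -
 have c: "frame.coord sc1 (idn (places V v)) U1 (sp V v) (vd V v)"
  unfolding sp_def vd_def vx_def by (rule frame.cvec_coord[OF frame1[OF finite_places] vc_inj[unfolded vx_def]])
 note cc = c[unfolded frame.coord_def[OF frame1[OF finite_places]]]
 show "z \<in> vx V v ==> vc V v z \<in> carrier (sp V v)" "\<zero>\<^bsub>sp V v\<^esub> = vc V v 0" by (simp_all add: sp_def cvec_simps)
 show "z \<in> vx V v ==> vd V v (vc V v z) = z" unfolding vd_def by (rule inv_into_f_f[OF vc_inj])
 show "y \<in> carrier (sp V v) ==> vd V v y \<in> vx V v" "y \<in> carrier (sp V v) ==> vc V v (vd V v y) = y"
  by (simp_all add: sp_def cvec_simps vd_def inv_into_into f_inv_into_f)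
 show "[|y \<in> carrier (sp V v); y' \<in> carrier (sp V v)|] ==> vd V v (y \<oplus>\<^bsub>sp V v\<^esub> y') = vd V v y + vd V v y'"
  "y \<in> carrier (sp V v) ==> vd V v (a \<odot>\<^bsub>sp V v\<^esub> y) = sc1 a (vd V v y)"
  "[|y \<in> carrier (sp V v); y' \<in> carrier (sp V v)|] ==> vd V v y = vd V v y' \<longleftrightarrow> y = y'"
  using cc by (auto simp: bij_betw_def inj_on_def)
qed

lemma sp_closed: "[|x \<in> carrier (sp V v); y \<in> carrier (sp V v)|] ==> x \<oplus>\<^bsub>sp V v\<^esub> y \<in> carrier (sp V v)"
 "x \<in> carrier (sp V v) ==> a \<odot>\<^bsub>sp V v\<^esub> x \<in> carrier (sp V v)" "\<zero>\<^bsub>sp V v\<^esub> \<in> carrier (sp V v)"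
 using class_vectorspace_facts(1-3)[OF sp_vectorspace(1)] by blast+

lemma amat_corner:
 assumes "is_tri_rep Q V" "\<alpha> \<in> arcs Q"
 shows "idn (places V (head Q \<alpha>)) * amat V \<alpha> = amat V \<alpha>" "amat V \<alpha> * idn (places V (tail Q \<alpha>)) = amat V \<alpha>"
proof -
 have *: "b \<in> places V (head Q \<alpha>) \<and> a \<in> places V (tail Q \<alpha>)" if "ent (amat V \<alpha>) b a \<noteq> 0" for b a
  using assms that unfolding is_tri_rep_def places_def by (metis (mono_tags, lifting) mem_Collect_eq order.strict_trans)
 show "idn (places V (head Q \<alpha>)) * amat V \<alpha> = amat V \<alpha>" "amat V \<alpha> * idn (places V (tail Q \<alpha>)) = amat V \<alpha>"
  by (rule fmat_eqI; use * in \<open>auto simp: ent_idn_times ent_times_idn\<close>)+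
qed

lemma amat_vx: "[|is_tri_rep Q V; \<alpha> \<in> arcs Q; x \<in> vx V (tail Q \<alpha>)|] ==> amat V \<alpha> * x \<in> vx V (head Q \<alpha>)"
 unfolding vx_def by (rule col_mult[OF amat_corner(1)])

lemma tri_hom_vx:
 assumes "\<phi> \<in> tri_hom Q V W"
 shows "idn (places W v) * \<phi> = \<phi> * idn (places V v)" "x \<in> vx V v ==> \<phi> * x \<in> vx W v"
proof -
 have *: "a < tsize V \<and> b < tsize W \<and> label V a = label W b" if "ent \<phi> b a \<noteq> 0" for b a
  using assms that unfolding tri_hom_def by blast
 show i: "idn (places W v) * \<phi> = \<phi> * idn (places V v)"
 proof (rule fmat_eqI)
  fix b a
  show "ent (idn (places W v) * \<phi>) b a = ent (\<phi> * idn (places V v)) b a"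
   using *[of b a] by (cases "ent \<phi> b a = 0") (auto simp: ent_idn_times ent_times_idn places_def)
 qed
 assume x: "x \<in> vx V v"
 show "\<phi> * x \<in> vx W v" unfolding vx_def
 proof (rule colI)
  show "idn (places W v) * (\<phi> * x) = \<phi> * x"
   using i x colD(1)[of x "idn (places V v)" U1] by (simp add: mult.assoc[symmetric] vx_def) (simp add: mult.assoc)
  show "\<phi> * x * U1 = \<phi> * x" using colD(2)[of x "idn (places V v)" U1] x by (simp add: vx_def mult.assoc)
 qed
qed

lemma nilpotent_reps_simps:
 "Ob (nilpotent_reps Q) = {Y. is_quiver_rep Q Y \<and> nilpotent_rep Q Y}"
 "h \<in> Hom (nilpotent_reps Q) Y Z \<longleftrightarrow> h \<in> extensional (verts Q) \<and>
   (\<forall>v\<in>verts Q. h v \<in> module_hom class_ring (space Y v) (space Z v) \<and> h v \<in> extensional (carrier (space Y v))) \<and>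
   (\<forall>a\<in>arcs Q. \<forall>x\<in>carrier (space Y (tail Q a)). h (head Q a) (arrow Y a x) = arrow Z a (h (tail Q a) x))"
 "Ident (nilpotent_reps Q) Y = (\<lambda>v\<in>verts Q. \<lambda>x\<in>carrier (space Y v). x)"
 "Comp (nilpotent_reps Q) Y Z Z' k h = (\<lambda>v\<in>verts Q. compose (carrier (space Y v)) (k v) (h v))"
 "Plus (nilpotent_reps Q) Y Z h k = (\<lambda>v\<in>verts Q. \<lambda>x\<in>carrier (space Y v). h v x \<oplus>\<^bsub>space Z v\<^esub> k v x)"
 "Scale (nilpotent_reps Q) Y Z a h = (\<lambda>v\<in>verts Q. \<lambda>x\<in>carrier (space Y v). a \<odot>\<^bsub>space Z v\<^esub> h v x)"
 by (auto simp: nilpotent_reps_def quiver_reps_def full_subcategory_def PiE_iff)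

lemma linear_hom_iff:
 "h \<in> module_hom class_ring Y Z \<longleftrightarrow> (\<forall>x\<in>carrier Y. h x \<in> carrier Z) \<and>
   (\<forall>x\<in>carrier Y. \<forall>y\<in>carrier Y. h (x \<oplus>\<^bsub>Y\<^esub> y) = h x \<oplus>\<^bsub>Z\<^esub> h y) \<and> (\<forall>a. \<forall>x\<in>carrier Y. h (a \<odot>\<^bsub>Y\<^esub> x) = a \<odot>\<^bsub>Z\<^esub> h x)"
 by (auto simp: LinearCombinations.module_hom_def)

lemma matrix_linear:
 assumes T: "\<And>x. x \<in> vx V v ==> T * x \<in> vx W u"
 shows "(\<lambda>y. vc W u (T * vd V v y)) \<in> module_hom class_ring (sp V v) (sp W u)"
 unfolding linear_hom_iff
proof (intro conjI ballI allI)
 fix x y a assume x: "x \<in> carrier (sp V v)"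
 note Tx = T[OF vd(3)[OF x]]
 show "vc W u (T * vd V v x) \<in> carrier (sp W u)" by (rule vd(1)[OF Tx])
 have "vd W u (vc W u (T * vd V v (a \<odot>\<^bsub>sp V v\<^esub> x))) = vd W u (a \<odot>\<^bsub>sp W u\<^esub> vc W u (T * vd V v x))"
 proof (rule trans[OF vd(2)[OF T[OF vd(3)[OF sp_closed(2)[OF x]]]]])
  show "T * vd V v (a \<odot>\<^bsub>sp V v\<^esub> x) = vd W u (a \<odot>\<^bsub>sp W u\<^esub> vc W u (T * vd V v x))"
   by (simp add: vd(6)[OF vd(1)[OF Tx]] vd(2)[OF Tx] vd(6)[OF x] sc1.sc_mult_right)
 qed
 then show "vc W u (T * vd V v (a \<odot>\<^bsub>sp V v\<^esub> x)) = a \<odot>\<^bsub>sp W u\<^esub> vc W u (T * vd V v x)"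
  using vd(7)[OF vd(1)[OF T[OF vd(3)[OF sp_closed(2)[OF x]]]] sp_closed(2)[OF vd(1)[OF Tx]]] by blast
 assume y: "y \<in> carrier (sp V v)"
 note Ty = T[OF vd(3)[OF y]]
 have "vd W u (vc W u (T * vd V v (x \<oplus>\<^bsub>sp V v\<^esub> y))) = vd W u (vc W u (T * vd V v x) \<oplus>\<^bsub>sp W u\<^esub> vc W u (T * vd V v y))"
 proof (rule trans[OF vd(2)[OF T[OF vd(3)[OF sp_closed(1)[OF x y]]]]])
  show "T * vd V v (x \<oplus>\<^bsub>sp V v\<^esub> y) = vd W u (vc W u (T * vd V v x) \<oplus>\<^bsub>sp W u\<^esub> vc W u (T * vd V v y))"
   by (simp add: vd(5)[OF vd(1)[OF Tx] vd(1)[OF Ty]] vd(2)[OF Tx] vd(2)[OF Ty] vd(5)[OF x y] distrib_left)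
 qed
 then show "vc W u (T * vd V v (x \<oplus>\<^bsub>sp V v\<^esub> y)) = vc W u (T * vd V v x) \<oplus>\<^bsub>sp W u\<^esub> vc W u (T * vd V v y)"
  using vd(7)[OF vd(1)[OF T[OF vd(3)[OF sp_closed(1)[OF x y]]]] sp_closed(1)[OF vd(1)[OF Tx] vd(1)[OF Ty]]] by blast
qed

text \<open>Each arrow of a walk lowers the indices in the support of a vector, so a walk of length \<open>tsize V\<close> acts as zero.\<close>

lemma qrep_nilpotent:
 assumes V: "is_tri_rep Q V"
 shows "qrep V \<in> Ob (nilpotent_reps Q)"
 unfolding nilpotent_reps_simps
proof (intro CollectI conjI)
 have "arrow (qrep V) \<alpha> \<in> module_hom class_ring (sp V (tail Q \<alpha>)) (sp V (head Q \<alpha>))" if "\<alpha> \<in> arcs Q" for \<alpha>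
  using matrix_linear[of V "tail Q \<alpha>" "amat V \<alpha>" V "head Q \<alpha>"] amat_vx[OF V that] by (simp add: qrep_def)
 then show "is_quiver_rep Q (qrep V)" unfolding is_quiver_rep_def using sp_vectorspace by simp
 have fold: "fold (arrow (qrep V)) p x \<in> carrier (sp V v) \<and>
   (\<forall>b a. ent (vd V v (fold (arrow (qrep V)) p x)) b a \<noteq> 0 \<longrightarrow> b + j + length p < tsize V)"
  if "awalk u p v" "x \<in> carrier (sp V u)" "\<forall>b a. ent (vd V u x) b a \<noteq> 0 \<longrightarrow> b + j < tsize V" for u p v x j
  using that
 proof (induction p arbitrary: u x j)
  case Nil
  then show ?case by (auto simp: awalk_def)
 next
  case (Cons \<alpha> p)
  have \<alpha>: "\<alpha> \<in> arcs Q" "tail Q \<alpha> = u" and w: "awalk (head Q \<alpha>) p v"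
   using Cons.prems(1) by (auto simp: awalk_def)
  let ?y = "arrow (qrep V) \<alpha> x"
  have ax: "amat V \<alpha> * vd V u x \<in> vx V (head Q \<alpha>)"
   using amat_vx[OF V \<alpha>(1)] vd(3)[OF Cons.prems(2)] \<alpha>(2) by simp
  have y: "?y \<in> carrier (sp V (head Q \<alpha>))" "vd V (head Q \<alpha>) ?y = amat V \<alpha> * vd V u x"
   using vd(1,2)[OF ax] \<alpha>(2) by simp_all
  have "b + Suc j < tsize V" if nz: "ent (vd V (head Q \<alpha>) ?y) b a \<noteq> 0" for b a
  proof -
   obtain e where e: "ent (amat V \<alpha>) b e \<noteq> 0" "ent (vd V u x) e a \<noteq> 0"
    using ent_times_nz[OF nz[unfolded y(2)]] by blast
   have "b < e" using e(1) V \<alpha>(1) unfolding is_tri_rep_def by blast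
   moreover have "e + j < tsize V" using e(2) Cons.prems(3) by blast
   ultimately show ?thesis by simp
  qed
  then show ?case using Cons.IH[OF w y(1), of "Suc j"] by simp
 qed
 show "nilpotent_rep Q (qrep V)"
  unfolding nilpotent_rep_def
 proof (intro exI[of _ "tsize V"] allI impI ballI; elim conjE)
  fix u p v x assume w: "awalk u p v" and l: "tsize V \<le> length p" and x: "x \<in> carrier (space (qrep V) u)"
  have b: "b < tsize V" if "ent (vd V u x) b a \<noteq> 0" for b a
  proof -
   have "idn (places V u) * vd V u x = vd V u x" using vd(3)[of x V u] x by (simp add: vx_def colD(1))
   then have "ent (idn (places V u) * vd V u x) b a \<noteq> 0" using that by simp
   then show ?thesis by (auto simp: ent_idn_times places_def split: if_splits)
  qed
  note fo = fold[OF w, of x 0]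
  have "vd V v (fold (arrow (qrep V)) p x) = 0"
   by (rule fmat_eqI) (use fo x b l in fastforce)
  then show "fold (arrow (qrep V)) p x = \<zero>\<^bsub>space (qrep V) v\<^esub>"
   using vd(4)[of "fold (arrow (qrep V)) p x" V v] fo x b by (simp add: vd(8))
 qed
qed

lemma qhom:
 assumes V: "is_tri_rep Q V" and W: "is_tri_rep Q W" and \<phi>: "\<phi> \<in> tri_hom Q V W"
 shows "qhom V W \<phi> \<in> Hom (nilpotent_reps Q) (qrep V) (qrep W)"
  and "v \<in> verts Q ==> y \<in> carrier (sp V v) ==> vd W v (qhom V W \<phi> v y) = \<phi> * vd V v y"
  and "v \<in> verts Q ==> y \<in> carrier (sp V v) ==> qhom V W \<phi> v y \<in> carrier (sp W v)"
proof -
 show 2: "v \<in> verts Q ==> y \<in> carrier (sp V v) ==> vd W v (qhom V W \<phi> v y) = \<phi> * vd V v y"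
  and 3: "v \<in> verts Q ==> y \<in> carrier (sp V v) ==> qhom V W \<phi> v y \<in> carrier (sp W v)" for v y
  using vd(1,2)[OF tri_hom_vx(2)[OF \<phi> vd(3)]] by (simp_all add: qhom_def)
 show "qhom V W \<phi> \<in> Hom (nilpotent_reps Q) (qrep V) (qrep W)"
  unfolding nilpotent_reps_simps qrep_simps
 proof (intro conjI ballI)
  show "qhom V W \<phi> \<in> extensional (verts Q)" by (simp add: qhom_def)
  fix v assume v: "v \<in> verts Q"
  show "qhom V W \<phi> v \<in> extensional (carrier (sp V v))" using v by (simp add: qhom_def)
  show "qhom V W \<phi> v \<in> module_hom class_ring (sp V v) (sp W v)"
   using matrix_linear[of V v \<phi> W v, OF tri_hom_vx(2)[OF \<phi>]] v sp_closed unfolding linear_hom_iff by (simp add: qhom_def)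
 next
  fix \<alpha> y assume \<alpha>: "\<alpha> \<in> arcs Q" and y: "y \<in> carrier (sp V (tail Q \<alpha>))"
  have ax: "amat V \<alpha> * vd V (tail Q \<alpha>) y \<in> vx V (head Q \<alpha>)" by (rule amat_vx[OF V \<alpha> vd(3)[OF y]])
  have "\<phi> * amat V \<alpha> = amat W \<alpha> * \<phi>" using \<phi> \<alpha> by (simp add: tri_hom_def)
  then have "\<phi> * (amat V \<alpha> * vd V (tail Q \<alpha>) y) = amat W \<alpha> * (\<phi> * vd V (tail Q \<alpha>) y)"
   by (simp add: mult.assoc[symmetric])
  then show "qhom V W \<phi> (head Q \<alpha>) (vc V (head Q \<alpha>) (amat V \<alpha> * vd V (tail Q \<alpha>) y))
   = vc W (head Q \<alpha>) (amat W \<alpha> * vd W (tail Q \<alpha>) (qhom V W \<phi> (tail Q \<alpha>) y))"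
   unfolding 2[OF tail_in_verts[OF \<alpha>] y]
   using vd(1,2)[OF ax] head_in_verts[OF \<alpha>] by (simp add: qhom_def)
 qed
qed

lemma qhom_eqI:
 assumes h: "h \<in> extensional (verts Q)" "\<And>v. v \<in> verts Q ==> h v \<in> extensional (carrier (sp V v))"
  and hx: "\<And>v y. v \<in> verts Q ==> y \<in> carrier (sp V v) ==> h v y \<in> carrier (sp W v) \<and> vd W v (h v y) = \<phi> * vd V v y"
 shows "h = qhom V W \<phi>"
proof (rule extensionalityI[OF h(1)])
 show "qhom V W \<phi> \<in> extensional (verts Q)" by (simp add: qhom_def)
 fix v assume v: "v \<in> verts Q"
 show "h v = qhom V W \<phi> v"
 proof (rule extensionalityI[OF h(2)[OF v]])
  show "qhom V W \<phi> v \<in> extensional (carrier (sp V v))" using v by (simp add: qhom_def)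
  show "h v y = qhom V W \<phi> v y" if y: "y \<in> carrier (sp V v)" for y
   using hx[OF v y] vd(4)[of "h v y" W v] v y by (simp add: qhom_def)
 qed
qed

lemma qrep_functor: "linear_functor (tri_cat Q) (nilpotent_reps Q) qrep qhom"
 unfolding linear_functor_def
proof (intro conjI ballI allI; simp only: tri_cat_simps mem_Collect_eq)
 fix V :: "('w, 'e, 'k) tri_rep" assume V: "is_tri_rep Q V"
 show "qrep V \<in> Ob (nilpotent_reps Q)" by (rule qrep_nilpotent[OF V])
 show "qhom V V (idn {..<tsize V}) = Ident (nilpotent_reps Q) (qrep V)"
 proof (rule qhom_eqI[symmetric])
  fix v y assume v: "v \<in> verts Q" and y: "y \<in> carrier (sp V v)"
  have "idn {..<tsize V} * idn (places V v) = (idn (places V v) :: 'k fmat)"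
   by (rule fmat_eqI) (auto simp: ent_idn_times ent_idn places_def)
  then have "idn {..<tsize V} * vd V v y = vd V v y"
   using vd(3)[OF y] colD(1)[of "vd V v y" "idn (places V v)" U1] by (metis mult.assoc vx_def)
  then show "Ident (nilpotent_reps Q) (qrep V) v y \<in> carrier (sp V v) \<and>
    vd V v (Ident (nilpotent_reps Q) (qrep V) v y) = idn {..<tsize V} * vd V v y"
   using v y by (simp add: nilpotent_reps_simps)
 qed (simp_all add: nilpotent_reps_simps)
next
 fix V W :: "('w, 'e, 'k) tri_rep" and \<phi> assume "is_tri_rep Q V" "is_tri_rep Q W" "\<phi> \<in> tri_hom Q V W"
 then show "qhom V W \<phi> \<in> Hom (nilpotent_reps Q) (qrep V) (qrep W)" by (rule qhom(1))
next
 fix V W Z :: "('w, 'e, 'k) tri_rep" and \<phi> \<psi> assume V: "is_tri_rep Q V" and W: "is_tri_rep Q W" and Z: "is_tri_rep Q Z"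
  and \<phi>: "\<phi> \<in> tri_hom Q V W" and \<psi>: "\<psi> \<in> tri_hom Q W Z"
 show "qhom V Z (\<psi> * \<phi>) = Comp (nilpotent_reps Q) (qrep V) (qrep W) (qrep Z) (qhom W Z \<psi>) (qhom V W \<phi>)"
  by (rule qhom_eqI[symmetric])
   (simp_all add: nilpotent_reps_simps compose_def qhom(2,3)[OF V W \<phi>] qhom(2,3)[OF W Z \<psi>] mult.assoc)
next
 fix V W :: "('w, 'e, 'k) tri_rep" and \<phi> \<psi> assume V: "is_tri_rep Q V" and W: "is_tri_rep Q W"
  and \<phi>: "\<phi> \<in> tri_hom Q V W" and \<psi>: "\<psi> \<in> tri_hom Q V W"
 show "qhom V W (\<phi> + \<psi>) = Plus (nilpotent_reps Q) (qrep V) (qrep W) (qhom V W \<phi>) (qhom V W \<psi>)"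
  by (rule qhom_eqI[symmetric])
   (simp_all add: nilpotent_reps_simps qhom(2,3)[OF V W \<phi>] qhom(2,3)[OF V W \<psi>] vd(5) sp_closed distrib_right)
next
 fix V W :: "('w, 'e, 'k) tri_rep" and \<phi> a assume V: "is_tri_rep Q V" and W: "is_tri_rep Q W" and \<phi>: "\<phi> \<in> tri_hom Q V W"
 show "qhom V W (sc1 a \<phi>) = Scale (nilpotent_reps Q) (qrep V) (qrep W) a (qhom V W \<phi>)"
  by (rule qhom_eqI[symmetric])
   (simp_all add: nilpotent_reps_simps qhom(2,3)[OF V W \<phi>] vd(6) sp_closed sc1.sc_mult_left)
qed

text \<open>A morphism of representations is a matrix at each vertex, and the labels tell how these fit into one matrix.\<close>

lemma qrep_fully_faithful: "fully_faithful (tri_cat Q) (nilpotent_reps Q) qrep qhom"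
 unfolding fully_faithful_def
proof (intro ballI; simp only: tri_cat_simps mem_Collect_eq)
 fix V W :: "('w, 'e, 'k) tri_rep" assume V: "is_tri_rep Q V" and W: "is_tri_rep Q W"
 show "bij_betw (qhom V W) (tri_hom Q V W) (Hom (nilpotent_reps Q) (qrep V) (qrep W))"
  unfolding bij_betw_def
 proof (intro conjI inj_onI equalityI subsetI)
  fix \<phi> \<psi> assume \<phi>: "\<phi> \<in> tri_hom Q V W" and \<psi>: "\<psi> \<in> tri_hom Q V W" and eq: "qhom V W \<phi> = qhom V W \<psi>"
  have *: "\<phi> * idn (places V v) = \<psi> * idn (places V v)" if v: "v \<in> verts Q" for v
  proof (rule frame.matrix_unique[OF frame1[OF finite_places]])
   have "idn (places V v) * idn (places V v) = (idn (places V v) :: 'k fmat)" by (rule frame.I_idem[OF frame1[OF finite_places]])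
   then show "\<phi> * idn (places V v) * idn (places V v) = \<phi> * idn (places V v)" "\<psi> * idn (places V v) * idn (places V v) = \<psi> * idn (places V v)"
    by (simp_all add: mult.assoc)
   fix x :: "'k fmat" assume x: "x \<in> col (idn (places V v)) U1"
   then have y: "vc V v x \<in> carrier (sp V v)" "vd V v (vc V v x) = x" using vd(1,2) by (simp_all add: vx_def)
   have "\<phi> * x = \<psi> * x" using qhom(2)[OF V W \<phi> v y(1)] qhom(2)[OF V W \<psi> v y(1)] eq y(2) by simp
   then show "\<phi> * idn (places V v) * x = \<psi> * idn (places V v) * x" using colD(1)[OF x] by (simp add: mult.assoc)
  qed
  show "\<phi> = \<psi>"
  proof (rule fmat_eqI)
   fix b a
   show "ent \<phi> b a = ent \<psi> b a"
   proof (cases "a < tsize V")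
    case True
    then have "label V a \<in> verts Q" "a \<in> places V (label V a)" using V by (auto simp: is_tri_rep_def places_def)
    then show ?thesis using arg_cong[OF *, of "label V a" "\<lambda>z. ent z b a"] by (simp add: ent_times_idn)
   next
    case False
    then have "ent \<phi> b a = 0" "ent \<psi> b a = 0" using \<phi> \<psi> unfolding tri_hom_def by blast+
    then show ?thesis by simp
   qed
  qed
 next
  fix h assume "h \<in> qhom V W ` tri_hom Q V W"
  then show "h \<in> Hom (nilpotent_reps Q) (qrep V) (qrep W)" using qhom(1)[OF V W] by blast
 next
  fix h assume "h \<in> Hom (nilpotent_reps Q) (qrep V) (qrep W)"
  then have h: "h \<in> extensional (verts Q)" "\<And>v. v \<in> verts Q ==> h v \<in> extensional (carrier (sp V v))"
   "\<And>v. v \<in> verts Q ==> h v \<in> module_hom class_ring (sp V v) (sp W v)"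
   "\<And>a x. a \<in> arcs Q ==> x \<in> carrier (sp V (tail Q a)) ==> h (head Q a) (arrow (qrep V) a x) = arrow (qrep W) a (h (tail Q a) x)"
   by (simp_all add: nilpotent_reps_simps del: qrep_simps(2))
  have "\<exists>T. idn (places W v) * T = T \<and> T * idn (places V v) = T \<and> (\<forall>x\<in>vx V v. T * x = vd W v (h v (vc V v x)))" if v: "v \<in> verts Q" for v
  proof -
   note hv = h(3)[OF v, unfolded linear_hom_iff]
   have sums: "vc V v (x + y) = vc V v x \<oplus>\<^bsub>sp V v\<^esub> vc V v y" "vc V v (sc1 a x) = a \<odot>\<^bsub>sp V v\<^esub> vc V v x"
    if "x \<in> vx V v" "y \<in> vx V v" for x y a
    using that vc_inj[of V v] by (simp_all add: sp_def cvec_simps)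
   show ?thesis unfolding vx_def
   proof (rule frame.matrix_exists[OF frame1[OF finite_places]]; fold vx_def)
    fix x y assume x: "x \<in> vx V v" and y: "y \<in> vx V v"
    show "vd W v (h v (vc V v (x + y))) = vd W v (h v (vc V v x)) + vd W v (h v (vc V v y))"
     using hv vd(1)[OF x] vd(1)[OF y] by (simp add: sums[OF x y] vd(5))
   next
    fix x a assume x: "x \<in> vx V v"
    show "vd W v (h v (vc V v (sc1 a x))) = sc1 a (vd W v (h v (vc V v x)))"
     using hv vd(1)[OF x] by (simp add: sums(2)[OF x x] vd(6))
   next
    fix x assume x: "x \<in> vx V v"
    show "vd W v (h v (vc V v x)) \<in> vx W v" using hv vd(1)[OF x] vd(3) by blast
   qed
  qed
  then obtain T where T: "\<And>v. v \<in> verts Q ==> idn (places W v) * T v = T v" "\<And>v. v \<in> verts Q ==> T v * idn (places V v) = T v"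
   "\<And>v x. v \<in> verts Q ==> x \<in> vx V v ==> T v * x = vd W v (h v (vc V v x))" by metis
  define \<phi> where "\<phi> = fm (tsize W) (tsize V) (\<lambda>b a. ent (T (label V a)) b a)"
  have Tnz: "b \<in> places W v \<and> a \<in> places V v" if "v \<in> verts Q" "ent (T v) b a \<noteq> 0" for v b a
   using arg_cong[OF T(1)[OF that(1)], of "\<lambda>z. ent z b a"] arg_cong[OF T(2)[OF that(1)], of "\<lambda>z. ent z b a"] that(2)
   by (auto simp: ent_idn_times ent_times_idn split: if_splits)
  have \<phi>T: "\<phi> * idn (places V v) = T v" "idn (places W v) * \<phi> = T v" if v: "v \<in> verts Q" for v
  proof -
   show "\<phi> * idn (places V v) = T v"
    by (rule fmat_eqI) (use Tnz[OF v] in \<open>force simp: \<phi>_def ent_times_idn places_def\<close>)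
   show "idn (places W v) * \<phi> = T v"
   proof (rule fmat_eqI)
    fix b a
    have lv: "label V a \<in> verts Q" if "a < tsize V" using that V unfolding is_tri_rep_def by blast
    show "ent (idn (places W v) * \<phi>) b a = ent (T v) b a"
    proof (cases "ent (T v) b a = 0")
     case True
     have "ent (T (label V a)) b a = 0" if "b \<in> places W v" "a < tsize V"
     proof (rule ccontr)
      assume "ent (T (label V a)) b a \<noteq> 0"
      then have "label V a = v" using Tnz[OF lv[OF that(2)], of b a] that(1) by (simp add: places_def)
      with \<open>ent (T (label V a)) b a \<noteq> 0\<close> True show False by simp
     qed
     then show ?thesis using True by (simp add: ent_idn_times \<phi>_def)
    next
     case False
     then show ?thesis using Tnz[OF v False] by (simp add: ent_idn_times \<phi>_def places_def)
    qed
   qed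
  qed
  have "\<phi> \<in> tri_hom Q V W"
   unfolding tri_hom_def
  proof (intro CollectI conjI ballI allI impI)
   fix b a assume nz: "ent \<phi> b a \<noteq> 0"
   then show ab: "a < tsize V" "b < tsize W" by (auto simp: \<phi>_def split: if_splits)
   have "label V a \<in> verts Q" using ab V unfolding is_tri_rep_def by blast
   then show "label V a = label W b" using Tnz[of "label V a" b a] nz ab by (auto simp: \<phi>_def places_def)
  next
   fix \<alpha> assume \<alpha>: "\<alpha> \<in> arcs Q"
   let ?t = "tail Q \<alpha>" and ?h = "head Q \<alpha>"
   note t = tail_in_verts[OF \<alpha>] and hh = head_in_verts[OF \<alpha>]
   have "T ?h * amat V \<alpha> = amat W \<alpha> * T ?t"
   proof (rule frame.matrix_unique[OF frame1[OF finite_places[of V ?t]]])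
    show "T ?h * amat V \<alpha> * idn (places V ?t) = T ?h * amat V \<alpha>" using amat_corner(2)[OF V \<alpha>] by (simp add: mult.assoc)
    show "amat W \<alpha> * T ?t * idn (places V ?t) = amat W \<alpha> * T ?t" using T(2)[OF t] by (simp add: mult.assoc)
    fix x :: "'k fmat" assume "x \<in> col (idn (places V ?t)) U1"
    then have x: "x \<in> vx V ?t" by (simp add: vx_def)
    have hx: "h ?t (vc V ?t x) \<in> carrier (sp W ?t)" using h(3)[OF t] vd(1)[OF x] unfolding linear_hom_iff by blast
    have "T ?h * (amat V \<alpha> * x) = vd W ?h (h ?h (arrow (qrep V) \<alpha> (vc V ?t x)))"
     using T(3)[OF hh amat_vx[OF V \<alpha> x]] vd(2)[OF x] by simp
    also have "\<dots> = vd W ?h (arrow (qrep W) \<alpha> (h ?t (vc V ?t x)))" using h(4)[OF \<alpha> vd(1)[OF x]] by simp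
    also have "\<dots> = amat W \<alpha> * vd W ?t (h ?t (vc V ?t x))" using vd(2)[OF amat_vx[OF W \<alpha> vd(3)[OF hx]]] by simp
    also have "\<dots> = amat W \<alpha> * (T ?t * x)" using T(3)[OF t x] by simp
    finally show "T ?h * amat V \<alpha> * x = amat W \<alpha> * T ?t * x" by (simp add: mult.assoc)
   qed
   moreover have "T ?h * amat V \<alpha> = \<phi> * amat V \<alpha>"
    using \<phi>T(1)[OF hh] amat_corner(1)[OF V \<alpha>] by (metis mult.assoc)
   moreover have "amat W \<alpha> * T ?t = amat W \<alpha> * \<phi>"
    using \<phi>T(2)[OF t] amat_corner(2)[OF W \<alpha>] by (metis mult.assoc)
   ultimately show "\<phi> * amat V \<alpha> = amat W \<alpha> * \<phi>" by simp
  qed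
  moreover have "h = qhom V W \<phi>"
  proof (rule qhom_eqI[OF h(1,2)])
   fix v y assume v: "v \<in> verts Q" and y: "y \<in> carrier (sp V v)"
   have "\<phi> * vd V v y = \<phi> * (idn (places V v) * vd V v y)" using vd(3)[OF y] by (simp add: vx_def colD(1))
   also have "\<dots> = T v * vd V v y" using \<phi>T(1)[OF v] by (simp add: mult.assoc[symmetric])
   also have "\<dots> = vd W v (h v y)" using T(3)[OF v vd(3)[OF y]] vd(4)[OF y] by simp
   finally show "h v y \<in> carrier (sp W v) \<and> vd W v (h v y) = \<phi> * vd V v y"
    using h(3)[OF v] y unfolding linear_hom_iff by simp
  qed
  ultimately show "h \<in> qhom V W ` tri_hom Q V W" by blast
 qed
qed

end

section \<open>Triangular bases of nilpotent representations\<close>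

context coded_quiver
begin

text \<open>Appends a basis vector at \<open>v\<close>, which the arrows map to \<open>z\<close>.\<close>

definition extend :: "('w, 'e, 'k) tri_rep \<Rightarrow> 'w \<Rightarrow> ('e \<Rightarrow> 'k fmat) \<Rightarrow> ('w, 'e, 'k) tri_rep" where
 "extend V v z = \<lparr>tsize = Suc (tsize V), label = (label V)(tsize V := v),
   amat = (\<lambda>\<alpha>. amat V \<alpha> + (if tail Q \<alpha> = v then z \<alpha> * eunit 0 (tsize V) 1 else 0))\<rparr>"

lemma extend:
 assumes V: "is_tri_rep Q V" and v: "v \<in> verts Q"
  and z: "\<And>\<alpha>. \<alpha> \<in> arcs Q ==> tail Q \<alpha> = v ==> z \<alpha> \<in> vx V (head Q \<alpha>)"
 shows "is_tri_rep Q (extend V v z)"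
  and "idn (places (extend V v z) u) = idn (places V u) + (if u = v then eunit (tsize V) (tsize V) 1 else 0)"
proof -
 show "is_tri_rep Q (extend V v z)"
  unfolding is_tri_rep_def
 proof (intro conjI allI impI ballI)
  show "label (extend V v z) a \<in> verts Q" if "a < tsize (extend V v z)" for a
   using that V v by (auto simp: extend_def is_tri_rep_def less_Suc_eq)
 next
  fix \<alpha> b a assume \<alpha>: "\<alpha> \<in> arcs Q" and nz: "ent (amat (extend V v z) \<alpha>) b a \<noteq> 0"
  consider "ent (amat V \<alpha>) b a \<noteq> 0" | "tail Q \<alpha> = v" "a = tsize V" "ent (z \<alpha>) b 0 \<noteq> 0"
   using nz by (cases "ent (amat V \<alpha>) b a = 0") (auto simp: extend_def ent_times_eunit split: if_splits)
  then have "b < a \<and> a < tsize (extend V v z) \<and> label (extend V v z) a = tail Q \<alpha> \<and> label (extend V v z) b = head Q \<alpha>"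
  proof cases
   case 1
   then have "b < a \<and> a < tsize V \<and> label V a = tail Q \<alpha> \<and> label V b = head Q \<alpha>"
    using V \<alpha> unfolding is_tri_rep_def by blast
   then show ?thesis by (auto simp: extend_def)
  next
   case 2
   have "idn (places V (head Q \<alpha>)) * z \<alpha> = z \<alpha>" using z[OF \<alpha> 2(1)] by (simp add: vx_def colD(1))
   then have "ent (idn (places V (head Q \<alpha>)) * z \<alpha>) b 0 \<noteq> 0" using 2(3) by simp
   then have "b < tsize V" "label V b = head Q \<alpha>" by (auto simp: ent_idn_times places_def split: if_splits)
   then show ?thesis using 2 by (auto simp: extend_def)
  qed
  then show "b < a" "a < tsize (extend V v z)" "label (extend V v z) a = tail Q \<alpha>" "label (extend V v z) b = head Q \<alpha>"
   by blast+
 qed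
 show "idn (places (extend V v z) u) = idn (places V u) + (if u = v then eunit (tsize V) (tsize V) 1 else 0)"
  by (rule fmat_eqI) (auto simp: ent_idn places_def extend_def)
qed

text \<open>A partial system is a triangular representation \<open>V\<close> with an injective morphism \<open>\<Theta>\<close> to \<open>Y\<close>. If the images do
not exhaust \<open>Y\<close>, then some vector outside them is mapped into them by all arrows: otherwise there would be
arbitrarily long walks that map some vector outside of the images, in particular not to zero. Such a vector can
be appended to the basis, so a system of maximal rank is an isomorphism.\<close>

lemma qrep_essentially_surjective: "essentially_surjective (tri_cat Q) (nilpotent_reps Q) qrep"
 unfolding essentially_surjective_def
proof (intro ballI)
 fix Y :: "('w, 'e, 'k, 'u) quiver_rep" assume "Y \<in> Ob (nilpotent_reps Q)"
 then have Yq: "is_quiver_rep Q Y" and Yn: "nilpotent_rep Q Y" by (auto simp: nilpotent_reps_simps)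
 have vs: "vectorspace class_ring (space Y v)" and fd: "vectorspace.fin_dim class_ring (space Y v)" if "v \<in> verts Q" for v
  using Yq that unfolding is_quiver_rep_def by auto
 have ar: "arrow Y \<alpha> \<in> module_hom class_ring (space Y (tail Q \<alpha>)) (space Y (head Q \<alpha>))" if "\<alpha> \<in> arcs Q" for \<alpha>
  using Yq that unfolding is_quiver_rep_def by blast
 note arl = ar[unfolded linear_hom_iff]
 define J where "J v = (idn {..<vectorspace.dim class_ring (space Y v)} :: 'k fmat)" for v
 have "\<forall>v\<in>verts Q. \<exists>c. frame.coord sc1 (J v) U1 (space Y v) c"
  using coordinates_exist[OF vs fd] unfolding J_def by blast
 then obtain cY where cY: "\<And>v. v \<in> verts Q ==> frame.coord sc1 (J v) U1 (space Y v) (cY v)" by metis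
 have fJ: "frame sc1 (J v) U1 {..<vectorspace.dim class_ring (space Y v)} (\<lambda>k. eunit k 0 1) (\<lambda>k. eunit 0 k (1 :: 'k))" for v
  unfolding J_def by (rule frame1[OF finite_lessThan])
 note co = cY[unfolded frame.coord_def[OF fJ]]
 have c1: "cY v y \<in> col (J v) U1" if "v \<in> verts Q" "y \<in> carrier (space Y v)" for v y
  using co[OF that(1)] that(2) by (auto simp: bij_betw_def)
 have c2: "\<exists>y\<in>carrier (space Y v). cY v y = x" if "v \<in> verts Q" "x \<in> col (J v) U1" for v x
  using co[OF that(1)] that(2) unfolding bij_betw_def by (metis imageE)
 have c3: "y = y'" if "v \<in> verts Q" "y \<in> carrier (space Y v)" "y' \<in> carrier (space Y v)" "cY v y = cY v y'" for v y y'
  using co[OF that(1)] that(2-4) unfolding bij_betw_def inj_on_def by blast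
 have c4: "cY v (y \<oplus>\<^bsub>space Y v\<^esub> y') = cY v y + cY v y'" if "v \<in> verts Q" "y \<in> carrier (space Y v)" "y' \<in> carrier (space Y v)" for v y y'
  using co[OF that(1)] that(2,3) by blast
 have c5: "cY v (a \<odot>\<^bsub>space Y v\<^esub> y) = sc1 a (cY v y)" if "v \<in> verts Q" "y \<in> carrier (space Y v)" for v y a
  using co[OF that(1)] that(2) by blast
 note cf = class_vectorspace_facts[OF vs]
 have c0: "cY v \<zero>\<^bsub>space Y v\<^esub> = 0" if "v \<in> verts Q" for v
  using c5[OF that cf(3)[OF that], of 0] cf(14)[OF that, of 0] by simp
 have "\<forall>\<alpha>\<in>arcs Q. \<exists>B. B * J (tail Q \<alpha>) = B \<and> (\<forall>y\<in>carrier (space Y (tail Q \<alpha>)). B * cY (tail Q \<alpha>) y = cY (head Q \<alpha>) (arrow Y \<alpha> y))"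
 proof
  fix \<alpha> assume \<alpha>: "\<alpha> \<in> arcs Q"
  let ?t = "tail Q \<alpha>" and ?h = "head Q \<alpha>"
  note t = tail_in_verts[OF \<alpha>] and hh = head_in_verts[OF \<alpha>] and al = arl[OF \<alpha>]
  define g where "g x = cY ?h (arrow Y \<alpha> (inv_into (carrier (space Y ?t)) (cY ?t) x))" for x
  have g: "g (cY ?t y) = cY ?h (arrow Y \<alpha> y)" if "y \<in> carrier (space Y ?t)" for y
   unfolding g_def using inv_into_f_f[OF bij_betw_imp_inj_on[OF conjunct1[OF co[OF t]]] that] by simp
  have "\<exists>B. J ?h * B = B \<and> B * J ?t = B \<and> (\<forall>x\<in>col (J ?t) U1. B * x = g x)"
  proof (rule frame.matrix_exists[OF fJ])
   fix x y assume "x \<in> col (J ?t) U1" "y \<in> col (J ?t) U1"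
   then obtain x' y' where x: "x' \<in> carrier (space Y ?t)" "cY ?t x' = x" and y: "y' \<in> carrier (space Y ?t)" "cY ?t y' = y"
    using c2[OF t] by metis
   have "x + y = cY ?t (x' \<oplus>\<^bsub>space Y ?t\<^esub> y')" using c4[OF t x(1) y(1)] x y by simp
   then show "g (x + y) = g x + g y"
    using g[OF cf(1)[OF t x(1) y(1)]] g[OF x(1)] g[OF y(1)] x y al c4[OF hh, of "arrow Y \<alpha> x'" "arrow Y \<alpha> y'"] by simp
  next
   fix x a assume "x \<in> col (J ?t) U1"
   then obtain x' where x: "x' \<in> carrier (space Y ?t)" "cY ?t x' = x" using c2[OF t] by metis
   have "sc1 a x = cY ?t (a \<odot>\<^bsub>space Y ?t\<^esub> x')" using c5[OF t x(1)] x by simp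
   then show "g (sc1 a x) = sc1 a (g x)"
    using g[OF cf(2)[OF t x(1)]] g[OF x(1)] x al c5[OF hh, of "arrow Y \<alpha> x'"] by simp
  next
   fix x assume "x \<in> col (J ?t) U1"
   then obtain x' where x: "x' \<in> carrier (space Y ?t)" "cY ?t x' = x" using c2[OF t] by metis
   then show "g x \<in> col (J ?h) U1" using g[OF x(1)] al c1[OF hh] by simp
  qed
  then show "\<exists>B. B * J ?t = B \<and> (\<forall>y\<in>carrier (space Y ?t). B * cY ?t y = cY ?h (arrow Y \<alpha> y))"
   using g c1[OF t] by metis
 qed
 then obtain B where B: "\<And>\<alpha> y. \<alpha> \<in> arcs Q ==> y \<in> carrier (space Y (tail Q \<alpha>)) ==> B \<alpha> * cY (tail Q \<alpha>) y = cY (head Q \<alpha>) (arrow Y \<alpha> y)"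
  by metis
 define system where "system V\<Theta> \<longleftrightarrow> (case V\<Theta> of (V, \<Theta>) \<Rightarrow> is_tri_rep Q V \<and>
   (\<forall>v\<in>verts Q. J v * \<Theta> v = \<Theta> v \<and> \<Theta> v * idn (places V v) = \<Theta> v \<and> (\<forall>x\<in>vx V v. \<Theta> v * x = 0 \<longrightarrow> x = 0)) \<and>
   (\<forall>\<alpha>\<in>arcs Q. B \<alpha> * \<Theta> (tail Q \<alpha>) = \<Theta> (head Q \<alpha>) * amat V \<alpha>))" for V\<Theta>
 define im where "im V\<Theta> v = (case V\<Theta> of (V, \<Theta>) \<Rightarrow> {y \<in> carrier (space Y v). \<exists>x\<in>vx V v. cY v y = \<Theta> v * x})" for V\<Theta> v
 have "\<forall>v\<in>verts Q. \<exists>\<mu> :: 'u set \<Rightarrow> nat. \<forall>W W'. W \<subset> W' \<longrightarrow> W' \<subseteq> carrier (space Y v) \<longrightarrow> \<zero>\<^bsub>space Y v\<^esub> \<in> W \<longrightarrow>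
   (\<forall>x\<in>W. \<forall>y\<in>W. x \<oplus>\<^bsub>space Y v\<^esub> y \<in> W) \<longrightarrow> (\<forall>a. \<forall>x\<in>W. a \<odot>\<^bsub>space Y v\<^esub> x \<in> W) \<longrightarrow> \<mu> W < \<mu> W'"
  using subspace_rank_exists[OF vs fd] by blast
 then obtain \<mu> :: "'w \<Rightarrow> 'u set \<Rightarrow> nat" where \<mu>: "\<forall>v\<in>verts Q. \<forall>W W'. W \<subset> W' \<longrightarrow> W' \<subseteq> carrier (space Y v) \<longrightarrow> \<zero>\<^bsub>space Y v\<^esub> \<in> W \<longrightarrow>
   (\<forall>x\<in>W. \<forall>y\<in>W. x \<oplus>\<^bsub>space Y v\<^esub> y \<in> W) \<longrightarrow> (\<forall>a. \<forall>x\<in>W. a \<odot>\<^bsub>space Y v\<^esub> x \<in> W) \<longrightarrow> \<mu> v W < \<mu> v W'"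
  by (elim bchoice[THEN exE])
 have im_sub: "im V\<Theta> v \<subseteq> carrier (space Y v)" for V\<Theta> v by (auto simp: im_def split: prod.splits)
 have im0: "\<zero>\<^bsub>space Y v\<^esub> \<in> im V\<Theta> v" if "v \<in> verts Q" for V\<Theta> v
  using cf(3)[OF that] c0[OF that] by (auto simp: im_def vx_def split: prod.splits intro!: bexI[of _ 0])
 have im_mono: "\<mu> v (im V\<Theta> v) < \<mu> v W'" if v: "v \<in> verts Q" and lt: "im V\<Theta> v \<subset> W'" and W': "W' \<subseteq> carrier (space Y v)" for V\<Theta> v W'
 proof -
  obtain V \<Theta> where e: "V\<Theta> = (V, \<Theta>)" by (cases V\<Theta>)
  have add: "x \<oplus>\<^bsub>space Y v\<^esub> y \<in> im V\<Theta> v" if xy: "x \<in> im V\<Theta> v" "y \<in> im V\<Theta> v" for x y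
  proof -
   obtain x' y' where "x' \<in> vx V v" "cY v x = \<Theta> v * x'" "y' \<in> vx V v" "cY v y = \<Theta> v * y'"
    using xy by (auto simp: im_def e)
   then show ?thesis using xy cf(1)[OF v] c4[OF v]
    by (auto simp: im_def e vx_def distrib_left intro!: bexI[of _ "x' + y'"] col_add)
  qed
  have sm: "a \<odot>\<^bsub>space Y v\<^esub> x \<in> im V\<Theta> v" if x: "x \<in> im V\<Theta> v" for a x
  proof -
   obtain x' where "x' \<in> vx V v" "cY v x = \<Theta> v * x'" using x by (auto simp: im_def e)
   then show ?thesis using x cf(2)[OF v] c5[OF v]
    by (auto simp: im_def e vx_def sc1.sc_mult_right intro!: bexI[of _ "sc1 a x'"] sc1.col_sc)
  qed
  show ?thesis using \<mu> v lt W' im0[OF v] add sm by simp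
 qed
 define rank where "rank V\<Theta> = (\<Sum>v\<in>verts Q. \<mu> v (im V\<Theta> v))" for V\<Theta>
 have bound: "rank V\<Theta> \<le> (\<Sum>v\<in>verts Q. \<mu> v (carrier (space Y v)))" for V\<Theta>
  unfolding rank_def
 proof (rule sum_mono)
  fix v assume v: "v \<in> verts Q"
  show "\<mu> v (im V\<Theta> v) \<le> \<mu> v (carrier (space Y v))"
   using im_mono[OF v _ order_refl, of V\<Theta>] im_sub[of V\<Theta> v] by (cases "im V\<Theta> v = carrier (space Y v)") (auto simp: psubset_eq)
 qed
 define V0 :: "('w, 'e, 'k) tri_rep" where "V0 = \<lparr>tsize = 0, label = undefined, amat = (\<lambda>_. 0)\<rparr>"
 have "idn (places V0 v) = (0 :: 'k fmat)" for v by (rule fmat_eqI) (simp add: ent_idn places_def V0_def)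
 then have sys0: "system (V0, \<lambda>_. 0)" by (simp add: system_def is_tri_rep_def V0_def vx_def col_def)
 have "\<exists>V\<Theta>. system V\<Theta> \<and> (\<forall>V\<Theta>'. system V\<Theta>' \<longrightarrow> rank V\<Theta>' \<le> rank V\<Theta>)"
  by (rule ex_has_greatest_nat[of system "(V0, \<lambda>_. 0)" rank "Suc (\<Sum>v\<in>verts Q. \<mu> v (carrier (space Y v)))", OF sys0])
   (simp add: bound less_Suc_eq_le)
 then obtain V\<Theta> where max0: "system V\<Theta> \<and> (\<forall>V\<Theta>'. system V\<Theta>' \<longrightarrow> rank V\<Theta>' \<le> rank V\<Theta>)" ..
 obtain V \<Theta> where e: "V\<Theta> = (V, \<Theta>)" by (cases V\<Theta>)
 have sys: "system (V, \<Theta>)" and max: "\<And>V' \<Theta>'. system (V', \<Theta>') ==> rank (V', \<Theta>') \<le> rank (V, \<Theta>)" using max0 e by auto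
 have V: "is_tri_rep Q V" and \<Theta>1: "\<And>v. v \<in> verts Q ==> J v * \<Theta> v = \<Theta> v"
  and \<Theta>2: "\<And>v. v \<in> verts Q ==> \<Theta> v * idn (places V v) = \<Theta> v"
  and \<Theta>3: "\<And>v x. v \<in> verts Q ==> x \<in> vx V v ==> \<Theta> v * x = 0 ==> x = 0"
  and \<Theta>4: "\<And>\<alpha>. \<alpha> \<in> arcs Q ==> B \<alpha> * \<Theta> (tail Q \<alpha>) = \<Theta> (head Q \<alpha>) * amat V \<alpha>"
  using sys unfolding system_def by auto
 have full: False if v: "v \<in> verts Q" and x: "x \<in> carrier (space Y v)" "x \<notin> im (V, \<Theta>) v"
  and arx: "\<And>\<alpha>. \<alpha> \<in> arcs Q ==> tail Q \<alpha> = v ==> arrow Y \<alpha> x \<in> im (V, \<Theta>) (head Q \<alpha>)" for v x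
 proof -
  have "\<forall>\<alpha>\<in>{\<alpha> \<in> arcs Q. tail Q \<alpha> = v}. \<exists>z. z \<in> vx V (head Q \<alpha>) \<and> cY (head Q \<alpha>) (arrow Y \<alpha> x) = \<Theta> (head Q \<alpha>) * z"
   using arx by (auto simp: im_def)
  from bchoice[OF this] obtain z where z: "\<And>\<alpha>. \<alpha> \<in> arcs Q ==> tail Q \<alpha> = v ==> z \<alpha> \<in> vx V (head Q \<alpha>)"
   "\<And>\<alpha>. \<alpha> \<in> arcs Q ==> tail Q \<alpha> = v ==> cY (head Q \<alpha>) (arrow Y \<alpha> x) = \<Theta> (head Q \<alpha>) * z \<alpha>" by blast
  define n where "n = tsize V"
  define V' where "V' = extend V v z"
  define \<Theta>' where "\<Theta>' u = \<Theta> u + (if u = v then cY v x * eunit 0 n 1 else 0)" for u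
  note ex = extend[OF V v z(1), folded V'_def n_def]
  have pn: "idn (places V u) * eunit n n 1 = 0" "eunit 0 n 1 * idn (places V u) = 0" for u
   by (rule fmat_eqI; simp add: ent_idn_times ent_times_idn places_def n_def)+
  have \<Theta>n: "\<Theta> u * eunit n n 1 = 0" if "u \<in> verts Q" for u
  proof -
   have "\<Theta> u * eunit n n 1 = \<Theta> u * (idn (places V u) * eunit n n 1)" using \<Theta>2[OF that] by (simp add: mult.assoc[symmetric])
   then show ?thesis by (simp add: pn)
  qed
  have en: "eunit 0 n 1 * y = 0" if "y \<in> vx V u" for y u
  proof -
   have "eunit 0 n 1 * y = eunit 0 n 1 * idn (places V u) * y" using that by (simp add: vx_def colD(1) mult.assoc)
   then show ?thesis by (simp add: pn)
  qed
  have xU: "cY v x * U1 = cY v x" and Jx: "J v * cY v x = cY v x" using c1[OF v x(1)] by (simp_all add: colD)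
  have vx': "vx V u \<subseteq> vx V' u" for u
  proof
   fix y assume y: "y \<in> vx V u"
   have "eunit n n 1 * y = eunit n 0 1 * (eunit 0 n 1 * y)" by (simp add: mult.assoc[symmetric] eunit_times)
   then have "eunit n n 1 * y = 0" using en[OF y] by simp
   then show "y \<in> vx V' u" using y by (auto simp: vx_def col_def ex(2) distrib_right)
  qed
  have sys': "system (V', \<Theta>')"
   unfolding system_def prod.case
  proof (intro conjI ballI impI)
   show "is_tri_rep Q V'" by (rule ex(1))
  next
   fix u assume u: "u \<in> verts Q"
   show "J u * \<Theta>' u = \<Theta>' u" using \<Theta>1[OF u] Jx by (simp add: \<Theta>'_def distrib_left mult.assoc[symmetric])
   have xn: "cY v x * eunit 0 n 1 * idn (places V u) = 0" by (simp add: mult.assoc pn)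
   show "\<Theta>' u * idn (places V' u) = \<Theta>' u"
    using \<Theta>2[OF u] \<Theta>n[OF u] xn
    by (cases "u = v") (simp_all add: \<Theta>'_def ex(2) distrib_left distrib_right mult.assoc eunit_times)
   fix y assume y: "y \<in> vx V' u" and 0: "\<Theta>' u * y = 0"
   have y': "y = idn (places V u) * y + (if u = v then eunit n n 1 * y else 0)"
    using colD(1)[of y "idn (places V' u)" U1] y by (simp add: vx_def ex(2) distrib_right split: if_splits)
   have yU: "y * U1 = y" using y by (simp add: vx_def colD(2))
   have py: "idn (places V u) * y \<in> vx V u"
    unfolding vx_def using frame.I_idem[OF frame1[OF finite_places[of V u]], where ?'k = 'k]
    by (intro colI) (simp_all only: mult.assoc[symmetric], simp add: mult.assoc yU)
   have \<Theta>y: "\<Theta> u * y = \<Theta> u * (idn (places V u) * y)" using \<Theta>2[OF u] by (simp add: mult.assoc[symmetric])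
   show "y = 0"
   proof (cases "u = v")
    case False
    then have "\<Theta> u * (idn (places V u) * y) = 0" using 0 \<Theta>y by (simp add: \<Theta>'_def)
    from \<Theta>3[OF u py this] show ?thesis using y' False by simp
   next
    case True
    have e0: "eunit 0 n 1 * y = sc1 (ent y n 0) U1"
    proof (rule fmat_eqI)
     fix b a
     have "ent y n a = 0" if "a \<noteq> 0"
      using arg_cong[OF yU, of "\<lambda>z. ent z n a"] that by (simp add: U1_def ent_times_eunit)
     then show "ent (eunit 0 n 1 * y) b a = ent (sc1 (ent y n 0) U1) b a"
      by (auto simp: ent_eunit_times U1_def)
    qed
    have eq: "\<Theta> v * (idn (places V v) * y) + sc1 (ent y n 0) (cY v x) = 0"
     using 0 \<Theta>y e0 xU True by (simp add: \<Theta>'_def distrib_right mult.assoc sc1.sc_mult_right)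
    have s: "ent y n 0 = 0"
    proof (rule ccontr)
     assume nz: "ent y n 0 \<noteq> 0"
     let ?s = "- inverse (ent y n 0)"
     have "sc1 (ent y n 0) (cY v x) = - (\<Theta> v * (idn (places V v) * y))" using eq by (simp add: eq_neg_iff_add_eq_0 add.commute)
     then have "sc1 (inverse (ent y n 0)) (sc1 (ent y n 0) (cY v x)) = sc1 (inverse (ent y n 0)) (- (\<Theta> v * (idn (places V v) * y)))" by simp
     then have "cY v x = \<Theta> v * sc1 ?s (idn (places V v) * y)"
      using nz by (simp add: sc1.sc_sc[symmetric] sc1.sc_mult_right sc1.sc_minus_left sc1.sc_minus_right)
     then have "x \<in> im (V, \<Theta>) v"
      using x(1) py True by (auto simp: im_def vx_def intro!: bexI[of _ "sc1 ?s (idn (places V v) * y)"] sc1.col_sc)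
     then show False using x(2) by blast
    qed
    have "\<Theta> u * (idn (places V u) * y) = 0" using eq s True by simp
    from \<Theta>3[OF u py this] have p0: "idn (places V u) * y = 0" .
    have "eunit n n 1 * y = eunit n 0 1 * (eunit 0 n 1 * y)" by (simp add: mult.assoc[symmetric] eunit_times)
    then have "eunit n n 1 * y = 0" using e0 s by simp
    then show ?thesis using y' p0 True by simp
   qed
  next
   fix \<alpha> assume \<alpha>: "\<alpha> \<in> arcs Q"
   let ?t = "tail Q \<alpha>" and ?h = "head Q \<alpha>"
   note t = tail_in_verts[OF \<alpha>] and hh = head_in_verts[OF \<alpha>]
   have am: "amat V' \<alpha> = amat V \<alpha> + (if ?t = v then z \<alpha> * eunit 0 n 1 else 0)" by (simp add: V'_def extend_def n_def)
   have na: "eunit 0 n 1 * amat V \<alpha> = 0"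
   proof -
    have "eunit 0 n 1 * amat V \<alpha> = eunit 0 n 1 * idn (places V ?h) * amat V \<alpha>" using amat_corner(1)[OF V \<alpha>] by (simp add: mult.assoc)
    then show ?thesis by (simp add: pn)
   qed
   have nz: "eunit 0 n 1 * z \<alpha> = 0" if "?t = v" by (rule en[OF z(1)[OF \<alpha> that]])
   have "B \<alpha> * cY v x = \<Theta> ?h * z \<alpha>" if "?t = v" using B[OF \<alpha>, of x] z(2)[OF \<alpha> that] x(1) that by simp
   then have "B \<alpha> * \<Theta>' ?t = \<Theta> ?h * amat V' \<alpha>"
    using \<Theta>4[OF \<alpha>] by (simp add: \<Theta>'_def am distrib_left mult.assoc[symmetric])
   moreover have "eunit 0 n 1 * amat V' \<alpha> = 0"
    using na nz by (simp add: am distrib_left mult.assoc[symmetric])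
   then have "\<Theta>' ?h * amat V' \<alpha> = \<Theta> ?h * amat V' \<alpha>"
    by (simp add: \<Theta>'_def distrib_right mult.assoc)
   ultimately show "B \<alpha> * \<Theta>' ?t = \<Theta>' ?h * amat V' \<alpha>" by simp
  qed
  have sub: "im (V, \<Theta>) u \<subseteq> im (V', \<Theta>') u" for u
  proof
   fix y assume "y \<in> im (V, \<Theta>) u"
   then obtain y' where y: "y \<in> carrier (space Y u)" "y' \<in> vx V u" "cY u y = \<Theta> u * y'" by (auto simp: im_def)
   have "\<Theta>' u * y' = \<Theta> u * y'" using en[OF y(2)] by (simp add: \<Theta>'_def distrib_right mult.assoc)
   then show "y \<in> im (V', \<Theta>') u" using y vx'[of u] by (auto simp: im_def intro!: bexI[of _ y'])
  qed
  have "eunit n 0 1 \<in> vx V' v"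
  proof -
   have "idn (places V v) * eunit n 0 1 = (0 :: 'k fmat)" by (rule fmat_eqI) (simp add: ent_idn_times places_def n_def)
   then show ?thesis unfolding vx_def by (intro colI) (simp_all add: ex(2) distrib_right eunit_times U1_def)
  qed
  moreover have "cY v x = \<Theta>' v * eunit n 0 1"
  proof -
   have "\<Theta> v * eunit n 0 1 = \<Theta> v * eunit n n 1 * eunit n 0 1" by (simp add: mult.assoc eunit_times)
   then have "\<Theta> v * eunit n 0 1 = 0" using \<Theta>n[OF v] by simp
   then show ?thesis using xU by (simp add: \<Theta>'_def distrib_right mult.assoc eunit_times U1_def)
  qed
  ultimately have "x \<in> im (V', \<Theta>') v" using x(1) by (auto simp: im_def)
  then have "im (V, \<Theta>) v \<subset> im (V', \<Theta>') v" using sub x(2) by blast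
  then have lt: "\<mu> v (im (V, \<Theta>) v) < \<mu> v (im (V', \<Theta>') v)" by (rule im_mono[OF v _ im_sub])
  have le: "\<mu> u (im (V, \<Theta>) u) \<le> \<mu> u (im (V', \<Theta>') u)" if "u \<in> verts Q" for u
   using im_mono[OF that _ im_sub, of "(V, \<Theta>)" "(V', \<Theta>')"] sub[of u] by (cases "im (V, \<Theta>) u = im (V', \<Theta>') u") (auto simp: psubset_eq)
  have "rank (V, \<Theta>) < rank (V', \<Theta>')"
   unfolding rank_def by (rule sum_strict_mono_ex1) (use fin_verts le lt v in auto)
  then show False using max[OF sys'] by simp
 qed
 have imall: "im (V, \<Theta>) v = carrier (space Y v)" if vQ: "v \<in> verts Q" for v
 proof (rule ccontr)
  assume "im (V, \<Theta>) v \<noteq> carrier (space Y v)"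
  then obtain x where x: "x \<in> carrier (space Y v)" "x \<notin> im (V, \<Theta>) v" using im_sub by blast
  have walk: "\<exists>p u. awalk v p u \<and> length p = l \<and> fold (arrow Y) p x \<notin> im (V, \<Theta>) u"
   if "v \<in> verts Q" "x \<in> carrier (space Y v)" "x \<notin> im (V, \<Theta>) v" for l v x
   using that
  proof (induction l arbitrary: v x)
   case 0
   then show ?case by (intro exI[of _ "[]"] exI[of _ v]) (simp add: awalk_def)
  next
   case (Suc l)
   obtain \<alpha> where \<alpha>: "\<alpha> \<in> arcs Q" "tail Q \<alpha> = v" "arrow Y \<alpha> x \<notin> im (V, \<Theta>) (head Q \<alpha>)"
    using full[OF Suc.prems] by blast
   have "arrow Y \<alpha> x \<in> carrier (space Y (head Q \<alpha>))" using arl[OF \<alpha>(1)] \<alpha>(2) Suc.prems(2) by blast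
   from Suc.IH[OF head_in_verts[OF \<alpha>(1)] this \<alpha>(3)] obtain p u where
    p: "awalk (head Q \<alpha>) p u" "length p = l" "fold (arrow Y) p (arrow Y \<alpha> x) \<notin> im (V, \<Theta>) u" by blast
   then show ?case using \<alpha> Suc.prems(1) by (intro exI[of _ "\<alpha> # p"] exI[of _ u]) (auto simp: awalk_def)
  qed
  obtain l where l: "\<forall>u p v. awalk u p v \<and> length p \<ge> l \<longrightarrow> (\<forall>x\<in>carrier (space Y u). fold (arrow Y) p x = \<zero>\<^bsub>space Y v\<^esub>)"
   using Yn unfolding nilpotent_rep_def by blast
  obtain p u where p: "awalk v p u" "length p = l" "fold (arrow Y) p x \<notin> im (V, \<Theta>) u" using walk[OF vQ x] by blast
  have "fold (arrow Y) p x = \<zero>\<^bsub>space Y u\<^esub>" using l p x(1) by blast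
  moreover have "u \<in> verts Q" using p(1) by (rule awalk_last_in_verts)
  ultimately show False using im0 p(3) by metis
 qed
 have \<Theta>c: "\<Theta> v * x \<in> col (J v) U1" if "v \<in> verts Q" "x \<in> vx V v" for v x
  using col_mult[OF \<Theta>1[OF that(1)]] that(2) by (simp add: vx_def)
 have "\<forall>v\<in>verts Q. \<forall>y\<in>carrier (sp V v). \<exists>x. x \<in> carrier (space Y v) \<and> cY v x = \<Theta> v * vd V v y"
  using c2 \<Theta>c vd(3) by metis
 then obtain g where g: "\<And>v y. v \<in> verts Q ==> y \<in> carrier (sp V v) ==> g v y \<in> carrier (space Y v)"
  "\<And>v y. v \<in> verts Q ==> y \<in> carrier (sp V v) ==> cY v (g v y) = \<Theta> v * vd V v y" by metis
 have ghom: "g v \<in> module_hom class_ring (sp V v) (space Y v)" if v: "v \<in> verts Q" for v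
  unfolding linear_hom_iff
 proof (intro conjI ballI allI)
  fix x a assume x: "x \<in> carrier (sp V v)"
  show "g v x \<in> carrier (space Y v)" by (rule g(1)[OF v x])
  show "g v (a \<odot>\<^bsub>sp V v\<^esub> x) = a \<odot>\<^bsub>space Y v\<^esub> g v x"
   by (rule c3[OF v]) (use g[OF v] x sp_closed cf(2)[OF v] c5[OF v] in \<open>simp_all add: vd(6) sc1.sc_mult_right\<close>)
  fix y assume y: "y \<in> carrier (sp V v)"
  show "g v (x \<oplus>\<^bsub>sp V v\<^esub> y) = g v x \<oplus>\<^bsub>space Y v\<^esub> g v y"
   by (rule c3[OF v]) (use g[OF v] x y sp_closed cf(1)[OF v] c4[OF v] in \<open>simp_all add: vd(5) distrib_left\<close>)
 qed
 have gbij: "bij_betw (g v) (carrier (sp V v)) (carrier (space Y v))" if v: "v \<in> verts Q" for v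
  unfolding bij_betw_def
 proof (intro conjI inj_onI equalityI subsetI)
  fix x y assume x: "x \<in> carrier (sp V v)" and y: "y \<in> carrier (sp V v)" and eq: "g v x = g v y"
  have "\<Theta> v * vd V v x = \<Theta> v * vd V v y" using g(2)[OF v x] g(2)[OF v y] eq by simp
  then have 0: "\<Theta> v * (vd V v x - vd V v y) = 0" by (simp add: right_diff_distrib)
  have "vd V v x - vd V v y \<in> vx V v" using vd(3)[OF x] vd(3)[OF y] by (simp add: vx_def col_diff)
  from \<Theta>3[OF v this 0] show "x = y" using vd(7)[OF x y] by simp
 next
  fix x assume "x \<in> g v ` carrier (sp V v)" then show "x \<in> carrier (space Y v)" using g(1)[OF v] by blast
 next
  fix x assume x: "x \<in> carrier (space Y v)"
  then have "x \<in> im (V, \<Theta>) v" using imall[OF v] by simp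
  then obtain z where z: "z \<in> vx V v" "cY v x = \<Theta> v * z" by (auto simp: im_def)
  have "g v (vc V v z) = x"
   by (rule c3[OF v g(1)[OF v vd(1)[OF z(1)]] x]) (simp add: g(2)[OF v vd(1)[OF z(1)]] vd(2)[OF z(1)] z(2))
  then show "x \<in> g v ` carrier (sp V v)" using vd(1)[OF z(1)] by blast
 qed
 define h where "h = (\<lambda>v\<in>verts Q. \<lambda>y\<in>carrier (sp V v). g v y)"
 define k where "k = (\<lambda>v\<in>verts Q. restrict (inv_into (carrier (sp V v)) (g v)) (carrier (space Y v)))"
 have kg: "k v (g v y) = y" if "v \<in> verts Q" "y \<in> carrier (sp V v)" for v y
  using gbij[OF that(1)] that by (auto simp: k_def bij_betw_def)
 have gk: "g v (k v y) = y" "k v y \<in> carrier (sp V v)" if "v \<in> verts Q" "y \<in> carrier (space Y v)" for v y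
  using gbij[OF that(1)] that by (auto simp: k_def bij_betw_def f_inv_into_f inv_into_into)
 have garr: "g (head Q \<alpha>) (arrow (qrep V) \<alpha> y) = arrow Y \<alpha> (g (tail Q \<alpha>) y)" if \<alpha>: "\<alpha> \<in> arcs Q" and y: "y \<in> carrier (sp V (tail Q \<alpha>))" for \<alpha> y
 proof -
  note t = tail_in_verts[OF \<alpha>] and hh = head_in_verts[OF \<alpha>]
  have ax: "amat V \<alpha> * vd V (tail Q \<alpha>) y \<in> vx V (head Q \<alpha>)" by (rule amat_vx[OF V \<alpha> vd(3)[OF y]])
  have gy: "g (tail Q \<alpha>) y \<in> carrier (space Y (tail Q \<alpha>))" by (rule g(1)[OF t y])
  show ?thesis
  proof (rule c3[OF hh])
   show "g (head Q \<alpha>) (arrow (qrep V) \<alpha> y) \<in> carrier (space Y (head Q \<alpha>))" using g(1)[OF hh] vd(1)[OF ax] by simp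
   show "arrow Y \<alpha> (g (tail Q \<alpha>) y) \<in> carrier (space Y (head Q \<alpha>))" using arl[OF \<alpha>] gy by blast
   have "cY (head Q \<alpha>) (g (head Q \<alpha>) (arrow (qrep V) \<alpha> y)) = \<Theta> (head Q \<alpha>) * amat V \<alpha> * vd V (tail Q \<alpha>) y"
    using g(2)[OF hh vd(1)[OF ax]] vd(2)[OF ax] by (simp add: mult.assoc)
   also have "\<dots> = B \<alpha> * cY (tail Q \<alpha>) (g (tail Q \<alpha>) y)" using \<Theta>4[OF \<alpha>, symmetric] g(2)[OF t y] by (simp add: mult.assoc)
   also have "\<dots> = cY (head Q \<alpha>) (arrow Y \<alpha> (g (tail Q \<alpha>) y))" by (rule B[OF \<alpha> gy])
   finally show "cY (head Q \<alpha>) (g (head Q \<alpha>) (arrow (qrep V) \<alpha> y)) = cY (head Q \<alpha>) (arrow Y \<alpha> (g (tail Q \<alpha>) y))" .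
  qed
 qed
 have arrc: "arrow (qrep V) \<alpha> y \<in> carrier (sp V (head Q \<alpha>))" if "\<alpha> \<in> arcs Q" "y \<in> carrier (sp V (tail Q \<alpha>))" for \<alpha> y
  using vd(1)[OF amat_vx[OF V that(1) vd(3)[OF that(2)]]] by simp
 have hH: "h \<in> Hom (nilpotent_reps Q) (qrep V) Y"
  unfolding nilpotent_reps_simps qrep_simps(1)
 proof (intro conjI ballI)
  show "h \<in> extensional (verts Q)" by (simp add: h_def)
  fix v assume v: "v \<in> verts Q"
  show "h v \<in> extensional (carrier (sp V v))" using v by (simp add: h_def)
  show "h v \<in> module_hom class_ring (sp V v) (space Y v)"
   using ghom[OF v] sp_closed v unfolding linear_hom_iff by (simp add: h_def)
 next
  fix \<alpha> y assume \<alpha>: "\<alpha> \<in> arcs Q" and y: "y \<in> carrier (sp V (tail Q \<alpha>))"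
  show "h (head Q \<alpha>) (arrow (qrep V) \<alpha> y) = arrow Y \<alpha> (h (tail Q \<alpha>) y)"
   using garr[OF \<alpha> y] arrc[OF \<alpha> y] y tail_in_verts[OF \<alpha>] head_in_verts[OF \<alpha>] by (simp add: h_def del: qrep_simps(2))
 qed
 have kH: "k \<in> Hom (nilpotent_reps Q) Y (qrep V)"
  unfolding nilpotent_reps_simps qrep_simps(1)
 proof (intro conjI ballI)
  show "k \<in> extensional (verts Q)" by (simp add: k_def)
  fix v assume v: "v \<in> verts Q"
  show "k v \<in> extensional (carrier (space Y v))" using v by (simp add: k_def)
  show "k v \<in> module_hom class_ring (space Y v) (sp V v)"
   using inverse_module_hom[OF sp_closed(1,2) ghom[OF v] gbij[OF v]] v by (simp add: k_def)
 next
  fix \<alpha> y assume \<alpha>: "\<alpha> \<in> arcs Q" and y: "y \<in> carrier (space Y (tail Q \<alpha>))"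
  note t = tail_in_verts[OF \<alpha>] and hh = head_in_verts[OF \<alpha>]
  have "k (head Q \<alpha>) (g (head Q \<alpha>) (arrow (qrep V) \<alpha> (k (tail Q \<alpha>) y))) = arrow (qrep V) \<alpha> (k (tail Q \<alpha>) y)"
   by (rule kg[OF hh arrc[OF \<alpha> gk(2)[OF t y]]])
  then show "k (head Q \<alpha>) (arrow Y \<alpha> y) = arrow (qrep V) \<alpha> (k (tail Q \<alpha>) y)"
   using garr[OF \<alpha> gk(2)[OF t y]] gk(1)[OF t y] by simp
 qed
 have "isomorphism (nilpotent_reps Q) Y (qrep V) k"
  unfolding isomorphism_def
 proof (intro conjI bexI[of _ h] kH hH)
  show "Comp (nilpotent_reps Q) Y (qrep V) Y h k = Ident (nilpotent_reps Q) Y"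
   unfolding nilpotent_reps_simps using gk by (intro restrict_ext) (auto simp: compose_def h_def intro!: restrict_ext)
  show "Comp (nilpotent_reps Q) (qrep V) Y (qrep V) k h = Ident (nilpotent_reps Q) (qrep V)"
   unfolding nilpotent_reps_simps using kg by (intro restrict_ext) (auto simp: compose_def h_def intro!: restrict_ext)
 qed
 then show "\<exists>V\<in>Ob (tri_cat Q). \<exists>f. isomorphism (nilpotent_reps Q) Y (qrep V) f" using V by auto
qed

end

section \<open>The equivalence\<close>

theorem proposition7p1:
 fixes m :: nat and r :: "nat \<Rightarrow> nat" and w :: "nat \<Rightarrow> nat \<Rightarrow> nat"
  and \<S> :: "('k::alg_closed_field coprod, 'v) module set"
 assumes "m \<ge> 1"
  and "\<And>i j. \<lbrakk>i < m; j < r i\<rbrakk> \<Longrightarrow> w i j \<ge> 1"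
  and "\<And>i. i < m \<Longrightarrow> vectorspace.dim class_ring
      (matrix_product_algebra (r i) (w i) :: ('k, 'k mat list) module) \<noteq> 1"
  and "\<exists>f :: 'k \<Rightarrow> 'v. inj f"
  and "\<exists>f :: 'k \<Rightarrow> 'u. inj f"
  and "finite \<S>"
  and "\<S> \<subseteq> Ob (rep (semisimple_free_product m r w))"
  and "\<And>S. S \<in> \<S> \<Longrightarrow> simple_module (semisimple_free_product m r w) S"
  and "\<And>S T. \<lbrakk>S \<in> \<S>; T \<in> \<S>; S \<noteq> T\<rbrakk>
      \<Longrightarrow> \<not> isomorphic_modules (semisimple_free_product m r w) S T"
 shows "equivalent_categories
      (wide (semisimple_free_product m r w) \<S>)
      (nilpotent_reps (simples_quiver m r w \<S>) ::
       (_, _ \<Rightarrow> 'u \<Rightarrow> 'u, 'k) lincat)"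
proof -
 let ?A = "semisimple_free_product m r w :: ('k, 'k coprod) module"
 have lm: "left_module ?A S" and fd: "vectorspace.fin_dim class_ring (over_field ?A S)" if "S \<in> \<S>" for S
  using assms(7) that by (auto simp: rep_def)
 have "\<forall>S\<in>\<S>. \<exists>c L. frame.mcoord sc1 (idn {..<dimension_vector m r w S Sink}) U1 ?A S c L"
 proof
  fix S assume S: "S \<in> \<S>"
  have "vectorspace class_ring (over_field ?A S)"
   by (rule over_field_vectorspace[OF semisimple_free_product_assoc_algebra lm[OF S]])
  from coordinates_exist[OF this fd[OF S]] obtain c where
   "frame.coord sc1 (idn {..<dimension_vector m r w S Sink}) U1 (over_field ?A S) c" by (auto simp: dimension_vector.simps)
  from frame.mcoord_exists[OF frame1[OF finite_lessThan] semisimple_free_product_assoc_algebra lm[OF S] this]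
  show "\<exists>c L. frame.mcoord sc1 (idn {..<dimension_vector m r w S Sink}) U1 ?A S c L" by blast
 qed
 then obtain c L where mc: "\<And>S. S \<in> \<S> \<Longrightarrow> frame.mcoord sc1 (idn {..<dimension_vector m r w S Sink}) U1 ?A S (c S) (L S)"
  by metis
 interpret W: coded_simples m r w \<S> c L
  by (intro coded_simples.intro simples.intro coded_simples_axioms.intro) (use assms fd mc in auto)
 obtain f :: "'k \<Rightarrow> 'u" where f: "inj f" using assms(5) by blast
 interpret N: coded_quiver "simples_quiver m r w \<S>" f
  by (intro coded_quiver.intro wf_simples_quiver coded_quiver_axioms.intro f) (use assms(6) in \<open>simp add: simples_quiver_def\<close>)
 show ?thesis
  by (rule equivalent_categories_span[OF wide_linear_category nilpotent_reps_linear_category tri_homs_closed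
   W.glued_functor W.glued_fully_faithful W.glued_essentially_surjective
   N.qrep_functor N.qrep_fully_faithful N.qrep_essentially_surjective])
qed

end
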